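(* Let $k$ be a field, $\Gamma=\mathbb Z$ and $\Lambda=\{-1,0\}$. Let $G$ and $H$ be finite groups, and let $F(kG)$ and $F(kH)$ be the standard one-step filtrations of the group bialgebras $kG$ and $kH$. There is a group isomorphism $G\cong H$ if and only if there is a ($k$-linear) monoidal equivalence $\operatorname{glid}_\Lambda F(kG)\simeq\operatorname{glid}_\Lambda F(kH)$.
   Context: For a finite-dimensional $k$-bialgebra $B$ (here $B=kG$ with all $g\in G$ grouplike), the standard one-step filtration is the $\mathbb Z$-filtration with $F_iB=0$ for $i<0$, $F_0B=k\cdot1_B$, and $F_iB=B$ for $i\ge1$. With $\Lambda=\{-1,0\}$, the category $\mathcal F_\Lambda B$ has objects $-1,0$ and $\operatorname{Hom}(\alpha,\beta)=F_{\beta-\alpha}B$ if $\alpha\le\beta$ and $0$ otherwise, with composition given by multiplication in $B$. The category $\overline{\mathcal F}_\Lambda B$ has objects $-1,0,\infty$, contains $\mathcal F_\Lambda B$ as a full subcategory, and has $\operatorname{Hom}(\alpha,\infty)=B$ for $\alpha\in\{-1,0,\infty\}$ and $\operatorname{Hom}(\infty,\alpha)=0$ for $\alpha\ne\infty$, with composition given by multiplication in $B$. For $\alpha\le\beta$ or $\beta=\infty$, write $1_{\alpha,\beta}\in\operatorname{Hom}(\alpha,\beta)$ for the element $1_B$. $\operatorname{Preglid}_\Lambda FB$ is the category of $k$-linear functors $M\colon\overline{\mathcal F}_\Lambda B\to\mathrm{Vect}_k$ for which all $M(1_{\alpha,\beta})$ are monomorphisms. Let $\Sigma$ be the class of its morphisms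 $f$ such that $f_{-1}$ and $f_0$ are isomorphisms. Then $\operatorname{Glid}_\Lambda FB=(\operatorname{Preglid}_\Lambda FB)[\Sigma^{-1}]$, with localization functor $Q$. The category $\operatorname{glid}_\Lambda FB$ is its full subcategory of Noetherian objects (those in which every ascending sequence of subobjects is stationary). Monoidal structure: $\operatorname{Preglid}_\Lambda FB$ is monoidal with $(M\otimes N)(\lambda)=M(\lambda)\otimes_kN(\lambda)$, where $b\in\operatorname{Hom}(\lambda,\mu)\subseteq B$ acts by $\sum M(b_{(1)})\otimes N(b_{(2)})$ for $\Delta(b)=\sum b_{(1)}\otimes b_{(2)}$; the unit object has value $k$ everywhere with $b$ acting by the counit. If $s,t\in\Sigma$ then $s\otimes t\in\Sigma$, so $\operatorname{Glid}_\Lambda FB$ inherits the monoidal structure for which $Q$ (the identity on objects) is monoidal; $\operatorname{glid}_\Lambda FB$ is a monoidal subcategory. *)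

theory Defs
  imports "HOL-Algebra.Module"
begin

section \<open>Categories, functors and natural transformations\<close>

text \<open>
  Every arrow carries its source and target, so equality of arrows includes equality of
  endpoints. All categories below are given concretely; the records only collect their data.
\<close>

datatype ('o, 'd) arrow = Arrow (src: 'o) (dat: 'd) (trg: 'o)

record ('o, 'd) category =
  Obj :: "'o set"
  Arr :: "('o, 'd) arrow set"
  Id :: "'o \<Rightarrow> ('o, 'd) arrow"
  Comp :: "('o, 'd) arrow \<Rightarrow> ('o, 'd) arrow \<Rightarrow> ('o, 'd) arrow"  (infixl "\<cdot>\<index>" 70)

record ('k, 'o, 'd) lin_category = "('o, 'd) category" +
  Add :: "('o, 'd) arrow \<Rightarrow> ('o, 'd) arrow \<Rightarrow> ('o, 'd) arrow"
  Scale :: "'k \<Rightarrow> ('o, 'd) arrow \<Rightarrow> ('o, 'd) arrow"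

record ('k, 'o, 'd) mon_category = "('k, 'o, 'd) lin_category" +
  TensO :: "'o \<Rightarrow> 'o \<Rightarrow> 'o"
  TensA :: "('o, 'd) arrow \<Rightarrow> ('o, 'd) arrow \<Rightarrow> ('o, 'd) arrow"
  UnitO :: 'o
  Assoc :: "'o \<Rightarrow> 'o \<Rightarrow> 'o \<Rightarrow> ('o, 'd) arrow"  \<comment> \<open>\<open>(X \<otimes> Y) \<otimes> Z \<rightarrow> X \<otimes> (Y \<otimes> Z)\<close>\<close>
  LUnit :: "'o \<Rightarrow> ('o, 'd) arrow"  \<comment> \<open>\<open>1 \<otimes> X \<rightarrow> X\<close>\<close>
  RUnit :: "'o \<Rightarrow> ('o, 'd) arrow"  \<comment> \<open>\<open>X \<otimes> 1 \<rightarrow> X\<close>\<close>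

definition homset :: "('o, 'd, 'x) category_scheme \<Rightarrow> 'o \<Rightarrow> 'o \<Rightarrow> ('o, 'd) arrow set" where
  "homset C x y = {f \<in> Arr C. src f = x \<and> trg f = y}"

definition mono_arr :: "('o, 'd, 'x) category_scheme \<Rightarrow> ('o, 'd) arrow \<Rightarrow> bool" where
  "mono_arr C m \<longleftrightarrow> m \<in> Arr C \<and>
     (\<forall>x \<in> Obj C. \<forall>f \<in> homset C x (src m). \<forall>g \<in> homset C x (src m).
        m \<cdot>\<^bsub>C\<^esub> f = m \<cdot>\<^bsub>C\<^esub> g \<longrightarrow> f = g)"

definition iso_arr :: "('o, 'd, 'x) category_scheme \<Rightarrow> ('o, 'd) arrow \<Rightarrow> bool" where
  "iso_arr C f \<longleftrightarrow> f \<in> Arr C \<and>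
     (\<exists>g \<in> homset C (trg f) (src f).
        g \<cdot>\<^bsub>C\<^esub> f = Id C (src f) \<and> f \<cdot>\<^bsub>C\<^esub> g = Id C (trg f))"

text \<open>A subobject of \<open>X\<close> is represented by a monomorphism into \<open>X\<close>; \<open>m\<close> is contained in \<open>n\<close>
  if it factors through \<open>n\<close>.\<close>

definition subobj_le ::
    "('o, 'd, 'x) category_scheme \<Rightarrow> ('o, 'd) arrow \<Rightarrow> ('o, 'd) arrow \<Rightarrow> bool" where
  "subobj_le C m n \<longleftrightarrow> (\<exists>h \<in> homset C (src m) (src n). m = n \<cdot>\<^bsub>C\<^esub> h)"

definition noetherian_obj :: "('o, 'd, 'x) category_scheme \<Rightarrow> 'o \<Rightarrow> bool" where
  "noetherian_obj C X \<longleftrightarrow> X \<in> Obj C \<and>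
     (\<forall>s :: nat \<Rightarrow> ('o, 'd) arrow.
        (\<forall>i. mono_arr C (s i) \<and> trg (s i) = X) \<and> (\<forall>i. subobj_le C (s i) (s (Suc i))) \<longrightarrow>
        (\<exists>n. \<forall>i \<ge> n. subobj_le C (s i) (s n)))"

definition full_subcategory ::
    "('o, 'd, 'x) category_scheme \<Rightarrow> ('o \<Rightarrow> bool) \<Rightarrow> ('o, 'd, 'x) category_scheme" where
  "full_subcategory C P =
     C\<lparr>Obj := {x \<in> Obj C. P x}, Arr := {f \<in> Arr C. P (src f) \<and> P (trg f)}\<rparr>"

record ('o1, 'd1, 'o2, 'd2) functor_data =
  ObjMap :: "'o1 \<Rightarrow> 'o2"
  ArrMap :: "('o1, 'd1) arrow \<Rightarrow> ('o2, 'd2) arrow"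

definition is_functor ::
    "('o1, 'd1, 'x) category_scheme \<Rightarrow> ('o2, 'd2, 'y) category_scheme \<Rightarrow>
     ('o1, 'd1, 'o2, 'd2) functor_data \<Rightarrow> bool" where
  "is_functor C D F \<longleftrightarrow>
     (\<forall>x \<in> Obj C. ObjMap F x \<in> Obj D) \<and>
     (\<forall>f \<in> Arr C. ArrMap F f \<in> homset D (ObjMap F (src f)) (ObjMap F (trg f))) \<and>
     (\<forall>x \<in> Obj C. ArrMap F (Id C x) = Id D (ObjMap F x)) \<and>
     (\<forall>f \<in> Arr C. \<forall>g \<in> Arr C. trg f = src g \<longrightarrow>
        ArrMap F (g \<cdot>\<^bsub>C\<^esub> f) = ArrMap F g \<cdot>\<^bsub>D\<^esub> ArrMap F f)"

definition is_linear_functor ::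
    "('k, 'm) ring_scheme \<Rightarrow> ('k, 'o1, 'd1, 'x) lin_category_scheme \<Rightarrow>
     ('k, 'o2, 'd2, 'y) lin_category_scheme \<Rightarrow> ('o1, 'd1, 'o2, 'd2) functor_data \<Rightarrow> bool" where
  "is_linear_functor K C D F \<longleftrightarrow> is_functor C D F \<and>
     (\<forall>f \<in> Arr C. \<forall>g \<in> Arr C. src f = src g \<and> trg f = trg g \<longrightarrow>
        ArrMap F (Add C f g) = Add D (ArrMap F f) (ArrMap F g)) \<and>
     (\<forall>c \<in> carrier K. \<forall>f \<in> Arr C. ArrMap F (Scale C c f) = Scale D c (ArrMap F f))"

definition id_functor :: "('o, 'd, 'o, 'd) functor_data" where
  "id_functor = \<lparr>ObjMap = (\<lambda>x. x), ArrMap = (\<lambda>f. f)\<rparr>"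

definition comp_functor ::
    "('o2, 'd2, 'o3, 'd3) functor_data \<Rightarrow> ('o1, 'd1, 'o2, 'd2) functor_data \<Rightarrow>
     ('o1, 'd1, 'o3, 'd3) functor_data" where
  "comp_functor G F =
     \<lparr>ObjMap = (\<lambda>x. ObjMap G (ObjMap F x)), ArrMap = (\<lambda>f. ArrMap G (ArrMap F f))\<rparr>"

definition is_nat_trans ::
    "('o1, 'd1, 'x) category_scheme \<Rightarrow> ('o2, 'd2, 'y) category_scheme \<Rightarrow>
     ('o1, 'd1, 'o2, 'd2) functor_data \<Rightarrow> ('o1, 'd1, 'o2, 'd2) functor_data \<Rightarrow>
     ('o1 \<Rightarrow> ('o2, 'd2) arrow) \<Rightarrow> bool" where
  "is_nat_trans C D F G \<eta> \<longleftrightarrow>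
     (\<forall>x \<in> Obj C. \<eta> x \<in> homset D (ObjMap F x) (ObjMap G x)) \<and>
     (\<forall>f \<in> Arr C. \<eta> (trg f) \<cdot>\<^bsub>D\<^esub> ArrMap F f = ArrMap G f \<cdot>\<^bsub>D\<^esub> \<eta> (src f))"

definition is_nat_iso ::
    "('o1, 'd1, 'x) category_scheme \<Rightarrow> ('o2, 'd2, 'y) category_scheme \<Rightarrow>
     ('o1, 'd1, 'o2, 'd2) functor_data \<Rightarrow> ('o1, 'd1, 'o2, 'd2) functor_data \<Rightarrow>
     ('o1 \<Rightarrow> ('o2, 'd2) arrow) \<Rightarrow> bool" where
  "is_nat_iso C D F G \<eta> \<longleftrightarrow> is_nat_trans C D F G \<eta> \<and> (\<forall>x \<in> Obj C. iso_arr D (\<eta> x))"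

definition is_equivalence ::
    "('o1, 'd1, 'x) category_scheme \<Rightarrow> ('o2, 'd2, 'y) category_scheme \<Rightarrow>
     ('o1, 'd1, 'o2, 'd2) functor_data \<Rightarrow> bool" where
  "is_equivalence C D F \<longleftrightarrow> is_functor C D F \<and>
     (\<exists>G \<eta> \<epsilon>. is_functor D C G \<and>
        is_nat_iso C C id_functor (comp_functor G F) \<eta> \<and>
        is_nat_iso D D (comp_functor F G) id_functor \<epsilon>)"

text \<open>\<open>\<mu> X Y: F X \<otimes> F Y \<rightarrow> F (X \<otimes> Y)\<close> and \<open>\<upsilon>: 1 \<rightarrow> F 1\<close> make \<open>F\<close> a strong monoidal functor.\<close>

definition is_monoidal_functor ::
    "('k1, 'o1, 'd1, 'x) mon_category_scheme \<Rightarrow> ('k2, 'o2, 'd2, 'y) mon_category_scheme \<Rightarrow>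
     ('o1, 'd1, 'o2, 'd2) functor_data \<Rightarrow> ('o1 \<Rightarrow> 'o1 \<Rightarrow> ('o2, 'd2) arrow) \<Rightarrow>
     ('o2, 'd2) arrow \<Rightarrow> bool" where
  "is_monoidal_functor C D F \<mu> \<upsilon> \<longleftrightarrow> is_functor C D F \<and>
     (\<forall>X \<in> Obj C. \<forall>Y \<in> Obj C.
        \<mu> X Y \<in> homset D (TensO D (ObjMap F X) (ObjMap F Y)) (ObjMap F (TensO C X Y)) \<and>
        iso_arr D (\<mu> X Y)) \<and>
     (\<forall>f \<in> Arr C. \<forall>g \<in> Arr C.
        \<mu> (trg f) (trg g) \<cdot>\<^bsub>D\<^esub> TensA D (ArrMap F f) (ArrMap F g) =
        ArrMap F (TensA C f g) \<cdot>\<^bsub>D\<^esub> \<mu> (src f) (src g)) \<and>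
     \<upsilon> \<in> homset D (UnitO D) (ObjMap F (UnitO C)) \<and> iso_arr D \<upsilon> \<and>
     (\<forall>X \<in> Obj C. \<forall>Y \<in> Obj C. \<forall>Z \<in> Obj C.
        ArrMap F (Assoc C X Y Z) \<cdot>\<^bsub>D\<^esub>
          (\<mu> (TensO C X Y) Z \<cdot>\<^bsub>D\<^esub> TensA D (\<mu> X Y) (Id D (ObjMap F Z))) =
        \<mu> X (TensO C Y Z) \<cdot>\<^bsub>D\<^esub>
          (TensA D (Id D (ObjMap F X)) (\<mu> Y Z) \<cdot>\<^bsub>D\<^esub>
           Assoc D (ObjMap F X) (ObjMap F Y) (ObjMap F Z))) \<and>
     (\<forall>X \<in> Obj C.
        ArrMap F (LUnit C X) \<cdot>\<^bsub>D\<^esub>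
          (\<mu> (UnitO C) X \<cdot>\<^bsub>D\<^esub> TensA D \<upsilon> (Id D (ObjMap F X))) =
        LUnit D (ObjMap F X)) \<and>
     (\<forall>X \<in> Obj C.
        ArrMap F (RUnit C X) \<cdot>\<^bsub>D\<^esub>
          (\<mu> X (UnitO C) \<cdot>\<^bsub>D\<^esub> TensA D (Id D (ObjMap F X)) \<upsilon>) =
        RUnit D (ObjMap F X))"

definition linear_monoidally_equivalent ::
    "('k, 'm) ring_scheme \<Rightarrow> ('k, 'o1, 'd1) mon_category \<Rightarrow> ('k, 'o2, 'd2) mon_category \<Rightarrow> bool"
  where
  "linear_monoidally_equivalent K C D \<longleftrightarrow>
     (\<exists>F \<mu> \<upsilon>. is_equivalence C D F \<and> is_linear_functor K C D F \<and> is_monoidal_functor C D F \<mu> \<upsilon>)"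

section \<open>Localization of a category at a class of arrows\<close>

text \<open>
  The Gabriel--Zisman construction: arrows of \<open>C[S\<^sup>-\<^sup>1]\<close> are equivalence classes of zigzags, i.e.
  paths (written in the order in which they are traversed) in the arrows of \<open>C\<close> and formal
  inverses of the arrows in \<open>S\<close>.
\<close>

datatype 'a step = Fwd 'a | Bwd 'a

fun is_zigzag ::
    "('o, 'd, 'x) category_scheme \<Rightarrow> ('o, 'd) arrow set \<Rightarrow>
     'o \<Rightarrow> ('o, 'd) arrow step list \<Rightarrow> 'o \<Rightarrow> bool" where
  "is_zigzag C S x [] y \<longleftrightarrow> x \<in> Obj C \<and> x = y"
| "is_zigzag C S x (Fwd f # p) y \<longleftrightarrow> f \<in> Arr C \<and> src f = x \<and> is_zigzag C S (trg f) p y"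
| "is_zigzag C S x (Bwd s # p) y \<longleftrightarrow> s \<in> S \<and> trg s = x \<and> is_zigzag C S (src s) p y"

inductive zigzag_rule ::
    "('o, 'd, 'x) category_scheme \<Rightarrow> ('o, 'd) arrow set \<Rightarrow>
     ('o, 'd) arrow step list \<Rightarrow> ('o, 'd) arrow step list \<Rightarrow> bool"
  for C S where
  "x \<in> Obj C \<Longrightarrow> zigzag_rule C S [Fwd (Id C x)] []"
| "f \<in> Arr C \<Longrightarrow> g \<in> Arr C \<Longrightarrow> trg f = src g \<Longrightarrow> zigzag_rule C S [Fwd f, Fwd g] [Fwd (g \<cdot>\<^bsub>C\<^esub> f)]"
| "s \<in> S \<Longrightarrow> zigzag_rule C S [Fwd s, Bwd s] []"
| "s \<in> S \<Longrightarrow> zigzag_rule C S [Bwd s, Fwd s] []"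

definition zigzag_equiv ::
    "('o, 'd, 'x) category_scheme \<Rightarrow> ('o, 'd) arrow set \<Rightarrow> 'o \<Rightarrow> 'o \<Rightarrow>
     (('o, 'd) arrow step list \<times> ('o, 'd) arrow step list) set" where
  "zigzag_equiv C S x y =
     (let R = {(u @ l @ v, u @ r @ v) | u l r v.
                 zigzag_rule C S l r \<and> is_zigzag C S x (u @ l @ v) y \<and> is_zigzag C S x (u @ r @ v) y}
      in (R \<union> R\<inverse>)\<^sup>*)"

type_synonym ('o, 'd) loc_arrow = "('o, ('o, 'd) arrow step list set) arrow"

definition zigzag_class ::
    "('o, 'd, 'x) category_scheme \<Rightarrow> ('o, 'd) arrow set \<Rightarrow>
     'o \<Rightarrow> ('o, 'd) arrow step list \<Rightarrow> 'o \<Rightarrow> ('o, 'd) loc_arrow" where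
  "zigzag_class C S x p y = Arrow x (zigzag_equiv C S x y `` {p}) y"

definition loc_functor ::
    "('o, 'd, 'x) category_scheme \<Rightarrow> ('o, 'd) arrow set \<Rightarrow> ('o, 'd) arrow \<Rightarrow> ('o, 'd) loc_arrow"
  where
  "loc_functor C S f = zigzag_class C S (src f) [Fwd f] (trg f)"

definition right_fraction ::
    "('o, 'd, 'x) category_scheme \<Rightarrow> ('o, 'd) arrow set \<Rightarrow>
     ('o, 'd) arrow \<Rightarrow> ('o, 'd) arrow \<Rightarrow> ('o, 'd) loc_arrow" where
  "right_fraction C S s a = zigzag_class C S (trg s) [Bwd s, Fwd a] (trg a)"

text \<open>
  The linear structure is the one obtained by putting two parallel arrows over a common
  denominator, \<open>a s\<^sup>-\<^sup>1 + b s\<^sup>-\<^sup>1 = (a + b) s\<^sup>-\<^sup>1\<close> and \<open>c (a s\<^sup>-\<^sup>1) = (c a) s\<^sup>-\<^sup>1\<close>. The tensor product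
  of arrows is the one making localization strict monoidal: on zigzags \<open>p\<close> from \<open>x\<close> to \<open>x'\<close> and
  \<open>q\<close> from \<open>y\<close> to \<open>y'\<close> it is \<open>p \<otimes> q = (1\<^bsub>x'\<^esub> \<otimes> q) (p \<otimes> 1\<^bsub>y\<^esub>)\<close>, computed step by step. Both make
  sense when \<open>S\<close> is closed under tensor products and any two parallel arrows have a common
  denominator.
\<close>

definition localization ::
    "('k, 'o, 'd) mon_category \<Rightarrow> ('o, 'd) arrow set \<Rightarrow>
     ('k, 'o, ('o, 'd) arrow step list set) mon_category" where
  "localization C S =
    \<lparr>Obj = Obj C,
     Arr = {zigzag_class C S x p y | x p y. is_zigzag C S x p y},
     Id = (\<lambda>x. zigzag_class C S x [] x),
     Comp = (\<lambda>g f. Arrow (src f)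
        (\<Union>p \<in> dat f. \<Union>q \<in> dat g. dat (zigzag_class C S (src f) (p @ q) (trg g))) (trg g)),
     Add = (\<lambda>f g. THE h. \<exists>s \<in> S. \<exists>a \<in> Arr C. \<exists>b \<in> Arr C.
        src a = src s \<and> src b = src s \<and> trg a = trg b \<and>
        f = right_fraction C S s a \<and> g = right_fraction C S s b \<and>
        h = right_fraction C S s (Add C a b)),
     Scale = (\<lambda>c f. THE h. \<exists>s \<in> S. \<exists>a \<in> Arr C. src a = src s \<and>
        f = right_fraction C S s a \<and> h = right_fraction C S s (Scale C c a)),
     TensO = TensO C,
     TensA = (\<lambda>f g. Arrow (TensO C (src f) (src g))
        (\<Union>p \<in> dat f. \<Union>q \<in> dat g.
           dat (zigzag_class C S (TensO C (src f) (src g))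
             (map (map_step (\<lambda>a. TensA C a (Id C (src g)))) p @
              map (map_step (\<lambda>b. TensA C (Id C (trg f)) b)) q)
             (TensO C (trg f) (trg g))))
        (TensO C (trg f) (trg g))),
     UnitO = UnitO C,
     Assoc = (\<lambda>x y z. loc_functor C S (Assoc C x y z)),
     LUnit = (\<lambda>x. loc_functor C S (LUnit C x)),
     RUnit = (\<lambda>x. loc_functor C S (RUnit C x))\<rparr>"

section \<open>The category of vector spaces\<close>

text \<open>
  Vector spaces over the field \<open>K\<close> are \<open>K\<close>-modules whose carrier is a subset of a type \<open>'u\<close>, which
  plays the role of the universe of small sets. It has to be infinite and at least as large as
  \<open>K\<close>, so that \<open>K\<close> and, for any two spaces in the universe, a tensor product of them can be found
  inside it. The fields \<open>mult\<close> and \<open>one\<close> that the record \<open>module\<close> inherits from \<open>ring\<close> play no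
  role.
\<close>

definition vector_space_universe :: "'u itself \<Rightarrow> ('k, 'm) ring_scheme \<Rightarrow> bool" where
  "vector_space_universe _ K \<longleftrightarrow>
     infinite (UNIV :: 'u set) \<and> (\<exists>\<iota> :: 'k \<Rightarrow> 'u. inj_on \<iota> (carrier K))"

definition linear_maps ::
    "('k, 'm) ring_scheme \<Rightarrow> ('k, 'u) module \<Rightarrow> ('k, 'v) module \<Rightarrow> ('u \<Rightarrow> 'v) set" where
  "linear_maps K V W = {f \<in> carrier V \<rightarrow>\<^sub>E carrier W.
     (\<forall>x \<in> carrier V. \<forall>y \<in> carrier V. f (x \<oplus>\<^bsub>V\<^esub> y) = f x \<oplus>\<^bsub>W\<^esub> f y) \<and>
     (\<forall>c \<in> carrier K. \<forall>x \<in> carrier V. f (c \<odot>\<^bsub>V\<^esub> x) = c \<odot>\<^bsub>W\<^esub> f x)}"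

definition bilinear ::
    "('k, 'm) ring_scheme \<Rightarrow> ('k, 'u) module \<Rightarrow> ('k, 'v) module \<Rightarrow> ('k, 'w) module \<Rightarrow>
     ('u \<Rightarrow> 'v \<Rightarrow> 'w) \<Rightarrow> bool" where
  "bilinear K V W Z \<beta> \<longleftrightarrow>
     (\<forall>x \<in> carrier V. (\<lambda>y \<in> carrier W. \<beta> x y) \<in> linear_maps K W Z) \<and>
     (\<forall>y \<in> carrier W. (\<lambda>x \<in> carrier V. \<beta> x y) \<in> linear_maps K V Z)"

definition is_tensor_product ::
    "('k, 'm) ring_scheme \<Rightarrow> ('k, 'u) module \<Rightarrow> ('k, 'u) module \<Rightarrow>
     ('k, 'u) module \<Rightarrow> ('u \<Rightarrow> 'u \<Rightarrow> 'u) \<Rightarrow> bool" where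
  "is_tensor_product K V W T \<tau> \<longleftrightarrow> module K T \<and> bilinear K V W T \<tau> \<and>
     (\<forall>(Z :: ('k, 'u) module) \<beta>. module K Z \<and> bilinear K V W Z \<beta> \<longrightarrow>
        (\<exists>!f. f \<in> linear_maps K T Z \<and>
              (\<forall>x \<in> carrier V. \<forall>y \<in> carrier W. f (\<tau> x y) = \<beta> x y)))"

definition tensor_choice ::
    "('k, 'm) ring_scheme \<Rightarrow> ('k, 'u) module \<Rightarrow> ('k, 'u) module \<Rightarrow>
     ('k, 'u) module \<times> ('u \<Rightarrow> 'u \<Rightarrow> 'u)" where
  "tensor_choice K V W = (SOME (T, \<tau>). is_tensor_product K V W T \<tau>)"

definition tensor ::
    "('k, 'm) ring_scheme \<Rightarrow> ('k, 'u) module \<Rightarrow> ('k, 'u) module \<Rightarrow> ('k, 'u) module" where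
  "tensor K V W = fst (tensor_choice K V W)"

definition pure_tensor ::
    "('k, 'm) ring_scheme \<Rightarrow> ('k, 'u) module \<Rightarrow> ('k, 'u) module \<Rightarrow> 'u \<Rightarrow> 'u \<Rightarrow> 'u" where
  "pure_tensor K V W = snd (tensor_choice K V W)"

definition scalar_embedding :: "('k, 'm) ring_scheme \<Rightarrow> 'k \<Rightarrow> 'u" where
  "scalar_embedding K = (SOME \<iota>. inj_on \<iota> (carrier K))"

text \<open>The field \<open>K\<close>, as a vector space over itself, transported into the universe:\<close>

definition scalar_space :: "('k, 'm) ring_scheme \<Rightarrow> ('k, 'u) module" where
  "scalar_space K =
     (let \<iota> = scalar_embedding K; \<pi> = inv_into (carrier K) \<iota>
      in \<lparr>carrier = \<iota> ` carrier K,
          mult = (\<lambda>x y. \<iota> (\<pi> x \<otimes>\<^bsub>K\<^esub> \<pi> y)),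
          one = \<iota> \<one>\<^bsub>K\<^esub>,
          zero = \<iota> \<zero>\<^bsub>K\<^esub>,
          add = (\<lambda>x y. \<iota> (\<pi> x \<oplus>\<^bsub>K\<^esub> \<pi> y)),
          smult = (\<lambda>c x. \<iota> (c \<otimes>\<^bsub>K\<^esub> \<pi> x))\<rparr>)"

definition vect ::
    "('k, 'm) ring_scheme \<Rightarrow> ('k, ('k, 'u) module, 'u \<Rightarrow> 'u) mon_category" where
  "vect K =
    \<lparr>Obj = {V. module K V},
     Arr = {Arrow V f W | V f W. module K V \<and> module K W \<and> f \<in> linear_maps K V W},
     Id = (\<lambda>V. Arrow V (\<lambda>x \<in> carrier V. x) V),
     Comp = (\<lambda>g f. Arrow (src f) (\<lambda>x \<in> carrier (src f). dat g (dat f x)) (trg g)),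
     Add = (\<lambda>f g. Arrow (src f)
        (\<lambda>x \<in> carrier (src f). dat f x \<oplus>\<^bsub>trg f\<^esub> dat g x) (trg f)),
     Scale = (\<lambda>c f. Arrow (src f) (\<lambda>x \<in> carrier (src f). c \<odot>\<^bsub>trg f\<^esub> dat f x) (trg f)),
     TensO = tensor K,
     TensA = (\<lambda>f g. Arrow (tensor K (src f) (src g))
        (THE h. h \<in> linear_maps K (tensor K (src f) (src g)) (tensor K (trg f) (trg g)) \<and>
           (\<forall>x \<in> carrier (src f). \<forall>y \<in> carrier (src g).
              h (pure_tensor K (src f) (src g) x y) =
              pure_tensor K (trg f) (trg g) (dat f x) (dat g y)))
        (tensor K (trg f) (trg g))),
     UnitO = scalar_space K,
     Assoc = (\<lambda>U V W. Arrow (tensor K (tensor K U V) W)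
        (THE h. h \<in> linear_maps K (tensor K (tensor K U V) W) (tensor K U (tensor K V W)) \<and>
           (\<forall>x \<in> carrier U. \<forall>y \<in> carrier V. \<forall>z \<in> carrier W.
              h (pure_tensor K (tensor K U V) W (pure_tensor K U V x y) z) =
              pure_tensor K U (tensor K V W) x (pure_tensor K V W y z)))
        (tensor K U (tensor K V W))),
     LUnit = (\<lambda>V. Arrow (tensor K (scalar_space K) V)
        (THE h. h \<in> linear_maps K (tensor K (scalar_space K) V) V \<and>
           (\<forall>c \<in> carrier K. \<forall>x \<in> carrier V.
              h (pure_tensor K (scalar_space K) V (scalar_embedding K c) x) = c \<odot>\<^bsub>V\<^esub> x)) V),
     RUnit = (\<lambda>V. Arrow (tensor K V (scalar_space K))
        (THE h. h \<in> linear_maps K (tensor K V (scalar_space K)) V \<and>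
           (\<forall>c \<in> carrier K. \<forall>x \<in> carrier V.
              h (pure_tensor K V (scalar_space K) x (scalar_embedding K c)) = c \<odot>\<^bsub>V\<^esub> x)) V)\<rparr>"

section \<open>Bialgebras, filtrations and glider representations\<close>

text \<open>
  \<open>comult_terms B b\<close> is a finite set of pairs with \<open>\<Delta>(b) = (\<Sum>(x, y) \<in> comult_terms B b. x \<otimes> y)\<close>.
\<close>

record ('k, 'b) bialgebra = "('k, 'b) module" +
  comult_terms :: "'b \<Rightarrow> ('b \<times> 'b) set"
  counit :: "'b \<Rightarrow> 'k"

definition basis_vector ::
    "('k, 'm) ring_scheme \<Rightarrow> ('g, 'n) monoid_scheme \<Rightarrow> 'g \<Rightarrow> 'g \<Rightarrow> 'k" where
  "basis_vector K G g = (\<lambda>h \<in> carrier G. if h = g then \<one>\<^bsub>K\<^esub> else \<zero>\<^bsub>K\<^esub>)"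

text \<open>
  The group bialgebra of a finite group \<open>G\<close>: an element \<open>\<Sum>\<^sub>g b\<^sub>g g\<close> is the function \<open>b\<close> on
  \<open>carrier G\<close>, and \<open>\<Delta>(b) = \<Sum>\<^sub>g b\<^sub>g g \<otimes> g\<close>. Only the \<open>g\<close> with \<open>b\<^sub>g \<noteq> 0\<close> are listed in
  \<open>comult_terms\<close>, so that both factors lie in every filtration degree of
  the one-step filtration that contains \<open>b\<close>.
\<close>

definition group_bialgebra ::
    "('k, 'm) ring_scheme \<Rightarrow> ('g, 'n) monoid_scheme \<Rightarrow> ('k, 'g \<Rightarrow> 'k) bialgebra" where
  "group_bialgebra K G =
    \<lparr>carrier = carrier G \<rightarrow>\<^sub>E carrier K,
     mult = (\<lambda>a b. \<lambda>g \<in> carrier G.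
        \<Oplus>\<^bsub>K\<^esub> h \<in> carrier G. a h \<otimes>\<^bsub>K\<^esub> b (inv\<^bsub>G\<^esub> h \<otimes>\<^bsub>G\<^esub> g)),
     one = basis_vector K G \<one>\<^bsub>G\<^esub>,
     zero = (\<lambda>g \<in> carrier G. \<zero>\<^bsub>K\<^esub>),
     add = (\<lambda>a b. \<lambda>g \<in> carrier G. a g \<oplus>\<^bsub>K\<^esub> b g),
     smult = (\<lambda>c b. \<lambda>g \<in> carrier G. c \<otimes>\<^bsub>K\<^esub> b g),
     comult_terms = (\<lambda>b.
        {((\<lambda>h \<in> carrier G. b g \<otimes>\<^bsub>K\<^esub> basis_vector K G g h), basis_vector K G g) | g.
           g \<in> carrier G \<and> b g \<noteq> \<zero>\<^bsub>K\<^esub>}),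
     counit = (\<lambda>b. \<Oplus>\<^bsub>K\<^esub> g \<in> carrier G. b g)\<rparr>"

definition one_step_filtration ::
    "('k, 'm) ring_scheme \<Rightarrow> ('k, 'b) bialgebra \<Rightarrow> int \<Rightarrow> 'b set" where
  "one_step_filtration K B i =
     (if i < 0 then {\<zero>\<^bsub>B\<^esub>}
      else if i = 0 then {c \<odot>\<^bsub>B\<^esub> \<one>\<^bsub>B\<^esub> | c. c \<in> carrier K}
      else carrier B)"

datatype index = Fin int | Infty

fun glider_hom ::
    "('k, 'b) bialgebra \<Rightarrow> (int \<Rightarrow> 'b set) \<Rightarrow> index \<Rightarrow> index \<Rightarrow> 'b set" where
  "glider_hom B F (Fin \<alpha>) (Fin \<beta>) = (if \<alpha> \<le> \<beta> then F (\<beta> - \<alpha>) else {\<zero>\<^bsub>B\<^esub>})"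
| "glider_hom B F \<alpha> Infty = carrier B"
| "glider_hom B F Infty (Fin \<beta>) = {\<zero>\<^bsub>B\<^esub>}"

text \<open>The category $\overline{\mathcal F}_\Lambda B$:\<close>

definition filtered_companion ::
    "int set \<Rightarrow> ('k, 'b) bialgebra \<Rightarrow> (int \<Rightarrow> 'b set) \<Rightarrow> ('k, index, 'b) lin_category" where
  "filtered_companion \<Lambda> B F =
     (let I = insert Infty (Fin ` \<Lambda>) in
      \<lparr>Obj = I,
       Arr = {Arrow \<alpha> b \<beta> | \<alpha> b \<beta>. \<alpha> \<in> I \<and> \<beta> \<in> I \<and> b \<in> glider_hom B F \<alpha> \<beta>},
       Id = (\<lambda>\<alpha>. Arrow \<alpha> \<one>\<^bsub>B\<^esub> \<alpha>),
       Comp = (\<lambda>g f. Arrow (src f) (dat g \<otimes>\<^bsub>B\<^esub> dat f) (trg g)),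
       Add = (\<lambda>f g. Arrow (src f) (dat f \<oplus>\<^bsub>B\<^esub> dat g) (trg f)),
       Scale = (\<lambda>c f. Arrow (src f) (c \<odot>\<^bsub>B\<^esub> dat f) (trg f))\<rparr>)"

fun index_le :: "index \<Rightarrow> index \<Rightarrow> bool" where
  "index_le (Fin \<alpha>) (Fin \<beta>) \<longleftrightarrow> \<alpha> \<le> \<beta>"
| "index_le \<alpha> Infty \<longleftrightarrow> True"
| "index_le Infty (Fin \<beta>) \<longleftrightarrow> False"

type_synonym ('k, 'u, 'b) glider = "(index, 'b, ('k, 'u) module, 'u \<Rightarrow> 'u) functor_data"
type_synonym ('k, 'u) glider_map = "index \<Rightarrow> (('k, 'u) module, 'u \<Rightarrow> 'u) arrow"

text \<open>Functors and natural transformations are extensional, so that equality of those that agree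
  on \<open>filtered_companion\<close> is equality in the logic.\<close>

definition is_preglider ::
    "('k, 'm) ring_scheme \<Rightarrow> int set \<Rightarrow> ('k, 'b) bialgebra \<Rightarrow> (int \<Rightarrow> 'b set) \<Rightarrow>
     ('k, 'u, 'b) glider \<Rightarrow> bool" where
  "is_preglider K \<Lambda> B F M \<longleftrightarrow>
     (let C = filtered_companion \<Lambda> B F in
      is_linear_functor K C (vect K) M \<and>
      ObjMap M \<in> extensional (Obj C) \<and> ArrMap M \<in> extensional (Arr C) \<and>
      (\<forall>\<alpha> \<in> Obj C. \<forall>\<beta> \<in> Obj C. index_le \<alpha> \<beta> \<longrightarrow>
         mono_arr (vect K) (ArrMap M (Arrow \<alpha> \<one>\<^bsub>B\<^esub> \<beta>))))"

definition glider_tensor ::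
    "('k, 'm) ring_scheme \<Rightarrow> int set \<Rightarrow> ('k, 'b) bialgebra \<Rightarrow> (int \<Rightarrow> 'b set) \<Rightarrow>
     ('k, 'u, 'b) glider \<Rightarrow> ('k, 'u, 'b) glider \<Rightarrow> ('k, 'u, 'b) glider" where
  "glider_tensor K \<Lambda> B F M N =
     (let C = filtered_companion \<Lambda> B F; T = (\<lambda>i. tensor K (ObjMap M i) (ObjMap N i)) in
      \<lparr>ObjMap = restrict T (Obj C),
       ArrMap = (\<lambda>f \<in> Arr C. Arrow (T (src f))
          (\<lambda>t \<in> carrier (T (src f)).
             \<Oplus>\<^bsub>T (trg f)\<^esub> p \<in> comult_terms B (dat f).
               dat (TensA (vect K) (ArrMap M (Arrow (src f) (fst p) (trg f)))
                                   (ArrMap N (Arrow (src f) (snd p) (trg f)))) t)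
          (T (trg f)))\<rparr>)"

definition glider_unit ::
    "('k, 'm) ring_scheme \<Rightarrow> int set \<Rightarrow> ('k, 'b) bialgebra \<Rightarrow> (int \<Rightarrow> 'b set) \<Rightarrow>
     ('k, 'u, 'b) glider" where
  "glider_unit K \<Lambda> B F =
     (let C = filtered_companion \<Lambda> B F in
      \<lparr>ObjMap = (\<lambda>i \<in> Obj C. scalar_space K),
       ArrMap = (\<lambda>f \<in> Arr C.
          Scale (vect K) (counit B (dat f)) (Id (vect K) (scalar_space K)))\<rparr>)"

definition preglid ::
    "('k, 'm) ring_scheme \<Rightarrow> int set \<Rightarrow> ('k, 'b) bialgebra \<Rightarrow> (int \<Rightarrow> 'b set) \<Rightarrow>
     ('k, ('k, 'u, 'b) glider, ('k, 'u) glider_map) mon_category" where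
  "preglid K \<Lambda> B F =
     (let C = filtered_companion \<Lambda> B F; V = vect K; I = Obj C; T = glider_tensor K \<Lambda> B F;
          E = glider_unit K \<Lambda> B F in
      \<lparr>Obj = {M. is_preglider K \<Lambda> B F M},
       Arr = {Arrow M \<eta> N | M \<eta> N. is_preglider K \<Lambda> B F M \<and> is_preglider K \<Lambda> B F N \<and>
                is_nat_trans C V M N \<eta> \<and> \<eta> \<in> extensional I},
       Id = (\<lambda>M. Arrow M (\<lambda>i \<in> I. Id V (ObjMap M i)) M),
       Comp = (\<lambda>g f. Arrow (src f) (\<lambda>i \<in> I. dat g i \<cdot>\<^bsub>V\<^esub> dat f i) (trg g)),
       Add = (\<lambda>f g. Arrow (src f) (\<lambda>i \<in> I. Add V (dat f i) (dat g i)) (trg f)),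
       Scale = (\<lambda>c f. Arrow (src f) (\<lambda>i \<in> I. Scale V c (dat f i)) (trg f)),
       TensO = T,
       TensA = (\<lambda>f g. Arrow (T (src f) (src g)) (\<lambda>i \<in> I. TensA V (dat f i) (dat g i))
                            (T (trg f) (trg g))),
       UnitO = E,
       Assoc = (\<lambda>L M N. Arrow (T (T L M) N)
          (\<lambda>i \<in> I. Assoc V (ObjMap L i) (ObjMap M i) (ObjMap N i)) (T L (T M N))),
       LUnit = (\<lambda>M. Arrow (T E M) (\<lambda>i \<in> I. LUnit V (ObjMap M i)) M),
       RUnit = (\<lambda>M. Arrow (T M E) (\<lambda>i \<in> I. RUnit V (ObjMap M i)) M)\<rparr>)"

definition glider_weak_isos ::
    "('k, 'm) ring_scheme \<Rightarrow> int set \<Rightarrow> ('k, 'b) bialgebra \<Rightarrow> (int \<Rightarrow> 'b set) \<Rightarrow>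
     (('k, 'u, 'b) glider, ('k, 'u) glider_map) arrow set" where
  "glider_weak_isos K \<Lambda> B F =
     {f \<in> Arr (preglid K \<Lambda> B F). \<forall>i \<in> \<Lambda>. iso_arr (vect K) (dat f (Fin i))}"

definition Glid ::
    "('k, 'm) ring_scheme \<Rightarrow> int set \<Rightarrow> ('k, 'b) bialgebra \<Rightarrow> (int \<Rightarrow> 'b set) \<Rightarrow>
     ('k, ('k, 'u, 'b) glider,
      (('k, 'u, 'b) glider, ('k, 'u) glider_map) arrow step list set) mon_category" where
  "Glid K \<Lambda> B F = localization (preglid K \<Lambda> B F) (glider_weak_isos K \<Lambda> B F)"

definition glid ::
    "'u itself \<Rightarrow> ('k, 'm) ring_scheme \<Rightarrow> int set \<Rightarrow> ('k, 'b) bialgebra \<Rightarrow> (int \<Rightarrow> 'b set) \<Rightarrow>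
     ('k, ('k, 'u, 'b) glider,
      (('k, 'u, 'b) glider, ('k, 'u) glider_map) arrow step list set) mon_category" where
  "glid _ K \<Lambda> B F = full_subcategory (Glid K \<Lambda> B F) (noetherian_obj (Glid K \<Lambda> B F))"

end

(*
A glider over the one-step filtration of kG consists of subspaces M_{-1} and M_0 of a representation
M_inf of G such that G moves M_{-1} into M_0.  Every zigzag reduces to a single fraction, because a
linear map on the levels -1 and 0 is realised on its graph inside the sum of the two ambient
representations, and because two maps that agree on these levels are equalised by a smaller ambient
representation.  Hence Glid is isomorphic, strictly, to the category of gliders whose morphisms only
see the levels -1 and 0; there a glider is Noetherian if and only if M_0 is finite-dimensional.

An isomorphism of groups transports gliders strictly.  Conversely, the monoidal category determines
the group: eta, the inclusion of X = (0 <= k <= k) into the unit, is the largest proper subobject,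
and eps, from P = (k1 <= kG <= kG) to the unit, is the weakly initial morphism to the unit that
factors through no proper subobject.  A morphism g from X to P is an element of kG.  It is an
element of G if and only if eps g = eta and g commutes with some P -> P (x) P and some isomorphism
X -> X (x) X, since all morphisms P -> P (x) P send each group element h to a multiple of h (x) h.
Finally, l = g h and l' = g h' for some g in G if and only if x h = y h' implies x l = y l' for all
parallel x and y with source P; this relation determines the multiplication up to a translation.
*)

theory Submission
  imports Defs
begin

section \<open>Categories\<close>

text \<open>The group algebra need not determine the group, so the tensor product has to single out
  G inside kG. Composition does not display the multiplication either: two morphisms from X to P
  cannot be composed, and the endomorphisms of P are scalars. What composition does display is G
  acting on pairs. If x and y correspond to vectors m and m' of level -1, then x h = y h' means h m
  = h' m', and inside the ambient representation any g may be applied to both sides. For the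
  converse the regular representation suffices, with m and m' the inverses of h and h'. An
  equivalence respects no chosen comultiplication of P and no chosen isomorphism of X with its
  square. Both are unique up to a scalar, so they are quantified existentially, and eps g = eta
  removes the scalar.

  The other obstacle is size. Gliders live on a fixed type, and arrows of the localization are
  classes of zigzags. Direct sums, kG and tensor products are therefore coded into that type, and a
  class of zigzags is handled through its value in a category with explicit morphisms.\<close>

locale cat =
  fixes C :: "('o, 'd, 'x) category_scheme" (structure)
  assumes src_obj [simp]: "f \<in> Arr C \<Longrightarrow> src f \<in> Obj C"
    and trg_obj [simp]: "f \<in> Arr C \<Longrightarrow> trg f \<in> Obj C"
    and Id_arr [simp]: "x \<in> Obj C \<Longrightarrow> Id C x \<in> Arr C"
    and src_Id [simp]: "x \<in> Obj C \<Longrightarrow> src (Id C x) = x"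
    and trg_Id [simp]: "x \<in> Obj C \<Longrightarrow> trg (Id C x) = x"
    and Comp_arr [simp]: "f \<in> Arr C \<Longrightarrow> g \<in> Arr C \<Longrightarrow> trg f = src g \<Longrightarrow> g \<cdot> f \<in> Arr C"
    and src_Comp [simp]: "f \<in> Arr C \<Longrightarrow> g \<in> Arr C \<Longrightarrow> trg f = src g \<Longrightarrow> src (g \<cdot> f) = src f"
    and trg_Comp [simp]: "f \<in> Arr C \<Longrightarrow> g \<in> Arr C \<Longrightarrow> trg f = src g \<Longrightarrow> trg (g \<cdot> f) = trg g"
    and Comp_assoc [simp]: "f \<in> Arr C \<Longrightarrow> g \<in> Arr C \<Longrightarrow> h \<in> Arr C \<Longrightarrow> trg f = src g \<Longrightarrow>
      trg g = src h \<Longrightarrow> (h \<cdot> g) \<cdot> f = h \<cdot> (g \<cdot> f)"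
    and Id_left: "f \<in> Arr C \<Longrightarrow> Id C (trg f) \<cdot> f = f"
    and Id_right: "f \<in> Arr C \<Longrightarrow> f \<cdot> Id C (src f) = f"
begin

lemma Id_left' [simp]: "f \<in> Arr C \<Longrightarrow> trg f = y \<Longrightarrow> Id C y \<cdot> f = f"
  and Id_right' [simp]: "f \<in> Arr C \<Longrightarrow> src f = x \<Longrightarrow> f \<cdot> Id C x = f"
  using Id_left Id_right by auto

lemma iso_arrE:
  assumes "iso_arr C f"
  obtains g where "f \<in> Arr C" "g \<in> Arr C" "src g = trg f" "trg g = src f"
    "g \<cdot> f = Id C (src f)" "f \<cdot> g = Id C (trg f)"
  using assms by (auto simp: iso_arr_def homset_def)

lemma iso_arrI:
  assumes "f \<in> Arr C" "g \<in> Arr C" "src g = trg f" "trg g = src f"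
    "g \<cdot> f = Id C (src f)" "f \<cdot> g = Id C (trg f)"
  shows "iso_arr C f"
  using assms by (auto simp: iso_arr_def homset_def)

lemma iso_Id: "x \<in> Obj C \<Longrightarrow> iso_arr C (Id C x)"
  by (rule iso_arrI[where g = "Id C x"]) auto

text \<open>Composites are normalised to the right, so \<open>g \<cdot> f\<close> is no subterm of
  \<open>g \<cdot> (f \<cdot> h)\<close>. This is the form in which an inverse can be cancelled
  there.\<close>

lemma cancel_left:
  assumes "h \<in> Arr C" "f \<in> Arr C" "g \<in> Arr C" "trg h = src f" "trg f = src g"
    "g \<cdot> f = Id C (trg h)"
  shows "g \<cdot> (f \<cdot> h) = h"
  using assms Comp_assoc[of h f g] by simp

lemma iso_Comp:
  assumes f: "iso_arr C f" and g: "iso_arr C g" and fg: "trg f = src g"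
  shows "iso_arr C (g \<cdot> f)"
proof -
  obtain f' where f': "f \<in> Arr C" "f' \<in> Arr C" "src f' = trg f" "trg f' = src f"
    "f' \<cdot> f = Id C (src f)" "f \<cdot> f' = Id C (trg f)" using iso_arrE[OF f] .
  obtain g' where g': "g \<in> Arr C" "g' \<in> Arr C" "src g' = trg g" "trg g' = src g"
    "g' \<cdot> g = Id C (src g)" "g \<cdot> g' = Id C (trg g)" using iso_arrE[OF g] .
  have 1: "g' \<cdot> (g \<cdot> f) = f" by (rule cancel_left) (use f' g' fg in auto)
  have 2: "f \<cdot> (f' \<cdot> g') = g'" by (rule cancel_left) (use f' g' fg in auto)
  show ?thesis
    by (rule iso_arrI[where g = "f' \<cdot> g'"]) (use f' g' fg 1 2 in auto)
qed

lemma iso_cancel_left: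
  assumes "iso_arr C g" "f \<in> Arr C" "f' \<in> Arr C" "trg f = src g" "trg f' = src g" "src f = src f'"
    "g \<cdot> f = g \<cdot> f'"
  shows "f = f'"
  using assms(1)
proof (rule iso_arrE)
  fix h
  assume h: "g \<in> Arr C" "h \<in> Arr C" "src h = trg g" "trg h = src g" "h \<cdot> g = Id C (src g)"
  have "h \<cdot> (g \<cdot> f) = f" by (rule cancel_left) (simp_all only: h assms)
  moreover have "h \<cdot> (g \<cdot> f') = f'" by (rule cancel_left) (simp_all only: h assms)
  ultimately show ?thesis using assms(7) by metis
qed

lemma iso_cancel_right:
  assumes g: "iso_arr C g" and f: "f \<in> Arr C" "f' \<in> Arr C" "src f = trg g" "src f' = trg g"
    and eq: "f \<cdot> g = f' \<cdot> g"
  shows "f = f'"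
  using g
proof (rule iso_arrE)
  fix h
  assume h: "g \<in> Arr C" "h \<in> Arr C" "src h = trg g" "trg h = src g" "g \<cdot> h = Id C (trg g)"
  have "f = (f \<cdot> g) \<cdot> h" using h f by simp
  also have "\<dots> = f'" unfolding eq using h f by simp
  finally show ?thesis .
qed

lemma mono_arrD:
  assumes "mono_arr C m" "f \<in> Arr C" "g \<in> Arr C" "trg f = src m" "trg g = src m" "src f = src g"
    "m \<cdot> f = m \<cdot> g"
  shows "f = g"
proof -
  have "f \<in> homset C (src f) (src m)" "g \<in> homset C (src f) (src m)"
    using assms by (auto simp: homset_def)
  then show ?thesis
    using assms(1,7) src_obj[OF assms(2)] unfolding mono_arr_def by metis
qed

lemma mono_arrI:
  assumes "m \<in> Arr C"
    and "\<And>f g. f \<in> Arr C \<Longrightarrow> g \<in> Arr C \<Longrightarrow> trg f = src m \<Longrightarrow> trg g = src m \<Longrightarrow> src f = src g \<Longrightarrow>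
      m \<cdot> f = m \<cdot> g \<Longrightarrow> f = g"
  shows "mono_arr C m"
  using assms unfolding mono_arr_def homset_def by blast

lemma iso_imp_mono: "iso_arr C f \<Longrightarrow> mono_arr C f"
proof (rule mono_arrI)
  assume f: "iso_arr C f"
  then show "f \<in> Arr C" by (simp add: iso_arr_def)
  show "h = h'" if "h \<in> Arr C" "h' \<in> Arr C" "trg h = src f" "trg h' = src f" "src h = src h'"
    "f \<cdot> h = f \<cdot> h'" for h h'
    using iso_cancel_left[OF f that] .
qed

lemma mono_Comp:
  assumes "mono_arr C f" "mono_arr C g" "trg f = src g"
  shows "mono_arr C (g \<cdot> f)"
proof (rule mono_arrI)
  have a: "f \<in> Arr C" "g \<in> Arr C" using assms by (auto simp: mono_arr_def)
  then show "g \<cdot> f \<in> Arr C" using assms by simp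
  fix h h'
  assume h: "h \<in> Arr C" "h' \<in> Arr C" "trg h = src (g \<cdot> f)" "trg h' = src (g \<cdot> f)" "src h = src h'"
    and eq: "g \<cdot> f \<cdot> h = g \<cdot> f \<cdot> h'"
  have "f \<cdot> h = f \<cdot> h'"
    by (rule mono_arrD[OF assms(2)]) (use a assms h eq in auto)
  then show "h = h'"
    using mono_arrD[OF assms(1), of h h'] a h assms by auto
qed

end

text \<open>Typing of all operations and bifunctoriality of the tensor product, with the coherence
  maps as mere data: the fragment of a linear monoidal category that passes through all
  constructions below.\<close>

locale lin_mon_cat = cat C
  for K :: "('k, 'm) ring_scheme" and C :: "('k, 'o, 'd) mon_category" (structure) +
  assumes Add_arr [simp]: "f \<in> Arr C \<Longrightarrow> g \<in> Arr C \<Longrightarrow> src f = src g \<Longrightarrow> trg f = trg g \<Longrightarrow> Add C f g \<in> Arr C"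
    and src_Add [simp]: "f \<in> Arr C \<Longrightarrow> g \<in> Arr C \<Longrightarrow> src f = src g \<Longrightarrow> trg f = trg g \<Longrightarrow> src (Add C f g) = src f"
    and trg_Add [simp]: "f \<in> Arr C \<Longrightarrow> g \<in> Arr C \<Longrightarrow> src f = src g \<Longrightarrow> trg f = trg g \<Longrightarrow> trg (Add C f g) = trg f"
    and Scale_arr [simp]: "c \<in> carrier K \<Longrightarrow> f \<in> Arr C \<Longrightarrow> Scale C c f \<in> Arr C"
    and src_Scale [simp]: "c \<in> carrier K \<Longrightarrow> f \<in> Arr C \<Longrightarrow> src (Scale C c f) = src f"
    and trg_Scale [simp]: "c \<in> carrier K \<Longrightarrow> f \<in> Arr C \<Longrightarrow> trg (Scale C c f) = trg f"
    and TensO_obj [simp]: "x \<in> Obj C \<Longrightarrow> y \<in> Obj C \<Longrightarrow> TensO C x y \<in> Obj C"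
    and TensA_arr [simp]: "f \<in> Arr C \<Longrightarrow> g \<in> Arr C \<Longrightarrow> TensA C f g \<in> Arr C"
    and src_TensA [simp]: "f \<in> Arr C \<Longrightarrow> g \<in> Arr C \<Longrightarrow> src (TensA C f g) = TensO C (src f) (src g)"
    and trg_TensA [simp]: "f \<in> Arr C \<Longrightarrow> g \<in> Arr C \<Longrightarrow> trg (TensA C f g) = TensO C (trg f) (trg g)"
    and TensA_Id [simp]: "x \<in> Obj C \<Longrightarrow> y \<in> Obj C \<Longrightarrow> TensA C (Id C x) (Id C y) = Id C (TensO C x y)"
    and TensA_Comp: "f \<in> Arr C \<Longrightarrow> g \<in> Arr C \<Longrightarrow> trg f = src g \<Longrightarrow>
      f' \<in> Arr C \<Longrightarrow> g' \<in> Arr C \<Longrightarrow> trg f' = src g' \<Longrightarrow>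
      TensA C (g \<cdot> f) (g' \<cdot> f') = TensA C g g' \<cdot> TensA C f f'"
    and UnitO_obj [simp]: "UnitO C \<in> Obj C"
    and Assoc_hom: "x \<in> Obj C \<Longrightarrow> y \<in> Obj C \<Longrightarrow> z \<in> Obj C \<Longrightarrow>
      Assoc C x y z \<in> homset C (TensO C (TensO C x y) z) (TensO C x (TensO C y z))"
    and LUnit_hom: "x \<in> Obj C \<Longrightarrow> LUnit C x \<in> homset C (TensO C (UnitO C) x) x"
    and RUnit_hom: "x \<in> Obj C \<Longrightarrow> RUnit C x \<in> homset C (TensO C x (UnitO C)) x"
begin

lemma iso_TensA:
  assumes "iso_arr C f" "iso_arr C g"
  shows "iso_arr C (TensA C f g)"
proof -
  obtain f' where f': "f \<in> Arr C" "f' \<in> Arr C" "src f' = trg f" "trg f' = src f"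
    "f' \<cdot> f = Id C (src f)" "f \<cdot> f' = Id C (trg f)" using iso_arrE[OF assms(1)] .
  obtain g' where g': "g \<in> Arr C" "g' \<in> Arr C" "src g' = trg g" "trg g' = src g"
    "g' \<cdot> g = Id C (src g)" "g \<cdot> g' = Id C (trg g)" using iso_arrE[OF assms(2)] .
  show ?thesis
    by (rule iso_arrI[where g = "TensA C f' g'"]) (use f' g' in \<open>auto simp flip: TensA_Comp\<close>)
qed

end

subsection \<open>Strict isomorphisms\<close>

text \<open>Equations take the place of coherence isomorphisms, so that properties of objects and
  arrows transfer by rewriting along \<open>fo\<close> and \<open>fa\<close>.\<close>

locale strict_iso =
  fixes K :: "('k, 'm) ring_scheme"
    and C :: "('k, 'o1, 'd1) mon_category"
    and D :: "('k, 'o2, 'd2) mon_category"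
    and fo :: "'o1 \<Rightarrow> 'o2" and fa :: "('o1, 'd1) arrow \<Rightarrow> ('o2, 'd2) arrow"
  assumes fo_bij: "bij_betw fo (Obj C) (Obj D)"
    and fa_bij: "bij_betw fa (Arr C) (Arr D)"
    and fa_src [simp]: "f \<in> Arr C \<Longrightarrow> src (fa f) = fo (src f)"
    and fa_trg [simp]: "f \<in> Arr C \<Longrightarrow> trg (fa f) = fo (trg f)"
    and fa_Id: "x \<in> Obj C \<Longrightarrow> fa (Id C x) = Id D (fo x)"
    and fa_Comp: "f \<in> Arr C \<Longrightarrow> g \<in> Arr C \<Longrightarrow> trg f = src g \<Longrightarrow>
      fa (g \<cdot>\<^bsub>C\<^esub> f) = fa g \<cdot>\<^bsub>D\<^esub> fa f"
    and fa_Add: "f \<in> Arr C \<Longrightarrow> g \<in> Arr C \<Longrightarrow> src f = src g \<Longrightarrow> trg f = trg g \<Longrightarrow>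
      fa (Add C f g) = Add D (fa f) (fa g)"
    and fa_Scale: "c \<in> carrier K \<Longrightarrow> f \<in> Arr C \<Longrightarrow> fa (Scale C c f) = Scale D c (fa f)"
    and fo_TensO: "x \<in> Obj C \<Longrightarrow> y \<in> Obj C \<Longrightarrow> fo (TensO C x y) = TensO D (fo x) (fo y)"
    and fa_TensA: "f \<in> Arr C \<Longrightarrow> g \<in> Arr C \<Longrightarrow> fa (TensA C f g) = TensA D (fa f) (fa g)"
    and fo_UnitO: "fo (UnitO C) = UnitO D"
    and fa_Assoc: "x \<in> Obj C \<Longrightarrow> y \<in> Obj C \<Longrightarrow> z \<in> Obj C \<Longrightarrow>
      fa (Assoc C x y z) = Assoc D (fo x) (fo y) (fo z)"
    and fa_LUnit: "x \<in> Obj C \<Longrightarrow> fa (LUnit C x) = LUnit D (fo x)"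
    and fa_RUnit: "x \<in> Obj C \<Longrightarrow> fa (RUnit C x) = RUnit D (fo x)"
begin

lemma fo_obj [simp]: "x \<in> Obj C \<Longrightarrow> fo x \<in> Obj D"
  using fo_bij by (auto simp: bij_betw_def)

lemma fa_arr [simp]: "f \<in> Arr C \<Longrightarrow> fa f \<in> Arr D"
  using fa_bij by (auto simp: bij_betw_def)

lemma fo_eq [simp]: "x \<in> Obj C \<Longrightarrow> y \<in> Obj C \<Longrightarrow> fo x = fo y \<longleftrightarrow> x = y"
  using fo_bij by (auto simp: bij_betw_def inj_on_def)

lemma fa_eq [simp]: "f \<in> Arr C \<Longrightarrow> g \<in> Arr C \<Longrightarrow> fa f = fa g \<longleftrightarrow> f = g"
  using fa_bij by (auto simp: bij_betw_def inj_on_def)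

lemma Obj_image: "Obj D = fo ` Obj C" and Arr_image: "Arr D = fa ` Arr C"
  using fo_bij fa_bij by (auto simp: bij_betw_def)

text \<open>Both \<open>fo\<close> and \<open>fa\<close> are onto, so every law in \<open>D\<close>
  is the image of the same law in \<open>C\<close>.\<close>

lemma lin_mon_cat_target:
  assumes "lin_mon_cat K C"
  shows "lin_mon_cat K D"
proof -
  interpret C: lin_mon_cat K C by fact
  have hom: "fa f \<in> homset D (fo x) (fo y)" if "f \<in> homset C x y" for f x y
    using that by (auto simp: homset_def)
  show ?thesis
    by unfold_locales
      (auto simp: Obj_image Arr_image fa_Id[symmetric] fa_Comp[symmetric] fa_Add[symmetric]
        fa_Scale[symmetric] fo_TensO[symmetric] fa_TensA[symmetric] fo_UnitO[symmetric]
        fa_Assoc[symmetric] fa_LUnit[symmetric] fa_RUnit[symmetric] C.TensA_Comp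
        intro!: hom C.Assoc_hom C.LUnit_hom C.RUnit_hom)
qed

lemma strict_iso_inverse:
  assumes "lin_mon_cat K C"
  shows "strict_iso K D C (inv_into (Obj C) fo) (inv_into (Arr C) fa)"
proof -
  interpret C: lin_mon_cat K C by fact
  have [simp]: "inv_into (Obj C) fo (fo x) = x" if "x \<in> Obj C" for x
    using that fo_bij by (simp add: bij_betw_def)
  have [simp]: "inv_into (Arr C) fa (fa f) = f" if "f \<in> Arr C" for f
    using that fa_bij by (simp add: bij_betw_def)
  have [simp]: "Assoc C x y z \<in> Arr C" "LUnit C x \<in> Arr C" "RUnit C x \<in> Arr C"
    if "x \<in> Obj C" "y \<in> Obj C" "z \<in> Obj C" for x y z
    using C.Assoc_hom[OF that] C.LUnit_hom[OF that(1)] C.RUnit_hom[OF that(1)]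
    by (auto simp: homset_def)
  show ?thesis
  proof
    show "bij_betw (inv_into (Obj C) fo) (Obj D) (Obj C)" using fo_bij by (rule bij_betw_inv_into)
    show "bij_betw (inv_into (Arr C) fa) (Arr D) (Arr C)" using fa_bij by (rule bij_betw_inv_into)
  qed (auto simp: Obj_image Arr_image fa_Id[symmetric] fa_Comp[symmetric] fa_Add[symmetric]
        fa_Scale[symmetric] fo_TensO[symmetric] fa_TensA[symmetric] fo_UnitO[symmetric]
        fa_Assoc[symmetric] fa_LUnit[symmetric] fa_RUnit[symmetric])
qed

lemma full_subcategory:
  assumes "\<And>x. x \<in> Obj C \<Longrightarrow> P x \<longleftrightarrow> Q (fo x)" "cat C"
  shows "strict_iso K (full_subcategory C P) (full_subcategory D Q) fo fa"
proof -
  interpret C: cat C by fact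
  have P: "P x \<longleftrightarrow> Q (fo x)" if "x \<in> Obj C" for x using assms that by blast
  show ?thesis
  proof
    show "bij_betw fo (Obj (full_subcategory C P)) (Obj (full_subcategory D Q))"
      by (rule bij_betwI') (auto simp: full_subcategory_def Obj_image P)
    show "bij_betw fa (Arr (full_subcategory C P)) (Arr (full_subcategory D Q))"
      by (rule bij_betwI') (auto simp: full_subcategory_def Arr_image P)
  qed (auto simp: full_subcategory_def fa_Id fa_Comp fa_Add fa_Scale fo_TensO fa_TensA fo_UnitO
      fa_Assoc fa_LUnit fa_RUnit)
qed

lemma mono_arr_iff:
  assumes "cat C" "m \<in> Arr C"
  shows "mono_arr D (fa m) \<longleftrightarrow> mono_arr C m"
proof -
  interpret C: cat C by fact
  show ?thesis
  proof
    assume m: "mono_arr D (fa m)"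
    show "mono_arr C m"
    proof (rule C.mono_arrI)
      fix f g
      assume *: "f \<in> Arr C" "g \<in> Arr C" "trg f = src m" "trg g = src m" "src f = src g"
        and eq: "m \<cdot>\<^bsub>C\<^esub> f = m \<cdot>\<^bsub>C\<^esub> g"
      have "fa f \<in> homset D (fo (src f)) (src (fa m))" "fa g \<in> homset D (fo (src f)) (src (fa m))"
        "fo (src f) \<in> Obj D"
        using * assms by (auto simp: homset_def)
      moreover have "fa m \<cdot>\<^bsub>D\<^esub> fa f = fa m \<cdot>\<^bsub>D\<^esub> fa g" using * assms eq by (simp flip: fa_Comp)
      ultimately have "fa f = fa g" using m unfolding mono_arr_def by blast
      then show "f = g" using * by simp
    qed fact
  next
    assume m: "mono_arr C m"
    show "mono_arr D (fa m)"
      unfolding mono_arr_def homset_def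
      using assms(2)
      by (auto simp: Arr_image Obj_image fa_Comp[symmetric]) (rule C.mono_arrD[OF m]; simp)
  qed
qed

lemma subobj_le_iff:
  assumes "cat C" "m \<in> Arr C" "n \<in> Arr C" "trg m = trg n"
  shows "subobj_le D (fa m) (fa n) \<longleftrightarrow> subobj_le C m n"
proof -
  interpret C: cat C by fact
  show ?thesis
    using assms(2-) unfolding subobj_le_def homset_def
    by (auto simp: Arr_image Obj_image fa_Comp[symmetric] intro!: bexI)
qed

text \<open>A chain of subobjects is pushed to \<open>D\<close>, becomes stationary there, and the
  factorizations are reflected. Applied to the inverse isomorphism this also gives the other
  direction.\<close>

lemma noetherian_target:
  assumes "cat C" "x \<in> Obj C" "noetherian_obj D (fo x)"
  shows "noetherian_obj C x"
  unfolding noetherian_obj_def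
proof (intro conjI allI impI assms)
  interpret C: cat C by fact
  fix s assume s: "(\<forall>i. mono_arr C (s i) \<and> trg (s i) = x) \<and> (\<forall>i. subobj_le C (s i) (s (Suc i)))"
  have a: "s i \<in> Arr C" for i using s by (simp add: mono_arr_def)
  have "(\<forall>i. mono_arr D (fa (s i)) \<and> trg (fa (s i)) = fo x) \<and>
    (\<forall>i. subobj_le D (fa (s i)) (fa (s (Suc i))))"
    using s a by (simp add: mono_arr_iff[OF assms(1)] subobj_le_iff[OF assms(1)])
  then obtain n where "\<forall>i\<ge>n. subobj_le D (fa (s i)) (fa (s n))"
    using assms(3) unfolding noetherian_obj_def by (elim conjE allE[where x = "\<lambda>i. fa (s i)"]) blast
  then show "\<exists>n. \<forall>i\<ge>n. subobj_le C (s i) (s n)"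
    using s a by (auto simp: subobj_le_iff[OF assms(1)])
qed

lemma noetherian_iff:
  assumes "lin_mon_cat K C" "x \<in> Obj C"
  shows "noetherian_obj D (fo x) \<longleftrightarrow> noetherian_obj C x"
proof
  interpret C: lin_mon_cat K C by fact
  interpret D: lin_mon_cat K D using assms(1) by (rule lin_mon_cat_target)
  interpret inv: strict_iso K D C "inv_into (Obj C) fo" "inv_into (Arr C) fa"
    using assms(1) by (rule strict_iso_inverse)
  show "noetherian_obj C x" if "noetherian_obj D (fo x)"
    using noetherian_target[OF C.cat_axioms assms(2) that] .
  show "noetherian_obj D (fo x)" if "noetherian_obj C x"
    by (rule inv.noetherian_target[OF D.cat_axioms])
      (use that assms(2) fo_bij in \<open>auto simp: bij_betw_def\<close>)
qed

text \<open>Strictness makes the endpoints coincide, so identities serve as unit and counit of the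
  equivalence and as its monoidal structure maps.\<close>

lemma linear_monoidally_equivalent:
  assumes "lin_mon_cat K C"
  shows "linear_monoidally_equivalent K C D"
proof -
  interpret C: lin_mon_cat K C by fact
  interpret D: lin_mon_cat K D using assms by (rule lin_mon_cat_target)
  interpret inv: strict_iso K D C "inv_into (Obj C) fo" "inv_into (Arr C) fa"
    using assms by (rule strict_iso_inverse)
  have [simp]: "inv_into (Obj C) fo (fo x) = x" if "x \<in> Obj C" for x
    using that fo_bij by (simp add: bij_betw_def)
  have [simp]: "inv_into (Arr C) fa (fa f) = f" if "f \<in> Arr C" for f
    using that fa_bij by (simp add: bij_betw_def)
  have [simp]: "fo (inv_into (Obj C) fo y) = y" if "y \<in> Obj D" for y
    using that fo_bij by (auto simp: bij_betw_def f_inv_into_f)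
  have [simp]: "fa (inv_into (Arr C) fa f) = f" if "f \<in> Arr D" for f
    using that fa_bij by (auto simp: bij_betw_def f_inv_into_f)
  have [simp]: "Assoc D x y z \<in> Arr D" "src (Assoc D x y z) = TensO D (TensO D x y) z"
    "trg (Assoc D x y z) = TensO D x (TensO D y z)"
    if "x \<in> Obj D" "y \<in> Obj D" "z \<in> Obj D" for x y z
    using D.Assoc_hom[OF that] by (auto simp: homset_def)
  have [simp]: "LUnit D x \<in> Arr D" "src (LUnit D x) = TensO D (UnitO D) x" "trg (LUnit D x) = x"
    "RUnit D x \<in> Arr D" "src (RUnit D x) = TensO D x (UnitO D)" "trg (RUnit D x) = x"
    if "x \<in> Obj D" for x
    using D.LUnit_hom[OF that] D.RUnit_hom[OF that]
    by (auto simp: homset_def)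
  define F where "F = \<lparr>ObjMap = fo, ArrMap = fa\<rparr>"
  define G where "G = \<lparr>ObjMap = inv_into (Obj C) fo, ArrMap = inv_into (Arr C) fa\<rparr>"
  have F: "is_functor C D F"
    by (auto simp: is_functor_def F_def homset_def fa_Id fa_Comp)
  have G: "is_functor D C G"
    by (auto simp: is_functor_def G_def homset_def inv.fa_Id inv.fa_Comp)
  have "is_nat_iso C C id_functor (comp_functor G F) (Id C)"
    by (auto simp: is_nat_iso_def is_nat_trans_def id_functor_def comp_functor_def F_def G_def
        homset_def C.iso_Id)
  moreover have "is_nat_iso D D (comp_functor F G) id_functor (Id D)"
    by (auto simp: is_nat_iso_def is_nat_trans_def id_functor_def comp_functor_def F_def G_def
        homset_def D.iso_Id)
  ultimately have "is_equivalence C D F"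
    unfolding is_equivalence_def using F G by blast
  moreover have "is_linear_functor K C D F"
    using F by (auto simp: is_linear_functor_def F_def fa_Add fa_Scale)
  moreover have "is_monoidal_functor C D F (\<lambda>x y. Id D (TensO D (fo x) (fo y))) (Id D (UnitO D))"
    using F by (auto simp: is_monoidal_functor_def F_def homset_def fo_TensO fo_UnitO D.iso_Id
        fa_TensA fa_Assoc fa_LUnit fa_RUnit)
  ultimately show ?thesis
    unfolding linear_monoidally_equivalent_def by blast
qed

end

lemma strict_iso_comp:
  assumes "strict_iso K C D fo fa" "strict_iso K D E go ga" "lin_mon_cat K C"
  shows "strict_iso K C E (go \<circ> fo) (ga \<circ> fa)"
proof -
  interpret f: strict_iso K C D fo fa by fact
  interpret g: strict_iso K D E go ga by fact
  interpret C: lin_mon_cat K C by fact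
  show ?thesis
  proof
    show "bij_betw (go \<circ> fo) (Obj C) (Obj E)" using f.fo_bij g.fo_bij by (rule bij_betw_trans)
    show "bij_betw (ga \<circ> fa) (Arr C) (Arr E)" using f.fa_bij g.fa_bij by (rule bij_betw_trans)
  qed (auto simp: f.fa_Id f.fa_Comp f.fa_Add f.fa_Scale f.fo_TensO f.fa_TensA f.fo_UnitO
      f.fa_Assoc f.fa_LUnit f.fa_RUnit g.fa_Id g.fa_Comp g.fa_Add g.fa_Scale g.fo_TensO g.fa_TensA
      g.fo_UnitO g.fa_Assoc g.fa_LUnit g.fa_RUnit)
qed

lemma (in lin_mon_cat) full_subcategory:
  assumes "P (UnitO C)"
    "\<And>x y. x \<in> Obj C \<Longrightarrow> y \<in> Obj C \<Longrightarrow> P x \<Longrightarrow> P y \<Longrightarrow> P (TensO C x y)"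
  shows "lin_mon_cat K (full_subcategory C P)"
  using assms Assoc_hom LUnit_hom RUnit_hom
  by unfold_locales (auto simp: full_subcategory_def TensA_Comp homset_def)

section \<open>Localization by a calculus of fractions\<close>

definition inv_arr :: "('o, 'd, 'x) category_scheme \<Rightarrow> ('o, 'd) arrow \<Rightarrow> ('o, 'd) arrow" where
  "inv_arr C f = (SOME g. g \<in> homset C (trg f) (src f) \<and>
     g \<cdot>\<^bsub>C\<^esub> f = Id C (src f) \<and> f \<cdot>\<^bsub>C\<^esub> g = Id C (trg f))"

context cat
begin

lemma inv_arr:
  assumes "iso_arr C f"
  shows "inv_arr C f \<in> Arr C" "src (inv_arr C f) = trg f" "trg (inv_arr C f) = src f"
    "inv_arr C f \<cdot> f = Id C (src f)" "f \<cdot> inv_arr C f = Id C (trg f)"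
proof -
  have "\<exists>g. g \<in> homset C (trg f) (src f) \<and> g \<cdot> f = Id C (src f) \<and> f \<cdot> g = Id C (trg f)"
    using assms unfolding iso_arr_def by blast
  from someI_ex[OF this] show "inv_arr C f \<in> Arr C" "src (inv_arr C f) = trg f"
    "trg (inv_arr C f) = src f" "inv_arr C f \<cdot> f = Id C (src f)" "f \<cdot> inv_arr C f = Id C (trg f)"
    unfolding inv_arr_def homset_def by auto
qed

lemma iso_inv_arr: "iso_arr C f \<Longrightarrow> iso_arr C (inv_arr C f)"
  by (rule iso_arrI[where g = f]) (auto simp: inv_arr iso_arr_def)

lemma iso_arr_in: "iso_arr C f \<Longrightarrow> f \<in> Arr C"
  by (simp add: iso_arr_def)

lemma inv_arr_unique:
  assumes f: "iso_arr C f" and g: "g \<in> Arr C" "src g = trg f" "f \<cdot> g = Id C (trg f)"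
    "trg g = src f"
  shows "inv_arr C f = g"
  by (rule iso_cancel_left[OF f]) (use g inv_arr[OF f] in auto)

lemma inv_arr_cancel:
  assumes "iso_arr C f" "h \<in> Arr C"
  shows "trg h = src f \<Longrightarrow> inv_arr C f \<cdot> (f \<cdot> h) = h"
    "trg h = trg f \<Longrightarrow> f \<cdot> (inv_arr C f \<cdot> h) = h"
proof -
  note [simp] = inv_arr[OF assms(1)] iso_arr_in[OF assms(1)] assms(2)
  show "trg h = src f \<Longrightarrow> inv_arr C f \<cdot> (f \<cdot> h) = h"
    by (rule cancel_left) auto
  show "trg h = trg f \<Longrightarrow> f \<cdot> (inv_arr C f \<cdot> h) = h"
    by (rule cancel_left) auto
qed

end

text \<open>\<open>D\<close> is the candidate for the localization and \<open>R\<close> for the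
  localization functor; \<open>S\<close> is the full class of arrows that \<open>R\<close> inverts.
  The substance lies in \<open>roof\<close>, by which every arrow of \<open>D\<close> is a right
  fraction, and in \<open>equalize\<close>, by which arrows identified by \<open>R\<close> already
  agree on a common denominator. The Ore condition is a consequence of the two.\<close>

locale fractions = C: lin_mon_cat K C + D: lin_mon_cat K D
  for K :: "('k, 'm) ring_scheme" and C :: "('k, 'o, 'd) mon_category" (structure)
    and D :: "('k, 'o, 'e) mon_category" +
  fixes R :: "('o, 'd) arrow \<Rightarrow> ('o, 'e) arrow" and S :: "('o, 'd) arrow set"
  assumes Obj_eq: "Obj D = Obj C"
    and R_arr [simp]: "f \<in> Arr C \<Longrightarrow> R f \<in> Arr D"
    and src_R [simp]: "f \<in> Arr C \<Longrightarrow> src (R f) = src f"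
    and trg_R [simp]: "f \<in> Arr C \<Longrightarrow> trg (R f) = trg f"
    and R_Id: "x \<in> Obj C \<Longrightarrow> R (Id C x) = Id D x"
    and R_Comp: "f \<in> Arr C \<Longrightarrow> g \<in> Arr C \<Longrightarrow> trg f = src g \<Longrightarrow> R (g \<cdot>\<^bsub>C\<^esub> f) = R g \<cdot>\<^bsub>D\<^esub> R f"
    and R_Add: "f \<in> Arr C \<Longrightarrow> g \<in> Arr C \<Longrightarrow> src f = src g \<Longrightarrow> trg f = trg g \<Longrightarrow>
      R (Add C f g) = Add D (R f) (R g)"
    and R_Scale: "c \<in> carrier K \<Longrightarrow> f \<in> Arr C \<Longrightarrow> R (Scale C c f) = Scale D c (R f)"
    and TensO_eq: "TensO D x y = TensO C x y"
    and R_TensA: "f \<in> Arr C \<Longrightarrow> g \<in> Arr C \<Longrightarrow> R (TensA C f g) = TensA D (R f) (R g)"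
    and UnitO_eq: "UnitO D = UnitO C"
    and R_Assoc: "x \<in> Obj C \<Longrightarrow> y \<in> Obj C \<Longrightarrow> z \<in> Obj C \<Longrightarrow> R (Assoc C x y z) = Assoc D x y z"
    and R_LUnit: "x \<in> Obj C \<Longrightarrow> R (LUnit C x) = LUnit D x"
    and R_RUnit: "x \<in> Obj C \<Longrightarrow> R (RUnit C x) = RUnit D x"
    and Add_Comp: "p \<in> Arr D \<Longrightarrow> q \<in> Arr D \<Longrightarrow> r \<in> Arr D \<Longrightarrow> src p = src q \<Longrightarrow> trg p = trg q \<Longrightarrow>
      trg r = src p \<Longrightarrow> Add D p q \<cdot>\<^bsub>D\<^esub> r = Add D (p \<cdot>\<^bsub>D\<^esub> r) (q \<cdot>\<^bsub>D\<^esub> r)"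
    and Scale_Comp: "c \<in> carrier K \<Longrightarrow> p \<in> Arr D \<Longrightarrow> r \<in> Arr D \<Longrightarrow>
      trg r = src p \<Longrightarrow> Scale D c p \<cdot>\<^bsub>D\<^esub> r = Scale D c (p \<cdot>\<^bsub>D\<^esub> r)"
    and S_eq: "S = {s \<in> Arr C. iso_arr D (R s)}"
    and roof: "r \<in> Arr D \<Longrightarrow> \<exists>s \<in> S. \<exists>a \<in> Arr C. src a = src s \<and> trg s = src r \<and> trg a = trg r \<and>
      r \<cdot>\<^bsub>D\<^esub> R s = R a"
    and equalize: "f \<in> Arr C \<Longrightarrow> g \<in> Arr C \<Longrightarrow> src f = src g \<Longrightarrow> trg f = trg g \<Longrightarrow> R f = R g \<Longrightarrow>
      \<exists>s \<in> S. trg s = src f \<and> f \<cdot>\<^bsub>C\<^esub> s = g \<cdot>\<^bsub>C\<^esub> s"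
begin

abbreviation compD (infixl "\<star>" 70) where "g \<star> f \<equiv> g \<cdot>\<^bsub>D\<^esub> f"

lemma S_arr [simp]: "s \<in> S \<Longrightarrow> s \<in> Arr C"
  and S_iso: "s \<in> S \<Longrightarrow> iso_arr D (R s)"
  and S_I: "s \<in> Arr C \<Longrightarrow> iso_arr D (R s) \<Longrightarrow> s \<in> S"
  unfolding S_eq by blast+

lemma S_Comp [simp]: "s \<in> S \<Longrightarrow> t \<in> S \<Longrightarrow> trg s = src t \<Longrightarrow> t \<cdot> s \<in> S"
  by (rule S_I) (auto simp: R_Comp S_iso intro!: D.iso_Comp)

lemma S_Id [simp]: "x \<in> Obj C \<Longrightarrow> Id C x \<in> S"
  by (rule S_I) (auto simp: R_Id D.iso_Id Obj_eq)

lemma R_inv [simp]: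
  assumes "s \<in> S"
  shows "inv_arr D (R s) \<in> Arr D" "src (inv_arr D (R s)) = trg s" "trg (inv_arr D (R s)) = src s"
    "inv_arr D (R s) \<star> R s = Id D (src s)" "R s \<star> inv_arr D (R s) = Id D (trg s)"
  using D.inv_arr[OF S_iso[OF assms]] assms by simp_all

text \<open>Writing the inverse of \<open>R s\<close> after \<open>R f\<close> as a fraction yields
  a square that commutes after \<open>R\<close>. Equalizing its two sides makes it commute in
  \<open>C\<close>.\<close>

lemma ore:
  assumes f: "f \<in> Arr C" and s: "s \<in> S" and fs: "trg f = trg s"
  obtains t c where "t \<in> S" "c \<in> Arr C" "trg t = src f" "src c = src t" "trg c = src s"
    "f \<cdot> t = s \<cdot> c"
proof -
  let ?r = "inv_arr D (R s) \<star> R f"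
  have "?r \<in> Arr D" using f s fs by simp
  from roof[OF this] f s fs obtain t c where tc: "t \<in> S" "c \<in> Arr C" "src c = src t" "trg t = src f"
    "trg c = src s" and eq: "?r \<star> R t = R c" by auto
  have "R (s \<cdot> c) = R s \<star> (?r \<star> R t)"
    using tc s eq by (simp add: R_Comp)
  also have "\<dots> = R f \<star> R t"
    using tc s f fs D.inv_arr_cancel(2)[OF S_iso[OF s], of "R f \<star> R t"] by simp
  also have "\<dots> = R (f \<cdot> t)" using tc f by (simp add: R_Comp)
  finally obtain u where u: "u \<in> S" "trg u = src t" "(f \<cdot> t) \<cdot> u = (s \<cdot> c) \<cdot> u"
    using equalize[of "f \<cdot> t" "s \<cdot> c"] tc s f fs by auto
  show thesis
    by (rule that[of "t \<cdot> u" "c \<cdot> u"]) (use u tc s f fs in auto)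
qed

abbreviation zigzag where "zigzag \<equiv> is_zigzag C S"
abbreviation E where "E \<equiv> zigzag_equiv C S"

lemma zigzag_obj: "zigzag x p y \<Longrightarrow> x \<in> Obj C \<and> y \<in> Obj C"
proof (induction p arbitrary: x)
  case (Cons st p)
  then show ?case by (cases st) auto
qed simp

lemma zigzag_append: "zigzag x (p @ q) z \<longleftrightarrow> (\<exists>y. zigzag x p y \<and> zigzag y q z)"
proof (induction p arbitrary: x)
  case Nil
  then show ?case using zigzag_obj by auto
next
  case (Cons st p)
  then show ?case by (cases st) auto
qed

text \<open>The functor on zigzags induced by \<open>R\<close>: formal inverses become actual
  inverses in \<open>D\<close>. It will turn out to be a complete invariant of zigzags.\<close>

primrec ev :: "'o \<Rightarrow> ('o, 'd) arrow step list \<Rightarrow> ('o, 'e) arrow" where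
  "ev x [] = Id D x"
| "ev x (st # p) = (case st of Fwd f \<Rightarrow> ev (trg f) p \<star> R f
     | Bwd s \<Rightarrow> ev (src s) p \<star> inv_arr D (R s))"

lemma ev_hom: "zigzag x p y \<Longrightarrow> ev x p \<in> Arr D \<and> src (ev x p) = x \<and> trg (ev x p) = y"
proof (induction p arbitrary: x)
  case Nil
  then show ?case by (auto simp: Obj_eq)
next
  case (Cons st p)
  then show ?case by (cases st) auto
qed

lemma ev_append:
  "zigzag x p y \<Longrightarrow> zigzag y q z \<Longrightarrow> ev x (p @ q) = ev y q \<star> ev x p"
proof (induction p arbitrary: x)
  case Nil
  then show ?case using ev_hom[OF Nil(2)] by simp
next
  case (Cons st p)
  then show ?case
    using ev_hom[OF Cons.prems(2)] ev_hom[of _ p y] by (cases st) auto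
qed

lemma ev_rule: "zigzag_rule C S l r \<Longrightarrow> zigzag x l y \<Longrightarrow> zigzag x r y \<Longrightarrow> ev x l = ev x r"
  by (induction rule: zigzag_rule.induct) (auto simp: R_Id R_Comp Obj_eq)

lemma zigzag_equiv_rule:
  assumes "zigzag_rule C S l r" "zigzag x l y" "zigzag x r y"
  shows "(l, r) \<in> E x y"
proof -
  show ?thesis
    unfolding zigzag_equiv_def Let_def
    by (intro r_into_rtrancl UnI1 CollectI exI[of _ "[]"] exI[of _ l] exI[of _ r])
      (use assms in simp)
qed

text \<open>The easy half of the invariance: every rewriting rule for zigzags is an identity in
  \<open>D\<close>, and \<open>ev\<close> is multiplicative for concatenation.\<close>

lemma zigzag_equiv_sound:
  assumes "(p, q) \<in> E x y" "zigzag x p y"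
  shows "zigzag x q y \<and> ev x p = ev x q"
  using assms unfolding zigzag_equiv_def Let_def
proof (induction rule: rtrancl_induct)
  case (step q r)
  have *: "ev x (u @ l @ v) = ev x (u @ r @ v)"
    if r: "zigzag_rule C S l r" and z: "zigzag x (u @ l @ v) y" "zigzag x (u @ r @ v) y" for u l r v
  proof -
    obtain a b where u: "zigzag x u a" and l: "zigzag a l b" and v: "zigzag b v y"
      using z(1) by (auto simp: zigzag_append)
    have "zigzag a r b" using r l by (induction rule: zigzag_rule.induct) auto
    with l v have "zigzag a (l @ v) y" "zigzag a (r @ v) y" by (auto simp: zigzag_append)
    then show ?thesis
      using ev_append[OF u] ev_append[OF l v] ev_append[OF \<open>zigzag a r b\<close> v]
        ev_rule[OF r l \<open>zigzag a r b\<close>] by simp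
  qed
  show ?case using step * by (auto simp: converse_iff)
qed simp

lemma zigzag_equiv_refl: "(p, p) \<in> E x y"
  and zigzag_equiv_sym: "(p, q) \<in> E x y \<Longrightarrow> (q, p) \<in> E x y"
  and zigzag_equiv_trans [trans]: "(p, q) \<in> E x y \<Longrightarrow> (q, r) \<in> E x y \<Longrightarrow> (p, r) \<in> E x y"
  unfolding zigzag_equiv_def Let_def
  by (auto intro: rtrancl_trans sym_rtrancl[THEN symD] simp: sym_Un_converse)

text \<open>Equivalence of zigzags is a congruence for concatenation, since each elementary
  rewriting already takes place inside a context.\<close>

lemma zigzag_equiv_context:
  assumes "(l, r) \<in> E a b" "zigzag x u a" "zigzag a l b" "zigzag b v y"
  shows "(u @ l @ v, u @ r @ v) \<in> E x y"
proof -
  define Q where "Q = {(u @ l @ v, u @ r @ v) | u l r v.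
    zigzag_rule C S l r \<and> zigzag a (u @ l @ v) b \<and> zigzag a (u @ r @ v) b}"
  define P where "P = {(u @ l @ v, u @ r @ v) | u l r v.
    zigzag_rule C S l r \<and> zigzag x (u @ l @ v) y \<and> zigzag x (u @ r @ v) y}"
  have E: "E a b = (Q \<union> Q\<inverse>)\<^sup>*" "E x y = (P \<union> P\<inverse>)\<^sup>*"
    unfolding zigzag_equiv_def Q_def P_def Let_def by auto
  have *: "(u @ l @ v, u @ r @ v) \<in> P" if lr: "(l, r) \<in> Q" for l r
  proof -
    obtain u' l' r' v' where lr: "l = u' @ l' @ v'" "r = u' @ r' @ v'" "zigzag_rule C S l' r'"
      "zigzag a (u' @ l' @ v') b" "zigzag a (u' @ r' @ v') b" using lr unfolding Q_def by auto
    have "zigzag a l b" "zigzag a r b" unfolding lr(1,2) by (rule lr)+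
    then have "zigzag x (u @ l @ v) y" "zigzag x (u @ r @ v) y"
      using assms(2,4) unfolding zigzag_append by blast+
    then show ?thesis unfolding P_def
      by (intro CollectI exI[of _ "u @ u'"] exI[of _ l'] exI[of _ r'] exI[of _ "v' @ v"])
        (use lr(3) in \<open>simp add: lr(1,2)\<close>)
  qed
  have "(l, r) \<in> (Q \<union> Q\<inverse>)\<^sup>*" using assms(1) E by simp
  then have "(u @ l @ v, u @ r @ v) \<in> (P \<union> P\<inverse>)\<^sup>*"
  proof (induction rule: rtrancl_induct)
    case (step q r)
    then show ?case using * by (auto intro: rtrancl_into_rtrancl)
  qed simp
  then show ?thesis using E by simp
qed

lemma Bwd_Fwd_equiv: "s \<in> S \<Longrightarrow> ([Bwd s, Fwd s], []) \<in> E (trg s) (trg s)"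
  and Fwd_Bwd_equiv: "s \<in> S \<Longrightarrow> ([Fwd s, Bwd s], []) \<in> E (src s) (src s)"
  and Fwd_Fwd_equiv: "f \<in> Arr C \<Longrightarrow> g \<in> Arr C \<Longrightarrow> trg f = src g \<Longrightarrow>
    ([Fwd f, Fwd g], [Fwd (g \<cdot> f)]) \<in> E (src f) (trg g)"
  by (auto intro!: zigzag_equiv_rule zigzag_rule.intros)

text \<open>The inverse of \<open>s\<close> is the inverse of \<open>s \<cdot> w\<close> followed by
  \<open>w\<close>. This is how denominators are enlarged.\<close>

lemma Bwd_expand:
  assumes s: "s \<in> S" and w: "w \<in> S" and sw: "trg w = src s"
  shows "([Bwd s], [Bwd (s \<cdot> w), Fwd w]) \<in> E (trg s) (src s)"
proof -
  let ?sw = "s \<cdot> w"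
  have "([Bwd s], [Bwd ?sw, Fwd ?sw, Bwd s]) \<in> E (trg s) (src s)"
    using zigzag_equiv_sym[OF zigzag_equiv_context[OF Bwd_Fwd_equiv[of ?sw], where u = "[]"
          and v = "[Bwd s]" and x = "trg s" and y = "src s"]] s w sw by simp
  also have "([Bwd ?sw, Fwd ?sw, Bwd s], [Bwd ?sw, Fwd w, Fwd s, Bwd s]) \<in> E (trg s) (src s)"
    using zigzag_equiv_sym[OF zigzag_equiv_context[OF Fwd_Fwd_equiv[of w s], where u = "[Bwd ?sw]"
          and v = "[Bwd s]" and x = "trg s" and y = "src s"]] s w sw by simp
  also have "([Bwd ?sw, Fwd w, Fwd s, Bwd s], [Bwd ?sw, Fwd w]) \<in> E (trg s) (src s)"
    using zigzag_equiv_context[OF Fwd_Bwd_equiv[of s], where u = "[Bwd ?sw, Fwd w]"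
          and v = "[]" and x = "trg s" and y = "src s"] s w sw by simp
  finally show ?thesis .
qed

text \<open>Induction along the zigzag: a backward step is absorbed into the denominator of the
  rest, while a forward step has to be moved past it by \<open>ore\<close>.\<close>

lemma zigzag_roof:
  "zigzag x p y \<Longrightarrow> \<exists>s \<in> S. \<exists>a \<in> Arr C. src a = src s \<and> trg s = x \<and> trg a = y \<and>
     (p, [Bwd s, Fwd a]) \<in> E x y"
proof (induction p arbitrary: x)
  case Nil
  then show ?case
    using zigzag_equiv_sym[OF Bwd_Fwd_equiv[of "Id C x"]]
    by (intro bexI[where x = "Id C x"]) auto
next
  case (Cons st p)
  show ?case
  proof (cases st)
    case (Fwd f)
    have f: "f \<in> Arr C" "src f = x" and p: "zigzag (trg f) p y" using Cons.prems Fwd by auto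
    obtain s a where sa: "s \<in> S" "a \<in> Arr C" "src a = src s" "trg s = trg f" "trg a = y"
      "(p, [Bwd s, Fwd a]) \<in> E (trg f) y" using Cons.IH[OF p] by auto
    \<comment> \<open>The arrow changes places with the denominator: \<open>f\<close> and then the
      inverse of \<open>s\<close> equals the inverse of \<open>t\<close> and then
      \<open>c\<close>.\<close>
    obtain t c where tc: "t \<in> S" "c \<in> Arr C" "trg t = x" "src c = src t" "trg c = src s"
      "f \<cdot> t = s \<cdot> c" using ore[OF f(1) sa(1)] sa(4) f(2) by metis
    have "(Fwd f # p, [Fwd f, Bwd s, Fwd a]) \<in> E x y"
      using zigzag_equiv_context[OF sa(6), where u = "[Fwd f]" and v = "[]" and x = x and y = y]
        f p zigzag_obj[OF p] by simp
    also have "([Fwd f, Bwd s, Fwd a], [Bwd t, Fwd t, Fwd f, Bwd s, Fwd a]) \<in> E x y"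
      using zigzag_equiv_sym[OF zigzag_equiv_context[OF Bwd_Fwd_equiv[of t], where u = "[]"
            and v = "[Fwd f, Bwd s, Fwd a]" and x = x and y = y]] f sa tc by auto
    also have "([Bwd t, Fwd t, Fwd f, Bwd s, Fwd a], [Bwd t, Fwd (f \<cdot> t), Bwd s, Fwd a]) \<in> E x y"
      using zigzag_equiv_context[OF Fwd_Fwd_equiv[of t f], where u = "[Bwd t]"
            and v = "[Bwd s, Fwd a]" and x = x and y = y] f sa tc by auto
    also have "([Bwd t, Fwd (f \<cdot> t), Bwd s, Fwd a], [Bwd t, Fwd c, Fwd s, Bwd s, Fwd a]) \<in> E x y"
      using zigzag_equiv_sym[OF zigzag_equiv_context[OF Fwd_Fwd_equiv[of c s], where u = "[Bwd t]"
            and v = "[Bwd s, Fwd a]" and x = x and y = y]] f sa tc by auto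
    also have "([Bwd t, Fwd c, Fwd s, Bwd s, Fwd a], [Bwd t, Fwd c, Fwd a]) \<in> E x y"
      using zigzag_equiv_context[OF Fwd_Bwd_equiv[of s], where u = "[Bwd t, Fwd c]"
            and v = "[Fwd a]" and x = x and y = y] f sa tc by auto
    also have "([Bwd t, Fwd c, Fwd a], [Bwd t, Fwd (a \<cdot> c)]) \<in> E x y"
      using zigzag_equiv_context[OF Fwd_Fwd_equiv[of c a], where u = "[Bwd t]"
            and v = "[]" and x = x and y = y] f sa tc by auto
    finally show ?thesis using Fwd sa tc by (intro bexI[where x = t] bexI[where x = "a \<cdot> c"]) auto
  next
    case (Bwd s')
    have s': "s' \<in> S" "trg s' = x" and p: "zigzag (src s') p y" using Cons.prems Bwd by auto
    obtain s a where sa: "s \<in> S" "a \<in> Arr C" "src a = src s" "trg s = src s'" "trg a = y"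
      "(p, [Bwd s, Fwd a]) \<in> E (src s') y" using Cons.IH[OF p] by auto
    have "(Bwd s' # p, [Bwd s', Bwd s, Fwd a]) \<in> E x y"
      using zigzag_equiv_context[OF sa(6), where u = "[Bwd s']" and v = "[]" and x = x and y = y]
        s' p zigzag_obj[OF p] by simp
    also have "([Bwd s', Bwd s, Fwd a], [Bwd (s' \<cdot> s), Fwd s, Bwd s, Fwd a]) \<in> E x y"
      using zigzag_equiv_context[OF Bwd_expand[of s' s], where u = "[]"
            and v = "[Bwd s, Fwd a]" and x = x and y = y] s' sa by auto
    also have "([Bwd (s' \<cdot> s), Fwd s, Bwd s, Fwd a], [Bwd (s' \<cdot> s), Fwd a]) \<in> E x y"
      using zigzag_equiv_context[OF Fwd_Bwd_equiv[of s], where u = "[Bwd (s' \<cdot> s)]"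
            and v = "[Fwd a]" and x = x and y = y] s' sa by auto
    finally show ?thesis using Bwd sa s' by (intro bexI[where x = "s' \<cdot> s"] bexI[where x = a]) auto
  qed
qed

lemma roof_expand:
  assumes s: "s \<in> S" and a: "a \<in> Arr C" "src a = src s" and w: "w \<in> S" "trg w = src s"
  shows "([Bwd s, Fwd a], [Bwd (s \<cdot> w), Fwd (a \<cdot> w)]) \<in> E (trg s) (trg a)"
proof -
  have "([Bwd s, Fwd a], [Bwd (s \<cdot> w), Fwd w, Fwd a]) \<in> E (trg s) (trg a)"
    using zigzag_equiv_context[OF Bwd_expand[of s w], where u = "[]"
          and v = "[Fwd a]" and x = "trg s" and y = "trg a"] assms by auto
  also have "([Bwd (s \<cdot> w), Fwd w, Fwd a], [Bwd (s \<cdot> w), Fwd (a \<cdot> w)]) \<in> E (trg s) (trg a)"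
    using zigzag_equiv_context[OF Fwd_Fwd_equiv[of w a], where u = "[Bwd (s \<cdot> w)]"
          and v = "[]" and x = "trg s" and y = "trg a"] assms by auto
  finally show ?thesis .
qed

text \<open>The Ore condition supplies a common denominator; the enlarged numerators have the same
  image under \<open>R\<close>, so they agree after one further enlargement.\<close>

lemma roof_equiv:
  assumes s: "s \<in> S" and a: "a \<in> Arr C" "src a = src s"
    and s': "s' \<in> S" and a': "a' \<in> Arr C" "src a' = src s'"
    and eq: "trg s = trg s'" "trg a = trg a'" "R a \<star> inv_arr D (R s) = R a' \<star> inv_arr D (R s')"
  shows "([Bwd s, Fwd a], [Bwd s', Fwd a']) \<in> E (trg s) (trg a)"
proof -
  obtain t c where tc: "t \<in> S" "c \<in> Arr C" "trg t = src s" "src c = src t" "trg c = src s'"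
    "s \<cdot> t = s' \<cdot> c" using ore[of s s'] s s' eq by (metis S_arr)
  have Rc: "R s \<star> R t = R s' \<star> R c"
    using tc s s' eq by (simp flip: R_Comp)
  have "R (a \<cdot> t) = (R a \<star> inv_arr D (R s)) \<star> (R s \<star> R t)"
    using s a tc D.inv_arr_cancel(1)[OF S_iso[OF s], of "R t"] by (simp add: R_Comp)
  also have "\<dots> = R (a' \<cdot> c)"
    unfolding eq(3) Rc
    using s' a' tc D.inv_arr_cancel(1)[OF S_iso[OF s'], of "R c"] by (simp add: R_Comp)
  finally obtain u where u: "u \<in> S" "trg u = src t" "(a \<cdot> t) \<cdot> u = (a' \<cdot> c) \<cdot> u"
    using equalize[of "a \<cdot> t" "a' \<cdot> c"] tc a a' eq by auto
  \<comment> \<open>Two out of three: \<open>R c\<close> is a composite of isomorphisms, hence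
    \<open>c\<close> is itself a denominator.\<close>
  have "R c = inv_arr D (R s') \<star> (R s \<star> R t)"
    unfolding Rc using s' tc D.inv_arr_cancel(1)[OF S_iso[OF s'], of "R c"] by simp
  moreover have "iso_arr D \<dots>"
    by (intro D.iso_Comp D.iso_inv_arr S_iso) (use s s' tc eq in auto)
  ultimately have "c \<in> S" using tc by (simp add: S_I)
  have 1: "t \<cdot> u \<in> S" "c \<cdot> u \<in> S" using tc u \<open>c \<in> S\<close> by auto
  have "s \<cdot> (t \<cdot> u) = (s \<cdot> t) \<cdot> u" using s tc(1-5) u by simp
  also have "\<dots> = s' \<cdot> (c \<cdot> u)" unfolding tc(6) using s' tc(1-5) u by simp
  finally have 2: "s \<cdot> (t \<cdot> u) = s' \<cdot> (c \<cdot> u)" .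
  have 3: "a \<cdot> (t \<cdot> u) = a' \<cdot> (c \<cdot> u)" using u a a' tc(1-5) by simp
  show ?thesis
    using roof_expand[OF s a 1(1)] roof_expand[OF s' a' 1(2)] tc u eq
    unfolding 2 3 by (auto intro: zigzag_equiv_trans zigzag_equiv_sym)
qed

lemma ev_roof:
  "s \<in> S \<Longrightarrow> a \<in> Arr C \<Longrightarrow> src a = src s \<Longrightarrow>
     ev x [Bwd s, Fwd a] = R a \<star> inv_arr D (R s)"
  by simp

text \<open>Completeness of \<open>ev\<close>: both zigzags reduce to roofs with the same value, and
  such roofs are equivalent. From here on classes of zigzags are replaced by arrows of
  \<open>D\<close>.\<close>

lemma zigzag_equiv_iff:
  assumes p: "zigzag x p y"
  shows "(p, q) \<in> E x y \<longleftrightarrow> zigzag x q y \<and> ev x q = ev x p"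
proof
  show "zigzag x q y \<and> ev x q = ev x p" if "(p, q) \<in> E x y"
    using zigzag_equiv_sound[OF that p] by simp
next
  assume q: "zigzag x q y \<and> ev x q = ev x p"
  obtain s a where sa: "s \<in> S" "a \<in> Arr C" "src a = src s" "trg s = x" "trg a = y"
    "(p, [Bwd s, Fwd a]) \<in> E x y" using zigzag_roof[OF p] by blast
  obtain s' a' where sa': "s' \<in> S" "a' \<in> Arr C" "src a' = src s'" "trg s' = x" "trg a' = y"
    "(q, [Bwd s', Fwd a']) \<in> E x y" using zigzag_roof q by blast
  have "R a \<star> inv_arr D (R s) = R a' \<star> inv_arr D (R s')"
    using zigzag_equiv_sound[OF sa(6) p] zigzag_equiv_sound[OF sa'(6)] q
      ev_roof[OF sa(1-3), of x] ev_roof[OF sa'(1-3), of x] by auto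
  then have "([Bwd s, Fwd a], [Bwd s', Fwd a']) \<in> E x y"
    using roof_equiv[OF sa(1-3) sa'(1-3)] sa sa' by simp
  then show "(p, q) \<in> E x y"
    using sa(6) sa'(6) by (blast intro: zigzag_equiv_trans zigzag_equiv_sym)
qed

text \<open>The class is described as a fibre of \<open>ev\<close> and not through a representative,
  so no choice enters.\<close>

definition frac_class :: "('o, 'e) arrow \<Rightarrow> ('o, ('o, 'd) arrow step list set) arrow" where
  "frac_class r = Arrow (src r) {q. zigzag (src r) q (trg r) \<and> ev (src r) q = r} (trg r)"

lemma frac_class_sel [simp]:
  "src (frac_class r) = src r" "trg (frac_class r) = trg r"
  "dat (frac_class r) = {q. zigzag (src r) q (trg r) \<and> ev (src r) q = r}"
  by (simp_all add: frac_class_def)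

lemma zigzag_class_eq:
  assumes p: "zigzag x p y"
  shows "zigzag_class C S x p y = frac_class (ev x p)"
  using ev_hom[OF p] zigzag_equiv_iff[OF p]
  by (auto simp: zigzag_class_def frac_class_def)

lemma ev_surj:
  assumes "r \<in> Arr D"
  obtains p where "zigzag (src r) p (trg r)" "ev (src r) p = r"
proof -
  obtain s a where sa: "s \<in> S" "a \<in> Arr C" "src a = src s" "trg s = src r" "trg a = trg r"
    and eq: "r \<star> R s = R a" using roof[OF assms] by blast
  have "ev (src r) [Bwd s, Fwd a] = (r \<star> R s) \<star> inv_arr D (R s)"
    using ev_roof[OF sa(1-3)] eq by simp
  also have "\<dots> = r" using sa assms by simp
  finally show thesis using that[of "[Bwd s, Fwd a]"] sa D.trg_obj[OF assms] by (simp add: Obj_eq)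
qed

lemma right_fraction_eq:
  "s \<in> S \<Longrightarrow> a \<in> Arr C \<Longrightarrow> src a = src s \<Longrightarrow>
    right_fraction C S s a = frac_class (R a \<star> inv_arr D (R s))"
  unfolding right_fraction_def by (subst zigzag_class_eq) auto

lemma frac_class_eq: "f \<in> Arr D \<Longrightarrow> g \<in> Arr D \<Longrightarrow> frac_class f = frac_class g \<longleftrightarrow> f = g"
  by (rule ev_surj[of f]) (auto simp: frac_class_def)

lemma S_TensA: "s \<in> S \<Longrightarrow> t \<in> S \<Longrightarrow> TensA C s t \<in> S"
  by (rule S_I) (auto simp: R_TensA S_iso intro!: D.iso_TensA)

lemma inv_TensA:
  assumes "iso_arr D f" "iso_arr D g"
  shows "inv_arr D (TensA D f g) = TensA D (inv_arr D f) (inv_arr D g)"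
  by (rule D.inv_arr_unique)
    (use assms D.inv_arr[OF assms(1)] D.inv_arr[OF assms(2)] D.iso_arr_in in
      \<open>auto simp: D.iso_TensA simp flip: D.TensA_Comp\<close>)

lemma inv_Id: "x \<in> Obj C \<Longrightarrow> inv_arr D (Id D x) = Id D x"
  by (rule D.inv_arr_unique) (auto simp: Obj_eq D.iso_Id)

lemma zigzag_tensor_left:
  assumes "y \<in> Obj C"
  shows "zigzag x p x' \<Longrightarrow>
    zigzag (TensO C x y) (map (map_step (\<lambda>a. TensA C a (Id C y))) p) (TensO C x' y) \<and>
    ev (TensO C x y) (map (map_step (\<lambda>a. TensA C a (Id C y))) p) = TensA D (ev x p) (Id D y)"
proof (induction p arbitrary: x)
  case Nil
  then show ?case using assms by (auto simp: TensO_eq D.TensA_Id[unfolded Obj_eq])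
next
  case (Cons st p)
  then show ?case
    using assms ev_hom[of _ p x']
    by (cases st) (auto simp: S_TensA R_TensA R_Id inv_TensA inv_Id S_iso D.iso_Id Obj_eq
        simp flip: D.TensA_Comp)
qed

lemma zigzag_tensor_right:
  assumes "x \<in> Obj C"
  shows "zigzag y p y' \<Longrightarrow>
    zigzag (TensO C x y) (map (map_step (TensA C (Id C x))) p) (TensO C x y') \<and>
    ev (TensO C x y) (map (map_step (TensA C (Id C x))) p) = TensA D (Id D x) (ev y p)"
proof (induction p arbitrary: y)
  case Nil
  then show ?case using assms by (auto simp: TensO_eq D.TensA_Id[unfolded Obj_eq])
next
  case (Cons st p)
  then show ?case
    using assms ev_hom[of _ p y']
    by (cases st) (auto simp: S_TensA R_TensA R_Id inv_TensA inv_Id S_iso D.iso_Id Obj_eq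
        simp flip: D.TensA_Comp)
qed

text \<open>The second arrow is written as a fraction only after composing it with the denominator
  of the first; the product of the two denominators then serves both.\<close>

lemma common_denominator:
  assumes f: "f \<in> Arr D" and g: "g \<in> Arr D" "src f = src g" "trg f = trg g"
  obtains s a b where "s \<in> S" "a \<in> Arr C" "b \<in> Arr C" "src a = src s" "src b = src s"
    "trg s = src f" "trg a = trg f" "trg b = trg f"
    "f = R a \<star> inv_arr D (R s)" "g = R b \<star> inv_arr D (R s)"
proof -
  obtain s a where sa: "s \<in> S" "a \<in> Arr C" "src a = src s" "trg s = src f" "trg a = trg f"
    "f \<star> R s = R a" using roof[OF f] by blast
  have "g \<star> R s \<in> Arr D" using sa g by simp
  from roof[OF this] obtain t b where tb: "t \<in> S" "b \<in> Arr C" "src b = src t" "trg t = src s"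
    "trg b = trg f" "(g \<star> R s) \<star> R t = R b" using sa g by auto
  have st: "s \<cdot> t \<in> S" using sa tb by simp
  have *: "h = (h \<star> R (s \<cdot> t)) \<star> inv_arr D (R (s \<cdot> t))"
    if "h \<in> Arr D" "src h = trg s" for h
    using that R_inv[OF st] sa(1) tb(1,4) by simp
  have a: "f \<star> R (s \<cdot> t) = R (a \<cdot> t)"
    using sa(1-5) tb f by (simp add: R_Comp sa(6)[symmetric])
  have b: "g \<star> R (s \<cdot> t) = R b"
    using sa(1-5) tb(1-5) g tb(6)[symmetric] by (simp add: R_Comp)
  show thesis
  proof (rule that)
    show "s \<cdot> t \<in> S" by fact
    show "f = R (a \<cdot> t) \<star> inv_arr D (R (s \<cdot> t))"
      unfolding a[symmetric] by (rule *) (use f sa in auto)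
    show "g = R b \<star> inv_arr D (R (s \<cdot> t))" unfolding b[symmetric] by (rule *) (use g sa in auto)
  qed (use sa(1-5) tb(1-5) in auto)
qed

text \<open>The definite description is legitimate because the sum can be computed in
  \<open>D\<close>, where it does not depend on the fractions chosen; a common denominator gives
  existence.\<close>

lemma Add_localization:
  assumes f: "f \<in> Arr D" and g: "g \<in> Arr D" "src f = src g" "trg f = trg g"
  shows "Add (localization C S) (frac_class f) (frac_class g) = frac_class (Add D f g)"
proof -
  obtain s a b where s: "s \<in> S" and a: "a \<in> Arr C" "src a = src s" and b: "b \<in> Arr C" "src b = src s"
    and t: "trg s = src f" "trg a = trg f" "trg b = trg f"
    and eq: "f = R a \<star> inv_arr D (R s)" "g = R b \<star> inv_arr D (R s)"
    using common_denominator[OF assms] by metis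
  let ?P = "\<lambda>h. \<exists>s \<in> S. \<exists>a \<in> Arr C. \<exists>b \<in> Arr C.
        src a = src s \<and> src b = src s \<and> trg a = trg b \<and>
        frac_class f = right_fraction C S s a \<and> frac_class g = right_fraction C S s b \<and>
        h = right_fraction C S s (Add C a b)"
  have *: "right_fraction C S s (Add C a b) = frac_class (Add D f g)"
    if "s \<in> S" "a \<in> Arr C" "b \<in> Arr C" "src a = src s" "src b = src s" "trg a = trg b"
      "frac_class f = right_fraction C S s a" "frac_class g = right_fraction C S s b" for s a b
  proof -
    have "f = R a \<star> inv_arr D (R s)" "g = R b \<star> inv_arr D (R s)"
      using that f g by (auto simp: right_fraction_eq frac_class_eq)
    then show ?thesis using that by (simp add: right_fraction_eq R_Add Add_Comp)
  qed
  have "?P (frac_class (Add D f g))"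
    by (intro bexI[where x = s] bexI[where x = a] bexI[where x = b])
      (use s a b t in \<open>auto simp: eq right_fraction_eq R_Add Add_Comp\<close>)
  then have "(THE h. ?P h) = frac_class (Add D f g)"
    by (rule the_equality) (use * in blast)
  then show ?thesis by (simp add: localization_def)
qed

lemma Scale_localization:
  assumes c: "c \<in> carrier K" and f: "f \<in> Arr D"
  shows "Scale (localization C S) c (frac_class f) = frac_class (Scale D c f)"
proof -
  obtain s a where s: "s \<in> S" and a: "a \<in> Arr C" "src a = src s"
    and eq: "f = R a \<star> inv_arr D (R s)"
    using common_denominator[OF f f] by metis
  let ?P = "\<lambda>h. \<exists>s \<in> S. \<exists>a \<in> Arr C. src a = src s \<and>
        frac_class f = right_fraction C S s a \<and> h = right_fraction C S s (Scale C c a)"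
  have *: "right_fraction C S s (Scale C c a) = frac_class (Scale D c f)"
    if "s \<in> S" "a \<in> Arr C" "src a = src s" "frac_class f = right_fraction C S s a" for s a
  proof -
    have "f = R a \<star> inv_arr D (R s)"
      using that f by (auto simp: right_fraction_eq frac_class_eq)
    then show ?thesis using that c by (simp add: right_fraction_eq R_Scale Scale_Comp)
  qed
  have "?P (frac_class (Scale D c f))"
    by (intro bexI[where x = s] bexI[where x = a])
      (use s a c in \<open>auto simp: eq right_fraction_eq R_Scale Scale_Comp\<close>)
  then have "(THE h. ?P h) = frac_class (Scale D c f)"
    by (rule the_equality) (use * in blast)
  then show ?thesis by (simp add: localization_def)
qed

text \<open>Operations on classes are unions over all representatives. They collapse to one set
  because all members coincide and, \<open>ev\<close> being onto, there is at least one.\<close>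

lemma frac_class_UN:
  assumes f: "f \<in> Arr D" and g: "g \<in> Arr D"
    and "\<And>p q. zigzag (src f) p (trg f) \<Longrightarrow> ev (src f) p = f \<Longrightarrow>
      zigzag (src g) q (trg g) \<Longrightarrow> ev (src g) q = g \<Longrightarrow> X p q = Y"
  shows "(\<Union>p \<in> dat (frac_class f). \<Union>q \<in> dat (frac_class g). X p q) = Y"
proof -
  obtain p where p: "zigzag (src f) p (trg f)" "ev (src f) p = f" using ev_surj[OF f] .
  obtain q where q: "zigzag (src g) q (trg g)" "ev (src g) q = g" using ev_surj[OF g] .
  have "p \<in> dat (frac_class f)" "q \<in> dat (frac_class g)"
    unfolding frac_class_sel using p q by blast+
  moreover have "X p q = Y" if "p \<in> dat (frac_class f)" "q \<in> dat (frac_class g)" for p q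
    using that unfolding frac_class_sel mem_Collect_eq by (intro assms(3)) (erule conjE, assumption)+
  ultimately show ?thesis by fast
qed

lemma Comp_localization:
  assumes f: "f \<in> Arr D" and g: "g \<in> Arr D" and fg: "trg f = src g"
  shows "frac_class g \<cdot>\<^bsub>localization C S\<^esub> frac_class f = frac_class (g \<star> f)"
proof -
  have "(\<Union>p \<in> dat (frac_class f). \<Union>q \<in> dat (frac_class g). dat (zigzag_class C S (src f) (p @ q) (trg g)))
    = dat (frac_class (g \<star> f))"
  proof (rule frac_class_UN[OF f g])
    fix p q assume p: "zigzag (src f) p (trg f)" "ev (src f) p = f"
      and q: "zigzag (src g) q (trg g)" "ev (src g) q = g"
    have "zigzag (src f) (p @ q) (trg g)" using p(1) q(1) fg by (auto simp: zigzag_append)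
    moreover have "ev (src f) (p @ q) = g \<star> f"
      using ev_append[OF p(1), of q "trg g"] p(2) q fg by metis
    ultimately show "dat (zigzag_class C S (src f) (p @ q) (trg g)) = dat (frac_class (g \<star> f))"
      using zigzag_class_eq by simp
  qed
  then show ?thesis
    using assms by (simp add: localization_def frac_class_def)
qed

text \<open>In the defining zigzag the first factor is traversed before the second; bifunctoriality
  in \<open>D\<close> merges the two parts.\<close>

lemma TensA_localization:
  assumes f: "f \<in> Arr D" and g: "g \<in> Arr D"
  shows "TensA (localization C S) (frac_class f) (frac_class g) = frac_class (TensA D f g)"
proof -
  let ?z = "\<lambda>p q. map (map_step (\<lambda>a. TensA C a (Id C (src g)))) p @
              map (map_step (TensA C (Id C (trg f)))) q"
  have "(\<Union>p \<in> dat (frac_class f). \<Union>q \<in> dat (frac_class g). dat (zigzag_class C S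
      (TensO C (src f) (src g)) (?z p q) (TensO C (trg f) (trg g))))
    = dat (frac_class (TensA D f g))"
  proof (rule frac_class_UN[OF f g])
    fix p q assume p: "zigzag (src f) p (trg f)" "ev (src f) p = f"
      and q: "zigzag (src g) q (trg g)" "ev (src g) q = g"
    have o: "src g \<in> Obj C" "trg f \<in> Obj C" "src f \<in> Obj C" "trg g \<in> Obj C"
      using f g D.src_obj D.trg_obj Obj_eq by metis+
    note l = zigzag_tensor_left[OF o(1) p(1)] and r = zigzag_tensor_right[OF o(2) q(1)]
    have z: "zigzag (TensO C (src f) (src g)) (?z p q) (TensO C (trg f) (trg g))"
      using l r zigzag_append by blast
    have "ev (TensO C (src f) (src g)) (?z p q) = TensA D (Id D (trg f)) g \<star> TensA D f (Id D (src g))"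
      using ev_append l r p q by metis
    also have "\<dots> = TensA D f g" using f g o by (simp add: Obj_eq flip: D.TensA_Comp)
    finally show "dat (zigzag_class C S (TensO C (src f) (src g)) (?z p q) (TensO C (trg f) (trg g)))
      = dat (frac_class (TensA D f g))"
      using zigzag_class_eq[OF z] by simp
  qed
  then show ?thesis
    using assms by (simp add: localization_def frac_class_def TensO_eq)
qed

lemma loc_functor_eq: "f \<in> Arr C \<Longrightarrow> loc_functor C S f = frac_class (R f)"
  unfolding loc_functor_def by (subst zigzag_class_eq) auto

lemma localization_objects [simp]:
  "TensO (localization C S) = TensO C" "UnitO (localization C S) = UnitO C"
  by (simp_all add: localization_def)

text \<open>\<open>ev\<close> reaches every arrow of \<open>D\<close> by \<open>roof\<close> and
  separates classes by \<open>zigzag_equiv_iff\<close>; the operations have been matched one by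
  one.\<close>

theorem strict_iso_localization: "strict_iso K D (localization C S) (\<lambda>x. x) frac_class"
proof
  show "bij_betw (\<lambda>x. x) (Obj D) (Obj (localization C S))"
    by (simp add: localization_def Obj_eq bij_betw_def)
  show "bij_betw frac_class (Arr D) (Arr (localization C S))"
  proof (rule bij_betwI')
    fix r assume "r \<in> Arr D"
    from ev_surj[OF this] obtain p where "zigzag (src r) p (trg r)" "ev (src r) p = r" .
    then show "frac_class r \<in> Arr (localization C S)"
      using zigzag_class_eq[of "src r" p "trg r"] by (auto simp: localization_def intro!: exI)
  next
    fix f assume "f \<in> Arr (localization C S)"
    then show "\<exists>r \<in> Arr D. f = frac_class r"
      using zigzag_class_eq ev_hom by (auto simp: localization_def)
  qed (simp add: frac_class_eq)
  fix x assume x: "x \<in> Obj D"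
  show "frac_class (Id D x) = Id (localization C S) x"
    using zigzag_class_eq[of x "[]" x] x by (simp add: localization_def Obj_eq)
  show "frac_class (LUnit D x) = LUnit (localization C S) x"
    using x C.LUnit_hom[of x] by (simp add: localization_def Obj_eq loc_functor_eq R_LUnit homset_def)
  show "frac_class (RUnit D x) = RUnit (localization C S) x"
    using x C.RUnit_hom[of x] by (simp add: localization_def Obj_eq loc_functor_eq R_RUnit homset_def)
  fix y z assume yz: "y \<in> Obj D" "z \<in> Obj D"
  show "frac_class (Assoc D x y z) = Assoc (localization C S) x y z"
    using x yz C.Assoc_hom[of x y z]
    by (simp add: localization_def Obj_eq loc_functor_eq R_Assoc homset_def)
qed (simp_all add: Comp_localization Add_localization Scale_localization TensA_localization
    TensO_eq UnitO_eq)

end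

section \<open>A group encoded in a monoidal category\<close>

definition is_maximal_sub :: "('o, 'd, 'x) category_scheme \<Rightarrow> ('o, 'd) arrow \<Rightarrow> bool" where
  "is_maximal_sub C eta \<longleftrightarrow> mono_arr C eta \<and> \<not> iso_arr C eta \<and>
     (\<forall>m. mono_arr C m \<and> \<not> iso_arr C m \<and> trg m = trg eta \<longrightarrow> subobj_le C m eta)"

text \<open>The factorization property of an extremal epimorphism. For gliders over the unit it
  detects surjectivity on level -1.\<close>

definition is_cover :: "('o, 'd, 'x) category_scheme \<Rightarrow> ('o, 'd) arrow \<Rightarrow> bool" where
  "is_cover C f \<longleftrightarrow> f \<in> Arr C \<and>
     (\<forall>m h. mono_arr C m \<and> trg m = trg f \<and> h \<in> homset C (src f) (src m) \<and> f = m \<cdot>\<^bsub>C\<^esub> h \<longrightarrow>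
        iso_arr C m)"

text \<open>The last clause is rigidity. Together with the second one it makes two minimal covers of
  the same object isomorphic over that object.\<close>

definition is_minimal_cover :: "('o, 'd, 'x) category_scheme \<Rightarrow> ('o, 'd) arrow \<Rightarrow> bool" where
  "is_minimal_cover C eps \<longleftrightarrow> is_cover C eps \<and>
     (\<forall>f. is_cover C f \<and> trg f = trg eps \<longrightarrow> (\<exists>h \<in> homset C (src eps) (src f). f \<cdot>\<^bsub>C\<^esub> h = eps)) \<and>
     (\<forall>h \<in> homset C (src eps) (src eps). eps \<cdot>\<^bsub>C\<^esub> h = eps \<longrightarrow> h = Id C (src eps))"

text \<open>The usual equation for grouplike elements, with the comultiplication and the
  identification of the source with its square left unspecified, because an equivalence preserves
  only their existence.\<close>

definition grouplikes ::
    "('k, 'o, 'd) mon_category \<Rightarrow> ('o, 'd) arrow \<Rightarrow> ('o, 'd) arrow \<Rightarrow> ('o, 'd) arrow set" where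
  "grouplikes C eta eps = {g \<in> homset C (src eta) (src eps). eps \<cdot>\<^bsub>C\<^esub> g = eta \<and>
     (\<exists>\<Delta> \<in> homset C (src eps) (TensO C (src eps) (src eps)).
      \<exists>\<delta> \<in> homset C (src eta) (TensO C (src eta) (src eta)).
        iso_arr C \<delta> \<and> \<Delta> \<cdot>\<^bsub>C\<^esub> g = TensA C g g \<cdot>\<^bsub>C\<^esub> \<delta>)}"

text \<open>Read \<open>x\<close> and \<open>y\<close> as vectors m and m' of a representation and
  the other arrows as group elements: whenever h m = h' m' then also l m = l' m'. This happens when
  (l, l') arises from (h, h') by a common left factor.\<close>

definition quotient_rel :: "('o, 'd, 'x) category_scheme \<Rightarrow> 'o \<Rightarrow> ('o, 'd) arrow \<Rightarrow> ('o, 'd) arrow \<Rightarrow>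
    ('o, 'd) arrow \<Rightarrow> ('o, 'd) arrow \<Rightarrow> bool" where
  "quotient_rel C P h h' l l' \<longleftrightarrow> (\<forall>x \<in> Arr C. \<forall>y \<in> Arr C.
     src x = P \<and> src y = P \<and> trg x = trg y \<and> x \<cdot>\<^bsub>C\<^esub> h = y \<cdot>\<^bsub>C\<^esub> h' \<longrightarrow> x \<cdot>\<^bsub>C\<^esub> l = y \<cdot>\<^bsub>C\<^esub> l')"

definition encodes_group :: "('k, 'o, 'd) mon_category \<Rightarrow> ('g, 'n) monoid_scheme \<Rightarrow> bool" where
  "encodes_group C G \<longleftrightarrow> (\<exists>eta eps \<beta>. is_maximal_sub C eta \<and> trg eta = UnitO C \<and>
     is_minimal_cover C eps \<and> trg eps = UnitO C \<and> bij_betw \<beta> (carrier G) (grouplikes C eta eps) \<and>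
     (\<forall>h \<in> carrier G. \<forall>h' \<in> carrier G. \<forall>l \<in> carrier G. \<forall>l' \<in> carrier G.
        quotient_rel C (src eps) (\<beta> h) (\<beta> h') (\<beta> l) (\<beta> l') \<longleftrightarrow>
        (\<exists>g \<in> carrier G. l = g \<otimes>\<^bsub>G\<^esub> h \<and> l' = g \<otimes>\<^bsub>G\<^esub> h')))"

text \<open>A bijection respecting the relation \<open>h\<inverse> h' = l\<inverse> l'\<close> becomes a homomorphism once it is
  translated to preserve the unit.\<close>

lemma iso_of_quotient_bijection:
  assumes "group G" "group H" and \<gamma>: "bij_betw \<gamma> (carrier G) (carrier H)"
    and rel: "\<And>h h' l l'. h \<in> carrier G \<Longrightarrow> h' \<in> carrier G \<Longrightarrow> l \<in> carrier G \<Longrightarrow> l' \<in> carrier G \<Longrightarrow>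
      \<exists>g \<in> carrier G. l = g \<otimes>\<^bsub>G\<^esub> h \<and> l' = g \<otimes>\<^bsub>G\<^esub> h' \<Longrightarrow>
      \<exists>g \<in> carrier H. \<gamma> l = g \<otimes>\<^bsub>H\<^esub> \<gamma> h \<and> \<gamma> l' = g \<otimes>\<^bsub>H\<^esub> \<gamma> h'"
  shows "G \<cong> H"
proof -
  interpret G: group G by fact
  interpret H: group H by fact
  have [simp]: "\<gamma> g \<in> carrier H" if "g \<in> carrier G" for g
    using \<gamma> that by (auto simp: bij_betw_def)
  define u where "u = inv\<^bsub>H\<^esub> (\<gamma> \<one>\<^bsub>G\<^esub>)"
  have u [simp]: "u \<in> carrier H" by (simp add: u_def)
  define f where "f = (\<lambda>g. u \<otimes>\<^bsub>H\<^esub> \<gamma> g)"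
  have "f (g \<otimes>\<^bsub>G\<^esub> h) = f g \<otimes>\<^bsub>H\<^esub> f h" if gh: "g \<in> carrier G" "h \<in> carrier G" for g h
  proof -
    \<comment> \<open>The pair (g, g h) is g times the pair (1, h), so a single \<open>k\<close>
      translates both images.\<close>
    obtain k where k: "k \<in> carrier H" "\<gamma> g = k \<otimes>\<^bsub>H\<^esub> \<gamma> \<one>\<^bsub>G\<^esub>" "\<gamma> (g \<otimes>\<^bsub>G\<^esub> h) = k \<otimes>\<^bsub>H\<^esub> \<gamma> h"
      using rel[of "\<one>\<^bsub>G\<^esub>" h g "g \<otimes>\<^bsub>G\<^esub> h"] gh by force
    have "f g \<otimes>\<^bsub>H\<^esub> f h = u \<otimes>\<^bsub>H\<^esub> (k \<otimes>\<^bsub>H\<^esub> ((\<gamma> \<one>\<^bsub>G\<^esub> \<otimes>\<^bsub>H\<^esub> u) \<otimes>\<^bsub>H\<^esub> \<gamma> h))"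
      using k gh by (simp add: f_def H.m_assoc)
    also have "\<gamma> \<one>\<^bsub>G\<^esub> \<otimes>\<^bsub>H\<^esub> u = \<one>\<^bsub>H\<^esub>" by (simp add: u_def)
    finally show ?thesis using k gh by (simp add: f_def)
  qed
  moreover have "bij_betw f (carrier G) (carrier H)"
  proof -
    have "bij_betw ((\<otimes>\<^bsub>H\<^esub>) u) (carrier H) (carrier H)"
      by (rule bij_betw_byWitness[where f' = "(\<otimes>\<^bsub>H\<^esub>) (inv\<^bsub>H\<^esub> u)"])
        (auto simp flip: H.m_assoc)
    from bij_betw_trans[OF \<gamma> this] show ?thesis by (simp add: f_def comp_def)
  qed
  ultimately have "f \<in> iso G H"
    by (auto simp: iso_def hom_def f_def)
  then show ?thesis by (auto simp: is_iso_def)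
qed

context lin_mon_cat
begin

text \<open>The witnesses \<open>\<Delta>\<close> and \<open>\<delta>\<close> are conjugated by the
  isomorphisms and their tensor squares.\<close>

lemma grouplikes_transport:
  assumes xi: "xi \<in> Arr C" "trg xi = src eta" "src xi = src eta'" "eta \<cdot> xi = eta'"
    and xi': "xi' \<in> Arr C" "src xi' = src eta" "trg xi' = src eta'" "xi \<cdot> xi' = Id C (src eta)"
      "xi' \<cdot> xi = Id C (src eta')"
    and th: "th \<in> Arr C" "src th = src eps" "trg th = src eps'" "eps' \<cdot> th = eps"
    and th': "th' \<in> Arr C" "src th' = src eps'" "trg th' = src eps" "th' \<cdot> th = Id C (src eps)"
    and eta: "eta \<in> Arr C" and eps: "eps' \<in> Arr C"
    and g: "g \<in> grouplikes C eta eps"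
  shows "th \<cdot> (g \<cdot> xi) \<in> grouplikes C eta' eps'"
proof -
  obtain \<Delta> \<delta> where g1: "g \<in> Arr C" "src g = src eta" "trg g = src eps" "eps \<cdot> g = eta"
    and \<Delta>: "\<Delta> \<in> Arr C" "src \<Delta> = src eps" "trg \<Delta> = TensO C (src eps) (src eps)"
    and \<delta>: "\<delta> \<in> Arr C" "src \<delta> = src eta" "trg \<delta> = TensO C (src eta) (src eta)" "iso_arr C \<delta>"
    and eq: "\<Delta> \<cdot> g = TensA C g g \<cdot> \<delta>"
    using g by (auto simp: grouplikes_def homset_def)
  define \<delta>' where "\<delta>' = TensA C xi' xi' \<cdot> (\<delta> \<cdot> xi)"
  define \<Delta>' where "\<Delta>' = TensA C th th \<cdot> (\<Delta> \<cdot> th')"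
  have iso: "iso_arr C xi" "iso_arr C xi'"
    by (rule iso_arrI[where g = xi'], auto simp: xi xi')
      (rule iso_arrI[where g = xi], auto simp: xi xi')
  have \<delta>': "\<delta>' \<in> Arr C" "src \<delta>' = src eta'" "trg \<delta>' = TensO C (src eta') (src eta')"
    unfolding \<delta>'_def using xi xi' \<delta> by auto
  have "iso_arr C \<delta>'"
    unfolding \<delta>'_def using xi xi' \<delta> by (intro iso_Comp iso_TensA iso) auto
  have \<Delta>': "\<Delta>' \<in> Arr C" "src \<Delta>' = src eps'" "trg \<Delta>' = TensO C (src eps') (src eps')"
    unfolding \<Delta>'_def using th th' \<Delta> by auto
  have c1: "th' \<cdot> (th \<cdot> (g \<cdot> xi)) = g \<cdot> xi"
    by (rule cancel_left) (use th th' g1 xi in auto)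
  have "\<Delta>' \<cdot> (th \<cdot> (g \<cdot> xi)) = TensA C th th \<cdot> (\<Delta> \<cdot> (g \<cdot> xi))"
    unfolding \<Delta>'_def using th th' g1 xi \<Delta> c1 by simp
  also have "\<Delta> \<cdot> (g \<cdot> xi) = (\<Delta> \<cdot> g) \<cdot> xi" using g1(1-3) xi(1-3) \<Delta> by simp
  also have "\<dots> = TensA C g g \<cdot> (\<delta> \<cdot> xi)" unfolding eq using g1(1-3) xi(1-3) \<delta> by simp
  also have "TensA C th th \<cdot> \<dots> = TensA C (th \<cdot> g) (th \<cdot> g) \<cdot> (\<delta> \<cdot> xi)"
    using th(1-3) g1(1-3) \<delta> xi(1-3) by (simp add: TensA_Comp)
  also have "th \<cdot> g = (th \<cdot> (g \<cdot> xi)) \<cdot> xi'"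
    using th(1-3) g1(1-3) xi(1-3) xi' by simp
  also have "TensA C ((th \<cdot> (g \<cdot> xi)) \<cdot> xi') ((th \<cdot> (g \<cdot> xi)) \<cdot> xi') \<cdot> (\<delta> \<cdot> xi) =
    TensA C (th \<cdot> (g \<cdot> xi)) (th \<cdot> (g \<cdot> xi)) \<cdot> \<delta>'"
    unfolding \<delta>'_def
    using th(1-3) g1(1-3) xi(1-3) xi' \<delta> by (simp add: TensA_Comp del: Comp_assoc) simp
  finally have "\<Delta>' \<cdot> (th \<cdot> (g \<cdot> xi)) = TensA C (th \<cdot> (g \<cdot> xi)) (th \<cdot> (g \<cdot> xi)) \<cdot> \<delta>'" .
  moreover have "eps' \<cdot> (th \<cdot> (g \<cdot> xi)) = eta'"
  proof -
    have "eps' \<cdot> (th \<cdot> (g \<cdot> xi)) = (eps' \<cdot> th) \<cdot> (g \<cdot> xi)" using th(1-3) g1(1-3) xi(1-3) eps by simp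
    also have "\<dots> = (eps \<cdot> g) \<cdot> xi"
      unfolding th(4) using th g1(1-3) xi(1-3) eps by (subst Comp_assoc) auto
    finally show ?thesis using g1 xi by simp
  qed
  ultimately show ?thesis
    unfolding grouplikes_def homset_def
    using \<delta>' \<Delta>' \<open>iso_arr C \<delta>'\<close> th(1-3) g1(1-3) xi(1-3) by auto
qed

text \<open>Test arrows out of \<open>P'\<close> become test arrows out of \<open>P\<close> by
  composing with \<open>th\<close>; the isomorphism \<open>xi\<close> on the other side is
  cancelled.\<close>

lemma quotient_rel_transport:
  assumes rel: "quotient_rel C P h h' l l'"
    and th: "th \<in> Arr C" "src th = P" "trg th = P'" and xi: "iso_arr C xi"
    and h: "\<And>k. k \<in> {h, h', l, l'} \<Longrightarrow> k \<in> Arr C \<and> src k = trg xi \<and> trg k = P"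
  shows "quotient_rel C P' (th \<cdot> (h \<cdot> xi)) (th \<cdot> (h' \<cdot> xi)) (th \<cdot> (l \<cdot> xi)) (th \<cdot> (l' \<cdot> xi))"
  unfolding quotient_rel_def
proof (intro ballI impI)
  fix x y
  assume x: "x \<in> Arr C" and y: "y \<in> Arr C"
    and xy: "src x = P' \<and> src y = P' \<and> trg x = trg y \<and> x \<cdot> (th \<cdot> (h \<cdot> xi)) = y \<cdot> (th \<cdot> (h' \<cdot> xi))"
  have xi1: "xi \<in> Arr C" using xi by (simp add: iso_arr_def)
  have *: "z \<cdot> (th \<cdot> (k \<cdot> xi)) = ((z \<cdot> th) \<cdot> k) \<cdot> xi" if "z \<in> {x, y}" "k \<in> {h, h', l, l'}" for z k
    using that h[of k] x y conjunct1[OF xy] conjunct1[OF conjunct2[OF xy]] th xi1 by auto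
  have "(x \<cdot> th) \<cdot> h = (y \<cdot> th) \<cdot> h'"
  proof (rule iso_cancel_right[OF xi])
    show "((x \<cdot> th) \<cdot> h) \<cdot> xi = ((y \<cdot> th) \<cdot> h') \<cdot> xi"
      using *[of x h, simplified, symmetric] *[of y h', simplified, symmetric] xy by metis
  qed (use x y conjunct1[OF xy] conjunct1[OF conjunct2[OF xy]] th h in auto)
  moreover have "x \<cdot> th \<in> Arr C" "y \<cdot> th \<in> Arr C" "src (x \<cdot> th) = P" "src (y \<cdot> th) = P"
    "trg (x \<cdot> th) = trg (y \<cdot> th)"
    using x y xy th by simp_all
  ultimately have "(x \<cdot> th) \<cdot> l = (y \<cdot> th) \<cdot> l'"
    using rel unfolding quotient_rel_def by blast
  then show "x \<cdot> (th \<cdot> (l \<cdot> xi)) = y \<cdot> (th \<cdot> (l' \<cdot> xi))"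
    using *[of x l] *[of y l'] by simp
qed

text \<open>Two largest proper subobjects of the unit are isomorphic over it, and so are two minimal
  covers. Conjugation by these isomorphisms is a bijection between the two sets of grouplike arrows
  that respects the relation of common left factors.\<close>

lemma encoded_group_unique:
  assumes "group G" "group H" "encodes_group C G" "encodes_group C H"
  shows "G \<cong> H"
proof -
  obtain eta eps \<beta> where eta: "is_maximal_sub C eta" "trg eta = UnitO C"
    and eps: "is_minimal_cover C eps" "trg eps = UnitO C"
    and \<beta>: "bij_betw \<beta> (carrier G) (grouplikes C eta eps)"
    and \<beta>rel: "\<And>h h' l l'. h \<in> carrier G \<Longrightarrow> h' \<in> carrier G \<Longrightarrow> l \<in> carrier G \<Longrightarrow> l' \<in> carrier G \<Longrightarrow>
        quotient_rel C (src eps) (\<beta> h) (\<beta> h') (\<beta> l) (\<beta> l') \<longleftrightarrow>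
        (\<exists>g \<in> carrier G. l = g \<otimes>\<^bsub>G\<^esub> h \<and> l' = g \<otimes>\<^bsub>G\<^esub> h')"
    using assms(3) unfolding encodes_group_def by metis
  obtain eta' eps' \<beta>' where eta': "is_maximal_sub C eta'" "trg eta' = UnitO C"
    and eps': "is_minimal_cover C eps'" "trg eps' = UnitO C"
    and \<beta>': "bij_betw \<beta>' (carrier H) (grouplikes C eta' eps')"
    and \<beta>rel': "\<And>h h' l l'. h \<in> carrier H \<Longrightarrow> h' \<in> carrier H \<Longrightarrow> l \<in> carrier H \<Longrightarrow> l' \<in> carrier H \<Longrightarrow>
        quotient_rel C (src eps') (\<beta>' h) (\<beta>' h') (\<beta>' l) (\<beta>' l') \<longleftrightarrow>
        (\<exists>g \<in> carrier H. l = g \<otimes>\<^bsub>H\<^esub> h \<and> l' = g \<otimes>\<^bsub>H\<^esub> h')"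
    using assms(4) unfolding encodes_group_def by metis
  have arr: "eta \<in> Arr C" "eta' \<in> Arr C" "eps \<in> Arr C" "eps' \<in> Arr C"
    and mono: "mono_arr C eta" "mono_arr C eta'"
    using eta eta' eps eps' by (auto simp: is_maximal_sub_def mono_arr_def is_minimal_cover_def is_cover_def)
  have max: "\<exists>h. h \<in> Arr C \<and> src h = src b \<and> trg h = src a \<and> a \<cdot> h = b"
    if "is_maximal_sub C a" "is_maximal_sub C b" "trg a = trg b" for a b
  proof -
    have "subobj_le C b a" using that unfolding is_maximal_sub_def by metis
    then show ?thesis unfolding subobj_le_def homset_def by (auto intro: sym)
  qed
  obtain xi where xi: "xi \<in> Arr C" "src xi = src eta'" "trg xi = src eta" "eta \<cdot> xi = eta'"
    using max[of eta eta'] eta eta' by auto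
  obtain xi' where xi': "xi' \<in> Arr C" "src xi' = src eta" "trg xi' = src eta'" "eta' \<cdot> xi' = eta"
    using max[of eta' eta] eta eta' by auto
  \<comment> \<open>Each composite lies over the unit, and \<open>eta\<close> and
    \<open>eta'\<close> are monomorphisms.\<close>
  have xixi': "xi \<cdot> xi' = Id C (src eta)"
    by (rule mono_arrD[OF mono(1)]) (use xi xi' arr Comp_assoc[of xi' xi eta] in auto)
  have xi'xi: "xi' \<cdot> xi = Id C (src eta')"
    by (rule mono_arrD[OF mono(2)]) (use xi xi' arr Comp_assoc[of xi xi' eta'] in auto)
  have min: "\<exists>h. h \<in> Arr C \<and> src h = src a \<and> trg h = src b \<and> b \<cdot> h = a"
    if "is_minimal_cover C a" "is_minimal_cover C b" "trg a = trg b" for a b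
  proof -
    have "\<exists>h \<in> homset C (src a) (src b). b \<cdot> h = a"
      using that unfolding is_minimal_cover_def by metis
    then show ?thesis unfolding homset_def by auto
  qed
  obtain th where th: "th \<in> Arr C" "src th = src eps" "trg th = src eps'" "eps' \<cdot> th = eps"
    using min[of eps eps'] eps eps' by auto
  obtain th' where th': "th' \<in> Arr C" "src th' = src eps'" "trg th' = src eps" "eps \<cdot> th' = eps'"
    using min[of eps' eps] eps eps' by auto
  have rigid: "h = Id C (src a)"
    if "is_minimal_cover C a" "h \<in> Arr C" "src h = src a" "trg h = src a" "a \<cdot> h = a" for a h
  proof -
    have "h \<in> homset C (src a) (src a)" using that by (simp add: homset_def)
    then show ?thesis using that unfolding is_minimal_cover_def by blast
  qed
  \<comment> \<open>Minimal covers need not be monomorphisms; here the rigidity clause takes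
    over.\<close>
  have th'th: "th' \<cdot> th = Id C (src eps)"
    by (rule rigid[OF eps(1)]) (use th th' arr Comp_assoc[of th th' eps] in auto)
  have thth': "th \<cdot> th' = Id C (src eps')"
    by (rule rigid[OF eps'(1)]) (use th th' arr Comp_assoc[of th' th eps'] in auto)
  have iso: "iso_arr C xi" "iso_arr C xi'"
    by (rule iso_arrI[where g = xi'], auto simp: xi(1-3) xi'(1-3) xixi' xi'xi)
      (rule iso_arrI[where g = xi], auto simp: xi(1-3) xi'(1-3) xixi' xi'xi)
  define \<sigma> where "\<sigma> g = th \<cdot> (g \<cdot> xi)" for g
  define \<tau> where "\<tau> g = th' \<cdot> (g \<cdot> xi')" for g
  have gl: "g \<in> Arr C \<and> src g = src eta \<and> trg g = src eps" if "g \<in> grouplikes C eta eps" for g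
    using that by (auto simp: grouplikes_def homset_def)
  have gl': "g \<in> Arr C \<and> src g = src eta' \<and> trg g = src eps'" if "g \<in> grouplikes C eta' eps'" for g
    using that by (auto simp: grouplikes_def homset_def)
  have \<sigma>: "\<sigma> g \<in> grouplikes C eta' eps'" if "g \<in> grouplikes C eta eps" for g
    unfolding \<sigma>_def
    by (rule grouplikes_transport[OF xi(1,3,2,4) xi'(1-3) xixi' xi'xi th th'(1-3) th'th arr(1,4) that])
  have \<tau>: "\<tau> g \<in> grouplikes C eta eps" if "g \<in> grouplikes C eta' eps'" for g
    unfolding \<tau>_def
    by (rule grouplikes_transport[OF xi'(1,3,2,4) xi(1-3) xi'xi xixi' th' th(1-3) thth' arr(2,3) that])
  have \<tau>\<sigma>: "\<tau> (\<sigma> g) = g" if "g \<in> grouplikes C eta eps" for g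
    using gl[OF that] xi(1-3) xi'(1-3) th(1-3) th'(1-3) xixi'
      cancel_left[of "g \<cdot> (xi \<cdot> xi')" th th'] th'th
    unfolding \<sigma>_def \<tau>_def by simp
  have \<sigma>\<tau>: "\<sigma> (\<tau> g) = g" if "g \<in> grouplikes C eta' eps'" for g
    using gl'[OF that] xi(1-3) xi'(1-3) th(1-3) th'(1-3) xi'xi
      cancel_left[of "g \<cdot> (xi' \<cdot> xi)" th' th] thth'
    unfolding \<sigma>_def \<tau>_def by simp
  have bij\<sigma>: "bij_betw \<sigma> (grouplikes C eta eps) (grouplikes C eta' eps')"
    by (rule bij_betw_byWitness[where f' = \<tau>]) (use \<sigma> \<tau> \<tau>\<sigma> \<sigma>\<tau> in auto)
  \<comment> \<open>A group element is encoded with the first data, conjugated to the second data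
    and decoded there.\<close>
  define \<gamma> where "\<gamma> = inv_into (carrier H) \<beta>' \<circ> (\<sigma> \<circ> \<beta>)"
  have bij: "bij_betw \<gamma> (carrier G) (carrier H)"
    unfolding \<gamma>_def
    by (rule bij_betw_trans[OF bij_betw_trans[OF \<beta> bij\<sigma>] bij_betw_inv_into[OF \<beta>']])
  have \<beta>mem: "\<beta> g \<in> grouplikes C eta eps" if "g \<in> carrier G" for g
    using \<beta> that by (auto simp: bij_betw_def)
  have \<beta>\<gamma>: "\<beta>' (\<gamma> g) = \<sigma> (\<beta> g)" if "g \<in> carrier G" for g
    using \<sigma>[OF \<beta>mem[OF that]] \<beta>' by (simp add: \<gamma>_def bij_betw_def f_inv_into_f)
  show ?thesis
  proof (rule iso_of_quotient_bijection[OF assms(1,2) bij])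
    fix h h' l l'
    assume *: "h \<in> carrier G" "h' \<in> carrier G" "l \<in> carrier G" "l' \<in> carrier G"
      and "\<exists>g \<in> carrier G. l = g \<otimes>\<^bsub>G\<^esub> h \<and> l' = g \<otimes>\<^bsub>G\<^esub> h'"
    then have "quotient_rel C (src eps) (\<beta> h) (\<beta> h') (\<beta> l) (\<beta> l')" using \<beta>rel by blast
    then have "quotient_rel C (src eps') (\<sigma> (\<beta> h)) (\<sigma> (\<beta> h')) (\<sigma> (\<beta> l)) (\<sigma> (\<beta> l'))" unfolding \<sigma>_def
      by (rule quotient_rel_transport[OF _ th(1-3) iso(1)])
        (use * \<beta>mem gl xi(3) in auto)
    moreover have "\<gamma> g \<in> carrier H" if "g \<in> carrier G" for g
      using bij that by (auto simp: bij_betw_def)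
    ultimately show "\<exists>g \<in> carrier H. \<gamma> l = g \<otimes>\<^bsub>H\<^esub> \<gamma> h \<and> \<gamma> l' = g \<otimes>\<^bsub>H\<^esub> \<gamma> h'"
      using \<beta>rel'[of "\<gamma> h" "\<gamma> h'" "\<gamma> l" "\<gamma> l'"] * by (simp add: \<beta>\<gamma>)
  qed
qed

end


subsection \<open>Invariance under monoidal equivalence\<close>

locale mon_equivalence = C: lin_mon_cat K C + D: lin_mon_cat K D
  for K :: "('k, 'm) ring_scheme" and C :: "('k, 'o1, 'd1) mon_category" (structure)
    and D :: "('k, 'o2, 'd2) mon_category" +
  fixes F :: "('o1, 'd1, 'o2, 'd2) functor_data" and \<mu> \<upsilon>
  assumes equivalence: "is_equivalence C D F" and monoidal: "is_monoidal_functor C D F \<mu> \<upsilon>"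
begin

abbreviation compD (infixl "\<star>" 70) where "g \<star> f \<equiv> g \<cdot>\<^bsub>D\<^esub> f"

abbreviation Fo where "Fo \<equiv> ObjMap F"
abbreviation Fa where "Fa \<equiv> ArrMap F"

lemma functorial: "is_functor C D F"
  using equivalence by (simp add: is_equivalence_def)

lemma Fo_obj [simp]: "x \<in> Obj C \<Longrightarrow> Fo x \<in> Obj D"
  and Fa_arr [simp]: "f \<in> Arr C \<Longrightarrow> Fa f \<in> Arr D"
  and src_Fa [simp]: "f \<in> Arr C \<Longrightarrow> src (Fa f) = Fo (src f)"
  and trg_Fa [simp]: "f \<in> Arr C \<Longrightarrow> trg (Fa f) = Fo (trg f)"
  and Fa_Id: "x \<in> Obj C \<Longrightarrow> Fa (Id C x) = Id D (Fo x)"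
  and Fa_Comp: "f \<in> Arr C \<Longrightarrow> g \<in> Arr C \<Longrightarrow> trg f = src g \<Longrightarrow>
    Fa (g \<cdot> f) = Fa g \<star> Fa f"
  using functorial by (auto simp: is_functor_def homset_def)

text \<open>All later transfer uses only these three properties; the quasi-inverse with its unit and
  counit is consumed here.\<close>

lemma faithful_full_surjective:
  shows faithful: "f \<in> Arr C \<Longrightarrow> g \<in> Arr C \<Longrightarrow> src f = src g \<Longrightarrow> trg f = trg g \<Longrightarrow>
      Fa f = Fa g \<Longrightarrow> f = g"
    and full: "p \<in> Arr D \<Longrightarrow> x \<in> Obj C \<Longrightarrow> y \<in> Obj C \<Longrightarrow> src p = Fo x \<Longrightarrow> trg p = Fo y \<Longrightarrow>
      \<exists>f \<in> Arr C. src f = x \<and> trg f = y \<and> Fa f = p"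
    and surjective: "z \<in> Obj D \<Longrightarrow> \<exists>x \<in> Obj C. \<exists>e. iso_arr D e \<and> src e = Fo x \<and> trg e = z"
proof -
  obtain G eta eps where G: "is_functor D C G"
    and eta: "is_nat_iso C C id_functor (comp_functor G F) eta"
    and eps: "is_nat_iso D D (comp_functor F G) id_functor eps"
    using equivalence by (auto simp: is_equivalence_def)
  let ?Go = "ObjMap G" and ?Ga = "ArrMap G"
  have Go [simp]: "z \<in> Obj D \<Longrightarrow> ?Go z \<in> Obj C" for z using G by (auto simp: is_functor_def)
  have Ga [simp]: "p \<in> Arr D \<Longrightarrow> ?Ga p \<in> Arr C" "p \<in> Arr D \<Longrightarrow> src (?Ga p) = ?Go (src p)"
    "p \<in> Arr D \<Longrightarrow> trg (?Ga p) = ?Go (trg p)" for p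
    using G by (auto simp: is_functor_def homset_def)
  have etai: "x \<in> Obj C \<Longrightarrow> iso_arr C (eta x)"
    and etah [simp]: "x \<in> Obj C \<Longrightarrow> eta x \<in> Arr C" "x \<in> Obj C \<Longrightarrow> src (eta x) = x"
      "x \<in> Obj C \<Longrightarrow> trg (eta x) = ?Go (Fo x)"
    and etan: "f \<in> Arr C \<Longrightarrow> eta (trg f) \<cdot> f = ?Ga (Fa f) \<cdot> eta (src f)" for x f
    using eta by (auto simp: is_nat_iso_def is_nat_trans_def id_functor_def comp_functor_def homset_def)
  have epsi: "z \<in> Obj D \<Longrightarrow> iso_arr D (eps z)"
    and epsh [simp]: "z \<in> Obj D \<Longrightarrow> eps z \<in> Arr D" "z \<in> Obj D \<Longrightarrow> src (eps z) = Fo (?Go z)"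
      "z \<in> Obj D \<Longrightarrow> trg (eps z) = z"
    and epsn: "p \<in> Arr D \<Longrightarrow> eps (trg p) \<star> Fa (?Ga p) = p \<star> eps (src p)" for z p
    using eps by (auto simp: is_nat_iso_def is_nat_trans_def id_functor_def comp_functor_def homset_def)
  have cancel: "f = g" if "f \<in> Arr C" "g \<in> Arr C" "src f = src g" "trg f = trg g"
    "?Ga (Fa f) = ?Ga (Fa g)" for f g
    by (rule C.iso_cancel_left[OF etai[of "trg f"]]) (use that etan[of f] etan[of g] in auto)
  show "f = g" if "f \<in> Arr C" "g \<in> Arr C" "src f = src g" "trg f = trg g" "Fa f = Fa g"
    using cancel[OF that(1-4)] that(5) by simp
  \<comment> \<open>Naturality of the counit makes the quasi-inverse faithful as well.\<close>
  have Gcancel: "p = q" if "p \<in> Arr D" "q \<in> Arr D" "src p = src q" "trg p = trg q" "?Ga p = ?Ga q" for p q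
    by (rule D.iso_cancel_right[OF epsi[of "src p"]]) (use that epsn[of p] epsn[of q] in auto)
  show "\<exists>f \<in> Arr C. src f = x \<and> trg f = y \<and> Fa f = p"
    if p: "p \<in> Arr D" "src p = Fo x" "trg p = Fo y" and xy: "x \<in> Obj C" "y \<in> Obj C"
  proof -
    obtain i where i: "i \<in> Arr C" "src i = ?Go (Fo y)" "trg i = y" "i \<cdot> eta y = Id C y"
      "eta y \<cdot> i = Id C (?Go (Fo y))"
      using C.iso_arrE[OF etai[OF xy(2)]] xy by auto
    \<comment> \<open>The preimage is the image of \<open>p\<close> under the quasi-inverse,
      conjugated by the unit. It is compared with \<open>p\<close> after applying the
      quasi-inverse.\<close>
    define f where "f = i \<cdot> (?Ga p \<cdot> eta x)"
    have f: "f \<in> Arr C" "src f = x" "trg f = y" using i p xy by (auto simp: f_def)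
    have "?Ga (Fa f) \<cdot> eta x = eta y \<cdot> f" using etan[OF f(1)] f by simp
    also have "\<dots> = ?Ga p \<cdot> eta x" unfolding f_def by (rule C.cancel_left) (use i p xy in auto)
    finally have "?Ga (Fa f) = ?Ga p"
      by (rule C.iso_cancel_right[OF etai[OF xy(1)], rotated -1]) (use f p xy in auto)
    then have "Fa f = p" by (intro Gcancel) (use f p in auto)
    then show ?thesis using f by blast
  qed
  show "\<exists>x \<in> Obj C. \<exists>e. iso_arr D e \<and> src e = Fo x \<and> trg e = z" if "z \<in> Obj D"
    using epsi[OF that] that by (intro bexI[where x = "?Go z"] exI[where x = "eps z"]) auto
qed

lemma iso_Fa_iff:
  assumes f: "f \<in> Arr C"
  shows "iso_arr D (Fa f) \<longleftrightarrow> iso_arr C f"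
proof
  assume "iso_arr D (Fa f)"
  then obtain g where g: "g \<in> Arr D" "src g = Fo (trg f)" "trg g = Fo (src f)"
    "g \<star> Fa f = Id D (Fo (src f))" "Fa f \<star> g = Id D (Fo (trg f))"
    by (rule D.iso_arrE) (use f in auto)
  obtain g' where g': "g' \<in> Arr C" "src g' = trg f" "trg g' = src f" "Fa g' = g"
    using full[OF g(1) _ _ g(2,3)] f by auto
  have "g' \<cdot> f = Id C (src f)" by (rule faithful) (use f g g' in \<open>auto simp: Fa_Comp Fa_Id\<close>)
  moreover have "f \<cdot> g' = Id C (trg f)" by (rule faithful) (use f g g' in \<open>auto simp: Fa_Comp Fa_Id\<close>)
  ultimately show "iso_arr C f" using f g' C.iso_arrI by blast
next
  assume "iso_arr C f"
  then obtain g where g: "g \<in> Arr C" "src g = trg f" "trg g = src f"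
    "g \<cdot> f = Id C (src f)" "f \<cdot> g = Id C (trg f)"
    by (rule C.iso_arrE) (use f in auto)
  show "iso_arr D (Fa f)"
    by (rule D.iso_arrI[where g = "Fa g"]) (use f g in \<open>auto simp: Fa_Id simp flip: Fa_Comp\<close>)
qed

lemma mono_Fa_iff:
  assumes m: "m \<in> Arr C"
  shows "mono_arr D (Fa m) \<longleftrightarrow> mono_arr C m"
proof
  assume mono: "mono_arr D (Fa m)"
  show "mono_arr C m"
  proof (rule C.mono_arrI[OF m])
    fix f g
    assume fg: "f \<in> Arr C" "g \<in> Arr C" "trg f = src m" "trg g = src m" "src f = src g"
      and eq: "m \<cdot> f = m \<cdot> g"
    have "Fa m \<star> Fa f = Fa m \<star> Fa g" using fg m eq Fa_Comp[of f m] Fa_Comp[of g m] by simp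
    then have "Fa f = Fa g" using D.mono_arrD[OF mono, of "Fa f" "Fa g"] fg m by simp
    then show "f = g" using faithful fg by simp
  qed
next
  assume mono: "mono_arr C m"
  show "mono_arr D (Fa m)"
  proof (rule D.mono_arrI)
    fix f g
    assume fg: "f \<in> Arr D" "g \<in> Arr D" "trg f = src (Fa m)" "trg g = src (Fa m)" "src f = src g"
      and eq: "Fa m \<star> f = Fa m \<star> g"
    \<comment> \<open>Test arrows in \<open>D\<close> start at arbitrary objects. Composing with an
      isomorphism from some \<open>Fo x\<close> turns them into images under
      \<open>Fa\<close>.\<close>
    obtain x e where x: "x \<in> Obj C" and e: "iso_arr D e" "src e = Fo x" "trg e = src f"
      using surjective[OF D.src_obj[OF fg(1)]] by blast
    note e' = D.iso_arrE[OF e(1)]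
    have eA: "e \<in> Arr D" using e by (simp add: iso_arr_def)
    obtain f' where f': "f' \<in> Arr C" "src f' = x" "trg f' = src m" "Fa f' = f \<star> e"
      using full[of "f \<star> e" x "src m"] fg eA e x m by auto
    obtain g' where g': "g' \<in> Arr C" "src g' = x" "trg g' = src m" "Fa g' = g \<star> e"
      using full[of "g \<star> e" x "src m"] fg eA e x m by auto
    have "Fa m \<star> (f \<star> e) = (Fa m \<star> f) \<star> e" using fg m e eA by simp
    also have "\<dots> = Fa m \<star> (g \<star> e)" unfolding eq using fg m e eA by simp
    finally have "m \<cdot> f' = m \<cdot> g'" by (intro faithful) (use f' g' m in \<open>auto simp: Fa_Comp\<close>)
    then have "f' = g'" using C.mono_arrD[OF mono, of f' g'] f' g' by simp
    then have "f \<star> e = g \<star> e" using f' g' by simp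
    then show "f = g" by (rule D.iso_cancel_right[OF e(1), rotated -1]) (use fg e in auto)
  qed (use m in simp)
qed

text \<open>The unit of \<open>C\<close> is sent to an object that is only isomorphic to the unit of
  \<open>D\<close>; arrows into the unit have to be corrected by this isomorphism.\<close>

definition lower :: "('o2, 'd2) arrow" where "lower = inv_arr D \<upsilon>"

lemma \<upsilon>: "iso_arr D \<upsilon>" "src \<upsilon> = UnitO D" "trg \<upsilon> = Fo (UnitO C)"
  using monoidal by (auto simp: is_monoidal_functor_def homset_def)

lemma lower [simp]: "lower \<in> Arr D" "src lower = Fo (UnitO C)" "trg lower = UnitO D"
  and iso_lower: "iso_arr D lower"
  using D.inv_arr[OF \<upsilon>(1)] D.iso_inv_arr[OF \<upsilon>(1)] \<upsilon> by (auto simp: lower_def)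

lemma \<mu>: "x \<in> Obj C \<Longrightarrow> y \<in> Obj C \<Longrightarrow> iso_arr D (\<mu> x y)"
  "x \<in> Obj C \<Longrightarrow> y \<in> Obj C \<Longrightarrow> \<mu> x y \<in> Arr D"
  "x \<in> Obj C \<Longrightarrow> y \<in> Obj C \<Longrightarrow> src (\<mu> x y) = TensO D (Fo x) (Fo y)"
  "x \<in> Obj C \<Longrightarrow> y \<in> Obj C \<Longrightarrow> trg (\<mu> x y) = Fo (TensO C x y)"
  and \<mu>_natural: "f \<in> Arr C \<Longrightarrow> g \<in> Arr C \<Longrightarrow>
    \<mu> (trg f) (trg g) \<star> TensA D (Fa f) (Fa g) = Fa (TensA C f g) \<star> \<mu> (src f) (src g)"
  using monoidal by (auto simp: is_monoidal_functor_def homset_def)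

abbreviation push :: "('o1, 'd1) arrow \<Rightarrow> ('o2, 'd2) arrow" where
  "push f \<equiv> lower \<star> Fa f"

lemma push_mono_iff: "f \<in> Arr C \<Longrightarrow> trg f = UnitO C \<Longrightarrow> mono_arr D (push f) \<longleftrightarrow> mono_arr C f"
proof
  assume f: "f \<in> Arr C" "trg f = UnitO C" and "mono_arr D (push f)"
  have "mono_arr D (Fa f)"
  proof (rule D.mono_arrI)
    fix p q assume "p \<in> Arr D" "q \<in> Arr D" "trg p = src (Fa f)" "trg q = src (Fa f)" "src p = src q"
      "Fa f \<star> p = Fa f \<star> q"
    then show "p = q" using D.mono_arrD[OF \<open>mono_arr D (push f)\<close>, of p q] f by simp
  qed (use f in simp)
  then show "mono_arr C f" using mono_Fa_iff f by simp
next
  assume "f \<in> Arr C" "trg f = UnitO C" "mono_arr C f"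
  then show "mono_arr D (push f)"
    by (intro D.mono_Comp D.iso_imp_mono[OF iso_lower]) (auto simp: mono_Fa_iff)
qed

lemma push_iso_iff:
  assumes f: "f \<in> Arr C" "trg f = UnitO C"
  shows "iso_arr D (push f) \<longleftrightarrow> iso_arr C f"
proof
  assume *: "iso_arr D (push f)"
  have "Fa f = inv_arr D lower \<star> push f"
    using D.inv_arr_cancel(1)[OF iso_lower, of "Fa f"] f by simp
  moreover have "iso_arr D \<dots>"
    using f D.inv_arr[OF iso_lower] by (intro D.iso_Comp D.iso_inv_arr iso_lower *) auto
  ultimately show "iso_arr C f" using iso_Fa_iff f by simp
qed (use f in \<open>auto simp: iso_Fa_iff intro!: D.iso_Comp iso_lower\<close>)

text \<open>Essential surjectivity and fullness relative to the unit: up to an isomorphism of its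
  source, every arrow into the unit of \<open>D\<close> is pushed from \<open>C\<close>.\<close>

lemma lift_over_unit:
  assumes m: "m \<in> Arr D" "trg m = UnitO D"
  obtains m' e where "m' \<in> Arr C" "trg m' = UnitO C" "iso_arr D e" "e \<in> Arr D" "src e = Fo (src m')"
    "trg e = src m" "push m' = m \<star> e"
proof -
  obtain x e where x: "x \<in> Obj C" and e: "iso_arr D e" "src e = Fo x" "trg e = src m"
    using surjective[OF D.src_obj[OF m(1)]] by blast
  have eA: "e \<in> Arr D" using e by (simp add: iso_arr_def)
  note il = D.inv_arr[OF iso_lower]
  obtain m' where m': "m' \<in> Arr C" "src m' = x" "trg m' = UnitO C"
    "Fa m' = inv_arr D lower \<star> (m \<star> e)"
    using full[of "inv_arr D lower \<star> (m \<star> e)" x "UnitO C"] m eA e x il by auto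
  have "push m' = m \<star> e"
    unfolding m'(4) by (rule D.inv_arr_cancel(2)[OF iso_lower]) (use m eA e in auto)
  then show thesis using that[of m' e] m' e eA by simp
qed

lemma push_factor:
  assumes "f \<in> Arr C" "m \<in> Arr C" "h \<in> Arr C" "trg h = src m" "src h = src f" "trg m = UnitO C"
    "trg f = UnitO C" and eq: "push f = push m \<star> Fa h"
  shows "f = m \<cdot> h"
proof (rule faithful)
  show "Fa f = Fa (m \<cdot> h)"
    by (rule D.iso_cancel_left[OF iso_lower]) (use assms in \<open>auto simp: Fa_Comp\<close>)
qed (use assms in auto)

lemma push_Comp:
  assumes "m \<in> Arr C" "h \<in> Arr C" "trg h = src m" "trg m = UnitO C"
  shows "push (m \<cdot> h) = push m \<star> Fa h"
  using assms by (simp add: Fa_Comp)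

text \<open>A proper subobject of the unit of \<open>D\<close> is lifted to \<open>C\<close>,
  factored through \<open>eta\<close> there, and the factorization is pushed back.\<close>

lemma push_maximal_sub:
  assumes eta: "is_maximal_sub C eta" "trg eta = UnitO C"
  shows "is_maximal_sub D (push eta)"
proof -
  have etaA: "eta \<in> Arr C" using eta by (simp add: is_maximal_sub_def mono_arr_def)
  have "subobj_le D m (push eta)" if m: "mono_arr D m" "\<not> iso_arr D m" "trg m = UnitO D" for m
  proof -
    have mA: "m \<in> Arr D" using m by (simp add: mono_arr_def)
    obtain m' e where m': "m' \<in> Arr C" "trg m' = UnitO C" "iso_arr D e" "e \<in> Arr D"
      "src e = Fo (src m')" "trg e = src m" "push m' = m \<star> e"
      using lift_over_unit[OF mA m(3)] .
    note e = D.inv_arr[OF m'(3)]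
    have m_eq: "m = push m' \<star> inv_arr D e" unfolding m'(7) using m'(4-6) mA e by simp
    have "mono_arr D (push m')"
      unfolding m'(7) by (rule D.mono_Comp[OF D.iso_imp_mono[OF m'(3)] m(1) m'(6)])
    then have "mono_arr C m'" by (simp only: push_mono_iff[OF m'(1,2)])
    moreover have "\<not> iso_arr C m'"
    proof
      assume "iso_arr C m'"
      then have "iso_arr D (push m' \<star> inv_arr D e)" using push_iso_iff[OF m'(1,2)] m'(1-6) e
      by (intro D.iso_Comp[OF D.iso_inv_arr[OF m'(3)]]) simp_all
      then show False using m(2) m_eq by simp
    qed
    ultimately obtain h where h: "h \<in> Arr C" "src h = src m'" "trg h = src eta" "m' = eta \<cdot> h"
    proof -
      assume "mono_arr C m'" "\<not> iso_arr C m'"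
      then have "subobj_le C m' eta" using eta m'(2) unfolding is_maximal_sub_def by metis
      then show thesis using that unfolding subobj_le_def homset_def by auto
    qed
    have "m = push eta \<star> (Fa h \<star> inv_arr D e)"
      using m_eq unfolding h(4) using h(1-3) etaA eta e m'(4-6) by (simp add: Fa_Comp)
    then show ?thesis unfolding subobj_le_def homset_def using h(1-3) etaA eta e m'(4-6)
      by (intro bexI[where x = "Fa h \<star> inv_arr D e"]) auto
  qed
  then show ?thesis
    using eta etaA unfolding is_maximal_sub_def by (auto simp: push_mono_iff push_iso_iff)
qed

lemma push_cover_iff:
  assumes f: "f \<in> Arr C" "trg f = UnitO C"
  shows "is_cover D (push f) \<longleftrightarrow> is_cover C f"
proof
  assume cover: "is_cover D (push f)"
  show "is_cover C f"
    unfolding is_cover_def homset_def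
  proof (intro conjI allI impI f)
    fix m h
    assume "mono_arr C m \<and> trg m = trg f \<and> h \<in> {u \<in> Arr C. src u = src f \<and> trg u = src m} \<and>
      f = m \<cdot> h"
    then have mh: "mono_arr C m" "h \<in> Arr C" "trg m = trg f" "src h = src f" "trg h = src m"
      and eq: "f = m \<cdot> h" by blast+
    have mA: "m \<in> Arr C" using mh(1) by (simp add: mono_arr_def)
    have "push f = push m \<star> Fa h" by (subst eq, rule push_Comp) (use mh mA f in auto)
    moreover have "mono_arr D (push m)" using push_mono_iff mh mA f by simp
    moreover have "Fa h \<in> homset D (src (push f)) (src (push m))" "trg (push m) = trg (push f)"
      using mh mA f by (auto simp: homset_def)
    ultimately have "iso_arr D (push m)" using cover unfolding is_cover_def by blast
    then show "iso_arr C m" using push_iso_iff mh mA f by simp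
  qed
next
  assume cover: "is_cover C f"
  show "is_cover D (push f)"
    unfolding is_cover_def homset_def
  proof (intro conjI allI impI)
    show "push f \<in> Arr D" using f by simp
    fix m h
    assume "mono_arr D m \<and> trg m = trg (push f) \<and>
      h \<in> {u \<in> Arr D. src u = src (push f) \<and> trg u = src m} \<and> push f = m \<star> h"
    then have mh: "mono_arr D m" "m \<in> Arr D" "h \<in> Arr D" "trg m = UnitO D" "src h = Fo (src f)"
      "trg h = src m" and eq: "push f = m \<star> h" using f by (auto simp: mono_arr_def)
    obtain m' e where m': "m' \<in> Arr C" "trg m' = UnitO C" "iso_arr D e" "e \<in> Arr D"
      "src e = Fo (src m')" "trg e = src m" "push m' = m \<star> e"
      using lift_over_unit[OF mh(2,4)] .
    note e = D.inv_arr[OF m'(3)]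
    obtain h' where h': "h' \<in> Arr C" "src h' = src f" "trg h' = src m'" "Fa h' = inv_arr D e \<star> h"
      using full[of "inv_arr D e \<star> h" "src f" "src m'"] mh e m' f by auto
    have "push m' \<star> Fa h' = m \<star> (e \<star> (inv_arr D e \<star> h))"
      unfolding m'(7) h'(4) using mh m'(4-6) e by simp
    also have "\<dots> = push f" unfolding eq by (subst D.inv_arr_cancel(2)[OF m'(3)]) (use mh m' in auto)
    finally have "f = m' \<cdot> h'" by (intro push_factor) (use f m' h' in auto)
    moreover have "mono_arr C m'"
      using push_mono_iff[OF m'(1,2)] unfolding m'(7)
      using m' mh by (metis D.mono_Comp D.iso_imp_mono)
    moreover have "h' \<in> homset C (src f) (src m')" "trg m' = trg f"
      using h' m' f by (simp_all add: homset_def)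
    ultimately have "iso_arr C m'" using cover unfolding is_cover_def by blast
    then have "iso_arr D (push m' \<star> inv_arr D e)" using push_iso_iff[OF m'(1,2)] m'(1-6) e
      by (intro D.iso_Comp[OF D.iso_inv_arr[OF m'(3)]]) simp_all
    also have "push m' \<star> inv_arr D e = m" unfolding m'(7) using m'(4-6) mh e by simp
    finally show "iso_arr D m" .
  qed
qed

lemma push_minimal_cover:
  assumes eps: "is_minimal_cover C eps" "trg eps = UnitO C"
  shows "is_minimal_cover D (push eps)"
proof -
  have epsA: "eps \<in> Arr C" using eps by (simp add: is_minimal_cover_def is_cover_def)
  have "is_cover D (push eps)" using eps epsA push_cover_iff by (simp add: is_minimal_cover_def)
  moreover have "\<exists>h \<in> homset D (src (push eps)) (src f). f \<star> h = push eps"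
    if f: "is_cover D f" "trg f = UnitO D" for f
  proof -
    have fA: "f \<in> Arr D" using f by (simp add: is_cover_def)
    obtain f' e where f': "f' \<in> Arr C" "trg f' = UnitO C" "iso_arr D e" "e \<in> Arr D"
      "src e = Fo (src f')" "trg e = src f" "push f' = f \<star> e"
      using lift_over_unit[OF fA f(2)] .
    note e = D.inv_arr[OF f'(3)]
    \<comment> \<open>Changing the source by an isomorphism does not affect being a cover.\<close>
    have "is_cover D (f \<star> e)" unfolding is_cover_def homset_def
    proof (intro conjI allI impI)
      show "f \<star> e \<in> Arr D" using fA f' by simp
      fix m h assume "mono_arr D m \<and> trg m = trg (f \<star> e) \<and>
        h \<in> {u \<in> Arr D. src u = src (f \<star> e) \<and> trg u = src m} \<and> f \<star> e = m \<star> h"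
      then have mh: "mono_arr D m" "m \<in> Arr D" "h \<in> Arr D" "trg m = trg f" "src h = src e" "trg h = src m"
        and eq: "f \<star> e = m \<star> h" using fA f'(4-6) by (auto simp: mono_arr_def)
      have "f = (f \<star> e) \<star> inv_arr D e" using fA f'(4-6) e by simp
      also have "\<dots> = m \<star> (h \<star> inv_arr D e)" unfolding eq using mh e by simp
      finally have "f = m \<star> (h \<star> inv_arr D e)" .
      moreover have "h \<star> inv_arr D e \<in> homset D (src f) (src m)"
        using mh e f'(4-6) by (simp add: homset_def)
      ultimately show "iso_arr D m" using f(1) mh unfolding is_cover_def by blast
    qed
    then have "is_cover C f'" using push_cover_iff[OF f'(1,2)] unfolding f'(7) by blast
    then have "\<exists>h \<in> homset C (src eps) (src f'). f' \<cdot> h = eps"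
      using eps f'(2) unfolding is_minimal_cover_def by metis
    then obtain h where h: "h \<in> Arr C" "src h = src eps" "trg h = src f'" "f' \<cdot> h = eps"
      by (auto simp: homset_def)
    have "push eps = push f' \<star> Fa h"
      unfolding h(4)[symmetric] by (rule push_Comp) (use f' h in auto)
    also have "\<dots> = f \<star> (e \<star> Fa h)" unfolding f'(7) using f'(1-6) h(1-3) fA by simp
    finally have "f \<star> (e \<star> Fa h) = push eps" by simp
    then show ?thesis
      using f' h(1-3) fA epsA eps by (intro bexI[where x = "e \<star> Fa h"]) (auto simp: homset_def)
  qed
  moreover have "h = Id D (src (push eps))"
    if h: "h \<in> homset D (src (push eps)) (src (push eps))" "push eps \<star> h = push eps" for h
  proof -
    have hA: "h \<in> Arr D" "src h = Fo (src eps)" "trg h = Fo (src eps)"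
      using h epsA eps by (auto simp: homset_def)
    obtain h' where h': "h' \<in> Arr C" "src h' = src eps" "trg h' = src eps" "Fa h' = h"
      using full[OF hA(1) _ _ hA(2,3)] epsA by auto
    have "eps = eps \<cdot> h'" by (rule push_factor) (use epsA eps h' h in auto)
    then have "h' = Id C (src eps)" using eps h' unfolding is_minimal_cover_def homset_def by simp
    then show ?thesis using h' epsA eps by (auto simp: Fa_Id)
  qed
  ultimately show ?thesis
    unfolding is_minimal_cover_def using epsA eps by auto
qed

text \<open>The comparison isomorphisms \<open>\<mu>\<close> are inserted at \<open>src eps\<close>
  and at \<open>src eta\<close>; naturality at \<open>g\<close> makes them cancel from the grouplike
  equation, in both directions.\<close>

lemma push_grouplikes:
  assumes eta: "eta \<in> Arr C" "trg eta = UnitO C" and eps: "eps \<in> Arr C" "trg eps = UnitO C"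
    and g: "g \<in> Arr C" "src g = src eta" "trg g = src eps"
  shows "Fa g \<in> grouplikes D (push eta) (push eps) \<longleftrightarrow> g \<in> grouplikes C eta eps"
proof -
  let ?P = "src eps" and ?X = "src eta"
  have o: "?P \<in> Obj C" "?X \<in> Obj C" using eta eps by auto
  note \<mu>P = \<mu>[OF o(1) o(1)] and \<mu>X = \<mu>[OF o(2) o(2)]
  note i\<mu>P = D.inv_arr[OF \<mu>P(1)] and i\<mu>X = D.inv_arr[OF \<mu>X(1)]
  have counit: "push eps \<star> Fa g = push eta \<longleftrightarrow> eps \<cdot> g = eta"
    using push_factor[of eta eps g] push_Comp[of eps g] eta eps g by metis
  have nat: "\<mu> ?P ?P \<star> TensA D (Fa g) (Fa g) = Fa (TensA C g g) \<star> \<mu> ?X ?X"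
    using \<mu>_natural[OF g(1) g(1)] g by simp
  show ?thesis
  proof
    assume *: "g \<in> grouplikes C eta eps"
    then obtain \<Delta> \<delta> where \<Delta>: "\<Delta> \<in> Arr C" "src \<Delta> = ?P" "trg \<Delta> = TensO C ?P ?P"
      and \<delta>: "\<delta> \<in> Arr C" "src \<delta> = ?X" "trg \<delta> = TensO C ?X ?X" "iso_arr C \<delta>"
      and eq: "\<Delta> \<cdot> g = TensA C g g \<cdot> \<delta>" and c: "eps \<cdot> g = eta"
      by (auto simp: grouplikes_def homset_def)
    define \<Delta>' where "\<Delta>' = inv_arr D (\<mu> ?P ?P) \<star> Fa \<Delta>"
    define \<delta>' where "\<delta>' = inv_arr D (\<mu> ?X ?X) \<star> Fa \<delta>"
    have \<delta>': "\<delta>' \<in> Arr D" "src \<delta>' = Fo ?X" "trg \<delta>' = TensO D (Fo ?X) (Fo ?X)" "iso_arr D \<delta>'"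
      unfolding \<delta>'_def using \<delta> \<mu>X i\<mu>X iso_Fa_iff by (auto intro!: D.iso_Comp D.iso_inv_arr)
    have \<Delta>': "\<Delta>' \<in> Arr D" "src \<Delta>' = Fo ?P" "trg \<Delta>' = TensO D (Fo ?P) (Fo ?P)"
      unfolding \<Delta>'_def using \<Delta> \<mu>P i\<mu>P by auto
    have "\<mu> ?P ?P \<star> (\<Delta>' \<star> Fa g) = Fa (\<Delta> \<cdot> g)"
      unfolding \<Delta>'_def using \<Delta> g \<mu>P i\<mu>P D.inv_arr_cancel(2)[OF \<mu>P(1), of "Fa \<Delta> \<star> Fa g"]
      by (simp add: Fa_Comp)
    also have "\<dots> = Fa (TensA C g g) \<star> (\<mu> ?X ?X \<star> \<delta>')"
      unfolding eq \<delta>'_def using g \<delta> D.inv_arr_cancel(2)[OF \<mu>X(1), of "Fa \<delta>"] \<mu>X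
      by (simp add: Fa_Comp)
    also have "\<dots> = (Fa (TensA C g g) \<star> \<mu> ?X ?X) \<star> \<delta>'" using g \<mu>X \<delta>' by simp
    also have "\<dots> = \<mu> ?P ?P \<star> (TensA D (Fa g) (Fa g) \<star> \<delta>')"
      unfolding nat[symmetric] using g \<mu>P \<delta>' by simp
    finally have "\<Delta>' \<star> Fa g = TensA D (Fa g) (Fa g) \<star> \<delta>'"
      by (rule D.iso_cancel_left[OF \<mu>P(1), rotated -1]) (use \<Delta>' \<delta>' \<mu>P g in auto)
    then show "Fa g \<in> grouplikes D (push eta) (push eps)"
      unfolding grouplikes_def homset_def
      using counit c \<Delta>' \<delta>' g eta eps by auto
  next
    assume *: "Fa g \<in> grouplikes D (push eta) (push eps)"
    then obtain \<Delta>' \<delta>' where \<Delta>': "\<Delta>' \<in> Arr D" "src \<Delta>' = Fo ?P" "trg \<Delta>' = TensO D (Fo ?P) (Fo ?P)"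
      and \<delta>': "\<delta>' \<in> Arr D" "src \<delta>' = Fo ?X" "trg \<delta>' = TensO D (Fo ?X) (Fo ?X)" "iso_arr D \<delta>'"
      and eq: "\<Delta>' \<star> Fa g = TensA D (Fa g) (Fa g) \<star> \<delta>'" and c: "push eps \<star> Fa g = push eta"
      using eta eps by (auto simp: grouplikes_def homset_def)
    obtain \<Delta> where \<Delta>: "\<Delta> \<in> Arr C" "src \<Delta> = ?P" "trg \<Delta> = TensO C ?P ?P" "Fa \<Delta> = \<mu> ?P ?P \<star> \<Delta>'"
      using full[of "\<mu> ?P ?P \<star> \<Delta>'" ?P "TensO C ?P ?P"] \<Delta>' \<mu>P o by auto
    obtain \<delta> where \<delta>: "\<delta> \<in> Arr C" "src \<delta> = ?X" "trg \<delta> = TensO C ?X ?X" "Fa \<delta> = \<mu> ?X ?X \<star> \<delta>'"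
      using full[of "\<mu> ?X ?X \<star> \<delta>'" ?X "TensO C ?X ?X"] \<delta>' \<mu>X o by auto
    have "iso_arr D (Fa \<delta>)" unfolding \<delta>(4) using \<delta>' \<mu>X by (intro D.iso_Comp) auto
    then have "iso_arr C \<delta>" using iso_Fa_iff[OF \<delta>(1)] by blast
    have "Fa (\<Delta> \<cdot> g) = \<mu> ?P ?P \<star> (\<Delta>' \<star> Fa g)" using \<Delta> g \<mu>P \<Delta>' by (simp add: Fa_Comp)
    also have "\<dots> = (\<mu> ?P ?P \<star> TensA D (Fa g) (Fa g)) \<star> \<delta>'" unfolding eq using g \<mu>P \<delta>' by simp
    also have "\<dots> = Fa (TensA C g g \<cdot> \<delta>)" unfolding nat using g \<mu>X \<delta>' \<delta> by (simp add: Fa_Comp)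
    finally have "\<Delta> \<cdot> g = TensA C g g \<cdot> \<delta>" by (intro faithful) (use g \<Delta> \<delta> in auto)
    then show "g \<in> grouplikes C eta eps"
      unfolding grouplikes_def homset_def
      using counit c \<Delta> \<delta> g \<open>iso_arr C \<delta>\<close> by auto
  qed
qed

text \<open>The common target of two test arrows in \<open>D\<close> may lie outside the image of
  \<open>Fo\<close>; it is replaced by an isomorphic object inside, which changes neither
  equation.\<close>

lemma quotient_rel_Fa_iff:
  assumes k: "\<And>k. k \<in> {h, h', l, l'} \<Longrightarrow> k \<in> Arr C \<and> src k = X \<and> trg k = P" and P: "P \<in> Obj C"
  shows "quotient_rel D (Fo P) (Fa h) (Fa h') (Fa l) (Fa l') \<longleftrightarrow> quotient_rel C P h h' l l'"
proof
  assume *: "quotient_rel D (Fo P) (Fa h) (Fa h') (Fa l) (Fa l')"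
  show "quotient_rel C P h h' l l'"
    unfolding quotient_rel_def
  proof (intro ballI impI, elim conjE)
    fix x y
    assume xy: "x \<in> Arr C" "y \<in> Arr C" "src x = P" "src y = P" "trg x = trg y"
      and eq: "x \<cdot> h = y \<cdot> h'"
    have "Fa x \<star> Fa h = Fa y \<star> Fa h'"
      using eq xy k[of h] k[of h'] Fa_Comp[of h x] Fa_Comp[of h' y] by simp
    then have "Fa x \<star> Fa l = Fa y \<star> Fa l'" using * xy unfolding quotient_rel_def by simp
    then show "x \<cdot> l = y \<cdot> l'" by (intro faithful) (use xy k[of l] k[of l'] in \<open>auto simp: Fa_Comp\<close>)
  qed
next
  assume *: "quotient_rel C P h h' l l'"
  show "quotient_rel D (Fo P) (Fa h) (Fa h') (Fa l) (Fa l')"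
    unfolding quotient_rel_def
  proof (intro ballI impI, elim conjE)
    fix x y
    assume xy: "x \<in> Arr D" "y \<in> Arr D" "src x = Fo P" "src y = Fo P" "trg x = trg y"
      and eq: "x \<star> Fa h = y \<star> Fa h'"
    obtain z e where z: "z \<in> Obj C" and e: "iso_arr D e" "src e = Fo z" "trg e = trg x"
      using surjective[OF D.trg_obj[OF xy(1)]] by blast
    note ie = D.inv_arr[OF e(1)]
    obtain x' where x': "x' \<in> Arr C" "src x' = P" "trg x' = z" "Fa x' = inv_arr D e \<star> x"
      using full[of "inv_arr D e \<star> x" P z] xy ie e z P by auto
    obtain y' where y': "y' \<in> Arr C" "src y' = P" "trg y' = z" "Fa y' = inv_arr D e \<star> y"
      using full[of "inv_arr D e \<star> y" P z] xy ie e z P by auto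
    have Fx: "Fa x' \<star> Fa m = inv_arr D e \<star> (x \<star> Fa m)"
      and Fy: "Fa y' \<star> Fa m = inv_arr D e \<star> (y \<star> Fa m)"
      if "m \<in> {h, h', l, l'}" for m
      unfolding x'(4) y'(4) using k[OF that] xy ie e by auto
    have "x' \<cdot> h = y' \<cdot> h'"
      by (rule faithful) (use k[of h] k[of h'] x'(1-3) y'(1-3) Fx[of h] Fy[of h'] eq in
          \<open>auto simp: Fa_Comp\<close>)
    then have "x' \<cdot> l = y' \<cdot> l'" using * x' y' unfolding quotient_rel_def by simp
    then have "Fa x' \<star> Fa l = Fa y' \<star> Fa l'"
      using k[of l] k[of l'] x' y' Fa_Comp[of l x'] Fa_Comp[of l' y'] by simp
    then have "inv_arr D e \<star> (x \<star> Fa l) = inv_arr D e \<star> (y \<star> Fa l')"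
      using Fx[of l] Fy[of l'] by simp
    then show "x \<star> Fa l = y \<star> Fa l'"
      by (rule D.iso_cancel_left[OF D.iso_inv_arr[OF e(1)], rotated -1])
        (use k[of l] k[of l'] xy ie e in auto)
  qed
qed

lemma encodes_group_target:
  assumes "encodes_group C G"
  shows "encodes_group D G"
proof -
  obtain eta eps \<beta> where eta: "is_maximal_sub C eta" "trg eta = UnitO C"
    and eps: "is_minimal_cover C eps" "trg eps = UnitO C"
    and \<beta>: "bij_betw \<beta> (carrier G) (grouplikes C eta eps)"
    and rel: "\<And>h h' l l'. h \<in> carrier G \<Longrightarrow> h' \<in> carrier G \<Longrightarrow> l \<in> carrier G \<Longrightarrow> l' \<in> carrier G \<Longrightarrow>
        quotient_rel C (src eps) (\<beta> h) (\<beta> h') (\<beta> l) (\<beta> l') \<longleftrightarrow>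
        (\<exists>g \<in> carrier G. l = g \<otimes>\<^bsub>G\<^esub> h \<and> l' = g \<otimes>\<^bsub>G\<^esub> h')"
    using assms unfolding encodes_group_def by metis
  have arr: "eta \<in> Arr C" "eps \<in> Arr C"
    using eta eps by (auto simp: is_maximal_sub_def mono_arr_def is_minimal_cover_def is_cover_def)
  have gl: "g \<in> Arr C" "src g = src eta" "trg g = src eps" if "g \<in> grouplikes C eta eps" for g
    using that by (auto simp: grouplikes_def homset_def)
  have "bij_betw Fa (grouplikes C eta eps) (grouplikes D (push eta) (push eps))"
  proof (rule bij_betwI')
    show "Fa x = Fa y \<longleftrightarrow> x = y" if "x \<in> grouplikes C eta eps" "y \<in> grouplikes C eta eps" for x y
      using faithful[of x y] gl[OF that(1)] gl[OF that(2)] by auto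
    show "Fa x \<in> grouplikes D (push eta) (push eps)" if "x \<in> grouplikes C eta eps" for x
      using push_grouplikes[OF arr(1) eta(2) arr(2) eps(2) gl[OF that]] that by simp
    show "\<exists>x \<in> grouplikes C eta eps. y = Fa x" if y: "y \<in> grouplikes D (push eta) (push eps)" for y
    proof -
      have "y \<in> Arr D" "src y = Fo (src eta)" "trg y = Fo (src eps)"
        using y arr eta eps by (auto simp: grouplikes_def homset_def)
      with full[of y "src eta" "src eps"] arr obtain g where g: "g \<in> Arr C" "src g = src eta"
        "trg g = src eps" "Fa g = y" by auto
      then show ?thesis using push_grouplikes[OF arr(1) eta(2) arr(2) eps(2) g(1-3)] y by auto
    qed
  qed
  with \<beta> have "bij_betw (Fa \<circ> \<beta>) (carrier G) (grouplikes D (push eta) (push eps))"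
    by (rule bij_betw_trans)
  moreover have "quotient_rel D (src (push eps)) ((Fa \<circ> \<beta>) h) ((Fa \<circ> \<beta>) h') ((Fa \<circ> \<beta>) l) ((Fa \<circ> \<beta>) l') \<longleftrightarrow>
      (\<exists>g \<in> carrier G. l = g \<otimes>\<^bsub>G\<^esub> h \<and> l' = g \<otimes>\<^bsub>G\<^esub> h')"
    if "h \<in> carrier G" "h' \<in> carrier G" "l \<in> carrier G" "l' \<in> carrier G" for h h' l l'
  proof -
    have "\<beta> k \<in> grouplikes C eta eps" if "k \<in> carrier G" for k
      using \<beta> that by (auto simp: bij_betw_def)
    then have "quotient_rel D (Fo (src eps)) (Fa (\<beta> h)) (Fa (\<beta> h')) (Fa (\<beta> l)) (Fa (\<beta> l')) \<longleftrightarrow>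
      quotient_rel C (src eps) (\<beta> h) (\<beta> h') (\<beta> l) (\<beta> l')"
      using that gl arr by (intro quotient_rel_Fa_iff[where X = "src eta"]) auto
    then show ?thesis using rel[OF that] arr eps by simp
  qed
  ultimately show ?thesis
    unfolding encodes_group_def
    using push_maximal_sub[OF eta] push_minimal_cover[OF eps] arr eta eps
    by (intro exI[where x = "push eta"] exI[where x = "push eps"] exI[where x = "Fa \<circ> \<beta>"]) auto
qed

end

lemma encodes_group_equivalent:
  assumes "lin_mon_cat K C" "lin_mon_cat K D" "linear_monoidally_equivalent K C D"
    "encodes_group C G"
  shows "encodes_group D G"
proof -
  obtain F \<mu> \<upsilon> where "is_equivalence C D F" "is_monoidal_functor C D F \<mu> \<upsilon>"
    using assms(3) by (auto simp: linear_monoidally_equivalent_def)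
  then interpret mon_equivalence K C D F \<mu> \<upsilon>
    using assms(1,2) by (auto simp: mon_equivalence_def mon_equivalence_axioms_def)
  show ?thesis using assms(4) by (rule encodes_group_target)
qed

section \<open>Linear algebra inside the universe\<close>

lemma linear_mapsI:
  assumes "f \<in> extensional (carrier V)" "\<And>x. x \<in> carrier V \<Longrightarrow> f x \<in> carrier W"
    "\<And>x y. x \<in> carrier V \<Longrightarrow> y \<in> carrier V \<Longrightarrow> f (x \<oplus>\<^bsub>V\<^esub> y) = f x \<oplus>\<^bsub>W\<^esub> f y"
    "\<And>c x. c \<in> carrier K \<Longrightarrow> x \<in> carrier V \<Longrightarrow> f (c \<odot>\<^bsub>V\<^esub> x) = c \<odot>\<^bsub>W\<^esub> f x"
  shows "f \<in> linear_maps K V W"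
  using assms by (auto simp: linear_maps_def PiE_iff)

lemma linear_mapsD:
  assumes "f \<in> linear_maps K V W"
  shows linear_closed: "x \<in> carrier V \<Longrightarrow> f x \<in> carrier W"
    and linear_ext: "f \<in> extensional (carrier V)"
    and linear_add: "x \<in> carrier V \<Longrightarrow> y \<in> carrier V \<Longrightarrow> f (x \<oplus>\<^bsub>V\<^esub> y) = f x \<oplus>\<^bsub>W\<^esub> f y"
    and linear_smult: "c \<in> carrier K \<Longrightarrow> x \<in> carrier V \<Longrightarrow> f (c \<odot>\<^bsub>V\<^esub> x) = c \<odot>\<^bsub>W\<^esub> f x"
  using assms by (auto simp: linear_maps_def PiE_iff)

lemma linear_eqI:
  assumes "f \<in> linear_maps K V W" "g \<in> linear_maps K V W'" "\<And>x. x \<in> carrier V \<Longrightarrow> f x = g x"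
  shows "f = g"
  using linear_ext[OF assms(1)] linear_ext[OF assms(2)] assms(3) by (rule extensionalityI)

text \<open>The zero law for \<open>\<odot>\<close> replaces the existence of additive inverses.\<close>

lemma moduleI':
  assumes "cring K" "\<zero>\<^bsub>V\<^esub> \<in> carrier V"
    "\<And>x y. x \<in> carrier V \<Longrightarrow> y \<in> carrier V \<Longrightarrow> x \<oplus>\<^bsub>V\<^esub> y \<in> carrier V"
    "\<And>x y z. x \<in> carrier V \<Longrightarrow> y \<in> carrier V \<Longrightarrow> z \<in> carrier V \<Longrightarrow>
      (x \<oplus>\<^bsub>V\<^esub> y) \<oplus>\<^bsub>V\<^esub> z = x \<oplus>\<^bsub>V\<^esub> (y \<oplus>\<^bsub>V\<^esub> z)"
    "\<And>x y. x \<in> carrier V \<Longrightarrow> y \<in> carrier V \<Longrightarrow> x \<oplus>\<^bsub>V\<^esub> y = y \<oplus>\<^bsub>V\<^esub> x"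
    "\<And>x. x \<in> carrier V \<Longrightarrow> \<zero>\<^bsub>V\<^esub> \<oplus>\<^bsub>V\<^esub> x = x"
    "\<And>c x. c \<in> carrier K \<Longrightarrow> x \<in> carrier V \<Longrightarrow> c \<odot>\<^bsub>V\<^esub> x \<in> carrier V"
    "\<And>a b x. a \<in> carrier K \<Longrightarrow> b \<in> carrier K \<Longrightarrow> x \<in> carrier V \<Longrightarrow>
      (a \<oplus>\<^bsub>K\<^esub> b) \<odot>\<^bsub>V\<^esub> x = a \<odot>\<^bsub>V\<^esub> x \<oplus>\<^bsub>V\<^esub> b \<odot>\<^bsub>V\<^esub> x"
    "\<And>a x y. a \<in> carrier K \<Longrightarrow> x \<in> carrier V \<Longrightarrow> y \<in> carrier V \<Longrightarrow>
      a \<odot>\<^bsub>V\<^esub> (x \<oplus>\<^bsub>V\<^esub> y) = a \<odot>\<^bsub>V\<^esub> x \<oplus>\<^bsub>V\<^esub> a \<odot>\<^bsub>V\<^esub> y"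
    "\<And>a b x. a \<in> carrier K \<Longrightarrow> b \<in> carrier K \<Longrightarrow> x \<in> carrier V \<Longrightarrow>
      (a \<otimes>\<^bsub>K\<^esub> b) \<odot>\<^bsub>V\<^esub> x = a \<odot>\<^bsub>V\<^esub> (b \<odot>\<^bsub>V\<^esub> x)"
    "\<And>x. x \<in> carrier V \<Longrightarrow> \<one>\<^bsub>K\<^esub> \<odot>\<^bsub>V\<^esub> x = x"
    "\<And>x. x \<in> carrier V \<Longrightarrow> \<zero>\<^bsub>K\<^esub> \<odot>\<^bsub>V\<^esub> x = \<zero>\<^bsub>V\<^esub>"
  shows "module K V"
proof -
  interpret K: cring K by fact
  have inv: "\<exists>y \<in> carrier V. y \<oplus>\<^bsub>V\<^esub> x = \<zero>\<^bsub>V\<^esub>" if x: "x \<in> carrier V" for x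
  proof (rule bexI)
    have "(\<ominus>\<^bsub>K\<^esub> \<one>\<^bsub>K\<^esub>) \<odot>\<^bsub>V\<^esub> x \<oplus>\<^bsub>V\<^esub> \<one>\<^bsub>K\<^esub> \<odot>\<^bsub>V\<^esub> x = \<zero>\<^bsub>V\<^esub>"
      using x by (simp add: assms(8)[symmetric] K.l_neg assms(12))
    then show "(\<ominus>\<^bsub>K\<^esub> \<one>\<^bsub>K\<^esub>) \<odot>\<^bsub>V\<^esub> x \<oplus>\<^bsub>V\<^esub> x = \<zero>\<^bsub>V\<^esub>" using x assms(11) by simp
  qed (use x assms(7) in simp)
  show ?thesis
    by (rule moduleI, fact, rule abelian_groupI) (use assms inv in auto)
qed

text \<open>Spaces are most easily built on products or function spaces; an injective coding then
  moves them into the universe.\<close>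

definition transport_module :: "('a \<Rightarrow> 'b) \<Rightarrow> ('k, 'a) module \<Rightarrow> ('k, 'b) module" where
  "transport_module \<iota> V = (let \<pi> = inv_into (carrier V) \<iota> in
     \<lparr>carrier = \<iota> ` carrier V, mult = (\<lambda>x y. \<iota> (\<pi> x \<otimes>\<^bsub>V\<^esub> \<pi> y)), one = \<iota> \<one>\<^bsub>V\<^esub>,
      zero = \<iota> \<zero>\<^bsub>V\<^esub>, add = (\<lambda>x y. \<iota> (\<pi> x \<oplus>\<^bsub>V\<^esub> \<pi> y)), smult = (\<lambda>c x. \<iota> (c \<odot>\<^bsub>V\<^esub> \<pi> x))\<rparr>)"

lemma transport_module_sel:
  assumes "inj_on \<iota> (carrier V)"
  shows "carrier (transport_module \<iota> V) = \<iota> ` carrier V"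
    and "\<zero>\<^bsub>transport_module \<iota> V\<^esub> = \<iota> \<zero>\<^bsub>V\<^esub>"
    and "x \<in> carrier V \<Longrightarrow> y \<in> carrier V \<Longrightarrow> \<iota> x \<oplus>\<^bsub>transport_module \<iota> V\<^esub> \<iota> y = \<iota> (x \<oplus>\<^bsub>V\<^esub> y)"
    and "x \<in> carrier V \<Longrightarrow> c \<odot>\<^bsub>transport_module \<iota> V\<^esub> \<iota> x = \<iota> (c \<odot>\<^bsub>V\<^esub> x)"
  using assms by (simp_all add: transport_module_def Let_def)

lemma module_transport_module:
  assumes "module K V" "inj_on \<iota> (carrier V)"
  shows "module K (transport_module \<iota> V)"
proof -
  interpret module K V by fact
  show ?thesis
    by (rule moduleI')
      (auto simp: transport_module_sel[OF assms(2)] R.is_cring M.add.m_ac smult_l_distr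
        smult_r_distr smult_assoc1)
qed

definition prod_module :: "('k, 'a) module \<Rightarrow> ('k, 'b) module \<Rightarrow> ('k, 'a \<times> 'b) module" where
  "prod_module V W = \<lparr>carrier = carrier V \<times> carrier W, mult = undefined, one = undefined,
     zero = (\<zero>\<^bsub>V\<^esub>, \<zero>\<^bsub>W\<^esub>), add = (\<lambda>p q. (fst p \<oplus>\<^bsub>V\<^esub> fst q, snd p \<oplus>\<^bsub>W\<^esub> snd q)),
     smult = (\<lambda>c p. (c \<odot>\<^bsub>V\<^esub> fst p, c \<odot>\<^bsub>W\<^esub> snd p))\<rparr>"

lemma module_prod_module:
  assumes "module K V" "module K W"
  shows "module K (prod_module V W)"
proof -
  interpret V: module K V by fact
  interpret W: module K W by fact
  show ?thesis
    by (rule moduleI')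
      (auto simp: prod_module_def V.R.is_cring V.M.add.m_ac V.smult_l_distr
        V.smult_r_distr V.smult_assoc1 W.M.add.m_ac W.smult_l_distr
        W.smult_r_distr W.smult_assoc1)
qed

locale vspace = module R M for R :: "('k, 'm) ring_scheme" (structure) and M :: "('k, 'a) module" (structure)
begin

text \<open>Negation is scaling by minus one, so closure under it follows from closure under
  scaling.\<close>

lemma submodule_iff:
  "submodule H R M \<longleftrightarrow> H \<subseteq> carrier M \<and> \<zero>\<^bsub>M\<^esub> \<in> H \<and>
     (\<forall>x \<in> H. \<forall>y \<in> H. x \<oplus>\<^bsub>M\<^esub> y \<in> H) \<and> (\<forall>c \<in> carrier R. \<forall>x \<in> H. c \<odot>\<^bsub>M\<^esub> x \<in> H)"
proof
  assume H: "submodule H R M"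
  have "\<zero>\<^bsub>M\<^esub> \<in> H"
  proof -
    obtain x where "x \<in> H" using submoduleE(2)[OF H] by auto
    then show ?thesis using submoduleE(1,4)[OF H] smult_l_null by (metis R.zero_closed subsetD)
  qed
  then show "H \<subseteq> carrier M \<and> \<zero>\<^bsub>M\<^esub> \<in> H \<and>
     (\<forall>x \<in> H. \<forall>y \<in> H. x \<oplus>\<^bsub>M\<^esub> y \<in> H) \<and> (\<forall>c \<in> carrier R. \<forall>x \<in> H. c \<odot>\<^bsub>M\<^esub> x \<in> H)"
    using submoduleE[OF H] by blast
next
  assume H: "H \<subseteq> carrier M \<and> \<zero>\<^bsub>M\<^esub> \<in> H \<and>
     (\<forall>x \<in> H. \<forall>y \<in> H. x \<oplus>\<^bsub>M\<^esub> y \<in> H) \<and> (\<forall>c \<in> carrier R. \<forall>x \<in> H. c \<odot>\<^bsub>M\<^esub> x \<in> H)"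
  have "\<ominus>\<^bsub>M\<^esub> x = (\<ominus> \<one>) \<odot>\<^bsub>M\<^esub> x" if "x \<in> H" for x
    using that H smult_l_minus[of \<one> x] by auto
  then show "submodule H R M" using H by (intro submoduleI) auto
qed

lemma submodule_zero: "submodule {\<zero>\<^bsub>M\<^esub>} R M"
  by (auto simp: submodule_iff)

lemma linear_map_zero:
  assumes "module R N" "f \<in> linear_maps R M N"
  shows "f \<zero>\<^bsub>M\<^esub> = \<zero>\<^bsub>N\<^esub>"
proof -
  interpret N: vspace R N by (rule vspace.intro) fact
  have "f (\<zero> \<odot>\<^bsub>M\<^esub> \<zero>\<^bsub>M\<^esub>) = \<zero> \<odot>\<^bsub>N\<^esub> f \<zero>\<^bsub>M\<^esub>" using assms(2) by (intro linear_smult) auto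
  then show ?thesis using linear_closed[OF assms(2)] by simp
qed

lemma linear_map_finsum:
  assumes "module R N" "f \<in> linear_maps R M N" "finite A" "g \<in> A \<rightarrow> carrier M"
  shows "f (\<Oplus>\<^bsub>M\<^esub> i \<in> A. g i) = (\<Oplus>\<^bsub>N\<^esub> i \<in> A. f (g i))"
proof -
  interpret N: vspace R N by (rule vspace.intro) fact
  show ?thesis
    using assms(3,4)
  proof (induction A)
    case (insert a A)
    then have "g \<in> A \<rightarrow> carrier M" "g a \<in> carrier M" by auto
    with insert show ?case
      using linear_closed[OF assms(2)] linear_add[OF assms(2), of "g a" "finsum M g A"]
      by (simp add: Pi_iff)
  qed (simp add: linear_map_zero[OF assms(1,2)])
qed

lemma linear_map_injI:
  assumes N: "module R N" and f: "f \<in> linear_maps R M N"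
    and ker: "\<And>x. x \<in> carrier M \<Longrightarrow> f x = \<zero>\<^bsub>N\<^esub> \<Longrightarrow> x = \<zero>\<^bsub>M\<^esub>"
  shows "inj_on f (carrier M)"
proof (rule inj_onI)
  fix x y assume xy: "x \<in> carrier M" "y \<in> carrier M" "f x = f y"
  let ?z = "(\<ominus> \<one>) \<odot>\<^bsub>M\<^esub> y"
  have z: "?z \<in> carrier M" "y \<oplus>\<^bsub>M\<^esub> ?z = \<zero>\<^bsub>M\<^esub>"
    using xy smult_l_distr[of "\<one>" "\<ominus> \<one>" y] by (simp_all add: R.r_neg)
  have "f (x \<oplus>\<^bsub>M\<^esub> ?z) = f (y \<oplus>\<^bsub>M\<^esub> ?z)"
    using xy z(1) by (simp add: linear_add[OF f])
  then have "x \<oplus>\<^bsub>M\<^esub> ?z = y \<oplus>\<^bsub>M\<^esub> ?z"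
    using ker[of "x \<oplus>\<^bsub>M\<^esub> ?z"] linear_map_zero[OF N f] xy z by simp
  then show "x = y" using xy z(1) M.add.right_cancel by blast
qed

lemma linear_map_id: "(\<lambda>x \<in> carrier M. x) \<in> linear_maps R M M"
  by (rule linear_mapsI) auto

lemma linear_map_comp:
  assumes "f \<in> linear_maps R M N" "g \<in> linear_maps R N P"
  shows "(\<lambda>x \<in> carrier M. g (f x)) \<in> linear_maps R M P"
  by (rule linear_mapsI)
    (auto simp: linear_closed[OF assms(1)] linear_closed[OF assms(2)] linear_add[OF assms(1)]
      linear_add[OF assms(2)] linear_smult[OF assms(1)] linear_smult[OF assms(2)])

lemma linear_map_add:
  assumes "module R N" "f \<in> linear_maps R M N" "g \<in> linear_maps R M N"
  shows "(\<lambda>x \<in> carrier M. f x \<oplus>\<^bsub>N\<^esub> g x) \<in> linear_maps R M N"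
proof -
  interpret N: vspace R N by (rule vspace.intro) fact
  note [simp] = linear_closed[OF assms(2)] linear_closed[OF assms(3)]
  show ?thesis
    by (rule linear_mapsI)
      (auto simp: linear_add[OF assms(2)] linear_add[OF assms(3)] linear_smult[OF assms(2)]
        linear_smult[OF assms(3)] N.M.add.m_ac N.smult_r_distr)
qed

lemma linear_map_scale:
  assumes "module R N" "f \<in> linear_maps R M N" "c \<in> carrier R"
  shows "(\<lambda>x \<in> carrier M. c \<odot>\<^bsub>N\<^esub> f x) \<in> linear_maps R M N"
proof -
  interpret N: vspace R N by (rule vspace.intro) fact
  note [simp] = linear_closed[OF assms(2)]
  show ?thesis
    by (rule linear_mapsI)
      (auto simp: linear_add[OF assms(2)] linear_smult[OF assms(2)] assms(3) N.smult_r_distr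
        N.smult_assoc1[symmetric] R.m_comm)
qed

lemma linear_map_zero_map:
  assumes "module R N"
  shows "(\<lambda>x \<in> carrier M. \<zero>\<^bsub>N\<^esub>) \<in> linear_maps R M N"
proof -
  interpret N: vspace R N by (rule vspace.intro) fact
  show ?thesis by (rule linear_mapsI) auto
qed

lemma linear_map_inverse:
  assumes f: "f \<in> linear_maps R M N" and bij: "bij_betw f (carrier M) (carrier N)"
  shows "(\<lambda>y \<in> carrier N. inv_into (carrier M) f y) \<in> linear_maps R N M"
proof -
  have N: "carrier N = f ` carrier M" and inj: "inj_on f (carrier M)"
    using bij by (auto simp: bij_betw_def)
  have c: "c \<odot>\<^bsub>N\<^esub> f x = f (c \<odot>\<^bsub>M\<^esub> x)" if "x \<in> carrier M" "c \<in> carrier R" for x c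
    using that linear_smult[OF f] by auto
  have a: "f x \<oplus>\<^bsub>N\<^esub> f y = f (x \<oplus>\<^bsub>M\<^esub> y)" if "x \<in> carrier M" "y \<in> carrier M" for x y
    using that linear_add[OF f] by auto
  show ?thesis
    by (rule linear_mapsI) (auto simp: N inj a c inj_on_eq_iff[OF inj])
qed

lemma linear_map_image_submodule:
  assumes "module R N" "f \<in> linear_maps R M N" "submodule H R M"
  shows "submodule (f ` H) R N"
proof -
  interpret N: vspace R N by (rule vspace.intro) fact
  have H: "H \<subseteq> carrier M" "\<zero>\<^bsub>M\<^esub> \<in> H" "\<And>x y. x \<in> H \<Longrightarrow> y \<in> H \<Longrightarrow> x \<oplus>\<^bsub>M\<^esub> y \<in> H"
    "\<And>c x. c \<in> carrier R \<Longrightarrow> x \<in> H \<Longrightarrow> c \<odot>\<^bsub>M\<^esub> x \<in> H" using assms(3) submodule_iff by auto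
  then have "\<zero>\<^bsub>N\<^esub> \<in> f ` H" using linear_map_zero[OF assms(1,2)] by force
  moreover have "f x \<oplus>\<^bsub>N\<^esub> f y \<in> f ` H" if "x \<in> H" "y \<in> H" for x y
    using H that linear_add[OF assms(2), of x y] by (metis imageI subsetD)
  moreover have "c \<odot>\<^bsub>N\<^esub> f x \<in> f ` H" if "x \<in> H" "c \<in> carrier R" for x c
    using H that linear_smult[OF assms(2), of c x] by (metis imageI subsetD)
  ultimately show ?thesis
    using H(1) linear_closed[OF assms(2)] by (auto simp: N.submodule_iff)
qed

lemma linear_map_vimage_submodule:
  assumes "module R N" "f \<in> linear_maps R M N" "submodule H R N"
  shows "submodule {x \<in> carrier M. f x \<in> H} R M"
proof -
  interpret N: vspace R N by (rule vspace.intro) fact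
  show ?thesis
    using assms(3) linear_map_zero[OF assms(1,2)]
    by (auto simp: submodule_iff N.submodule_iff linear_add[OF assms(2)] linear_smult[OF assms(2)])
qed

lemma linear_map_incl:
  assumes "submodule H R M"
  shows "(\<lambda>x \<in> H. x) \<in> linear_maps R (M\<lparr>carrier := H\<rparr>) M"
  using assms by (intro linear_mapsI) (auto simp: submodule_iff)

definition span :: "'a set \<Rightarrow> 'a set" where
  "span S = \<Inter>{H. submodule H R M \<and> S \<subseteq> H}"

lemma submodule_span: "S \<subseteq> carrier M \<Longrightarrow> submodule (span S) R M"
  using carrier_is_submodule by (auto simp: span_def submodule_iff)

lemma span_superset: "S \<subseteq> span S"
  and span_least: "submodule H R M \<Longrightarrow> S \<subseteq> H \<Longrightarrow> span S \<subseteq> H"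
  by (auto simp: span_def)

lemma span_mono: "S \<subseteq> T \<Longrightarrow> span S \<subseteq> span T"
  by (auto simp: span_def)

lemma span_insert:
  assumes S: "S \<subseteq> carrier M" and v: "v \<in> carrier M"
  shows "span (insert v S) = {s \<oplus>\<^bsub>M\<^esub> c \<odot>\<^bsub>M\<^esub> v | s c. s \<in> span S \<and> c \<in> carrier R}" (is "_ = ?H")
proof
  have sub: "submodule (span S) R M" "submodule (span (insert v S)) R M"
    using S v by (auto intro!: submodule_span)
  then have sS: "span S \<subseteq> carrier M" by (simp add: submodule_iff)
  have "submodule ?H R M"
    unfolding submodule_iff
  proof (intro conjI ballI)
    show "?H \<subseteq> carrier M" using sS v by auto
    show "\<zero>\<^bsub>M\<^esub> \<in> ?H"
      using sub(1) v by (auto simp: submodule_iff intro!: exI[of _ "\<zero>\<^bsub>M\<^esub>"] exI[of _ "\<zero>"])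
    show "x \<oplus>\<^bsub>M\<^esub> y \<in> ?H" if xy: "x \<in> ?H" "y \<in> ?H" for x y
    proof -
      obtain s c t d where "x = s \<oplus>\<^bsub>M\<^esub> c \<odot>\<^bsub>M\<^esub> v" "y = t \<oplus>\<^bsub>M\<^esub> d \<odot>\<^bsub>M\<^esub> v" "s \<in> span S" "t \<in> span S"
        "c \<in> carrier R" "d \<in> carrier R" using xy by auto
      moreover from this have "x \<oplus>\<^bsub>M\<^esub> y = (s \<oplus>\<^bsub>M\<^esub> t) \<oplus>\<^bsub>M\<^esub> (c \<oplus> d) \<odot>\<^bsub>M\<^esub> v"
        using sS v by (simp add: subset_iff smult_l_distr M.add.m_ac)
      moreover have "s \<oplus>\<^bsub>M\<^esub> t \<in> span S" using calculation sub(1) by (simp add: submodule_iff)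
      ultimately show ?thesis by blast
    qed
    show "a \<odot>\<^bsub>M\<^esub> x \<in> ?H" if ax: "a \<in> carrier R" "x \<in> ?H" for a x
    proof -
      obtain s c where "x = s \<oplus>\<^bsub>M\<^esub> c \<odot>\<^bsub>M\<^esub> v" "s \<in> span S" "c \<in> carrier R" using ax by auto
      moreover from this have "a \<odot>\<^bsub>M\<^esub> x = (a \<odot>\<^bsub>M\<^esub> s) \<oplus>\<^bsub>M\<^esub> (a \<otimes> c) \<odot>\<^bsub>M\<^esub> v"
        using sS v ax by (simp add: subset_iff smult_r_distr smult_assoc1)
      moreover have "a \<odot>\<^bsub>M\<^esub> s \<in> span S" using calculation sub(1) ax by (simp add: submodule_iff)
      ultimately show ?thesis using ax by blast
    qed
  qed
  moreover have "insert v S \<subseteq> ?H"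
  proof -
    have "v = \<zero>\<^bsub>M\<^esub> \<oplus>\<^bsub>M\<^esub> \<one> \<odot>\<^bsub>M\<^esub> v" using v by simp
    moreover have "\<zero>\<^bsub>M\<^esub> \<in> span S" using sub(1) by (simp add: submodule_iff)
    ultimately have "v \<in> ?H" by blast
    moreover have "s \<in> ?H" if "s \<in> S" for s
    proof -
      have "s = s \<oplus>\<^bsub>M\<^esub> \<zero> \<odot>\<^bsub>M\<^esub> v" using S that v by (simp add: subset_iff)
      moreover have "s \<in> span S" using that span_superset by blast
      ultimately show ?thesis by blast
    qed
    ultimately show ?thesis by blast
  qed
  ultimately show "span (insert v S) \<subseteq> ?H" by (rule span_least)
  have "v \<in> span (insert v S)" "span S \<subseteq> span (insert v S)"
    using span_superset[of "insert v S"] span_mono[of S "insert v S"] by auto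
  then show "?H \<subseteq> span (insert v S)" using sub(2) by (auto simp: submodule_iff)
qed

end

definition finitely_generated :: "('k, 'm) ring_scheme \<Rightarrow> ('k, 'u) module \<Rightarrow> bool" where
  "finitely_generated K V \<longleftrightarrow> (\<exists>S. finite S \<and> S \<subseteq> carrier V \<and> vspace.span K V S = carrier V)"

definition noetherian_space :: "('k, 'm) ring_scheme \<Rightarrow> ('k, 'u) module \<Rightarrow> bool" where
  "noetherian_space K V \<longleftrightarrow> (\<forall>A :: nat \<Rightarrow> 'u set.
     (\<forall>n. submodule (A n) K V) \<and> (\<forall>n. A n \<subseteq> A (Suc n)) \<longrightarrow> (\<exists>n. \<forall>i \<ge> n. A i \<subseteq> A n))"

text \<open>Otherwise one could forever adjoin a vector outside the span of the finitely many chosen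
  so far, and the spans would form a strictly ascending chain.\<close>

lemma noetherian_imp_finitely_generated:
  assumes "module K V" "noetherian_space K V"
  shows "finitely_generated K V"
proof (rule ccontr)
  interpret vspace K V by (rule vspace.intro) fact
  assume neg: "\<not> finitely_generated K V"
  have ex: "\<exists>x. x \<in> carrier V \<and> x \<notin> span S" if "finite S" "S \<subseteq> carrier V" for S
  proof -
    have "span S \<noteq> carrier V" using neg that unfolding finitely_generated_def by blast
    then show ?thesis using span_least[OF carrier_is_submodule that(2)] by blast
  qed
  define P where "P S = (SOME x. x \<in> carrier V \<and> x \<notin> span S)" for S
  have P: "P S \<in> carrier V" "P S \<notin> span S" if "finite S" "S \<subseteq> carrier V" for S
    using someI_ex[OF ex[OF that]] by (auto simp: P_def)
  define S where "S n = ((\<lambda>T. insert (P T) T) ^^ n) {}" for n :: nat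
  have Suc: "S (Suc n) = insert (P (S n)) (S n)" for n by (simp add: S_def)
  have "finite (S n) \<and> S n \<subseteq> carrier V" for n
    by (induction n) (simp add: S_def, simp add: Suc P)
  then have S: "finite (S n)" "S n \<subseteq> carrier V" for n by auto
  have "submodule (span (S n)) K V" for n by (rule submodule_span[OF S(2)])
  moreover have "span (S n) \<subseteq> span (S (Suc n))" for n by (rule span_mono) (auto simp: Suc)
  ultimately obtain n where "\<forall>i \<ge> n. span (S i) \<subseteq> span (S n)"
    using assms(2) unfolding noetherian_space_def by (elim allE[where x = "\<lambda>n. span (S n)"]) blast
  then have "P (S n) \<in> span (S n)"
    using span_superset[of "S (Suc n)"] Suc[of n] by (auto dest!: spec[where x = "Suc n"])
  then show False using P[OF S] by blast
qed

text \<open>Induction on a generating set. When a generator is adjoined, either the chain stays in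
  the old span, or one of its vectors involves the new generator and can be used to eliminate
  it.\<close>

lemma finitely_generated_imp_noetherian:
  assumes "field K" "module K V" "finitely_generated K V"
  shows "noetherian_space K V"
proof -
  interpret field K by fact
  interpret V: vspace K V by (rule vspace.intro) fact
  have *: "\<exists>n. \<forall>i \<ge> n. A i \<subseteq> A n"
    if "finite S" "S \<subseteq> carrier V" "\<forall>n. submodule (A n) K V" "\<forall>n. A n \<subseteq> A (Suc n)"
      "\<forall>n. A n \<subseteq> V.span S" for S and A :: "nat \<Rightarrow> _ set"
    using that
  proof (induction S arbitrary: A)
    case empty
    have "V.span {} \<subseteq> {\<zero>\<^bsub>V\<^esub>}" by (rule V.span_least[OF V.submodule_zero]) simp
    then have "A i \<subseteq> {\<zero>\<^bsub>V\<^esub>}" for i using empty by blast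
    moreover have "\<zero>\<^bsub>V\<^esub> \<in> A i" for i using empty by (simp add: V.submodule_iff)
    ultimately show ?case by (metis subset_singleton_iff empty_iff subsetI)
  next
    case (insert v S)
    have S: "S \<subseteq> carrier V" and v: "v \<in> carrier V" using insert by auto
    have mono: "A i \<subseteq> A j" if "i \<le> j" for i j using that insert.prems(3) by (metis lift_Suc_mono_le)
    note sub = V.submodule_span[OF S]
    have sS: "V.span S \<subseteq> carrier V" using sub by (simp add: V.submodule_iff)
    show ?case
    proof (cases "\<forall>n. A n \<subseteq> V.span S")
      case True
      then show ?thesis using insert.IH[OF S insert.prems(2,3)] by blast
    next
      case False
      \<comment> \<open>The pivot: \<open>a\<close> has a nonzero coefficient at \<open>v\<close>
        and belongs to all members of the chain from \<open>m\<close> on. Modulo \<open>a\<close>,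
        those members are governed by their intersections with the smaller span.\<close>
      then obtain m a where a: "a \<in> A m" "a \<notin> V.span S" by blast
      have "a \<in> V.span (insert v S)" using a insert.prems by blast
      then obtain s c where sc: "a = s \<oplus>\<^bsub>V\<^esub> c \<odot>\<^bsub>V\<^esub> v" "s \<in> V.span S" "c \<in> carrier K"
        by (auto simp: V.span_insert[OF S v])
      have c0: "c \<noteq> \<zero>\<^bsub>K\<^esub>" using a sc v sS by (auto simp: subset_iff)
      have "\<forall>n. submodule (A n \<inter> V.span S) K V" using insert.prems sub by (auto simp: V.submodule_iff)
      with insert.IH[OF S this] insert.prems(3) obtain n where
        n: "\<forall>i \<ge> n. A i \<inter> V.span S \<subseteq> A n \<inter> V.span S" by blast
      have "A i \<subseteq> A (max m n)" if i: "i \<ge> max m n" for i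
      proof
        fix x assume x: "x \<in> A i"
        then have "x \<in> V.span (insert v S)" using insert.prems by blast
        then obtain t d where td: "x = t \<oplus>\<^bsub>V\<^esub> d \<odot>\<^bsub>V\<^esub> v" "t \<in> V.span S" "d \<in> carrier K"
          by (auto simp: V.span_insert[OF S v])
        define e where "e = d \<otimes>\<^bsub>K\<^esub> inv\<^bsub>K\<^esub> c"
        have ic: "inv\<^bsub>K\<^esub> c \<in> carrier K" "c \<otimes>\<^bsub>K\<^esub> inv\<^bsub>K\<^esub> c = \<one>\<^bsub>K\<^esub>"
          using sc c0 by (auto simp: field_Units)
        have e: "e \<in> carrier K" "e \<otimes>\<^bsub>K\<^esub> c = d"
          using ic sc td by (auto simp: e_def m_assoc m_comm[of "inv\<^bsub>K\<^esub> c" c])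
        \<comment> \<open>Subtracting a multiple of the pivot from \<open>x\<close> cancels the
          component along \<open>v\<close>, so \<open>y\<close> lies both in \<open>A i\<close> and
          in the smaller span.\<close>
        define y where "y = t \<oplus>\<^bsub>V\<^esub> (\<ominus>\<^bsub>K\<^esub> e) \<odot>\<^bsub>V\<^esub> s"
        have st: "s \<in> carrier V" "t \<in> carrier V" using sS sc td by auto
        have "e \<odot>\<^bsub>V\<^esub> a = e \<odot>\<^bsub>V\<^esub> s \<oplus>\<^bsub>V\<^esub> d \<odot>\<^bsub>V\<^esub> v"
          using sc e st v by (simp add: V.smult_r_distr flip: V.smult_assoc1)
        moreover have "(\<ominus>\<^bsub>K\<^esub> e) \<odot>\<^bsub>V\<^esub> s \<oplus>\<^bsub>V\<^esub> e \<odot>\<^bsub>V\<^esub> s = \<zero>\<^bsub>V\<^esub>"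
          using e st by (simp add: l_neg flip: V.smult_l_distr)
        ultimately have xy: "x = y \<oplus>\<^bsub>V\<^esub> e \<odot>\<^bsub>V\<^esub> a"
          unfolding y_def td(1) using st e v td by (simp add: V.M.a_assoc flip: V.M.a_assoc[of _ _ "d \<odot>\<^bsub>V\<^esub> v"])
        have ai: "a \<in> A i" "a \<in> A (max m n)" using a mono[of m i] mono[of m "max m n"] i by auto
        have aV: "a \<in> carrier V" using sc st v by simp
        have "y = x \<oplus>\<^bsub>V\<^esub> (\<ominus>\<^bsub>K\<^esub> e) \<odot>\<^bsub>V\<^esub> a"
        proof -
          have "e \<odot>\<^bsub>V\<^esub> a \<oplus>\<^bsub>V\<^esub> (\<ominus>\<^bsub>K\<^esub> e) \<odot>\<^bsub>V\<^esub> a = \<zero>\<^bsub>V\<^esub>"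
            using e aV by (simp add: r_neg flip: V.smult_l_distr)
          moreover have "y \<in> carrier V" using st e by (simp add: y_def)
          ultimately show ?thesis unfolding xy using e aV by (simp add: V.M.a_assoc)
        qed
        then have "y \<in> A i" using x ai(1) e insert.prems(2) by (simp add: V.submodule_iff)
        moreover have "y \<in> V.span S" using sub sc td e by (simp add: y_def V.submodule_iff)
        ultimately have "y \<in> A n" using n i by auto
        then have "y \<in> A (max m n)" using mono[of n "max m n"] by auto
        then show "x \<in> A (max m n)" using ai(2) e insert.prems(2) by (simp add: xy V.submodule_iff)
      qed
      then show ?thesis by blast
    qed
  qed
  obtain S where S: "finite S" "S \<subseteq> carrier V" "V.span S = carrier V"
    using assms(3) by (auto simp: finitely_generated_def)
  have "\<exists>n. \<forall>i \<ge> n. A i \<subseteq> A n" if "\<forall>n. submodule (A n) K V" "\<forall>n. A n \<subseteq> A (Suc n)"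
    for A :: "nat \<Rightarrow> _ set"
    by (rule *[OF S(1,2) that]) (use that S(3) in \<open>auto simp: V.submodule_iff\<close>)
  then show ?thesis unfolding noetherian_space_def by blast
qed

text \<open>The retraction is the projection along a maximal subspace that meets the image trivially.\<close>

lemma linear_retraction:
  assumes "field K" "module K V" "module K W" and f: "f \<in> linear_maps K V W"
    and inj: "inj_on f (carrier V)"
  shows "\<exists>r \<in> linear_maps K W V. \<forall>x \<in> carrier V. r (f x) = x"
proof -
  interpret field K by fact
  interpret V: vspace K V by (rule vspace.intro) fact
  interpret W: vspace K W by (rule vspace.intro) fact
  let ?I = "f ` carrier V"
  have I: "submodule ?I K W"
    using V.linear_map_image_submodule[OF assms(3) f V.carrier_is_submodule] .
  define \<A> where "\<A> = {C. submodule C K W \<and> C \<inter> ?I = {\<zero>\<^bsub>W\<^esub>}}"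
  have "\<exists>M \<in> \<A>. \<forall>X \<in> \<A>. M \<subseteq> X \<longrightarrow> X = M"
  proof (rule subset_Zorn_nonempty)
    have "{\<zero>\<^bsub>W\<^esub>} \<in> \<A>" using I W.submodule_zero by (auto simp: \<A>_def W.submodule_iff)
    then show "\<A> \<noteq> {}" by blast
    fix \<C> assume "\<C> \<noteq> {}" "subset.chain \<A> \<C>"
    then have c: "\<C> \<noteq> {}" "\<C> \<subseteq> \<A>" "\<And>X Y. X \<in> \<C> \<Longrightarrow> Y \<in> \<C> \<Longrightarrow> X \<subseteq> Y \<or> Y \<subseteq> X"
      by (auto simp: subset.chain_def)
    have sub: "submodule X K W" "X \<inter> ?I = {\<zero>\<^bsub>W\<^esub>}" if "X \<in> \<C>" for X using c that by (auto simp: \<A>_def)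
    have "submodule (\<Union>\<C>) K W" unfolding W.submodule_iff
    proof (intro conjI ballI)
      show "\<zero>\<^bsub>W\<^esub> \<in> \<Union>\<C>" using c(1) sub by (auto simp: W.submodule_iff)
      show "x \<oplus>\<^bsub>W\<^esub> y \<in> \<Union>\<C>" if xy: "x \<in> \<Union>\<C>" "y \<in> \<Union>\<C>" for x y
      proof -
        obtain X Y where XY: "X \<in> \<C>" "x \<in> X" "Y \<in> \<C>" "y \<in> Y" using xy by auto
        then obtain Z where "Z \<in> \<C>" "x \<in> Z" "y \<in> Z" using c(3)[of X Y] by blast
        then show ?thesis using sub(1)[of Z] by (auto simp: W.submodule_iff)
      qed
      show "\<Union>\<C> \<subseteq> carrier W" using sub(1) unfolding W.submodule_iff by blast
      show "c \<odot>\<^bsub>W\<^esub> x \<in> \<Union>\<C>" if "c \<in> carrier K" "x \<in> \<Union>\<C>" for c x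
        using sub(1) that unfolding W.submodule_iff by blast
    qed
    moreover have "\<Union>\<C> \<inter> ?I = {\<zero>\<^bsub>W\<^esub>}" using sub(2) c(1) by blast
    ultimately show "\<Union>\<C> \<in> \<A>" by (simp add: \<A>_def)
  qed
  then obtain C where C: "submodule C K W" "C \<inter> ?I = {\<zero>\<^bsub>W\<^esub>}"
    and max: "\<And>X. submodule X K W \<Longrightarrow> X \<inter> ?I = {\<zero>\<^bsub>W\<^esub>} \<Longrightarrow> C \<subseteq> X \<Longrightarrow> X = C"
    by (auto simp: \<A>_def)
  have CW: "C \<subseteq> carrier W" using C by (simp add: W.submodule_iff)
  have spanC: "W.span C = C" using W.span_least[OF C(1)] W.span_superset[of C] by blast
  have decomp: "\<exists>v \<in> carrier V. \<exists>c \<in> C. w = f v \<oplus>\<^bsub>W\<^esub> c" if w: "w \<in> carrier W" for w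
  proof (rule ccontr)
    assume neg: "\<not> ?thesis"
    have "w \<notin> C"
    proof
      assume "w \<in> C"
      moreover have "w = f \<zero>\<^bsub>V\<^esub> \<oplus>\<^bsub>W\<^esub> w" using V.linear_map_zero[OF assms(3) f] w by simp
      ultimately show False using neg V.M.zero_closed by metis
    qed
    let ?D = "W.span (insert w C)"
    have D: "?D = {s \<oplus>\<^bsub>W\<^esub> c \<odot>\<^bsub>W\<^esub> w | s c. s \<in> C \<and> c \<in> carrier K}"
      using W.span_insert[OF CW w] spanC by simp
    have "?D \<inter> ?I \<subseteq> {\<zero>\<^bsub>W\<^esub>}"
    proof
      fix x assume "x \<in> ?D \<inter> ?I"
      then obtain s c v where x: "x = s \<oplus>\<^bsub>W\<^esub> c \<odot>\<^bsub>W\<^esub> w" "s \<in> C" "c \<in> carrier K" "v \<in> carrier V" "x = f v"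
        by (auto simp: D)
      have sW: "s \<in> carrier W" using x CW by auto
      \<comment> \<open>Otherwise the equation could be solved for \<open>w\<close>, exhibiting it
        as a sum of a vector of the image and one of \<open>C\<close>.\<close>
      have "c = \<zero>\<^bsub>K\<^esub>"
      proof (rule ccontr)
        assume "c \<noteq> \<zero>\<^bsub>K\<^esub>"
        then have ic: "inv\<^bsub>K\<^esub> c \<in> carrier K" "inv\<^bsub>K\<^esub> c \<otimes>\<^bsub>K\<^esub> c = \<one>\<^bsub>K\<^esub>"
          using x by (auto simp: field_Units)
        let ?s = "(\<ominus>\<^bsub>K\<^esub> \<one>\<^bsub>K\<^esub>) \<odot>\<^bsub>W\<^esub> s"
        have s: "?s \<in> C" "?s \<oplus>\<^bsub>W\<^esub> s = \<zero>\<^bsub>W\<^esub>" using C(1) x sW W.smult_l_distr[of "\<ominus>\<^bsub>K\<^esub> \<one>\<^bsub>K\<^esub>" "\<one>\<^bsub>K\<^esub>" s]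
          by (auto simp: W.submodule_iff l_neg)
        then have sC: "?s \<in> carrier W" using CW by auto
        have "w = inv\<^bsub>K\<^esub> c \<odot>\<^bsub>W\<^esub> (c \<odot>\<^bsub>W\<^esub> w)" using ic x(3) w by (simp flip: W.smult_assoc1)
        also have "c \<odot>\<^bsub>W\<^esub> w = ?s \<oplus>\<^bsub>W\<^esub> x"
          unfolding x(1) using s sC sW x(3) w by (simp flip: W.M.a_assoc)
        also have "inv\<^bsub>K\<^esub> c \<odot>\<^bsub>W\<^esub> (?s \<oplus>\<^bsub>W\<^esub> x) = inv\<^bsub>K\<^esub> c \<odot>\<^bsub>W\<^esub> (?s \<oplus>\<^bsub>W\<^esub> f v)" using x(5) by simp
        also have "\<dots> = f (inv\<^bsub>K\<^esub> c \<odot>\<^bsub>V\<^esub> v) \<oplus>\<^bsub>W\<^esub> inv\<^bsub>K\<^esub> c \<odot>\<^bsub>W\<^esub> ?s"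
          using ic x(4) sC linear_closed[OF f x(4)] linear_smult[OF f ic(1) x(4)]
          by (simp add: W.smult_r_distr W.M.a_comm)
        finally have "w = f (inv\<^bsub>K\<^esub> c \<odot>\<^bsub>V\<^esub> v) \<oplus>\<^bsub>W\<^esub> inv\<^bsub>K\<^esub> c \<odot>\<^bsub>W\<^esub> ?s" .
        moreover have "inv\<^bsub>K\<^esub> c \<odot>\<^bsub>W\<^esub> ?s \<in> C" using C(1) ic s by (simp add: W.submodule_iff)
        moreover have "inv\<^bsub>K\<^esub> c \<odot>\<^bsub>V\<^esub> v \<in> carrier V" using ic x(4) by simp
        ultimately show False using neg by blast
      qed
      then have "x \<in> C \<inter> ?I" using x sW w by auto
      then show "x \<in> {\<zero>\<^bsub>W\<^esub>}" using C by blast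
    qed
    moreover have subD: "submodule ?D K W" using CW w by (intro W.submodule_span) auto
    ultimately have "?D \<inter> ?I = {\<zero>\<^bsub>W\<^esub>}" using I by (auto simp: W.submodule_iff)
    then have "?D = C" using max[OF subD] W.span_superset[of "insert w C"] by blast
    then show False using \<open>w \<notin> C\<close> W.span_superset[of "insert w C"] by blast
  qed
  let ?C = "W\<lparr>carrier := C\<rparr>"
  let ?P = "prod_module V ?C"
  have mP: "module K ?P"
    by (rule module_prod_module[OF assms(2) submodule.submodule_is_module[OF C(1) assms(3)]])
  interpret P: vspace K ?P by (rule vspace.intro) (rule mP)
  \<comment> \<open>\<open>V\<close> times the complement maps isomorphically onto \<open>W\<close>.
    The retraction is the inverse of this map followed by the first projection.\<close>
  define g where "g = (\<lambda>p \<in> carrier ?P. f (fst p) \<oplus>\<^bsub>W\<^esub> snd p)"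
  have fW: "f v \<in> carrier W" if "v \<in> carrier V" for v using linear_closed[OF f that] .
  have cW: "c \<in> carrier W" if "c \<in> C" for c using CW that by blast
  have gl: "g \<in> linear_maps K ?P W"
  proof (rule linear_mapsI)
    show "g (p \<oplus>\<^bsub>?P\<^esub> q) = g p \<oplus>\<^bsub>W\<^esub> g q" if "p \<in> carrier ?P" "q \<in> carrier ?P" for p q
      using that P.M.a_closed[OF that] fW cW
      by (auto simp: g_def prod_module_def linear_add[OF f] W.M.add.m_ac)
    show "g (a \<odot>\<^bsub>?P\<^esub> p) = a \<odot>\<^bsub>W\<^esub> g p" if "a \<in> carrier K" "p \<in> carrier ?P" for a p
      using that P.smult_closed[OF that] fW cW
      by (auto simp: g_def prod_module_def linear_smult[OF f] W.smult_r_distr)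
  qed (auto simp: g_def prod_module_def fW cW)
  have "inj_on g (carrier ?P)"
  proof (rule P.linear_map_injI[OF assms(3) gl])
    fix p assume p: "p \<in> carrier ?P" "g p = \<zero>\<^bsub>W\<^esub>"
    obtain v c where vc: "p = (v, c)" "v \<in> carrier V" "c \<in> C" "f v \<oplus>\<^bsub>W\<^esub> c = \<zero>\<^bsub>W\<^esub>"
      using p by (auto simp: g_def prod_module_def)
    have "(\<ominus>\<^bsub>K\<^esub> \<one>\<^bsub>K\<^esub>) \<odot>\<^bsub>W\<^esub> c \<oplus>\<^bsub>W\<^esub> c = \<zero>\<^bsub>W\<^esub>"
      using cW[OF vc(3)] W.smult_l_distr[of "\<ominus>\<^bsub>K\<^esub> \<one>\<^bsub>K\<^esub>" "\<one>\<^bsub>K\<^esub>" c] by (simp add: l_neg)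
    then have "f v = (\<ominus>\<^bsub>K\<^esub> \<one>\<^bsub>K\<^esub>) \<odot>\<^bsub>W\<^esub> c"
      using vc cW[OF vc(3)] fW[OF vc(2)] W.M.add.right_cancel[of c "f v" "(\<ominus>\<^bsub>K\<^esub> \<one>\<^bsub>K\<^esub>) \<odot>\<^bsub>W\<^esub> c"] by simp
    then have "f v \<in> C" using vc(3) C(1) by (simp add: W.submodule_iff)
    then have z: "f v = \<zero>\<^bsub>W\<^esub>" using C(2) vc(2) by blast
    then have "v = \<zero>\<^bsub>V\<^esub>"
      using inj_onD[OF inj, of v "\<zero>\<^bsub>V\<^esub>"] vc V.linear_map_zero[OF assms(3) f] by simp
    then show "p = \<zero>\<^bsub>?P\<^esub>" using vc z cW[OF vc(3)] by (simp add: prod_module_def)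
  qed
  moreover have "g ` carrier ?P = carrier W"
    using decomp linear_closed[OF gl] by (force simp: g_def prod_module_def image_iff)
  ultimately have bij: "bij_betw g (carrier ?P) (carrier W)" by (simp add: bij_betw_def)
  have "(\<lambda>p \<in> carrier ?P. fst p) \<in> linear_maps K ?P V"
    by (rule linear_mapsI) (use C(1) in \<open>auto simp: prod_module_def W.submodule_iff\<close>)
  note r = W.linear_map_comp[OF P.linear_map_inverse[OF gl bij] this]
  show ?thesis
  proof (rule bexI[OF _ r], rule ballI)
    fix v assume v: "v \<in> carrier V"
    have p: "(v, \<zero>\<^bsub>W\<^esub>) \<in> carrier ?P" using v C(1) by (simp add: prod_module_def W.submodule_iff)
    moreover have "g (v, \<zero>\<^bsub>W\<^esub>) = f v" using p fW[OF v] by (simp add: g_def)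
    ultimately have "inv_into (carrier ?P) g (f v) = (v, \<zero>\<^bsub>W\<^esub>)"
      using inv_into_f_f[OF bij_betw_imp_inj_on[OF bij] p] by simp
    then show "(\<lambda>x \<in> carrier W. (\<lambda>p \<in> carrier ?P. fst p) ((\<lambda>y \<in> carrier W. inv_into (carrier ?P) g y) x)) (f v) = v"
      using fW[OF v] p by simp
  qed
qed

type_synonym ('k, 'u) vect_arrow = "(('k, 'u) module, 'u \<Rightarrow> 'u) arrow"
type_synonym ('k, 'u, 'g) glider_arrow = "(('k, 'u, 'g \<Rightarrow> 'k) glider, ('k, 'u) glider_map) arrow"

subsection \<open>The category of vector spaces\<close>

lemma vect_sel [simp]:
  "Obj (vect K) = {V. module K V}"
  "UnitO (vect K) = scalar_space K"
  "TensO (vect K) = tensor K"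
  by (simp_all add: vect_def)

lemma Arr_vect:
  "f \<in> Arr (vect K) \<longleftrightarrow> module K (src f) \<and> module K (trg f) \<and> dat f \<in> linear_maps K (src f) (trg f)"
  by (cases f) (auto simp: vect_def)

lemma vect_Id_sel [simp]:
  "src (Id (vect K) V) = V" "trg (Id (vect K) V) = V" "dat (Id (vect K) V) = (\<lambda>x \<in> carrier V. x)"
  by (simp_all add: vect_def)

lemma vect_Comp_sel [simp]:
  "src (g \<cdot>\<^bsub>vect K\<^esub> f) = src f" "trg (g \<cdot>\<^bsub>vect K\<^esub> f) = trg g"
  "dat (g \<cdot>\<^bsub>vect K\<^esub> f) = (\<lambda>x \<in> carrier (src f). dat g (dat f x))"
  by (simp_all add: vect_def)

lemma vect_Add_sel [simp]:
  "src (Add (vect K) f g) = src f" "trg (Add (vect K) f g) = trg f"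
  "dat (Add (vect K) f g) = (\<lambda>x \<in> carrier (src f). dat f x \<oplus>\<^bsub>trg f\<^esub> dat g x)"
  by (simp_all add: vect_def)

lemma vect_Scale_sel [simp]:
  "src (Scale (vect K) c f) = src f" "trg (Scale (vect K) c f) = trg f"
  "dat (Scale (vect K) c f) = (\<lambda>x \<in> carrier (src f). c \<odot>\<^bsub>trg f\<^esub> dat f x)"
  by (simp_all add: vect_def)

lemma vect_TensA_sel [simp]:
  "src (TensA (vect K) f g) = tensor K (src f) (src g)"
  "trg (TensA (vect K) f g) = tensor K (trg f) (trg g)"
  by (simp_all add: vect_def)

lemma vect_Assoc_sel [simp]:
  "src (Assoc (vect K) U V W) = tensor K (tensor K U V) W"
  "trg (Assoc (vect K) U V W) = tensor K U (tensor K V W)"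
  by (simp_all add: vect_def)

lemma vect_Unit_sel [simp]:
  "src (LUnit (vect K) V) = tensor K (scalar_space K) V" "trg (LUnit (vect K) V) = V"
  "src (RUnit (vect K) V) = tensor K V (scalar_space K)" "trg (RUnit (vect K) V) = V"
  by (simp_all add: vect_def)

lemma Arr_vectD:
  assumes "f \<in> Arr (vect K)"
  shows "module K (src f)" "module K (trg f)" "dat f \<in> linear_maps K (src f) (trg f)"
  using assms by (auto simp: Arr_vect)

lemma arrow_eqI: "src f = src g \<Longrightarrow> trg f = trg g \<Longrightarrow> dat f = dat g \<Longrightarrow> f = g"
  by (cases f; cases g) auto

lemma vect_eqI:
  assumes "f \<in> Arr (vect K)" "g \<in> Arr (vect K)" "src f = src g" "trg f = trg g"
    "\<And>x. x \<in> carrier (src f) \<Longrightarrow> dat f x = dat g x"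
  shows "f = g"
proof (rule arrow_eqI)
  have "dat f \<in> linear_maps K (src f) (trg f)" "dat g \<in> linear_maps K (src f) (trg g)"
    using assms by (auto simp: Arr_vect)
  then show "dat f = dat g" using assms(5) by (rule linear_eqI)
qed fact+

lemma cat_vect: "cat (vect K)"
proof
  fix f g h assume f: "f \<in> Arr (vect K)"
  then interpret vspace K "src f" by (simp add: Arr_vect vspace_def)
  show "Id (vect K) (trg f) \<cdot>\<^bsub>vect K\<^esub> f = f"
    "f \<cdot>\<^bsub>vect K\<^esub> Id (vect K) (src f) = f"
    using linear_ext[OF Arr_vectD(3)[OF f]] linear_closed[OF Arr_vectD(3)[OF f]]
    by (auto intro!: arrow_eqI simp: extensional_def restrict_def)
  assume g: "g \<in> Arr (vect K)" "trg f = src g"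
  then show "g \<cdot>\<^bsub>vect K\<^esub> f \<in> Arr (vect K)"
    using f linear_map_comp[of "dat f" "src g" "dat g" "trg g"] by (auto simp: Arr_vect)
  assume "h \<in> Arr (vect K)" "trg g = src h"
  then show "h \<cdot>\<^bsub>vect K\<^esub> g \<cdot>\<^bsub>vect K\<^esub> f = h \<cdot>\<^bsub>vect K\<^esub> (g \<cdot>\<^bsub>vect K\<^esub> f)"
    using linear_closed[OF Arr_vectD(3)[OF f]] g
    by (auto intro!: arrow_eqI)
qed (auto simp: Arr_vect vspace_def vspace.linear_map_id)

interpretation vect: cat "vect K" for K by (rule cat_vect)

lemma iso_vectD:
  assumes "iso_arr (vect K) f"
  shows "f \<in> Arr (vect K)" "bij_betw (dat f) (carrier (src f)) (carrier (trg f))"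
proof -
  obtain g where f: "f \<in> Arr (vect K)" and g: "g \<in> Arr (vect K)" "src g = trg f" "trg g = src f"
    and gf: "g \<cdot>\<^bsub>vect K\<^esub> f = Id (vect K) (src f)" and fg: "f \<cdot>\<^bsub>vect K\<^esub> g = Id (vect K) (trg f)"
    using vect.iso_arrE[OF assms] by blast
  show "f \<in> Arr (vect K)" by fact
  have "dat g (dat f x) = x" if "x \<in> carrier (src f)" for x
    using arg_cong[OF gf, of "\<lambda>a. dat a x"] that by simp
  moreover have "dat f (dat g y) = y" if "y \<in> carrier (trg f)" for y
    using arg_cong[OF fg, of "\<lambda>a. dat a y"] that g by simp
  ultimately show "bij_betw (dat f) (carrier (src f)) (carrier (trg f))"
    using linear_closed[OF Arr_vectD(3)[OF f]] linear_closed[OF Arr_vectD(3)[OF g(1)]] g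
    by (intro bij_betw_byWitness[where f' = "dat g"]) auto
qed

lemma iso_vectI:
  assumes f: "f \<in> Arr (vect K)" and bij: "bij_betw (dat f) (carrier (src f)) (carrier (trg f))"
  shows "iso_arr (vect K) f"
proof (rule vect.iso_arrI[OF f])
  interpret vspace K "src f" using f by (simp add: Arr_vect vspace_def)
  let ?g = "Arrow (trg f) (\<lambda>y \<in> carrier (trg f). inv_into (carrier (src f)) (dat f) y) (src f)"
  show "?g \<in> Arr (vect K)"
    using f linear_map_inverse[OF _ bij] by (auto simp: Arr_vect)
  show "?g \<cdot>\<^bsub>vect K\<^esub> f = Id (vect K) (src f)" "f \<cdot>\<^bsub>vect K\<^esub> ?g = Id (vect K) (trg f)"
    using bij linear_closed[OF Arr_vectD(3)[OF f]]
    by (auto intro!: arrow_eqI restrict_ext simp: bij_betw_def f_inv_into_f)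
qed simp_all

lemma mono_vectI:
  assumes f: "f \<in> Arr (vect K)" and inj: "inj_on (dat f) (carrier (src f))"
  shows "mono_arr (vect K) f"
proof (rule vect.mono_arrI[OF f])
  fix g h
  assume g: "g \<in> Arr (vect K)" "h \<in> Arr (vect K)" "trg g = src f" "trg h = src f" "src g = src h"
    and eq: "f \<cdot>\<^bsub>vect K\<^esub> g = f \<cdot>\<^bsub>vect K\<^esub> h"
  show "g = h"
  proof (rule vect_eqI[OF g(1,2,5)])
    fix x assume x: "x \<in> carrier (src g)"
    have "dat f (dat g x) = dat f (dat h x)" using arg_cong[OF eq, of "\<lambda>a. dat a x"] x g by simp
    then show "dat g x = dat h x"
      using inj x g linear_closed[OF Arr_vectD(3)[OF g(1)]] linear_closed[OF Arr_vectD(3)[OF g(2)]]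
      by (auto dest: inj_onD)
  qed (use g in simp)
qed

locale vector_spaces = field K for K :: "('k, 'm) ring_scheme" (structure) +
  fixes U :: "'u itself"
  assumes universe: "vector_space_universe U K"
begin

abbreviation vcomp :: "('k, 'u) vect_arrow \<Rightarrow> ('k, 'u) vect_arrow \<Rightarrow> ('k, 'u) vect_arrow"
  (infixl "\<star>" 70) where "g \<star> f \<equiv> g \<cdot>\<^bsub>vect K\<^esub> f"

lemma module_K: "module K \<lparr>carrier = carrier K, mult = mult K, one = one K, zero = zero K,
    add = add K, smult = mult K\<rparr>"
  by (rule moduleI') (auto simp: is_cring a_ac m_ac l_distr r_distr)

abbreviation sc :: "'k \<Rightarrow> 'u" where "sc \<equiv> scalar_embedding K"
abbreviation S :: "('k, 'u) module" where "S \<equiv> scalar_space K"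

lemma sc_inj: "inj_on sc (carrier K)"
proof -
  have "\<exists>\<iota> :: 'k \<Rightarrow> 'u. inj_on \<iota> (carrier K)"
    using universe by (simp add: vector_space_universe_def)
  then show ?thesis unfolding scalar_embedding_def by (rule someI_ex)
qed

lemma scalar_space_eq: "S = transport_module sc \<lparr>carrier = carrier K, mult = mult K, one = one K,
    zero = zero K, add = add K, smult = mult K\<rparr>"
  by (simp add: scalar_space_def transport_module_def Let_def)

lemma module_S: "module K S"
  unfolding scalar_space_eq by (rule module_transport_module[OF module_K]) (use sc_inj in simp)

lemma S_sel:
  shows carrier_S: "carrier S = sc ` carrier K"
    and zero_S: "\<zero>\<^bsub>S\<^esub> = sc \<zero>"
    and add_S: "a \<in> carrier K \<Longrightarrow> b \<in> carrier K \<Longrightarrow> sc a \<oplus>\<^bsub>S\<^esub> sc b = sc (a \<oplus> b)"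
    and smult_S: "a \<in> carrier K \<Longrightarrow> c \<odot>\<^bsub>S\<^esub> sc a = sc (c \<otimes> a)"
  using transport_module_sel[of sc "\<lparr>carrier = carrier K, mult = mult K, one = one K,
    zero = zero K, add = add K, smult = mult K\<rparr>"] sc_inj
  unfolding scalar_space_eq by simp_all

lemma sc_eq_iff [simp]: "a \<in> carrier K \<Longrightarrow> b \<in> carrier K \<Longrightarrow> sc a = sc b \<longleftrightarrow> a = b"
  using sc_inj by (auto dest: inj_onD)

lemma sc_in [simp]: "a \<in> carrier K \<Longrightarrow> sc a \<in> carrier S"
  by (simp add: carrier_S)

lemma sc_one: "a \<in> carrier K \<Longrightarrow> sc a = a \<odot>\<^bsub>S\<^esub> sc \<one>"
  by (simp add: smult_S)

definition us :: "'u \<Rightarrow> 'k" where "us = inv_into (carrier K) sc"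

lemma us_sc [simp]: "a \<in> carrier K \<Longrightarrow> us (sc a) = a"
  using sc_inj by (simp add: us_def)

lemma us_in [simp]: "x \<in> carrier S \<Longrightarrow> us x \<in> carrier K"
  and sc_us [simp]: "x \<in> carrier S \<Longrightarrow> sc (us x) = x"
  by (auto simp: carrier_S)

lemma scalar_line:
  assumes "module K V" "x \<in> carrier V"
  shows "(\<lambda>a \<in> carrier S. us a \<odot>\<^bsub>V\<^esub> x) \<in> linear_maps K S V"
proof -
  interpret V: module K V by fact
  show ?thesis
    by (rule linear_mapsI)
      (use assms(2) in \<open>auto simp: carrier_S add_S smult_S V.smult_l_distr V.smult_assoc1\<close>)
qed

text \<open>Tested on maps out of the scalar space, each of which amounts to one vector.\<close>

lemma mono_vectD:
  assumes "mono_arr (vect K) f" and src: "src f = (V :: ('k, 'u) module)"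
  shows "inj_on (dat f) (carrier V)"
proof (rule inj_onI)
  have f: "f \<in> Arr (vect K)" using assms by (simp add: mono_arr_def)
  then interpret V: module K V using src by (simp add: Arr_vect)
  fix x y assume xy: "x \<in> carrier V" "y \<in> carrier V" and eq: "dat f x = dat f y"
  let ?l = "\<lambda>x. Arrow S (\<lambda>a \<in> carrier S. us a \<odot>\<^bsub>V\<^esub> x) V"
  have l: "?l x \<in> Arr (vect K)" if "x \<in> carrier V" for x
    using that scalar_line module_S V.module_axioms by (auto simp: Arr_vect)
  have "dat f (us a \<odot>\<^bsub>V\<^esub> x) = dat f (us a \<odot>\<^bsub>V\<^esub> y)" if "a \<in> carrier S" for a
    using that xy eq linear_smult[OF Arr_vectD(3)[OF f]] src by simp
  then have "f \<star> ?l x = f \<star> ?l y"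
    by (auto intro!: arrow_eqI)
  then have "?l x = ?l y"
    using vect.mono_arrD[OF assms(1) l[OF xy(1)] l[OF xy(2)]] src by simp
  then have "dat (?l x) (sc \<one>) = dat (?l y) (sc \<one>)" by simp
  then show "x = y" using xy by simp
qed

subsection \<open>Tensor products\<close>

definition pair :: "'u \<times> 'u \<Rightarrow> 'u" where "pair = (SOME f. inj f)"

text \<open>An infinite type is equinumerous with its square. The pairing codes lists here and
  direct sums of ambient representations later.\<close>

lemma inj_pair: "inj pair"
proof -
  have "infinite (UNIV :: 'u set)" using universe by (simp add: vector_space_universe_def)
  from card_of_Times_same_infinite[OF this]
  obtain f :: "'u \<times> 'u \<Rightarrow> 'u" where "bij_betw f (UNIV \<times> UNIV) UNIV"
    unfolding card_of_ordIso[symmetric] by blast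
  then have "inj f" by (simp add: bij_betw_def)
  then show ?thesis unfolding pair_def by (rule someI[of inj])
qed

text \<open>Nested pairs do not show where a list ends, so its length is stored as well; for equal
  lengths the nesting can be undone.\<close>

lemma list_code:
  fixes j :: "'a \<Rightarrow> 'u"
  assumes j: "inj_on j A"
  shows "\<exists>code :: 'a list \<Rightarrow> 'u. inj_on code (lists A)"
proof -
  have "infinite (UNIV :: 'u set)" using universe by (simp add: vector_space_universe_def)
  then obtain i :: "nat \<Rightarrow> 'u" where i: "inj i" using infinite_countable_subset by blast
  let ?c = "\<lambda>xs :: 'a list. foldr (\<lambda>x y. pair (j x, y)) xs undefined"
  have c: "xs = ys" if "length xs = length ys" "?c xs = ?c ys" "set xs \<subseteq> A" "set ys \<subseteq> A" for xs ys
    using that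
    by (induction xs ys rule: list_induct2) (auto dest!: injD[OF inj_pair] inj_onD[OF j])
  have "inj_on (\<lambda>xs. pair (i (length xs), ?c xs)) (lists A)"
    by (rule inj_onI) (auto dest!: injD[OF inj_pair] injD[OF i] intro!: c)
  then show ?thesis by blast
qed

lemma bilinearI:
  assumes "\<And>x y. x \<in> carrier V \<Longrightarrow> y \<in> carrier W \<Longrightarrow> \<beta> x y \<in> carrier Z"
    "\<And>x x' y. x \<in> carrier V \<Longrightarrow> x' \<in> carrier V \<Longrightarrow> y \<in> carrier W \<Longrightarrow>
      \<beta> (x \<oplus>\<^bsub>V\<^esub> x') y = \<beta> x y \<oplus>\<^bsub>Z\<^esub> \<beta> x' y"
    "\<And>x y y'. x \<in> carrier V \<Longrightarrow> y \<in> carrier W \<Longrightarrow> y' \<in> carrier W \<Longrightarrow>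
      \<beta> x (y \<oplus>\<^bsub>W\<^esub> y') = \<beta> x y \<oplus>\<^bsub>Z\<^esub> \<beta> x y'"
    "\<And>c x y. c \<in> carrier K \<Longrightarrow> x \<in> carrier V \<Longrightarrow> y \<in> carrier W \<Longrightarrow> \<beta> (c \<odot>\<^bsub>V\<^esub> x) y = c \<odot>\<^bsub>Z\<^esub> \<beta> x y"
    "\<And>c x y. c \<in> carrier K \<Longrightarrow> x \<in> carrier V \<Longrightarrow> y \<in> carrier W \<Longrightarrow> \<beta> x (c \<odot>\<^bsub>W\<^esub> y) = c \<odot>\<^bsub>Z\<^esub> \<beta> x y"
    "module K V" "module K W"
  shows "bilinear K V W Z \<beta>"
proof -
  interpret V: module K V by fact
  interpret W: module K W by fact
  show ?thesis
    unfolding bilinear_def by (intro conjI ballI linear_mapsI) (auto simp: assms)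
qed

lemma bilinearD:
  assumes "bilinear K V W Z \<beta>" "module K V" "module K W"
  shows "x \<in> carrier V \<Longrightarrow> y \<in> carrier W \<Longrightarrow> \<beta> x y \<in> carrier Z"
    "x \<in> carrier V \<Longrightarrow> x' \<in> carrier V \<Longrightarrow> y \<in> carrier W \<Longrightarrow>
      \<beta> (x \<oplus>\<^bsub>V\<^esub> x') y = \<beta> x y \<oplus>\<^bsub>Z\<^esub> \<beta> x' y"
    "x \<in> carrier V \<Longrightarrow> y \<in> carrier W \<Longrightarrow> y' \<in> carrier W \<Longrightarrow>
      \<beta> x (y \<oplus>\<^bsub>W\<^esub> y') = \<beta> x y \<oplus>\<^bsub>Z\<^esub> \<beta> x y'"
    "c \<in> carrier K \<Longrightarrow> x \<in> carrier V \<Longrightarrow> y \<in> carrier W \<Longrightarrow> \<beta> (c \<odot>\<^bsub>V\<^esub> x) y = c \<odot>\<^bsub>Z\<^esub> \<beta> x y"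
    "c \<in> carrier K \<Longrightarrow> x \<in> carrier V \<Longrightarrow> y \<in> carrier W \<Longrightarrow> \<beta> x (c \<odot>\<^bsub>W\<^esub> y) = c \<odot>\<^bsub>Z\<^esub> \<beta> x y"
proof -
  interpret V: module K V by fact
  interpret W: module K W by fact
  have l: "(\<lambda>y \<in> carrier W. \<beta> x y) \<in> linear_maps K W Z" if "x \<in> carrier V" for x
    using assms(1) that by (simp add: bilinear_def)
  have r: "(\<lambda>x \<in> carrier V. \<beta> x y) \<in> linear_maps K V Z" if "y \<in> carrier W" for y
    using assms(1) that by (simp add: bilinear_def)
  show "x \<in> carrier V \<Longrightarrow> y \<in> carrier W \<Longrightarrow> \<beta> x y \<in> carrier Z"
    using linear_closed[OF l, of x y] by simp
  show "x \<in> carrier V \<Longrightarrow> x' \<in> carrier V \<Longrightarrow> y \<in> carrier W \<Longrightarrow>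
      \<beta> (x \<oplus>\<^bsub>V\<^esub> x') y = \<beta> x y \<oplus>\<^bsub>Z\<^esub> \<beta> x' y"
    using linear_add[OF r, of y x x'] by simp
  show "x \<in> carrier V \<Longrightarrow> y \<in> carrier W \<Longrightarrow> y' \<in> carrier W \<Longrightarrow>
      \<beta> x (y \<oplus>\<^bsub>W\<^esub> y') = \<beta> x y \<oplus>\<^bsub>Z\<^esub> \<beta> x y'"
    using linear_add[OF l, of x y y'] by simp
  show "c \<in> carrier K \<Longrightarrow> x \<in> carrier V \<Longrightarrow> y \<in> carrier W \<Longrightarrow> \<beta> (c \<odot>\<^bsub>V\<^esub> x) y = c \<odot>\<^bsub>Z\<^esub> \<beta> x y"
    using linear_smult[OF r, of y c x] by simp
  show "c \<in> carrier K \<Longrightarrow> x \<in> carrier V \<Longrightarrow> y \<in> carrier W \<Longrightarrow> \<beta> x (c \<odot>\<^bsub>W\<^esub> y) = c \<odot>\<^bsub>Z\<^esub> \<beta> x y"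
    using linear_smult[OF l, of x c y] by simp
qed

text \<open>Finite sums of pure tensors are lists of pairs, two of which are identified if every bilinear
  map to a space of the universe takes the same value on them. This avoids free modules and
  quotients, and lists over the universe can be encoded in it.\<close>

lemma tensor_product_exists:
  fixes V W :: "('k, 'u) module"
  assumes V: "module K V" and W: "module K W"
  shows "\<exists>T \<tau>. is_tensor_product K V W T \<tau>"
proof -
  interpret V: module K V by fact
  interpret W: module K W by fact
  define L where "L = lists (carrier V \<times> carrier W)"
  define val where "val Z \<beta> ls = foldr (\<lambda>p s. \<beta> (fst p) (snd p) \<oplus>\<^bsub>Z\<^esub> s) ls \<zero>\<^bsub>Z\<^esub>"
    for Z :: "('k, 'u) module" and \<beta> :: "'u \<Rightarrow> 'u \<Rightarrow> 'u" and ls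
  define scale where "scale c = map (\<lambda>p. (c \<odot>\<^bsub>V\<^esub> fst p, snd p :: 'u))" for c
  define test where "test Z \<beta> \<longleftrightarrow> module K Z \<and> bilinear K V W Z \<beta>" for Z :: "('k, 'u) module" and \<beta>
  define eqv where "eqv ls ls' \<longleftrightarrow> (\<forall>Z \<beta>. test Z \<beta> \<longrightarrow> val Z \<beta> ls = val Z \<beta> ls')" for ls ls'
  have val_Nil: "val Z \<beta> [] = \<zero>\<^bsub>Z\<^esub>"
    and val_Cons: "val Z \<beta> (p # ls) = \<beta> (fst p) (snd p) \<oplus>\<^bsub>Z\<^esub> val Z \<beta> ls" for Z \<beta> p ls
    by (simp_all add: val_def)
  have L_Cons: "p # ls \<in> L \<longleftrightarrow> fst p \<in> carrier V \<and> snd p \<in> carrier W \<and> ls \<in> L" for p ls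
    by (cases p) (auto simp: L_def)
  have val_in: "val Z \<beta> ls \<in> carrier Z" if "test Z \<beta>" "ls \<in> L" for Z \<beta> ls
  proof -
    interpret Z: module K Z using that by (simp add: test_def)
    have b: "bilinear K V W Z \<beta>" using that by (simp add: test_def)
    show ?thesis using that(2)
      by (induction ls) (auto simp: bilinearD(1)[OF b V W] val_Nil val_Cons L_Cons)
  qed
  have val_append: "val Z \<beta> (ls @ ls') = val Z \<beta> ls \<oplus>\<^bsub>Z\<^esub> val Z \<beta> ls'"
    if t: "test Z \<beta>" "ls \<in> L" "ls' \<in> L" for Z \<beta> ls ls'
  proof -
    interpret Z: module K Z using that by (simp add: test_def)
    have b: "bilinear K V W Z \<beta>" using that by (simp add: test_def)
    show ?thesis using t(2,3)
      by (induction ls)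
        (auto simp: bilinearD(1)[OF b V W] Z.M.a_assoc val_Nil val_Cons L_Cons val_in[OF t(1)])
  qed
  have val_scale: "val Z \<beta> (scale c ls) = c \<odot>\<^bsub>Z\<^esub> val Z \<beta> ls"
    if t: "test Z \<beta>" "ls \<in> L" "c \<in> carrier K" for Z \<beta> ls c
  proof -
    interpret Z: module K Z using that by (simp add: test_def)
    have b: "bilinear K V W Z \<beta>" using that by (simp add: test_def)
    show ?thesis using t(2,3)
      by (induction ls)
        (auto simp: bilinearD(1,4)[OF b V W] Z.smult_r_distr val_Nil val_Cons L_Cons scale_def
          val_in[OF t(1)])
  qed
  have [simp]: "[] \<in> L" "\<And>ls ls'. ls @ ls' \<in> L \<longleftrightarrow> ls \<in> L \<and> ls' \<in> L"
    "\<And>c ls. c \<in> carrier K \<Longrightarrow> ls \<in> L \<Longrightarrow> scale c ls \<in> L"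
    by (force simp: L_def scale_def)+
  obtain code :: "('u \<times> 'u) list \<Rightarrow> 'u" where code: "inj_on code L"
    using list_code[of pair "carrier V \<times> carrier W"] inj_pair unfolding L_def
    by (meson inj_on_subset subset_UNIV)
  \<comment> \<open>A class is named by the code of a chosen representative. The choice depends only
    on the predicate \<open>eqv ls\<close>, so equivalent lists receive the same name.\<close>
  define q where "q ls = code (SOME ls'. ls' \<in> L \<and> eqv ls ls')" for ls
  have some: "(SOME ls'. ls' \<in> L \<and> eqv ls ls') \<in> L \<and> eqv ls (SOME ls'. ls' \<in> L \<and> eqv ls ls')"
    if "ls \<in> L" for ls
    by (rule someI[of _ ls]) (use that in \<open>simp add: eqv_def\<close>)
  have q_eq: "q ls = q ls' \<longleftrightarrow> eqv ls ls'" if "ls \<in> L" "ls' \<in> L" for ls ls'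
  proof
    assume "q ls = q ls'"
    then have "(SOME l. l \<in> L \<and> eqv ls l) = (SOME l. l \<in> L \<and> eqv ls' l)"
      unfolding q_def using inj_onD[OF code] some[OF that(1)] some[OF that(2)] by blast
    then show "eqv ls ls'" using some[OF that(1)] some[OF that(2)] by (simp add: eqv_def)
  next
    assume "eqv ls ls'"
    then have "eqv ls = eqv ls'" by (auto simp: eqv_def fun_eq_iff)
    then show "q ls = q ls'" by (simp add: q_def)
  qed
  define d where "d x = (SOME ls. ls \<in> L \<and> q ls = x)" for x
  have d: "d (q ls) \<in> L" "eqv (d (q ls)) ls" if "ls \<in> L" for ls
  proof -
    have "d (q ls) \<in> L \<and> q (d (q ls)) = q ls"
      unfolding d_def by (rule someI[of _ ls]) (use that in simp)
    then show "d (q ls) \<in> L" "eqv (d (q ls)) ls" using q_eq that by auto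
  qed
  define T :: "('k, 'u) module" where "T = \<lparr>carrier = q ` L, mult = undefined, one = undefined, zero = q [],
    add = (\<lambda>x y. q (d x @ d y)), smult = (\<lambda>c x. q (scale c (d x)))\<rparr>"
  have T_add: "q ls \<oplus>\<^bsub>T\<^esub> q ls' = q (ls @ ls')" if "ls \<in> L" "ls' \<in> L" for ls ls'
    using d[OF that(1)] d[OF that(2)] that by (simp add: T_def q_eq) (simp add: eqv_def val_append)
  have T_smult: "c \<odot>\<^bsub>T\<^esub> q ls = q (scale c ls)" if "ls \<in> L" "c \<in> carrier K" for ls c
    using d[OF that(1)] that by (simp add: T_def q_eq) (simp add: eqv_def val_scale)
  have T_carrier: "carrier T = q ` L" and T_zero: "\<zero>\<^bsub>T\<^esub> = q []" by (simp_all add: T_def)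
  have Zmod: "module K Z" if "test Z \<beta>" for Z \<beta> using that by (simp add: test_def)
  \<comment> \<open>The module laws for \<open>T\<close> are verified after an arbitrary test, where
    they hold because the test space is a module.\<close>
  have Zfacts: "val Z \<beta> l1 \<oplus>\<^bsub>Z\<^esub> val Z \<beta> l2 = val Z \<beta> l2 \<oplus>\<^bsub>Z\<^esub> val Z \<beta> l1"
    "(a \<oplus> b) \<odot>\<^bsub>Z\<^esub> val Z \<beta> l1 = a \<odot>\<^bsub>Z\<^esub> val Z \<beta> l1 \<oplus>\<^bsub>Z\<^esub> b \<odot>\<^bsub>Z\<^esub> val Z \<beta> l1"
    "a \<odot>\<^bsub>Z\<^esub> (val Z \<beta> l1 \<oplus>\<^bsub>Z\<^esub> val Z \<beta> l2) = a \<odot>\<^bsub>Z\<^esub> val Z \<beta> l1 \<oplus>\<^bsub>Z\<^esub> a \<odot>\<^bsub>Z\<^esub> val Z \<beta> l2"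
    "(a \<otimes> b) \<odot>\<^bsub>Z\<^esub> val Z \<beta> l1 = a \<odot>\<^bsub>Z\<^esub> (b \<odot>\<^bsub>Z\<^esub> val Z \<beta> l1)"
    "\<one> \<odot>\<^bsub>Z\<^esub> val Z \<beta> l1 = val Z \<beta> l1" "\<zero> \<odot>\<^bsub>Z\<^esub> val Z \<beta> l1 = \<zero>\<^bsub>Z\<^esub>"
    if t: "test Z \<beta>" "l1 \<in> L" "l2 \<in> L" "a \<in> carrier K" "b \<in> carrier K" for Z \<beta> l1 l2 a b
  proof -
    interpret Z: module K Z using that by (simp add: test_def)
    note [simp] = val_in[OF t(1,2)] val_in[OF t(1,3)] t(4,5)
    show "val Z \<beta> l1 \<oplus>\<^bsub>Z\<^esub> val Z \<beta> l2 = val Z \<beta> l2 \<oplus>\<^bsub>Z\<^esub> val Z \<beta> l1" by (simp add: Z.M.a_comm)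
    show "(a \<oplus> b) \<odot>\<^bsub>Z\<^esub> val Z \<beta> l1 = a \<odot>\<^bsub>Z\<^esub> val Z \<beta> l1 \<oplus>\<^bsub>Z\<^esub> b \<odot>\<^bsub>Z\<^esub> val Z \<beta> l1"
      by (simp add: Z.smult_l_distr)
    show "a \<odot>\<^bsub>Z\<^esub> (val Z \<beta> l1 \<oplus>\<^bsub>Z\<^esub> val Z \<beta> l2) = a \<odot>\<^bsub>Z\<^esub> val Z \<beta> l1 \<oplus>\<^bsub>Z\<^esub> a \<odot>\<^bsub>Z\<^esub> val Z \<beta> l2"
      by (simp add: Z.smult_r_distr)
    show "(a \<otimes> b) \<odot>\<^bsub>Z\<^esub> val Z \<beta> l1 = a \<odot>\<^bsub>Z\<^esub> (b \<odot>\<^bsub>Z\<^esub> val Z \<beta> l1)" by (simp add: Z.smult_assoc1)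
    show "\<one> \<odot>\<^bsub>Z\<^esub> val Z \<beta> l1 = val Z \<beta> l1" "\<zero> \<odot>\<^bsub>Z\<^esub> val Z \<beta> l1 = \<zero>\<^bsub>Z\<^esub>" by simp_all
  qed
  have T: "module K T"
  proof (rule moduleI')
    show "cring K" by (rule is_cring)
    fix a x assume a: "a \<in> carrier K" "x \<in> carrier T"
    then obtain lx where x: "lx \<in> L" "x = q lx" by (auto simp: T_carrier)
    show "a \<odot>\<^bsub>T\<^esub> x \<in> carrier T" using a x by (auto simp: T_smult) (simp add: T_carrier)
    fix b assume b: "b \<in> carrier K"
    show "(a \<oplus> b) \<odot>\<^bsub>T\<^esub> x = a \<odot>\<^bsub>T\<^esub> x \<oplus>\<^bsub>T\<^esub> b \<odot>\<^bsub>T\<^esub> x"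
      using a b x by (simp add: T_smult T_add q_eq) (simp add: eqv_def val_scale val_append Zfacts)
    show "(a \<otimes> b) \<odot>\<^bsub>T\<^esub> x = a \<odot>\<^bsub>T\<^esub> (b \<odot>\<^bsub>T\<^esub> x)"
      using a b x by (simp add: T_smult T_add q_eq) (simp add: eqv_def val_scale val_append Zfacts)
  next
    fix a x y assume a: "a \<in> carrier K" "x \<in> carrier T" "y \<in> carrier T"
    then obtain lx ly where x: "lx \<in> L" "x = q lx" "ly \<in> L" "y = q ly" by (auto simp: T_carrier)
    show "a \<odot>\<^bsub>T\<^esub> (x \<oplus>\<^bsub>T\<^esub> y) = a \<odot>\<^bsub>T\<^esub> x \<oplus>\<^bsub>T\<^esub> a \<odot>\<^bsub>T\<^esub> y"
      using a x by (simp add: T_smult T_add q_eq) (simp add: eqv_def val_scale val_append Zfacts)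
  next
    fix x y assume "x \<in> carrier T" "y \<in> carrier T"
    then obtain lx ly where x: "lx \<in> L" "x = q lx" "ly \<in> L" "y = q ly" by (auto simp: T_carrier)
    show "x \<oplus>\<^bsub>T\<^esub> y \<in> carrier T" using x by (simp add: T_add) (simp add: T_carrier)
    show "x \<oplus>\<^bsub>T\<^esub> y = y \<oplus>\<^bsub>T\<^esub> x"
      using x by (simp add: T_add q_eq) (auto simp: eqv_def val_append intro: Zfacts)
    fix z assume "z \<in> carrier T"
    then obtain lz where z: "lz \<in> L" "z = q lz" by (auto simp: T_carrier)
    show "x \<oplus>\<^bsub>T\<^esub> y \<oplus>\<^bsub>T\<^esub> z = x \<oplus>\<^bsub>T\<^esub> (y \<oplus>\<^bsub>T\<^esub> z)" using x z by (simp add: T_add)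
  next
    fix x assume "x \<in> carrier T"
    then obtain lx where x: "lx \<in> L" "x = q lx" by (auto simp: T_carrier)
    show "\<zero>\<^bsub>T\<^esub> \<oplus>\<^bsub>T\<^esub> x = x" using x by (simp add: T_zero T_add)
    show "\<one> \<odot>\<^bsub>T\<^esub> x = x" "\<zero> \<odot>\<^bsub>T\<^esub> x = \<zero>\<^bsub>T\<^esub>" using x Zfacts(5,6)[of _ _ lx lx \<one> \<one>]
      by (simp_all add: T_smult T_zero q_eq) (simp_all add: eqv_def val_scale val_Nil)
  qed (simp add: T_carrier T_zero)
  interpret T: module K T by fact
  define \<tau> where "\<tau> v w = q [(v, w)]" for v w
  have sing: "[(v, w)] \<in> L" if "v \<in> carrier V" "w \<in> carrier W" for v w using that by (simp add: L_def)
  have val_sing: "val Z \<beta> [(v, w)] = \<beta> v w" if "test Z \<beta>" "v \<in> carrier V" "w \<in> carrier W" for Z \<beta> v w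
  proof -
    interpret Z: module K Z using that by (simp add: test_def)
    show ?thesis using that bilinearD(1)[OF _ V W, of Z \<beta>] by (simp add: val_def test_def)
  qed
  have "bilinear K V W T \<tau>"
  proof (rule bilinearI[OF _ _ _ _ _ V W])
    have b: "bilinear K V W Z \<beta>" if "test Z \<beta>" for Z \<beta> using that by (simp add: test_def)
    note bi = bilinearD[OF b V W]
    show "\<tau> x y \<in> carrier T" if "x \<in> carrier V" "y \<in> carrier W" for x y
      using sing[OF that] by (simp add: T_carrier \<tau>_def)
    show "\<tau> (x \<oplus>\<^bsub>V\<^esub> x') y = \<tau> x y \<oplus>\<^bsub>T\<^esub> \<tau> x' y"
      if "x \<in> carrier V" "x' \<in> carrier V" "y \<in> carrier W" for x x' y
      using that sing by (simp add: \<tau>_def T_add q_eq del: append.simps)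
        (simp add: eqv_def val_append val_sing bi del: append.simps)
    show "\<tau> x (y \<oplus>\<^bsub>W\<^esub> y') = \<tau> x y \<oplus>\<^bsub>T\<^esub> \<tau> x y'"
      if "x \<in> carrier V" "y \<in> carrier W" "y' \<in> carrier W" for x y y'
      using that sing by (simp add: \<tau>_def T_add q_eq del: append.simps)
        (simp add: eqv_def val_append val_sing bi del: append.simps)
    show "\<tau> (c \<odot>\<^bsub>V\<^esub> x) y = c \<odot>\<^bsub>T\<^esub> \<tau> x y"
      if "c \<in> carrier K" "x \<in> carrier V" "y \<in> carrier W" for c x y
      using that sing by (simp add: \<tau>_def T_smult q_eq)
        (simp add: eqv_def val_scale val_sing bi)
    show "\<tau> x (c \<odot>\<^bsub>W\<^esub> y) = c \<odot>\<^bsub>T\<^esub> \<tau> x y"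
      if "c \<in> carrier K" "x \<in> carrier V" "y \<in> carrier W" for c x y
      using that sing by (simp add: \<tau>_def T_smult q_eq)
        (simp add: eqv_def val_scale val_sing bi)
  qed
  moreover have "\<exists>!f. f \<in> linear_maps K T Z \<and> (\<forall>x \<in> carrier V. \<forall>y \<in> carrier W. f (\<tau> x y) = \<beta> x y)"
    if Z: "module K Z" and \<beta>: "bilinear K V W Z \<beta>" for Z :: "('k, 'u) module" and \<beta>
  proof (rule ex_ex1I)
    interpret Z: module K Z by fact
    have t: "test Z \<beta>" using Z \<beta> by (simp add: test_def)
    define f where "f = (\<lambda>x \<in> carrier T. val Z \<beta> (d x))"
    have f: "f (q ls) = val Z \<beta> ls" if "ls \<in> L" for ls
      using d[OF that] t that by (simp add: f_def T_carrier eqv_def)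
    have "f \<in> linear_maps K T Z"
    proof (rule linear_mapsI)
      show "f \<in> extensional (carrier T)" by (simp add: f_def)
    qed (auto simp: T_carrier T_add T_smult f val_in t val_append val_scale)
    moreover have "f (\<tau> x y) = \<beta> x y" if "x \<in> carrier V" "y \<in> carrier W" for x y
      using sing[OF that] that t by (simp add: \<tau>_def f val_sing)
    ultimately show "\<exists>f. f \<in> linear_maps K T Z \<and> (\<forall>x \<in> carrier V. \<forall>y \<in> carrier W. f (\<tau> x y) = \<beta> x y)"
      by blast
    fix f g
    assume fg: "f \<in> linear_maps K T Z \<and> (\<forall>x \<in> carrier V. \<forall>y \<in> carrier W. f (\<tau> x y) = \<beta> x y)"
      "g \<in> linear_maps K T Z \<and> (\<forall>x \<in> carrier V. \<forall>y \<in> carrier W. g (\<tau> x y) = \<beta> x y)"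
    \<comment> \<open>Uniqueness: a list is the sum of its one-element pieces, and those are the
      pure tensors.\<close>
    have "f (q ls) = g (q ls)" if "ls \<in> L" for ls using that
    proof (induction ls)
      case Nil
      interpret T': vspace K T by (rule vspace.intro) fact
      show ?case using fg T'.linear_map_zero[OF Z, of f] T'.linear_map_zero[OF Z, of g]
        by (simp flip: T_zero)
    next
      case (Cons p ls)
      then have p: "fst p \<in> carrier V" "snd p \<in> carrier W" "ls \<in> L" by (auto simp: L_def)
      have "q (p # ls) = \<tau> (fst p) (snd p) \<oplus>\<^bsub>T\<^esub> q ls"
        using T_add[OF sing[OF p(1,2)] p(3)] by (simp add: \<tau>_def)
      moreover have "\<tau> (fst p) (snd p) \<in> carrier T" "q ls \<in> carrier T"
        using sing[OF p(1,2)] p by (auto simp: T_carrier \<tau>_def)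
      ultimately show ?case using fg p Cons.IH by (simp add: linear_add[of _ K T Z])
    qed
    then show "f = g" using fg by (intro linear_eqI[of f K T Z g Z]) (auto simp: T_carrier)
  qed
  ultimately have "is_tensor_product K V W T \<tau>"
    using T by (simp add: is_tensor_product_def)
  then show ?thesis by blast
qed


abbreviation tens :: "('k, 'u) module \<Rightarrow> ('k, 'u) module \<Rightarrow> ('k, 'u) module" where
  "tens \<equiv> tensor K"

abbreviation pt :: "('k, 'u) module \<Rightarrow> ('k, 'u) module \<Rightarrow> 'u \<Rightarrow> 'u \<Rightarrow> 'u" where
  "pt \<equiv> pure_tensor K"

lemma is_tensor_product_tensor:
  assumes "module K V" "module K W"
  shows "is_tensor_product K V W (tens V W) (pt V W)"
proof -
  have "\<exists>p. case p of (T, \<tau>) \<Rightarrow> is_tensor_product K V W T \<tau>"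
    using tensor_product_exists[OF assms] by auto
  then have "case tensor_choice K V W of (T, \<tau>) \<Rightarrow> is_tensor_product K V W T \<tau>"
    unfolding tensor_choice_def by (rule someI_ex)
  then show ?thesis by (simp add: tensor_def pure_tensor_def case_prod_unfold)
qed

lemma module_tensor [simp]:
  shows "module K V \<Longrightarrow> module K W \<Longrightarrow> module K (tens V W)"
  using is_tensor_product_tensor by (simp add: is_tensor_product_def)

lemma bilinear_pt:
  shows "module K V \<Longrightarrow> module K W \<Longrightarrow> bilinear K V W (tens V W) (pt V W)"
  using is_tensor_product_tensor by (simp add: is_tensor_product_def)

lemma pt_rules:
  assumes "module K V" "module K W"
  shows "x \<in> carrier V \<Longrightarrow> y \<in> carrier W \<Longrightarrow> pt V W x y \<in> carrier (tens V W)"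
    "x \<in> carrier V \<Longrightarrow> x' \<in> carrier V \<Longrightarrow> y \<in> carrier W \<Longrightarrow>
      pt V W (x \<oplus>\<^bsub>V\<^esub> x') y = pt V W x y \<oplus>\<^bsub>tens V W\<^esub> pt V W x' y"
    "x \<in> carrier V \<Longrightarrow> y \<in> carrier W \<Longrightarrow> y' \<in> carrier W \<Longrightarrow>
      pt V W x (y \<oplus>\<^bsub>W\<^esub> y') = pt V W x y \<oplus>\<^bsub>tens V W\<^esub> pt V W x y'"
    "c \<in> carrier K \<Longrightarrow> x \<in> carrier V \<Longrightarrow> y \<in> carrier W \<Longrightarrow>
      pt V W (c \<odot>\<^bsub>V\<^esub> x) y = c \<odot>\<^bsub>tens V W\<^esub> pt V W x y"
    "c \<in> carrier K \<Longrightarrow> x \<in> carrier V \<Longrightarrow> y \<in> carrier W \<Longrightarrow>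
      pt V W x (c \<odot>\<^bsub>W\<^esub> y) = c \<odot>\<^bsub>tens V W\<^esub> pt V W x y"
  using bilinearD[OF bilinear_pt[OF assms] assms] by blast+

lemma pt_in [simp]:
  shows "module K V \<Longrightarrow> module K W \<Longrightarrow> x \<in> carrier V \<Longrightarrow> y \<in> carrier W \<Longrightarrow>
    pt V W x y \<in> carrier (tens V W)"
  by (rule pt_rules(1))

lemma tensor_lift:
  fixes Z :: "('k, 'u) module"
  assumes "module K V" "module K W" "module K Z" "bilinear K V W Z \<beta>"
  obtains f where "f \<in> linear_maps K (tens V W) Z"
    "\<And>x y. x \<in> carrier V \<Longrightarrow> y \<in> carrier W \<Longrightarrow> f (pt V W x y) = \<beta> x y"
  using is_tensor_product_tensor[OF assms(1,2)] assms(3,4) unfolding is_tensor_product_def by metis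

lemma bilinear_comp:
  fixes Z Z' :: "('k, 'u) module"
  assumes "module K V" "module K W" "bilinear K V W Z \<beta>" "f \<in> linear_maps K Z Z'"
  shows "bilinear K V W Z' (\<lambda>x y. f (\<beta> x y))"
  by (rule bilinearI[OF _ _ _ _ _ assms(1,2)])
    (auto simp: bilinearD[OF assms(3,1,2)] linear_closed[OF assms(4)] linear_add[OF assms(4)]
      linear_smult[OF assms(4)])

lemma tensor_eqI:
  fixes Z :: "('k, 'u) module"
  assumes "module K V" "module K W" "module K Z"
    and f: "f \<in> linear_maps K (tens V W) Z" and g: "g \<in> linear_maps K (tens V W) Z"
    and eq: "\<And>x y. x \<in> carrier V \<Longrightarrow> y \<in> carrier W \<Longrightarrow> f (pt V W x y) = g (pt V W x y)"
  shows "f = g"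
proof -
  have "bilinear K V W Z (\<lambda>x y. f (pt V W x y))"
    by (rule bilinear_comp[OF assms(1,2) bilinear_pt[OF assms(1,2)] f])
  then have "\<exists>!h. h \<in> linear_maps K (tens V W) Z \<and>
    (\<forall>x \<in> carrier V. \<forall>y \<in> carrier W. h (pt V W x y) = f (pt V W x y))"
    using is_tensor_product_tensor[OF assms(1,2)] assms(3) by (simp add: is_tensor_product_def)
  then show ?thesis using f g eq by (metis (no_types, lifting))
qed

text \<open>Pure tensors span: the universal property gives a map into \<open>H\<close>, which
  followed by the inclusion is the identity by uniqueness.\<close>

lemma tensor_submodule:
  assumes V: "module K V" and W: "module K W" and H: "submodule H K (tens V W)"
    and pt: "\<And>x y. x \<in> carrier V \<Longrightarrow> y \<in> carrier W \<Longrightarrow> pt V W x y \<in> H"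
  shows "H = carrier (tens V W)"
proof -
  interpret T: vspace K "tens V W" by (rule vspace.intro) (simp add: V W)
  let ?H = "(tens V W)\<lparr>carrier := H\<rparr>"
  have mH: "module K ?H" using submodule.submodule_is_module[OF H T.module_axioms] .
  note b = pt_rules[OF V W]
  have "bilinear K V W ?H (pt V W)"
    by (rule bilinearI[OF _ _ _ _ _ V W]) (simp_all add: b pt)
  then obtain f where f: "f \<in> linear_maps K (tens V W) ?H"
    "\<And>x y. x \<in> carrier V \<Longrightarrow> y \<in> carrier W \<Longrightarrow> f (pt V W x y) = pt V W x y"
    using tensor_lift[OF V W mH] by blast
  let ?g = "\<lambda>t \<in> carrier (tens V W). (\<lambda>x \<in> H. x) (f t)"
  have fH: "f t \<in> H" if "t \<in> carrier (tens V W)" for t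
    using linear_closed[OF f(1) that] by simp
  have eq: "?g = (\<lambda>t \<in> carrier (tens V W). t)"
  proof (rule tensor_eqI[OF V W T.module_axioms])
    show "?g \<in> linear_maps K (tens V W) (tens V W)"
      by (rule T.linear_map_comp[OF f(1) T.linear_map_incl[OF H]])
  qed (use f pt V W T.linear_map_id in auto)
  have "f t = t" if "t \<in> carrier (tens V W)" for t
    using fun_cong[OF eq, of t] that fH by simp
  then have "carrier (tens V W) \<subseteq> H" using fH by auto
  then show ?thesis using H by (auto simp: T.submodule_iff)
qed

lemma TensA_vect:
  fixes f g :: "('k, 'u) vect_arrow"
  assumes f: "f \<in> Arr (vect K)" and g: "g \<in> Arr (vect K)"
  shows TensA_vect_arr [simp]: "TensA (vect K) f g \<in> Arr (vect K)"
    and TensA_vect_pt: "x \<in> carrier (src f) \<Longrightarrow> y \<in> carrier (src g) \<Longrightarrow>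
      dat (TensA (vect K) f g) (pt (src f) (src g) x y) =
      pt (trg f) (trg g) (dat f x) (dat g y)"
proof -
  note m = Arr_vectD(1,2)[OF f] Arr_vectD(1,2)[OF g]
  note lf = Arr_vectD(3)[OF f] and lg = Arr_vectD(3)[OF g]
  let ?P = "\<lambda>h. h \<in> linear_maps K (tens (src f) (src g)) (tens (trg f) (trg g)) \<and>
           (\<forall>x \<in> carrier (src f). \<forall>y \<in> carrier (src g).
              h (pt (src f) (src g) x y) = pt (trg f) (trg g) (dat f x) (dat g y))"
  have "bilinear K (src f) (src g) (tens (trg f) (trg g)) (\<lambda>x y. pt (trg f) (trg g) (dat f x) (dat g y))"
    by (rule bilinearI[OF _ _ _ _ _ m(1,3)])
      (simp_all add: m pt_rules[OF m(2,4)] linear_closed[OF lf] linear_closed[OF lg]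
        linear_add[OF lf] linear_add[OF lg] linear_smult[OF lf] linear_smult[OF lg])
  then obtain h where h: "?P h" using tensor_lift[OF m(1,3) module_tensor[OF m(2,4)]] by metis
  have uniq: "h' = h" if "?P h'" for h'
    by (rule tensor_eqI[OF m(1,3) module_tensor[OF m(2,4)]]) (use h that in auto)
  have eq: "dat (TensA (vect K) f g) = (THE h. ?P h)" by (simp add: vect_def)
  have P: "?P (dat (TensA (vect K) f g))" unfolding eq by (rule theI[of ?P, OF h uniq])
  then show "TensA (vect K) f g \<in> Arr (vect K)" using m by (simp add: Arr_vect)
  show "x \<in> carrier (src f) \<Longrightarrow> y \<in> carrier (src g) \<Longrightarrow>
      dat (TensA (vect K) f g) (pt (src f) (src g) x y) =
      pt (trg f) (trg g) (dat f x) (dat g y)"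
    using P by blast
qed

lemma tensor_arr_eqI:
  fixes f g :: "('k, 'u) vect_arrow"
  assumes "module K V" "module K W" "f \<in> Arr (vect K)" "g \<in> Arr (vect K)" "src f = tens V W"
    "src g = tens V W" "trg f = trg g"
    and eq: "\<And>x y. x \<in> carrier V \<Longrightarrow> y \<in> carrier W \<Longrightarrow> dat f (pt V W x y) = dat g (pt V W x y)"
  shows "f = g"
proof -
  have "dat f = dat g"
    by (rule tensor_eqI[OF assms(1,2) Arr_vectD(2)[OF assms(3)]])
      (use assms Arr_vectD(3)[OF assms(3)] Arr_vectD(3)[OF assms(4)] in auto)
  then show ?thesis using assms(5-7) by (intro arrow_eqI) auto
qed

lemma TensA_vect_Comp:
  fixes f g f' g' :: "('k, 'u) vect_arrow"
  assumes "f \<in> Arr (vect K)" "g \<in> Arr (vect K)" "trg f = src g"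
    "f' \<in> Arr (vect K)" "g' \<in> Arr (vect K)" "trg f' = src g'"
  shows "TensA (vect K) (g \<star> f) (g' \<star> f') =
    TensA (vect K) g g' \<star> TensA (vect K) f f'"
proof -
  note m = Arr_vectD(1)[OF assms(1)] Arr_vectD(1)[OF assms(4)]
  note l = linear_closed[OF Arr_vectD(3)[OF assms(1)]] linear_closed[OF Arr_vectD(3)[OF assms(4)]]
  show ?thesis
  proof (rule tensor_arr_eqI[OF m])
    fix x y assume "x \<in> carrier (src f)" "y \<in> carrier (src f')"
    then show "dat (TensA (vect K) (g \<star> f) (g' \<star> f')) (pt (src f) (src f') x y) =
      dat (TensA (vect K) g g' \<star> TensA (vect K) f f') (pt (src f) (src f') x y)"
      using TensA_vect_pt[of "g \<star> f" "g' \<star> f'" x y] TensA_vect_pt[of f f' x y]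
        TensA_vect_pt[of g g' "dat f x" "dat f' y"] assms l m by simp
  qed (use assms in auto)
qed

lemma TensA_vect_Id:
  assumes "module K V" "module K W"
  shows "TensA (vect K) (Id (vect K) V) (Id (vect K) W) = Id (vect K) (tens V W)"
  using TensA_vect_pt[of "Id (vect K) V" "Id (vect K) W"] assms
  by (intro tensor_arr_eqI[OF assms]) auto

lemma TensA_vect_Scale:
  fixes f g :: "('k, 'u) vect_arrow"
  assumes f: "f \<in> Arr (vect K)" and g: "g \<in> Arr (vect K)" and c: "c \<in> carrier K"
  shows "TensA (vect K) (Scale (vect K) c f) g = Scale (vect K) c (TensA (vect K) f g)"
proof -
  note m = Arr_vectD(1,2)[OF f] Arr_vectD(1,2)[OF g]
  interpret V: vspace K "src f" by (rule vspace.intro) (rule m)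
  interpret T: vspace K "tens (src f) (src g)" by (rule vspace.intro) (simp add: m)
  have cf: "Scale (vect K) c f \<in> Arr (vect K)"
    using V.linear_map_scale[OF m(2) Arr_vectD(3)[OF f] c] m by (simp add: Arr_vect)
  have ct: "Scale (vect K) c (TensA (vect K) f g) \<in> Arr (vect K)"
    using T.linear_map_scale[OF module_tensor[OF m(2,4)] _ c, of "dat (TensA (vect K) f g)"]
      Arr_vectD(3)[OF TensA_vect_arr[OF f g]] m by (simp add: Arr_vect)
  show ?thesis
  proof (rule tensor_arr_eqI[OF m(1,3)])
    fix x y assume xy: "x \<in> carrier (src f)" "y \<in> carrier (src g)"
    then show "dat (TensA (vect K) (Scale (vect K) c f) g) (pt (src f) (src g) x y) =
      dat (Scale (vect K) c (TensA (vect K) f g)) (pt (src f) (src g) x y)"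
      using TensA_vect_pt[OF cf g, of x y] TensA_vect_pt[OF f g, of x y] m c
        linear_closed[OF Arr_vectD(3)[OF f]] linear_closed[OF Arr_vectD(3)[OF g]]
      by (simp add: pt_rules[OF m(2,4)])
  qed (use cf ct f g in auto)
qed

text \<open>Over a field injective maps have linear retractions, and the tensor product of two
  retractions is a retraction. This keeps the structure maps of a tensor product of gliders
  injective.\<close>

lemma inj_TensA_vect:
  fixes f g :: "('k, 'u) vect_arrow"
  assumes f: "f \<in> Arr (vect K)" "inj_on (dat f) (carrier (src f))"
    and g: "g \<in> Arr (vect K)" "inj_on (dat g) (carrier (src g))"
  shows "inj_on (dat (TensA (vect K) f g)) (carrier (tens (src f) (src g)))"
proof -
  have retract: "\<exists>r. r \<in> Arr (vect K) \<and> src r = trg h \<and> trg r = src h \<and>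
      r \<star> h = Id (vect K) (src h)"
    if h: "h \<in> Arr (vect K)" "inj_on (dat h) (carrier (src h))" for h :: "('k, 'u) vect_arrow"
  proof -
    note m = Arr_vectD[OF h(1)]
    obtain r where r: "r \<in> linear_maps K (trg h) (src h)" "\<forall>x \<in> carrier (src h). r (dat h x) = x"
      using linear_retraction[OF field_axioms m(1,2,3) h(2)] by blast
    then show ?thesis
      using m by (intro exI[of _ "Arrow (trg h) r (src h)"]) (auto simp: Arr_vect intro!: arrow_eqI)
  qed
  obtain r where r: "r \<in> Arr (vect K)" "src r = trg f" "trg r = src f"
    "r \<star> f = Id (vect K) (src f)" using retract[OF f] by blast
  obtain r' where r': "r' \<in> Arr (vect K)" "src r' = trg g" "trg r' = src g"
    "r' \<star> g = Id (vect K) (src g)" using retract[OF g] by blast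
  have eq: "TensA (vect K) r r' \<star> TensA (vect K) f g = Id (vect K) (tens (src f) (src g))"
    using TensA_vect_Comp[of f r g r'] f g r r' by (simp add: TensA_vect_Id Arr_vectD)
  have "dat (TensA (vect K) r r') (dat (TensA (vect K) f g) x) = x"
    if "x \<in> carrier (tens (src f) (src g))" for x
    using arg_cong[OF eq, of "\<lambda>a. dat a x"] that by simp
  then show ?thesis by (rule inj_on_inverseI)
qed

lemma linear_pt_right:
  assumes "module K V" "module K W" "z \<in> carrier W"
  shows "(\<lambda>x \<in> carrier V. pt V W x z) \<in> linear_maps K V (tens V W)"
  using bilinear_pt[OF assms(1,2)] assms(3) by (simp add: bilinear_def)

lemma linear_pt_left:
  assumes "module K V" "module K W" "z \<in> carrier V"
  shows "(\<lambda>x \<in> carrier W. pt V W z x) \<in> linear_maps K W (tens V W)"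
  using bilinear_pt[OF assms(1,2)] assms(3) by (simp add: bilinear_def)

text \<open>The universal property is applied twice: with the third vector fixed it gives a linear
  map on the inner tensor product, and that map depends linearly on the third vector.\<close>

lemma Assoc_vect:
  assumes m: "module K V1" "module K V2" "module K V3"
  shows Assoc_vect_arr: "Assoc (vect K) V1 V2 V3 \<in> Arr (vect K)"
    and Assoc_vect_pt: "x \<in> carrier V1 \<Longrightarrow> y \<in> carrier V2 \<Longrightarrow> z \<in> carrier V3 \<Longrightarrow>
      dat (Assoc (vect K) V1 V2 V3) (pt (tens V1 V2) V3 (pt V1 V2 x y) z) =
      pt V1 (tens V2 V3) x (pt V2 V3 y z)"
proof -
  let ?T = "tens V1 (tens V2 V3)" and ?L = "tens V1 V2"
  interpret T: vspace K ?T by (rule vspace.intro) (simp add: m)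
  interpret L: vspace K ?L by (rule vspace.intro) (simp add: m)
  have m': "module K ?L" "module K (tens V2 V3)" "module K ?T" using m by auto
  let ?P = "\<lambda>h. h \<in> linear_maps K (tens ?L V3) ?T \<and>
           (\<forall>x \<in> carrier V1. \<forall>y \<in> carrier V2. \<forall>z \<in> carrier V3.
              h (pt ?L V3 (pt V1 V2 x y) z) = pt V1 (tens V2 V3) x (pt V2 V3 y z))"
  note b1 = pt_rules[OF m(1) m'(2)] and b2 = pt_rules[OF m(2,3)]
  have "\<exists>h. h \<in> linear_maps K ?L ?T \<and> (\<forall>x \<in> carrier V1. \<forall>y \<in> carrier V2.
      h (pt V1 V2 x y) = pt V1 (tens V2 V3) x (pt V2 V3 y z))" if z: "z \<in> carrier V3" for z
  proof -
    have "bilinear K V1 V2 ?T (\<lambda>x y. pt V1 (tens V2 V3) x (pt V2 V3 y z))"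
      by (rule bilinearI[OF _ _ _ _ _ m(1,2)]) (simp_all add: b1 b2 z)
    from tensor_lift[OF m(1,2) m'(3) this] show ?thesis by metis
  qed
  then obtain H where H: "\<And>z. z \<in> carrier V3 \<Longrightarrow> H z \<in> linear_maps K ?L ?T"
    "\<And>x y z. x \<in> carrier V1 \<Longrightarrow> y \<in> carrier V2 \<Longrightarrow> z \<in> carrier V3 \<Longrightarrow>
      H z (pt V1 V2 x y) = pt V1 (tens V2 V3) x (pt V2 V3 y z)" by metis
  interpret V3: module K V3 by (rule m)
  have "bilinear K ?L V3 ?T (\<lambda>t z. H z t)"
  proof (rule bilinearI[OF _ _ _ _ _ m'(1) m(3)])
    fix t z z' assume t: "t \<in> carrier ?L" and z: "z \<in> carrier V3" "z' \<in> carrier V3"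
    have zz: "z \<oplus>\<^bsub>V3\<^esub> z' \<in> carrier V3" using z by simp
    \<comment> \<open>Linearity in the parameter \<open>z\<close> is an equality of linear maps, so
      it may be checked on pure tensors.\<close>
    have "H (z \<oplus>\<^bsub>V3\<^esub> z') = (\<lambda>t \<in> carrier ?L. H z t \<oplus>\<^bsub>?T\<^esub> H z' t)"
      by (rule tensor_eqI[OF m(1,2) m'(3) H(1)[OF zz] L.linear_map_add[OF m'(3) H(1)[OF z(1)] H(1)[OF z(2)]]])
        (simp add: m H z b1 b2)
    then show "H (z \<oplus>\<^bsub>V3\<^esub> z') t = H z t \<oplus>\<^bsub>?T\<^esub> H z' t" using t by simp
  next
    fix c t z assume c: "c \<in> carrier K" and t: "t \<in> carrier ?L" and z: "z \<in> carrier V3"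
    have cz: "c \<odot>\<^bsub>V3\<^esub> z \<in> carrier V3" using c z by simp
    have "H (c \<odot>\<^bsub>V3\<^esub> z) = (\<lambda>t \<in> carrier ?L. c \<odot>\<^bsub>?T\<^esub> H z t)"
      by (rule tensor_eqI[OF m(1,2) m'(3) H(1)[OF cz] L.linear_map_scale[OF m'(3) H(1)[OF z] c]])
        (simp add: m H z b1 b2 c)
    then show "H (c \<odot>\<^bsub>V3\<^esub> z) t = c \<odot>\<^bsub>?T\<^esub> H z t" using t by simp
  qed (simp_all add: linear_closed[OF H(1)] linear_add[OF H(1)] linear_smult[OF H(1)])
  then obtain h where h: "h \<in> linear_maps K (tens ?L V3) ?T"
    "\<And>t z. t \<in> carrier ?L \<Longrightarrow> z \<in> carrier V3 \<Longrightarrow> h (pt ?L V3 t z) = H z t"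
    using tensor_lift[OF m'(1) m(3) m'(3)] by metis
  then have hP: "?P h" using H m by simp
  have uniq: "h' = h" if h': "?P h'" for h'
  proof (rule tensor_eqI[OF m'(1) m(3) m'(3)])
    fix t z assume t: "t \<in> carrier ?L" and z: "z \<in> carrier V3"
    note l = linear_pt_right[OF m'(1) m(3) z]
    have eq: "(\<lambda>t \<in> carrier ?L. h' ((\<lambda>t \<in> carrier ?L. pt ?L V3 t z) t)) =
      (\<lambda>t \<in> carrier ?L. h ((\<lambda>t \<in> carrier ?L. pt ?L V3 t z) t))"
    proof (rule tensor_eqI[OF m(1,2) m'(3)])
      show "(\<lambda>t \<in> carrier ?L. h' ((\<lambda>t \<in> carrier ?L. pt ?L V3 t z) t)) \<in> linear_maps K ?L ?T"
        using h' by (intro L.linear_map_comp[OF l]) blast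
      show "(\<lambda>t \<in> carrier ?L. h ((\<lambda>t \<in> carrier ?L. pt ?L V3 t z) t)) \<in> linear_maps K ?L ?T"
        using hP by (intro L.linear_map_comp[OF l]) blast
    qed (use h' hP z m in simp)
    show "h' (pt ?L V3 t z) = h (pt ?L V3 t z)" using fun_cong[OF eq, of t] t by simp
  qed (use h' hP in auto)
  have eq: "dat (Assoc (vect K) V1 V2 V3) = (THE h. ?P h)" by (simp add: vect_def)
  have P: "?P (dat (Assoc (vect K) V1 V2 V3))" unfolding eq by (rule theI[of ?P, OF hP uniq])
  then show "Assoc (vect K) V1 V2 V3 \<in> Arr (vect K)" using m by (simp add: Arr_vect)
  show "x \<in> carrier V1 \<Longrightarrow> y \<in> carrier V2 \<Longrightarrow> z \<in> carrier V3 \<Longrightarrow>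
      dat (Assoc (vect K) V1 V2 V3) (pt (tens V1 V2) V3 (pt V1 V2 x y) z) =
      pt V1 (tens V2 V3) x (pt V2 V3 y z)"
    using P by blast
qed

text \<open>With the last factor fixed both sides are linear on the inner tensor product, so
  uniqueness is applied twice.\<close>

lemma tensor3_arr_eqI:
  fixes f g :: "('k, 'u) vect_arrow"
  assumes m: "module K V1" "module K V2" "module K V3"
    and f: "f \<in> Arr (vect K)" "src f = tens (tens V1 V2) V3"
    and g: "g \<in> Arr (vect K)" "src g = tens (tens V1 V2) V3" "trg f = trg g"
    and eq: "\<And>x y z. x \<in> carrier V1 \<Longrightarrow> y \<in> carrier V2 \<Longrightarrow> z \<in> carrier V3 \<Longrightarrow>
      dat f (pt (tens V1 V2) V3 (pt V1 V2 x y) z) = dat g (pt (tens V1 V2) V3 (pt V1 V2 x y) z)"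
  shows "f = g"
proof (rule tensor_arr_eqI[OF module_tensor[OF m(1,2)] m(3) f(1) g(1) f(2) g(2,3)])
  fix t z assume t: "t \<in> carrier (tens V1 V2)" and z: "z \<in> carrier V3"
  let ?L = "tens V1 V2"
  interpret L: vspace K ?L by (rule vspace.intro) (simp add: m)
  let ?l = "\<lambda>t \<in> carrier ?L. pt ?L V3 t z"
  note l = linear_pt_right[OF module_tensor[OF m(1,2)] m(3) z]
  have eq': "(\<lambda>t \<in> carrier ?L. dat f (?l t)) = (\<lambda>t \<in> carrier ?L. dat g (?l t))"
  proof (rule tensor_eqI[OF m(1,2) Arr_vectD(2)[OF f(1)]])
    show "(\<lambda>t \<in> carrier ?L. dat f (?l t)) \<in> linear_maps K ?L (trg f)"
      by (rule L.linear_map_comp[OF l]) (use Arr_vectD(3)[OF f(1)] f in simp)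
    show "(\<lambda>t \<in> carrier ?L. dat g (?l t)) \<in> linear_maps K ?L (trg f)"
      by (rule L.linear_map_comp[OF l]) (use Arr_vectD(3)[OF g(1)] g in simp)
  qed (use eq z m in simp)
  show "dat f (pt ?L V3 t z) = dat g (pt ?L V3 t z)"
    using fun_cong[OF eq', of t] t by simp
qed

lemma LUnit_vect:
  assumes V: "module K V"
  shows LUnit_vect_arr: "LUnit (vect K) V \<in> Arr (vect K)"
    and LUnit_vect_pt: "a \<in> carrier S \<Longrightarrow> x \<in> carrier V \<Longrightarrow>
      dat (LUnit (vect K) V) (pt S V a x) = us a \<odot>\<^bsub>V\<^esub> x"
proof -
  interpret V: module K V by (rule V)
  let ?P = "\<lambda>h. h \<in> linear_maps K (tens S V) V \<and>
           (\<forall>c \<in> carrier K. \<forall>x \<in> carrier V. h (pt S V (sc c) x) = c \<odot>\<^bsub>V\<^esub> x)"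
  have "bilinear K S V V (\<lambda>a x. us a \<odot>\<^bsub>V\<^esub> x)"
    by (rule bilinearI[OF _ _ _ _ _ module_S V])
      (auto simp: carrier_S add_S smult_S V.smult_l_distr V.smult_r_distr V.smult_assoc1[symmetric] m_comm)
  then obtain h where "h \<in> linear_maps K (tens S V) V"
    "\<And>a x. a \<in> carrier S \<Longrightarrow> x \<in> carrier V \<Longrightarrow> h (pt S V a x) = us a \<odot>\<^bsub>V\<^esub> x"
    using tensor_lift[OF module_S V V] by metis
  then have h: "?P h" by simp
  have uniq: "h' = h" if "?P h'" for h'
    by (rule tensor_eqI[OF module_S V V]) (use h that in \<open>auto simp: carrier_S\<close>)
  have eq: "dat (LUnit (vect K) V) = (THE h. ?P h)" by (simp add: vect_def)
  have P: "?P (dat (LUnit (vect K) V))" unfolding eq by (rule theI[of ?P, OF h uniq])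
  then show "LUnit (vect K) V \<in> Arr (vect K)" using V module_S by (simp add: Arr_vect)
  show "a \<in> carrier S \<Longrightarrow> x \<in> carrier V \<Longrightarrow> dat (LUnit (vect K) V) (pt S V a x) = us a \<odot>\<^bsub>V\<^esub> x"
    using P by (auto simp: carrier_S)
qed

lemma RUnit_vect:
  assumes V: "module K V"
  shows RUnit_vect_arr: "RUnit (vect K) V \<in> Arr (vect K)"
    and RUnit_vect_pt: "a \<in> carrier S \<Longrightarrow> x \<in> carrier V \<Longrightarrow>
      dat (RUnit (vect K) V) (pt V S x a) = us a \<odot>\<^bsub>V\<^esub> x"
proof -
  interpret V: module K V by (rule V)
  let ?P = "\<lambda>h. h \<in> linear_maps K (tens V S) V \<and>
           (\<forall>c \<in> carrier K. \<forall>x \<in> carrier V. h (pt V S x (sc c)) = c \<odot>\<^bsub>V\<^esub> x)"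
  have "bilinear K V S V (\<lambda>x a. us a \<odot>\<^bsub>V\<^esub> x)"
    by (rule bilinearI[OF _ _ _ _ _ V module_S])
      (auto simp: carrier_S add_S smult_S V.smult_l_distr V.smult_r_distr V.smult_assoc1[symmetric] m_comm)
  then obtain h where "h \<in> linear_maps K (tens V S) V"
    "\<And>x a. x \<in> carrier V \<Longrightarrow> a \<in> carrier S \<Longrightarrow> h (pt V S x a) = us a \<odot>\<^bsub>V\<^esub> x"
    using tensor_lift[OF V module_S V] by metis
  then have h: "?P h" by simp
  have uniq: "h' = h" if "?P h'" for h'
    by (rule tensor_eqI[OF V module_S V]) (use h that in \<open>auto simp: carrier_S\<close>)
  have eq: "dat (RUnit (vect K) V) = (THE h. ?P h)" by (simp add: vect_def)
  have P: "?P (dat (RUnit (vect K) V))" unfolding eq by (rule theI[of ?P, OF h uniq])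
  then show "RUnit (vect K) V \<in> Arr (vect K)" using V module_S by (simp add: Arr_vect)
  show "a \<in> carrier S \<Longrightarrow> x \<in> carrier V \<Longrightarrow> dat (RUnit (vect K) V) (pt V S x a) = us a \<odot>\<^bsub>V\<^esub> x"
    using P by (auto simp: carrier_S)
qed

lemma finitely_generatedI:
  assumes "module K V" "finite A" "A \<subseteq> carrier V"
    "\<And>H. submodule H K V \<Longrightarrow> A \<subseteq> H \<Longrightarrow> carrier V \<subseteq> H"
  shows "finitely_generated K V"
proof -
  interpret V: vspace K V by (rule vspace.intro) fact
  have "V.span A \<subseteq> carrier V" using V.submodule_span[OF assms(3)] by (simp add: V.submodule_iff)
  moreover have "carrier V \<subseteq> V.span A"
    using assms(4)[OF V.submodule_span[OF assms(3)] V.span_superset] .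
  ultimately show ?thesis unfolding finitely_generated_def using assms(2,3) by blast
qed

text \<open>A subspace \<open>H\<close> that contains the products of generators is pulled back
  along tensoring with a fixed vector; the preimage is a subspace containing the generators, first
  in one variable and then in the other.\<close>

lemma finitely_generated_tensor:
  assumes V: "module K V" and W: "module K W"
    and "finitely_generated K V" "finitely_generated K W"
  shows "finitely_generated K (tens V W)"
proof -
  interpret V: vspace K V by (rule vspace.intro) fact
  interpret W: vspace K W by (rule vspace.intro) fact
  note T = module_tensor[OF V W]
  obtain A B where A: "finite A" "A \<subseteq> carrier V" "V.span A = carrier V"
    and B: "finite B" "B \<subseteq> carrier W" "W.span B = carrier W"
    using assms(3,4) by (auto simp: finitely_generated_def)
  show ?thesis
  proof (rule finitely_generatedI[OF T])
    show "finite ((\<lambda>(x, y). pt V W x y) ` (A \<times> B))" using A B by simp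
    show "(\<lambda>(x, y). pt V W x y) ` (A \<times> B) \<subseteq> carrier (tens V W)"
      using A B V W by (auto simp: subset_iff)
    fix H assume H: "submodule H K (tens V W)" "(\<lambda>(x, y). pt V W x y) ` (A \<times> B) \<subseteq> H"
    have 1: "pt V W x y \<in> H" if x: "x \<in> carrier V" and y: "y \<in> B" for x y
    proof -
      have yW: "y \<in> carrier W" using y B by auto
      have "V.span A \<subseteq> {x \<in> carrier V. (\<lambda>x \<in> carrier V. pt V W x y) x \<in> H}"
        by (rule V.span_least[OF V.linear_map_vimage_submodule[OF T linear_pt_right[OF V W yW] H(1)]])
          (use A H y in auto)
      then show ?thesis using x A by auto
    qed
    have "pt V W x y \<in> H" if x: "x \<in> carrier V" and y: "y \<in> carrier W" for x y
    proof -
      have "W.span B \<subseteq> {y \<in> carrier W. (\<lambda>y \<in> carrier W. pt V W x y) y \<in> H}"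
        by (rule W.span_least[OF W.linear_map_vimage_submodule[OF T linear_pt_left[OF V W x] H(1)]])
          (use B 1 x in auto)
      then show ?thesis using y B by auto
    qed
    then show "carrier (tens V W) \<subseteq> H" using tensor_submodule[OF V W H(1)] by simp
  qed
qed

lemma noetherian_iff_finitely_generated:
  assumes "module K V"
  shows "noetherian_space K V \<longleftrightarrow> finitely_generated K V"
  using noetherian_imp_finitely_generated[OF assms] finitely_generated_imp_noetherian[OF field_axioms assms]
  by blast

end

section \<open>Gliders as representations\<close>

context vspace
begin

section \<open>Group algebras, and gliders as families of group actions\<close>

lemma finsum_swap:
  assumes "finite A" "finite B" "\<And>i j. i \<in> A \<Longrightarrow> j \<in> B \<Longrightarrow> f i j \<in> carrier M"
  shows "(\<Oplus>\<^bsub>M\<^esub> i \<in> A. \<Oplus>\<^bsub>M\<^esub> j \<in> B. f i j) = (\<Oplus>\<^bsub>M\<^esub> j \<in> B. \<Oplus>\<^bsub>M\<^esub> i \<in> A. f i j)"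
  using assms(1,3)
proof (induction A)
  case (insert a A)
  have "(\<Oplus>\<^bsub>M\<^esub> j \<in> B. \<Oplus>\<^bsub>M\<^esub> i \<in> insert a A. f i j) =
    (\<Oplus>\<^bsub>M\<^esub> j \<in> B. f a j \<oplus>\<^bsub>M\<^esub> (\<Oplus>\<^bsub>M\<^esub> i \<in> A. f i j))"
    using insert by (intro M.finsum_cong') (auto simp: Pi_iff)
  also have "\<dots> = (\<Oplus>\<^bsub>M\<^esub> j \<in> B. f a j) \<oplus>\<^bsub>M\<^esub> (\<Oplus>\<^bsub>M\<^esub> j \<in> B. \<Oplus>\<^bsub>M\<^esub> i \<in> A. f i j)"
    using insert by (intro M.finsum_addf) (auto intro!: M.finsum_closed)
  finally show ?case using insert by (simp add: Pi_iff)
qed (simp add: M.finsum_zero)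

lemma finsum_smult_scalars:
  assumes "finite A" "\<And>i. i \<in> A \<Longrightarrow> c i \<in> carrier R" "x \<in> carrier M"
  shows "(\<Oplus>\<^bsub>R\<^esub> i \<in> A. c i) \<odot>\<^bsub>M\<^esub> x = (\<Oplus>\<^bsub>M\<^esub> i \<in> A. c i \<odot>\<^bsub>M\<^esub> x)"
  using assms
proof (induction A)
  case (insert a A)
  then show ?case by (simp add: Pi_iff smult_l_distr)
qed simp

lemma linear_combination:
  assumes N: "module R N" and "finite A" "\<And>i. i \<in> A \<Longrightarrow> c i \<in> carrier R"
    "\<And>i. i \<in> A \<Longrightarrow> f i \<in> linear_maps R M N"
  shows "(\<lambda>x \<in> carrier M. \<Oplus>\<^bsub>N\<^esub> i \<in> A. c i \<odot>\<^bsub>N\<^esub> f i x) \<in> linear_maps R M N"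
proof -
  interpret N: vspace R N by (rule vspace.intro) fact
  show ?thesis
    using assms(2-)
  proof (induction A)
    case empty
    have "(\<lambda>x \<in> carrier M. \<Oplus>\<^bsub>N\<^esub> i \<in> {}. c i \<odot>\<^bsub>N\<^esub> f i x) = (\<lambda>x \<in> carrier M. \<zero>\<^bsub>N\<^esub>)"
      by (intro restrict_ext) simp
    then show ?case using linear_map_zero_map[OF N] by (simp only:)
  next
    case (insert a A)
    note cl = linear_closed[OF insert.prems(2)]
    have e: "(\<lambda>x \<in> carrier M. \<Oplus>\<^bsub>N\<^esub> i \<in> insert a A. c i \<odot>\<^bsub>N\<^esub> f i x) =
      (\<lambda>x \<in> carrier M. (\<lambda>x \<in> carrier M. c a \<odot>\<^bsub>N\<^esub> f a x) x \<oplus>\<^bsub>N\<^esub>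
        (\<lambda>x \<in> carrier M. \<Oplus>\<^bsub>N\<^esub> i \<in> A. c i \<odot>\<^bsub>N\<^esub> f i x) x)"
      using insert.hyps insert.prems(1) cl by (intro restrict_ext) (simp add: Pi_iff)
    show ?case
      unfolding e by (intro linear_map_add[OF N] linear_map_scale[OF N] insert.IH insert.prems) simp_all
  qed
qed

end

locale gliders = vector_spaces K U + G: group G
  for K :: "('k, 'm) ring_scheme" (structure) and U :: "'u itself" and G :: "('g, 'n) monoid_scheme" +
  assumes fin: "finite (carrier G)"
begin

abbreviation one_G ("\<one>\<^sub>G") where "\<one>\<^sub>G \<equiv> \<one>\<^bsub>G\<^esub>"

abbreviation B :: "('k, 'g \<Rightarrow> 'k) bialgebra" where "B \<equiv> group_bialgebra K G"
abbreviation Fl :: "int \<Rightarrow> ('g \<Rightarrow> 'k) set" where "Fl \<equiv> one_step_filtration K B"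
abbreviation Cc :: "('k, index, 'g \<Rightarrow> 'k) lin_category" where "Cc \<equiv> filtered_companion {-1, 0} B Fl"
abbreviation bv :: "'g \<Rightarrow> 'g \<Rightarrow> 'k" where "bv \<equiv> basis_vector K G"

lemma carrier_B: "carrier B = carrier G \<rightarrow>\<^sub>E carrier K"
  and zero_B: "\<zero>\<^bsub>B\<^esub> = (\<lambda>g \<in> carrier G. \<zero>)"
  and one_B: "\<one>\<^bsub>B\<^esub> = bv \<one>\<^sub>G"
  and add_B: "b \<oplus>\<^bsub>B\<^esub> b' = (\<lambda>g \<in> carrier G. b g \<oplus> b' g)"
  and smult_B: "c \<odot>\<^bsub>B\<^esub> b = (\<lambda>g \<in> carrier G. c \<otimes> b g)"
  and mult_B: "b \<otimes>\<^bsub>B\<^esub> b' = (\<lambda>g \<in> carrier G. \<Oplus> h \<in> carrier G. b h \<otimes> b' (inv\<^bsub>G\<^esub> h \<otimes>\<^bsub>G\<^esub> g))"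
  by (simp_all add: group_bialgebra_def)

lemma B_apply [simp]: "b \<in> carrier B \<Longrightarrow> g \<in> carrier G \<Longrightarrow> b g \<in> carrier K"
  by (auto simp: carrier_B)

lemma bv_in [simp]: "bv g \<in> carrier B"
  by (auto simp: carrier_B basis_vector_def)

lemma bv_apply: "h \<in> carrier G \<Longrightarrow> bv g h = (if h = g then \<one> else \<zero>)"
  by (simp add: basis_vector_def)

abbreviation lo :: index where "lo \<equiv> Fin (-1)"
abbreviation hi :: index where "hi \<equiv> Fin 0"

definition IX :: "index set" where "IX = {Infty, lo, hi}"

text \<open>The hom space \<open>Hom(u, v)\<close> is spanned by the group elements in \<open>hs u v\<close>, so
  a glider is a representation of the category with hom sets \<open>hs u v\<close>.\<close>

definition hs :: "index \<Rightarrow> index \<Rightarrow> 'g set" where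
  "hs u v = (if v = Infty \<or> u = lo \<and> v = hi then carrier G
     else if u = v then {\<one>\<^sub>G} else {})"

lemma IX_mem [simp]: "Infty \<in> IX" "hi \<in> IX" "lo \<in> IX"
  by (simp_all add: IX_def)

lemma IX_cases [consumes 1]: "u \<in> IX \<Longrightarrow> (u = Infty \<Longrightarrow> P) \<Longrightarrow> (u = lo \<Longrightarrow> P) \<Longrightarrow> (u = hi \<Longrightarrow> P) \<Longrightarrow> P"
  by (auto simp: IX_def)

lemma hs_subset: "hs u v \<subseteq> carrier G"
  by (auto simp: hs_def)

lemma hs_G [simp]: "g \<in> hs u v \<Longrightarrow> g \<in> carrier G"
  using hs_subset by blast

lemma finite_hs [simp]: "finite (hs u v)"
  using fin hs_subset finite_subset by blast

lemma hs_one [simp]: "\<one>\<^sub>G \<in> hs u u"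
  by (auto simp: hs_def)

lemma hs_comp: "u \<in> IX \<Longrightarrow> v \<in> IX \<Longrightarrow> w \<in> IX \<Longrightarrow> g \<in> hs u v \<Longrightarrow> h \<in> hs v w \<Longrightarrow> h \<otimes>\<^bsub>G\<^esub> g \<in> hs u w"
  by (elim IX_cases) (auto simp: hs_def simp del: hs_G)

lemma hs_le: "u \<in> IX \<Longrightarrow> v \<in> IX \<Longrightarrow> index_le u v \<Longrightarrow> \<one>\<^sub>G \<in> hs u v"
  by (elim IX_cases) (auto simp: hs_def simp del: hs_G)

lemma hs_simps [simp]: "hs u Infty = carrier G" "hs lo hi = carrier G"
  "hs (Fin i) (Fin i) = {\<one>\<^sub>G}" "hs hi lo = {}" "hs Infty (Fin i) = {}"
  by (auto simp: hs_def simp del: hs_G)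

text \<open>Functions supported on \<open>hs u v\<close>: one formula for the zero space, the
  scalars and the whole group algebra.\<close>

definition hom_space :: "index \<Rightarrow> index \<Rightarrow> ('g \<Rightarrow> 'k) set" where
  "hom_space u v = {b \<in> carrier B. \<forall>g \<in> carrier G. g \<notin> hs u v \<longrightarrow> b g = \<zero>}"

lemma glider_hom_eq:
  assumes "u \<in> IX" "v \<in> IX"
  shows "glider_hom B Fl u v = hom_space u v"
proof -
  have zero: "hom_space u v = {\<zero>\<^bsub>B\<^esub>}" if "hs u v = {}" for u v
    unfolding hom_space_def zero_B that by (auto simp: carrier_B PiE_iff intro!: extensionalityI[of _ "carrier G"])
  have one: "hom_space u v = {c \<odot>\<^bsub>B\<^esub> \<one>\<^bsub>B\<^esub> | c. c \<in> carrier K}" if "hs u v = {\<one>\<^sub>G}" for u v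
  proof (intro equalityI subsetI)
    fix b assume b: "b \<in> hom_space u v"
    then have "b = b \<one>\<^sub>G \<odot>\<^bsub>B\<^esub> \<one>\<^bsub>B\<^esub>" unfolding hom_space_def that
      by (intro extensionalityI[of _ "carrier G"]) (auto simp: carrier_B PiE_iff smult_B one_B bv_apply)
    moreover have "b \<one>\<^sub>G \<in> carrier K" using b by (simp add: hom_space_def)
    ultimately show "b \<in> {c \<odot>\<^bsub>B\<^esub> \<one>\<^bsub>B\<^esub> | c. c \<in> carrier K}" by blast
  qed (auto simp: hom_space_def that smult_B one_B bv_apply carrier_B)
  have all: "hom_space u v = carrier B" if "hs u v = carrier G" for u v
    using that by (auto simp: hom_space_def)
  show ?thesis
    using assms
    by (elim IX_cases) (simp_all add: one_step_filtration_def zero one all)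
qed

lemma Obj_Cc [simp]: "Obj Cc = IX"
  by (auto simp: filtered_companion_def Let_def IX_def)

lemma Arr_Cc: "f \<in> Arr Cc \<longleftrightarrow> src f \<in> IX \<and> trg f \<in> IX \<and> dat f \<in> hom_space (src f) (trg f)"
proof -
  have I: "insert Infty (Fin ` {-1, 0}) = IX" by (auto simp: IX_def)
  show ?thesis
    unfolding filtered_companion_def Let_def I using glider_hom_eq by (cases f) auto
qed

lemma Cc_sel [simp]:
  "Id Cc u = Arrow u \<one>\<^bsub>B\<^esub> u"
  "g \<cdot>\<^bsub>Cc\<^esub> f = Arrow (src f) (dat g \<otimes>\<^bsub>B\<^esub> dat f) (trg g)"
  "Add Cc f g = Arrow (src f) (dat f \<oplus>\<^bsub>B\<^esub> dat g) (trg f)"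
  "Scale Cc c f = Arrow (src f) (c \<odot>\<^bsub>B\<^esub> dat f) (trg f)"
  by (simp_all add: filtered_companion_def Let_def)

lemma hom_space_B: "b \<in> hom_space u v \<Longrightarrow> b \<in> carrier B"
  by (simp add: hom_space_def)

lemma bv_hom [simp]: "g \<in> hs u v \<Longrightarrow> bv g \<in> hom_space u v"
  by (auto simp: hom_space_def bv_apply)

text \<open>A nonzero term of the convolution at \<open>g\<close> writes \<open>g\<close> as a
  product of elements of the two hom sets, which are closed under composition.\<close>

lemma hom_space_mult:
  assumes u: "u \<in> IX" "v \<in> IX" "w \<in> IX" and b: "b \<in> hom_space u v" "b' \<in> hom_space v w"
  shows "b' \<otimes>\<^bsub>B\<^esub> b \<in> hom_space u w"
proof -
  note bB = hom_space_B[OF b(1)] hom_space_B[OF b(2)]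
  have "(\<Oplus> h \<in> carrier G. b' h \<otimes> b (inv\<^bsub>G\<^esub> h \<otimes>\<^bsub>G\<^esub> g)) = \<zero>" if g: "g \<in> carrier G" "g \<notin> hs u w" for g
  proof -
    have "b' h \<otimes> b (inv\<^bsub>G\<^esub> h \<otimes>\<^bsub>G\<^esub> g) = \<zero>" if h: "h \<in> carrier G" for h
    proof (cases "h \<in> hs v w \<and> inv\<^bsub>G\<^esub> h \<otimes>\<^bsub>G\<^esub> g \<in> hs u v")
      case True
      then have "h \<otimes>\<^bsub>G\<^esub> (inv\<^bsub>G\<^esub> h \<otimes>\<^bsub>G\<^esub> g) \<in> hs u w" using hs_comp u by blast
      then show ?thesis using g h by (simp add: G.m_assoc[symmetric])
    next
      case False
      then show ?thesis using b bB h g by (auto simp: hom_space_def)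
    qed
    then show ?thesis by (rule add.finprod_one_eqI)
  qed
  then show ?thesis
    using bB by (auto simp: hom_space_def mult_B carrier_B intro!: finsum_closed)
qed

lemma hom_space_add: "b \<in> hom_space u v \<Longrightarrow> b' \<in> hom_space u v \<Longrightarrow> b \<oplus>\<^bsub>B\<^esub> b' \<in> hom_space u v"
  and hom_space_smult: "c \<in> carrier K \<Longrightarrow> b \<in> hom_space u v \<Longrightarrow> c \<odot>\<^bsub>B\<^esub> b \<in> hom_space u v"
  and hom_space_zero: "\<zero>\<^bsub>B\<^esub> \<in> hom_space u v"
  and hom_space_one: "\<one>\<^bsub>B\<^esub> \<in> hom_space u u"
proof -
  have "\<one>\<^sub>G \<in> hs u u" by simp
  then show "\<one>\<^bsub>B\<^esub> \<in> hom_space u u" unfolding one_B by (rule bv_hom)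
qed (auto simp: hom_space_def add_B smult_B zero_B carrier_B)

lemma bv_mult:
  assumes "g \<in> carrier G" "h \<in> carrier G"
  shows "bv h \<otimes>\<^bsub>B\<^esub> bv g = bv (h \<otimes>\<^bsub>G\<^esub> g)"
proof (rule extensionalityI[of _ "carrier G"])
  fix k assume k: "k \<in> carrier G"
  have "(\<Oplus> i \<in> carrier G. bv h i \<otimes> bv g (inv\<^bsub>G\<^esub> i \<otimes>\<^bsub>G\<^esub> k)) =
    (\<Oplus> i \<in> carrier G. if h = i then bv g (inv\<^bsub>G\<^esub> h \<otimes>\<^bsub>G\<^esub> k) else \<zero>)"
    using assms k by (intro finsum_cong') (auto simp: bv_apply)
  also have "\<dots> = bv g (inv\<^bsub>G\<^esub> h \<otimes>\<^bsub>G\<^esub> k)"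
    using finsum_singleton[of h "carrier G" "\<lambda>_. bv g (inv\<^bsub>G\<^esub> h \<otimes>\<^bsub>G\<^esub> k)"] assms k fin by (simp add: bv_apply)
  also have "\<dots> = bv (h \<otimes>\<^bsub>G\<^esub> g) k"
    using assms k by (auto simp: bv_apply G.inv_solve_left')
  finally show "(bv h \<otimes>\<^bsub>B\<^esub> bv g) k = bv (h \<otimes>\<^bsub>G\<^esub> g) k" using k by (simp add: mult_B)
qed (simp_all add: mult_B basis_vector_def)

definition glider_rep :: "(index \<Rightarrow> ('k, 'u) module) \<Rightarrow> (index \<Rightarrow> 'g \<Rightarrow> index \<Rightarrow> 'u \<Rightarrow> 'u) \<Rightarrow> bool" where
  "glider_rep V act \<longleftrightarrow> (\<forall>u \<in> IX. module K (V u)) \<and>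
     (\<forall>u \<in> IX. \<forall>v \<in> IX. \<forall>g \<in> hs u v. act u g v \<in> linear_maps K (V u) (V v)) \<and>
     (\<forall>u \<in> IX. \<forall>x \<in> carrier (V u). act u \<one>\<^sub>G u x = x) \<and>
     (\<forall>u \<in> IX. \<forall>v \<in> IX. \<forall>w \<in> IX. \<forall>g \<in> hs u v. \<forall>h \<in> hs v w. \<forall>x \<in> carrier (V u).
        act v h w (act u g v x) = act u (h \<otimes>\<^bsub>G\<^esub> g) w x) \<and>
     (\<forall>u \<in> IX. \<forall>v \<in> IX. index_le u v \<longrightarrow> inj_on (act u \<one>\<^sub>G v) (carrier (V u)))"

definition rep_sum :: "(index \<Rightarrow> ('k, 'u) module) \<Rightarrow> (index \<Rightarrow> 'g \<Rightarrow> index \<Rightarrow> 'u \<Rightarrow> 'u) \<Rightarrow>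
    index \<Rightarrow> ('g \<Rightarrow> 'k) \<Rightarrow> index \<Rightarrow> 'u \<Rightarrow> 'u" where
  "rep_sum V act u b v = (\<lambda>x \<in> carrier (V u). \<Oplus>\<^bsub>V v\<^esub> g \<in> hs u v. b g \<odot>\<^bsub>V v\<^esub> act u g v x)"

definition mk_glider :: "(index \<Rightarrow> ('k, 'u) module) \<Rightarrow> (index \<Rightarrow> 'g \<Rightarrow> index \<Rightarrow> 'u \<Rightarrow> 'u) \<Rightarrow>
    ('k, 'u, 'g \<Rightarrow> 'k) glider" where
  "mk_glider V act = \<lparr>ObjMap = restrict V IX, ArrMap = (\<lambda>f \<in> Arr Cc.
     Arrow (V (src f)) (rep_sum V act (src f) (dat f) (trg f)) (V (trg f)))\<rparr>"

lemma glider_repD: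
  assumes "glider_rep V act" "u \<in> IX" "v \<in> IX"
  shows "module K (V u)" "g \<in> hs u v \<Longrightarrow> act u g v \<in> linear_maps K (V u) (V v)"
    "x \<in> carrier (V u) \<Longrightarrow> act u \<one>\<^sub>G u x = x"
    "w \<in> IX \<Longrightarrow> g \<in> hs u v \<Longrightarrow> h \<in> hs v w \<Longrightarrow> x \<in> carrier (V u) \<Longrightarrow>
      act v h w (act u g v x) = act u (h \<otimes>\<^bsub>G\<^esub> g) w x"
    "index_le u v \<Longrightarrow> inj_on (act u \<one>\<^sub>G v) (carrier (V u))"
    "g \<in> hs u v \<Longrightarrow> x \<in> carrier (V u) \<Longrightarrow> act u g v x \<in> carrier (V v)"
proof -
  note r = assms(1)[unfolded glider_rep_def]
  show "module K (V u)" and lin: "g \<in> hs u v \<Longrightarrow> act u g v \<in> linear_maps K (V u) (V v)"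
    "x \<in> carrier (V u) \<Longrightarrow> act u \<one>\<^sub>G u x = x"
    "w \<in> IX \<Longrightarrow> g \<in> hs u v \<Longrightarrow> h \<in> hs v w \<Longrightarrow> x \<in> carrier (V u) \<Longrightarrow>
      act v h w (act u g v x) = act u (h \<otimes>\<^bsub>G\<^esub> g) w x"
    "index_le u v \<Longrightarrow> inj_on (act u \<one>\<^sub>G v) (carrier (V u))"
    using r assms(2,3) by simp_all
  show "g \<in> hs u v \<Longrightarrow> x \<in> carrier (V u) \<Longrightarrow> act u g v x \<in> carrier (V v)"
    by (rule linear_closed[OF lin(1)])
qed

lemma rep_sum_apply: "x \<in> carrier (V u) \<Longrightarrow>
    rep_sum V act u b v x = (\<Oplus>\<^bsub>V v\<^esub> g \<in> hs u v. b g \<odot>\<^bsub>V v\<^esub> act u g v x)"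
  by (simp add: rep_sum_def)

lemma rep_sum_linear:
  assumes r: "glider_rep V act" "u \<in> IX" "v \<in> IX" and b: "b \<in> carrier B"
  shows "rep_sum V act u b v \<in> linear_maps K (V u) (V v)"
proof -
  interpret V: vspace K "V u" by (rule vspace.intro) (rule glider_repD[OF r])
  show ?thesis
    unfolding rep_sum_def
    by (rule V.linear_combination[OF glider_repD(1)[OF r(1,3,3)] finite_hs])
      (use b glider_repD(2)[OF r] in auto)
qed

lemma rep_sum_bv:
  assumes r: "glider_rep V act" "u \<in> IX" "v \<in> IX" and g: "g \<in> hs u v"
  shows "rep_sum V act u (bv g) v = act u g v"
proof (rule linear_eqI[OF rep_sum_linear[OF r bv_in] glider_repD(2)[OF r g]])
  interpret W: module K "V v" by (rule glider_repD(1)[OF r(1,3,3)])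
  fix x assume x: "x \<in> carrier (V u)"
  note cl = glider_repD(6)[OF r _ x]
  have "rep_sum V act u (bv g) v x = (\<Oplus>\<^bsub>V v\<^esub> h \<in> hs u v. if g = h then act u h v x else \<zero>\<^bsub>V v\<^esub>)"
    unfolding rep_sum_def using x cl g by (simp, intro W.M.finsum_cong') (auto simp: bv_apply)
  also have "\<dots> = act u g v x"
    using W.M.finsum_singleton[of g "hs u v" "\<lambda>h. act u h v x"] g cl by simp
  finally show "rep_sum V act u (bv g) v x = act u g v x" .
qed

text \<open>The linear extension turns convolution into composition: exchange the two sums and
  substitute a product for the outer group element.\<close>

lemma rep_sum_comp:
  assumes r: "glider_rep V act" and I: "u \<in> IX" "v \<in> IX" "w \<in> IX"
    and b: "b \<in> hom_space u v" "b' \<in> hom_space v w" and x: "x \<in> carrier (V u)"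
  shows "rep_sum V act u (b' \<otimes>\<^bsub>B\<^esub> b) w x = rep_sum V act v b' w (rep_sum V act u b v x)"
proof -
  interpret W: vspace K "V v" by (rule vspace.intro) (rule glider_repD(1)[OF r I(2,2)])
  interpret Z: vspace K "V w" by (rule vspace.intro) (rule glider_repD(1)[OF r I(3,3)])
  note bB [simp] = hom_space_B[OF b(1)] hom_space_B[OF b(2)]
  \<comment> \<open>The action is extended by zero outside the hom set, so that all sums may range
    over the whole group while they are rearranged.\<close>
  define A where "A g = (if g \<in> hs u w then act u g w x else \<zero>\<^bsub>V w\<^esub>)" for g
  have A0: "A g = \<zero>\<^bsub>V w\<^esub>" if "g \<notin> hs u w" for g using that by (simp add: A_def)
  have A [simp]: "A g \<in> carrier (V w)" for g using glider_repD(6)[OF r I(1,3) _ x] by (simp add: A_def)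
  have [simp]: "b (inv\<^bsub>G\<^esub> h \<otimes>\<^bsub>G\<^esub> k) \<in> carrier K" "b' h \<in> carrier K" "b h \<in> carrier K"
    if "h \<in> carrier G" "k \<in> carrier G" for h k using that by auto
  have b'h: "b' h \<in> carrier K" "b h \<in> carrier K" if "h \<in> carrier G" for h using that by auto
  have "rep_sum V act u (b' \<otimes>\<^bsub>B\<^esub> b) w x =
    (\<Oplus>\<^bsub>V w\<^esub> k \<in> hs u w. (\<Oplus> h \<in> carrier G. b' h \<otimes> b (inv\<^bsub>G\<^esub> h \<otimes>\<^bsub>G\<^esub> k)) \<odot>\<^bsub>V w\<^esub> A k)"
    unfolding rep_sum_apply[of x V u, OF x]
  proof (rule Z.M.finsum_cong')
    fix k assume k: "k \<in> hs u w"
    then show "(b' \<otimes>\<^bsub>B\<^esub> b) k \<odot>\<^bsub>V w\<^esub> act u k w x =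
      (\<Oplus> h \<in> carrier G. b' h \<otimes> b (inv\<^bsub>G\<^esub> h \<otimes>\<^bsub>G\<^esub> k)) \<odot>\<^bsub>V w\<^esub> A k" by (simp add: mult_B A_def)
  next
    show "(\<lambda>k. (\<Oplus> h \<in> carrier G. b' h \<otimes> b (inv\<^bsub>G\<^esub> h \<otimes>\<^bsub>G\<^esub> k)) \<odot>\<^bsub>V w\<^esub> A k)
      \<in> hs u w \<rightarrow> carrier (V w)"
      by (intro funcsetI Z.smult_closed A finsum_closed) auto
  qed simp
  also have "\<dots> = (\<Oplus>\<^bsub>V w\<^esub> k \<in> carrier G. (\<Oplus> h \<in> carrier G. b' h \<otimes> b (inv\<^bsub>G\<^esub> h \<otimes>\<^bsub>G\<^esub> k)) \<odot>\<^bsub>V w\<^esub> A k)"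
    by (rule Z.M.add.finprod_mono_neutral_cong_left[OF fin hs_subset])
      (auto simp: A0 intro!: Z.smult_closed finsum_closed)
  also have "\<dots> = (\<Oplus>\<^bsub>V w\<^esub> k \<in> carrier G. \<Oplus>\<^bsub>V w\<^esub> h \<in> carrier G. (b' h \<otimes> b (inv\<^bsub>G\<^esub> h \<otimes>\<^bsub>G\<^esub> k)) \<odot>\<^bsub>V w\<^esub> A k)"
    by (intro Z.M.finsum_cong') (auto simp: Z.finsum_smult_scalars fin intro!: Z.M.finsum_closed)
  also have "\<dots> = (\<Oplus>\<^bsub>V w\<^esub> h \<in> carrier G. \<Oplus>\<^bsub>V w\<^esub> k \<in> carrier G. (b' h \<otimes> b (inv\<^bsub>G\<^esub> h \<otimes>\<^bsub>G\<^esub> k)) \<odot>\<^bsub>V w\<^esub> A k)"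
    by (rule Z.finsum_swap[OF fin fin]) auto
  \<comment> \<open>Left multiplication by \<open>h\<close> permutes the group, so \<open>k\<close>
    may be replaced by the product of \<open>h\<close> and \<open>g\<close>.\<close>
  also have "\<dots> = (\<Oplus>\<^bsub>V w\<^esub> h \<in> carrier G. \<Oplus>\<^bsub>V w\<^esub> g \<in> carrier G. (b' h \<otimes> b g) \<odot>\<^bsub>V w\<^esub> A (h \<otimes>\<^bsub>G\<^esub> g))"
  proof (rule Z.M.finsum_cong')
    fix h assume h: "h \<in> carrier G"
    have img: "(\<otimes>\<^bsub>G\<^esub>) h ` carrier G = carrier G"
    proof
      show "carrier G \<subseteq> (\<otimes>\<^bsub>G\<^esub>) h ` carrier G"
      proof
        fix k assume "k \<in> carrier G"
        then show "k \<in> (\<otimes>\<^bsub>G\<^esub>) h ` carrier G"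
          using h by (intro image_eqI[where x = "inv\<^bsub>G\<^esub> h \<otimes>\<^bsub>G\<^esub> k"]) (auto simp flip: G.m_assoc)
      qed
    qed (use h in auto)
    have "(\<Oplus>\<^bsub>V w\<^esub> k \<in> (\<otimes>\<^bsub>G\<^esub>) h ` carrier G. (b' h \<otimes> b (inv\<^bsub>G\<^esub> h \<otimes>\<^bsub>G\<^esub> k)) \<odot>\<^bsub>V w\<^esub> A k) =
      (\<Oplus>\<^bsub>V w\<^esub> g \<in> carrier G. (b' h \<otimes> b (inv\<^bsub>G\<^esub> h \<otimes>\<^bsub>G\<^esub> (h \<otimes>\<^bsub>G\<^esub> g))) \<odot>\<^bsub>V w\<^esub> A (h \<otimes>\<^bsub>G\<^esub> g))"
      by (rule Z.M.finsum_reindex) (use h in \<open>auto simp: inj_on_def\<close>)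
    also have "\<dots> = (\<Oplus>\<^bsub>V w\<^esub> g \<in> carrier G. (b' h \<otimes> b g) \<odot>\<^bsub>V w\<^esub> A (h \<otimes>\<^bsub>G\<^esub> g))"
      by (rule Z.M.finsum_cong') (use h in \<open>auto simp flip: G.m_assoc\<close>)
    finally show "(\<Oplus>\<^bsub>V w\<^esub> k \<in> carrier G. (b' h \<otimes> b (inv\<^bsub>G\<^esub> h \<otimes>\<^bsub>G\<^esub> k)) \<odot>\<^bsub>V w\<^esub> A k) =
      (\<Oplus>\<^bsub>V w\<^esub> g \<in> carrier G. (b' h \<otimes> b g) \<odot>\<^bsub>V w\<^esub> A (h \<otimes>\<^bsub>G\<^esub> g))" unfolding img .
  qed (auto intro!: Z.M.finsum_closed)
  \<comment> \<open>Back to the hom sets: the coefficients of \<open>b'\<close> vanish outside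
    \<open>hs v w\<close>.\<close>
  also have "\<dots> = (\<Oplus>\<^bsub>V w\<^esub> h \<in> hs v w. \<Oplus>\<^bsub>V w\<^esub> g \<in> carrier G. (b' h \<otimes> b g) \<odot>\<^bsub>V w\<^esub> A (h \<otimes>\<^bsub>G\<^esub> g))"
  proof (rule Z.M.add.finprod_mono_neutral_cong_right[OF fin hs_subset])
    fix h assume "h \<in> carrier G - hs v w"
    then show "(\<Oplus>\<^bsub>V w\<^esub> g \<in> carrier G. (b' h \<otimes> b g) \<odot>\<^bsub>V w\<^esub> A (h \<otimes>\<^bsub>G\<^esub> g)) = \<zero>\<^bsub>V w\<^esub>"
      using b by (intro Z.M.add.finprod_one_eqI) (simp add: hom_space_def)
  qed (auto intro!: Z.M.finsum_closed)
  also have "\<dots> = (\<Oplus>\<^bsub>V w\<^esub> h \<in> hs v w. b' h \<odot>\<^bsub>V w\<^esub> act v h w (rep_sum V act u b v x))"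
  proof (rule Z.M.finsum_cong')
    fix h assume h: "h \<in> hs v w"
    note l = glider_repD(2)[OF r I(2,3) h]
    have "(\<Oplus>\<^bsub>V w\<^esub> g \<in> carrier G. (b' h \<otimes> b g) \<odot>\<^bsub>V w\<^esub> A (h \<otimes>\<^bsub>G\<^esub> g)) =
      (\<Oplus>\<^bsub>V w\<^esub> g \<in> hs u v. (b' h \<otimes> b g) \<odot>\<^bsub>V w\<^esub> A (h \<otimes>\<^bsub>G\<^esub> g))"
      by (rule Z.M.add.finprod_mono_neutral_cong_right[OF fin hs_subset])
        (use b h in \<open>auto simp: hom_space_def\<close>)
    also have "\<dots> = (\<Oplus>\<^bsub>V w\<^esub> g \<in> hs u v. b' h \<odot>\<^bsub>V w\<^esub> act v h w (b g \<odot>\<^bsub>V v\<^esub> act u g v x))"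
    proof (rule Z.M.finsum_cong')
      fix g assume g: "g \<in> hs u v"
      have "A (h \<otimes>\<^bsub>G\<^esub> g) = act v h w (act u g v x)"
        using hs_comp[OF I g h] glider_repD(4)[OF r I(1,2,3) g h x] by (simp add: A_def)
      then show "(b' h \<otimes> b g) \<odot>\<^bsub>V w\<^esub> A (h \<otimes>\<^bsub>G\<^esub> g) =
        b' h \<odot>\<^bsub>V w\<^esub> act v h w (b g \<odot>\<^bsub>V v\<^esub> act u g v x)"
        using g h glider_repD(6)[OF r I(1,2) g x] linear_smult[OF l] linear_closed[OF l]
        by (simp add: Z.smult_assoc1)
    qed (use glider_repD(6)[OF r I(1,2) _ x] linear_closed[OF l] h in auto)
    also have "\<dots> = b' h \<odot>\<^bsub>V w\<^esub> (\<Oplus>\<^bsub>V w\<^esub> g \<in> hs u v. act v h w (b g \<odot>\<^bsub>V v\<^esub> act u g v x))"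
      by (rule Z.finsum_smult_ldistr[symmetric])
        (use glider_repD(6)[OF r I(1,2) _ x] linear_closed[OF l] h in auto)
    also have "(\<Oplus>\<^bsub>V w\<^esub> g \<in> hs u v. act v h w (b g \<odot>\<^bsub>V v\<^esub> act u g v x)) = act v h w (rep_sum V act u b v x)"
      unfolding rep_sum_apply[of x V u, OF x]
      by (rule W.linear_map_finsum[OF Z.module_axioms l finite_hs, symmetric])
        (use glider_repD(6)[OF r I(1,2) _ x] in auto)
    finally show "(\<Oplus>\<^bsub>V w\<^esub> g \<in> carrier G. (b' h \<otimes> b g) \<odot>\<^bsub>V w\<^esub> A (h \<otimes>\<^bsub>G\<^esub> g)) =
      b' h \<odot>\<^bsub>V w\<^esub> act v h w (rep_sum V act u b v x)" .
  qed (use linear_closed[OF glider_repD(2)[OF r I(2,3)]] linear_closed[OF rep_sum_linear[OF r I(1,2) bB(1)] x] in auto)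
  also have "\<dots> = rep_sum V act v b' w (rep_sum V act u b v x)"
    using linear_closed[OF rep_sum_linear[OF r I(1,2) bB(1)] x] by (simp add: rep_sum_def[of V act v])
  finally show ?thesis .
qed

lemma rep_sum_add:
  assumes r: "glider_rep V act" "u \<in> IX" "v \<in> IX" and b: "b \<in> carrier B" "b' \<in> carrier B"
    and x: "x \<in> carrier (V u)"
  shows "rep_sum V act u (b \<oplus>\<^bsub>B\<^esub> b') v x = rep_sum V act u b v x \<oplus>\<^bsub>V v\<^esub> rep_sum V act u b' v x"
proof -
  interpret W: vspace K "V v" by (rule vspace.intro) (rule glider_repD(1)[OF r(1,3,3)])
  note cl = glider_repD(6)[OF r _ x]
  have "rep_sum V act u (b \<oplus>\<^bsub>B\<^esub> b') v x =
    (\<Oplus>\<^bsub>V v\<^esub> g \<in> hs u v. b g \<odot>\<^bsub>V v\<^esub> act u g v x \<oplus>\<^bsub>V v\<^esub> b' g \<odot>\<^bsub>V v\<^esub> act u g v x)"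
    unfolding rep_sum_apply[of x V u, OF x] using cl b
    by (intro W.M.finsum_cong') (auto simp: add_B W.smult_l_distr)
  also have "\<dots> = rep_sum V act u b v x \<oplus>\<^bsub>V v\<^esub> rep_sum V act u b' v x"
    unfolding rep_sum_apply[of x V u, OF x] using cl b by (intro W.M.finsum_addf) auto
  finally show ?thesis .
qed

lemma rep_sum_smult:
  assumes r: "glider_rep V act" "u \<in> IX" "v \<in> IX" and b: "b \<in> carrier B" "c \<in> carrier K"
    and x: "x \<in> carrier (V u)"
  shows "rep_sum V act u (c \<odot>\<^bsub>B\<^esub> b) v x = c \<odot>\<^bsub>V v\<^esub> rep_sum V act u b v x"
proof -
  interpret W: vspace K "V v" by (rule vspace.intro) (rule glider_repD(1)[OF r(1,3,3)])
  note cl = glider_repD(6)[OF r _ x]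
  have "rep_sum V act u (c \<odot>\<^bsub>B\<^esub> b) v x = (\<Oplus>\<^bsub>V v\<^esub> g \<in> hs u v. c \<odot>\<^bsub>V v\<^esub> (b g \<odot>\<^bsub>V v\<^esub> act u g v x))"
    unfolding rep_sum_apply[of x V u, OF x] using cl b
    by (intro W.M.finsum_cong') (auto simp: smult_B W.smult_assoc1)
  also have "\<dots> = c \<odot>\<^bsub>V v\<^esub> rep_sum V act u b v x"
    unfolding rep_sum_apply[of x V u, OF x] using cl b by (intro W.finsum_smult_ldistr[symmetric]) auto
  finally show ?thesis .
qed

lemma is_preglider_mk_glider:
  assumes r: "glider_rep V act"
  shows "is_preglider K {-1, 0} B Fl (mk_glider V act)"
proof -
  note m = glider_repD(1)[OF r]
  have arr: "Arrow (V u) (rep_sum V act u b v) (V v) \<in> Arr (vect K)"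
    if "u \<in> IX" "v \<in> IX" "b \<in> carrier B" for u v b
    using rep_sum_linear[OF r that] m that by (auto simp: Arr_vect)
  have one: "rep_sum V act u \<one>\<^bsub>B\<^esub> v = act u \<one>\<^sub>G v" if "u \<in> IX" "v \<in> IX" "\<one>\<^sub>G \<in> hs u v" for u v
    using rep_sum_bv[OF r that] by (simp add: one_B)
  have arrI: "f \<in> Arr Cc \<Longrightarrow> src f \<in> IX \<and> trg f \<in> IX \<and> dat f \<in> hom_space (src f) (trg f) \<and> dat f \<in> carrier B" for f
    by (auto simp: Arr_Cc hom_space_B)
  have "is_functor Cc (vect K) (mk_glider V act)"
    unfolding is_functor_def
  proof (intro conjI ballI impI)
    fix u assume u: "u \<in> Obj Cc"
    then show "ObjMap (mk_glider V act) u \<in> Obj (vect K)" using m by (simp add: mk_glider_def)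
    show "ArrMap (mk_glider V act) (Id Cc u) = Id (vect K) (ObjMap (mk_glider V act) u)"
      using u linear_ext[OF glider_repD(2)[OF r, of u u "\<one>\<^sub>G"]] glider_repD(3)[OF r, of u u]
      by (auto simp: mk_glider_def Arr_Cc hom_space_one one intro!: arrow_eqI extensionalityI)
  next
    fix f assume "f \<in> Arr Cc"
    then show "ArrMap (mk_glider V act) f
      \<in> homset (vect K) (ObjMap (mk_glider V act) (src f)) (ObjMap (mk_glider V act) (trg f))"
      using arrI[of f] arr by (auto simp: homset_def mk_glider_def)
  next
    fix f g assume fg: "f \<in> Arr Cc" "g \<in> Arr Cc" "trg f = src g"
    then have I: "src f \<in> IX" "trg f \<in> IX" "trg g \<in> IX" "dat f \<in> hom_space (src f) (trg f)"
      "dat g \<in> hom_space (trg f) (trg g)" by (auto simp: Arr_Cc)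
    have "Arrow (src f) (dat g \<otimes>\<^bsub>B\<^esub> dat f) (trg g) \<in> Arr Cc"
      using hom_space_mult[OF I] I by (simp add: Arr_Cc)
    then show "ArrMap (mk_glider V act) (g \<cdot>\<^bsub>Cc\<^esub> f) =
      ArrMap (mk_glider V act) g \<star> ArrMap (mk_glider V act) f"
      using fg rep_sum_comp[OF r I]
      by (auto simp: mk_glider_def rep_sum_def[of V act "src f" "dat g \<otimes>\<^bsub>B\<^esub> dat f"] intro!: arrow_eqI restrict_ext)
  qed
  moreover have "ArrMap (mk_glider V act) (Add Cc f g) =
      Add (vect K) (ArrMap (mk_glider V act) f) (ArrMap (mk_glider V act) g)"
    if fg: "f \<in> Arr Cc" "g \<in> Arr Cc" "src f = src g" "trg f = trg g" for f g
  proof -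
    have "Arrow (src f) (dat f \<oplus>\<^bsub>B\<^esub> dat g) (trg f) \<in> Arr Cc"
      using fg hom_space_add by (auto simp: Arr_Cc)
    then show ?thesis
      using fg arrI[of f] arrI[of g] rep_sum_add[OF r, of "src f" "trg f" "dat f" "dat g"]
      by (auto simp: mk_glider_def rep_sum_def[of V act "src g" "dat f \<oplus>\<^bsub>B\<^esub> dat g"] intro!: arrow_eqI restrict_ext)
  qed
  moreover have "ArrMap (mk_glider V act) (Scale Cc c f) = Scale (vect K) c (ArrMap (mk_glider V act) f)"
    if f: "f \<in> Arr Cc" "c \<in> carrier K" for f c
  proof -
    have "Arrow (src f) (c \<odot>\<^bsub>B\<^esub> dat f) (trg f) \<in> Arr Cc"
      using f hom_space_smult by (auto simp: Arr_Cc)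
    then show ?thesis using f arrI[of f] rep_sum_smult[OF r, of "src f" "trg f" "dat f" c]
      by (auto simp: mk_glider_def rep_sum_def[of V act "src f" "c \<odot>\<^bsub>B\<^esub> dat f"] intro!: arrow_eqI restrict_ext)
  qed
  moreover have "mono_arr (vect K) (ArrMap (mk_glider V act) (Arrow u \<one>\<^bsub>B\<^esub> v))"
    if "u \<in> IX" "v \<in> IX" "index_le u v" for u v
  proof -
    have o: "\<one>\<^sub>G \<in> hs u v" using hs_le[OF that] .
    then have "Arrow u \<one>\<^bsub>B\<^esub> v \<in> Arr Cc" using that by (simp add: Arr_Cc one_B)
    then show ?thesis using that arr[OF that(1,2), of "\<one>\<^bsub>B\<^esub>"] glider_repD(5)[OF r that]
      by (intro mono_vectI) (auto simp: mk_glider_def one[OF that(1,2) o], simp add: one_B)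
  qed
  ultimately show ?thesis
    by (simp add: is_preglider_def Let_def is_linear_functor_def) (simp add: mk_glider_def)
qed

abbreviation lev :: "('k, 'u, 'g \<Rightarrow> 'k) glider \<Rightarrow> index \<Rightarrow> 'u set" where
  "lev M i \<equiv> carrier (ObjMap M i)"

abbreviation preglider :: "('k, 'u, 'g \<Rightarrow> 'k) glider \<Rightarrow> bool" where
  "preglider \<equiv> is_preglider K {-1, 0} B Fl"

abbreviation ga :: "('k, 'u, 'g \<Rightarrow> 'k) glider \<Rightarrow> index \<Rightarrow> 'g \<Rightarrow> index \<Rightarrow> ('k, 'u) vect_arrow" where
  "ga M u g v \<equiv> ArrMap M (Arrow u (bv g) v)"

abbreviation gm :: "('k, 'u, 'g \<Rightarrow> 'k) glider \<Rightarrow> index \<Rightarrow> 'g \<Rightarrow> index \<Rightarrow> 'u \<Rightarrow> 'u" where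
  "gm M u g v \<equiv> dat (ga M u g v)"

lemma ga_mk_glider:
  assumes r: "glider_rep V act" "u \<in> IX" "v \<in> IX" and g: "g \<in> hs u v"
  shows "ga (mk_glider V act) u g v = Arrow (V u) (act u g v) (V v)"
proof -
  have "Arrow u (bv g) v \<in> Arr Cc" using assms by (simp add: Arr_Cc)
  then show ?thesis using rep_sum_bv[OF assms] by (simp add: mk_glider_def)
qed

lemma ObjMap_mk_glider [simp]: "u \<in> IX \<Longrightarrow> ObjMap (mk_glider V act) u = V u"
  by (simp add: mk_glider_def)

lemma mk_glider_cong:
  assumes "\<And>u. u \<in> IX \<Longrightarrow> V u = V' u"
    "\<And>u v g x. u \<in> IX \<Longrightarrow> v \<in> IX \<Longrightarrow> g \<in> hs u v \<Longrightarrow> x \<in> carrier (V u) \<Longrightarrow> act u g v x = act' u g v x"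
    "glider_rep V act"
  shows "mk_glider V act = mk_glider V' act'"
proof -
  have "rep_sum V act u b v = rep_sum V' act' u b v" if I: "u \<in> IX" "v \<in> IX" "b \<in> carrier B" for u v b
  proof -
    interpret W: vspace K "V' v"
      using glider_repD(1)[OF assms(3) I(2,2)] assms(1)[OF I(2)] by (simp add: vspace_def)
    show ?thesis
      unfolding rep_sum_def using assms(1)[OF I(1)] assms(1)[OF I(2)] I(3)
        glider_repD(6)[OF assms(3) I(1,2)] assms(2)[OF I(1,2)]
      by (auto intro!: restrict_ext W.M.finsum_cong')
  qed
  moreover have "dat f \<in> carrier B" if "f \<in> Arr Cc" for f using that by (auto simp: Arr_Cc dest: hom_space_B)
  ultimately show ?thesis
    unfolding mk_glider_def using assms(1) by (auto simp: Arr_Cc intro!: restrict_ext)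
qed

lemma preglider_functor: "preglider M \<Longrightarrow> is_functor Cc (vect K) M"
  unfolding is_preglider_def Let_def is_linear_functor_def by blast

lemma preglider_arr:
  assumes M: "preglider M" and f: "f \<in> Arr Cc"
  shows "ArrMap M f \<in> Arr (vect K)" "src (ArrMap M f) = ObjMap M (src f)" "trg (ArrMap M f) = ObjMap M (trg f)"
proof -
  have "ArrMap M f \<in> homset (vect K) (ObjMap M (src f)) (ObjMap M (trg f))"
    using preglider_functor[OF M] f unfolding is_functor_def by blast
  then show "ArrMap M f \<in> Arr (vect K)" "src (ArrMap M f) = ObjMap M (src f)"
    "trg (ArrMap M f) = ObjMap M (trg f)" by (auto simp: homset_def)
qed

lemma ga_arr [simp]:
  assumes "preglider M" "u \<in> IX" "v \<in> IX" "g \<in> hs u v"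
  shows "ga M u g v \<in> Arr (vect K)" "src (ga M u g v) = ObjMap M u" "trg (ga M u g v) = ObjMap M v"
  using preglider_arr[of M "Arrow u (bv g) v"] assms by (auto simp: Arr_Cc)

lemma preglider_module [simp]: "preglider M \<Longrightarrow> u \<in> IX \<Longrightarrow> module K (ObjMap M u)"
  using preglider_functor unfolding is_functor_def by fastforce

lemma ga_comp:
  assumes M: "preglider M" and I: "u \<in> IX" "v \<in> IX" "w \<in> IX" and g: "g \<in> hs u v" "h \<in> hs v w"
  shows "ga M v h w \<star> ga M u g v = ga M u (h \<otimes>\<^bsub>G\<^esub> g) w"
proof -
  have "ArrMap M (Arrow v (bv h) w \<cdot>\<^bsub>Cc\<^esub> Arrow u (bv g) v) = ga M v h w \<star> ga M u g v"
    using preglider_functor[OF M] I g unfolding is_functor_def by (simp add: Arr_Cc del: Cc_sel)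
  then show ?thesis using g by (simp add: bv_mult)
qed

lemma glider_rep_preglider:
  assumes M: "preglider M"
  shows "glider_rep (ObjMap M) (gm M)"
  unfolding glider_rep_def
proof (intro conjI ballI impI)
  fix u assume u: "u \<in> IX"
  then show "module K (ObjMap M u)" using M by simp
  fix x assume x: "x \<in> lev M u"
  have "ArrMap M (Id Cc u) = Id (vect K) (ObjMap M u)"
    using preglider_functor[OF M] u unfolding is_functor_def by (simp del: Cc_sel)
  then have "ga M u \<one>\<^sub>G u = Id (vect K) (ObjMap M u)" by (simp add: one_B)
  then show "gm M u \<one>\<^sub>G u x = x" using x by simp
next
  fix u v assume I: "u \<in> IX" "v \<in> IX"
  show "gm M u g v \<in> linear_maps K (ObjMap M u) (ObjMap M v)" if g: "g \<in> hs u v" for g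
    using Arr_vectD(3)[OF ga_arr(1)[OF M I g]] ga_arr(2,3)[OF M I g] by simp
  show "inj_on (gm M u \<one>\<^sub>G v) (lev M u)" if le: "index_le u v"
  proof (rule mono_vectD)
    show "mono_arr (vect K) (ga M u \<one>\<^sub>G v)"
      using M I le by (simp add: is_preglider_def Let_def one_B)
    show "src (ga M u \<one>\<^sub>G v) = ObjMap M u" using ga_arr(2)[OF M I hs_le[OF I le]] .
  qed
  fix w g h x assume a: "w \<in> IX" "g \<in> hs u v" "h \<in> hs v w" "x \<in> lev M u"
  have "gm M v h w (gm M u g v x) = dat (ga M v h w \<star> ga M u g v) x"
    using a M I by simp
  then show "gm M v h w (gm M u g v x) = gm M u (h \<otimes>\<^bsub>G\<^esub> g) w x"
    using ga_comp[OF M I a(1-3)] by simp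
qed

lemma preglider_linear:
  assumes M: "preglider M"
  shows "f \<in> Arr Cc \<Longrightarrow> g \<in> Arr Cc \<Longrightarrow> src f = src g \<Longrightarrow> trg f = trg g \<Longrightarrow>
      ArrMap M (Add Cc f g) = Add (vect K) (ArrMap M f) (ArrMap M g)"
    "c \<in> carrier K \<Longrightarrow> f \<in> Arr Cc \<Longrightarrow> ArrMap M (Scale Cc c f) = Scale (vect K) c (ArrMap M f)"
  using M unfolding is_preglider_def Let_def is_linear_functor_def by blast+

text \<open>A linear functor is determined by its values on the group elements, which span the hom
  spaces.\<close>

lemma preglider_arr_eq:
  assumes M: "preglider M" and I: "u \<in> IX" "v \<in> IX" and b: "b \<in> hom_space u v"
  shows "ArrMap M (Arrow u b v) = Arrow (ObjMap M u) (rep_sum (ObjMap M) (gm M) u b v) (ObjMap M v)"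
proof -
  note r = glider_rep_preglider[OF M]
  interpret W: vspace K "ObjMap M v" by (rule vspace.intro) (use M I in simp)
  have bB: "b \<in> carrier B" using b by (rule hom_space_B)
  \<comment> \<open>Truncations of \<open>b\<close> to subsets of its hom set, so that additivity of
    \<open>M\<close> can be used one group element at a time.\<close>
  define cut where "cut A = (\<lambda>g \<in> carrier G. if g \<in> A then b g else \<zero>)" for A
  have cut: "cut A \<in> hom_space u v" if "A \<subseteq> hs u v" for A
    using that bB by (auto simp: hom_space_def cut_def carrier_B)
  have *: "dat (ArrMap M (Arrow u (cut A) v)) x = (\<Oplus>\<^bsub>ObjMap M v\<^esub> g \<in> A. b g \<odot>\<^bsub>ObjMap M v\<^esub> gm M u g v x)"
    if "finite A" "A \<subseteq> hs u v" and x: "x \<in> lev M u" for A x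
    using that(1,2)
  proof (induction A)
    case empty
    let ?f = "Arrow u (cut {}) v"
    have f: "?f \<in> Arr Cc" using cut[of "{}"] I by (simp add: Arr_Cc)
    \<comment> \<open>The zero arrow is zero times itself, so scalar linearity alone shows that its
      image is zero.\<close>
    have "Scale Cc \<zero> ?f = ?f" by (auto simp: smult_B cut_def intro!: restrict_ext)
    then have e: "ArrMap M ?f = Scale (vect K) \<zero> (ArrMap M ?f)"
      using preglider_linear(2)[OF M _ f, of \<zero>] by simp
    have "dat (ArrMap M ?f) x \<in> lev M v"
      using linear_closed[OF Arr_vectD(3)[OF preglider_arr(1)[OF M f]]] preglider_arr(2,3)[OF M f] x by simp
    then show ?case by (subst e) (simp add: preglider_arr(2,3)[OF M f] x)
  next
    case (insert g A)
    then have g: "g \<in> hs u v" "g \<in> carrier G" "A \<subseteq> hs u v" by auto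
    let ?f = "Arrow u (bv g) v"
    have f: "?f \<in> Arr Cc" "Arrow u (cut A) v \<in> Arr Cc" using cut[OF g(3)] g I by (auto simp: Arr_Cc)
    have cf: "Scale Cc (b g) ?f \<in> Arr Cc" using f(1) bB g hom_space_smult by (simp add: Arr_Cc)
    have "cut (insert g A) = (b g \<odot>\<^bsub>B\<^esub> bv g) \<oplus>\<^bsub>B\<^esub> cut A"
      unfolding cut_def add_B smult_B using insert.hyps(2) bB g by (auto simp: bv_apply intro!: restrict_ext)
    then have "Arrow u (cut (insert g A)) v = Add Cc (Scale Cc (b g) ?f) (Arrow u (cut A) v)" by simp
    then have e: "ArrMap M (Arrow u (cut (insert g A)) v) =
      Add (vect K) (Scale (vect K) (b g) (ga M u g v)) (ArrMap M (Arrow u (cut A) v))"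
      using preglider_linear(1)[OF M cf f(2)] preglider_linear(2)[OF M _ f(1), of "b g"] bB g by simp
    have cl: "gm M u h v x \<in> lev M v" if "h \<in> hs u v" for h
      using glider_repD(6)[OF r I that x] .
    have cl': "b h \<odot>\<^bsub>ObjMap M v\<^esub> gm M u h v x \<in> lev M v" if "h \<in> hs u v" for h
      using cl[OF that] bB that by simp
    have "(\<Oplus>\<^bsub>ObjMap M v\<^esub> h \<in> insert g A. b h \<odot>\<^bsub>ObjMap M v\<^esub> gm M u h v x) =
      b g \<odot>\<^bsub>ObjMap M v\<^esub> gm M u g v x \<oplus>\<^bsub>ObjMap M v\<^esub>
      (\<Oplus>\<^bsub>ObjMap M v\<^esub> h \<in> A. b h \<odot>\<^bsub>ObjMap M v\<^esub> gm M u h v x)"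
      using insert.hyps g cl' by (intro W.M.finsum_insert) auto
    then show ?case unfolding e using insert.IH[OF g(3)] g x M I by simp
  qed
  have "cut (hs u v) = b"
    using b unfolding cut_def hom_space_def
    by (intro extensionalityI[of _ "carrier G"]) (auto simp: carrier_B PiE_iff)
  moreover have f: "Arrow u b v \<in> Arr Cc" using b I by (simp add: Arr_Cc)
  ultimately show ?thesis
    using *[OF finite_hs, of u v] preglider_arr[OF M f] linear_ext[OF Arr_vectD(3)[OF preglider_arr(1)[OF M f]]]
    by (intro arrow_eqI) (auto simp: rep_sum_def intro!: extensionalityI)
qed

lemma mk_glider_eq:
  assumes M: "preglider M"
  shows "mk_glider (ObjMap M) (gm M) = M"
proof -
  have "ObjMap M = restrict (ObjMap M) IX"
    using M by (simp add: is_preglider_def Let_def extensional_restrict)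
  moreover have "ArrMap M f = (\<lambda>f \<in> Arr Cc. Arrow (ObjMap M (src f))
      (rep_sum (ObjMap M) (gm M) (src f) (dat f) (trg f)) (ObjMap M (trg f))) f" for f
  proof (cases "f \<in> Arr Cc")
    case True
    then show ?thesis using preglider_arr_eq[OF M, of "src f" "trg f" "dat f"] by (cases f) (simp add: Arr_Cc)
  next
    case False
    then show ?thesis using M by (simp add: is_preglider_def Let_def extensional_def)
  qed
  ultimately show ?thesis by (cases M) (simp add: mk_glider_def fun_eq_iff)
qed

text \<open>Literal equality of functors, available because gliders are extensional. The strictness
  of the transport along a group isomorphism rests on it.\<close>

lemma preglider_eqI:
  assumes M: "preglider M" "preglider N" and "\<And>u. u \<in> IX \<Longrightarrow> ObjMap M u = ObjMap N u"
    and "\<And>u v g. u \<in> IX \<Longrightarrow> v \<in> IX \<Longrightarrow> g \<in> hs u v \<Longrightarrow> ga M u g v = ga N u g v"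
  shows "M = N"
  using mk_glider_cong[OF assms(3) _ glider_rep_preglider[OF M(1)], of "gm N"] assms(4)
    mk_glider_eq[OF M(1)] mk_glider_eq[OF M(2)] by simp


lemma vect_Add_arr:
  fixes f g :: "('k, 'u) vect_arrow"
  assumes "f \<in> Arr (vect K)" "g \<in> Arr (vect K)" "src f = src g" "trg f = trg g"
  shows "Add (vect K) f g \<in> Arr (vect K)"
proof -
  interpret V: vspace K "src f" by (rule vspace.intro) (rule Arr_vectD[OF assms(1)])
  show ?thesis
    using V.linear_map_add[of "trg f" "dat f" "dat g"] assms by (auto simp: Arr_vect)
qed

lemma vect_Scale_arr:
  fixes f :: "('k, 'u) vect_arrow"
  assumes "f \<in> Arr (vect K)" "c \<in> carrier K"
  shows "Scale (vect K) c f \<in> Arr (vect K)"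
proof -
  interpret V: vspace K "src f" by (rule vspace.intro) (rule Arr_vectD[OF assms(1)])
  show ?thesis
    using V.linear_map_scale[of "trg f" "dat f" c] assms by (auto simp: Arr_vect)
qed

lemma dat_in: "f \<in> Arr (vect K) \<Longrightarrow> x \<in> carrier (src f) \<Longrightarrow> dat f x \<in> carrier (trg f)"
  by (rule linear_closed[OF Arr_vectD(3)])

lemma vect_bilinear:
  fixes f g h :: "('k, 'u) vect_arrow"
  assumes "f \<in> Arr (vect K)" "g \<in> Arr (vect K)" "src f = src g" "trg f = trg g" "h \<in> Arr (vect K)"
  shows "trg h = src f \<Longrightarrow> Add (vect K) f g \<star> h =
      Add (vect K) (f \<star> h) (g \<star> h)"
    and "src h = trg f \<Longrightarrow> h \<star> Add (vect K) f g =
      Add (vect K) (h \<star> f) (h \<star> g)"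
    and "trg h = src f \<Longrightarrow> c \<in> carrier K \<Longrightarrow> Scale (vect K) c f \<star> h =
      Scale (vect K) c (f \<star> h)"
    and "src h = trg f \<Longrightarrow> c \<in> carrier K \<Longrightarrow> h \<star> Scale (vect K) c f =
      Scale (vect K) c (h \<star> f)"
  using assms dat_in[of f] dat_in[of g] dat_in[of h] linear_add[OF Arr_vectD(3)[OF assms(5)]]
    linear_smult[OF Arr_vectD(3)[OF assms(5)]]
  by (auto intro!: arrow_eqI restrict_ext)

lemma ga_one: "preglider M \<Longrightarrow> u \<in> IX \<Longrightarrow> ga M u \<one>\<^sub>G u = Id (vect K) (ObjMap M u)"
  using preglider_functor[of M] unfolding is_functor_def by (simp add: one_B)

lemma ga_inj: "preglider M \<Longrightarrow> u \<in> IX \<Longrightarrow> v \<in> IX \<Longrightarrow> index_le u v \<Longrightarrow>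
    inj_on (gm M u \<one>\<^sub>G v) (lev M u)"
  using glider_repD(5)[OF glider_rep_preglider] .

section \<open>Unit and tensor product of gliders\<close>

abbreviation T where "T \<equiv> glider_tensor K {-1, 0} B Fl"
abbreviation E :: "('k, 'u, 'g \<Rightarrow> 'k) glider" where "E \<equiv> glider_unit K {-1, 0} B Fl"

lemma glider_rep_unit: "glider_rep (\<lambda>_. S) (\<lambda>_ _ _. \<lambda>x \<in> carrier S. x)"
proof -
  interpret S: vspace K S by (rule vspace.intro) (rule module_S)
  show ?thesis
    using S.linear_map_id module_S by (auto simp: glider_rep_def inj_on_def)
qed

text \<open>The counit sums the coefficients, and this is the linear extension of the trivial
  action.\<close>

lemma glider_unit_eq: "E = mk_glider (\<lambda>_. S) (\<lambda>_ _ _. \<lambda>x \<in> carrier S. x)"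
proof -
  interpret S: vspace K S by (rule vspace.intro) (rule module_S)
  have "Scale (vect K) (counit B (dat f)) (Id (vect K) S) =
    Arrow S (rep_sum (\<lambda>_. S) (\<lambda>_ _ _. \<lambda>x \<in> carrier S. x) (src f) (dat f) (trg f)) S"
    if f: "f \<in> Arr Cc" for f
  proof (rule arrow_eqI)
    have b: "dat f \<in> hom_space (src f) (trg f)" using f by (simp add: Arr_Cc)
    note bB = hom_space_B[OF b]
    have "counit B (dat f) = (\<Oplus> g \<in> carrier G. dat f g)" by (simp add: group_bialgebra_def)
    also have "\<dots> = (\<Oplus> g \<in> hs (src f) (trg f). dat f g)"
      by (rule add.finprod_mono_neutral_cong_right[OF fin hs_subset])
        (use b bB in \<open>auto simp: hom_space_def\<close>)
    finally have "counit B (dat f) \<odot>\<^bsub>S\<^esub> x = (\<Oplus>\<^bsub>S\<^esub> g \<in> hs (src f) (trg f). dat f g \<odot>\<^bsub>S\<^esub> x)"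
      if "x \<in> carrier S" for x
      using S.finsum_smult_scalars[of "hs (src f) (trg f)" "dat f" x] bB that by simp
    then show "dat (Scale (vect K) (counit B (dat f)) (Id (vect K) S)) =
      dat (Arrow S (rep_sum (\<lambda>_. S) (\<lambda>_ _ _. \<lambda>x \<in> carrier S. x) (src f) (dat f) (trg f)) S)"
      by (auto simp: rep_sum_def intro!: restrict_ext)
  qed simp_all
  then show ?thesis
    unfolding glider_unit_def mk_glider_def Let_def by (auto intro!: restrict_ext)
qed

lemma preglider_E [simp]: "preglider E"
  unfolding glider_unit_eq by (rule is_preglider_mk_glider[OF glider_rep_unit])

lemma ObjMap_E [simp]: "u \<in> IX \<Longrightarrow> ObjMap E u = S"
  by (simp add: glider_unit_eq)

lemma ga_E: "u \<in> IX \<Longrightarrow> v \<in> IX \<Longrightarrow> g \<in> hs u v \<Longrightarrow> ga E u g v = Id (vect K) S"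
  by (simp add: glider_unit_eq ga_mk_glider[OF glider_rep_unit] vect_def)

lemma glider_rep_tensor:
  assumes M: "preglider M" and N: "preglider N"
  shows "glider_rep (\<lambda>i. tens (ObjMap M i) (ObjMap N i))
    (\<lambda>u g v. dat (TensA (vect K) (ga M u g v) (ga N u g v)))"
  unfolding glider_rep_def
proof (intro conjI ballI impI)
  fix u assume u: "u \<in> IX"
  then show "module K (tens (ObjMap M u) (ObjMap N u))" using M N by simp
  fix x assume "x \<in> carrier (tens (ObjMap M u) (ObjMap N u))"
  then show "dat (TensA (vect K) (ga M u \<one>\<^sub>G u) (ga N u \<one>\<^sub>G u)) x = x"
    using u M N by (simp add: ga_one TensA_vect_Id)
next
  fix u v assume I: "u \<in> IX" "v \<in> IX"
  show "dat (TensA (vect K) (ga M u g v) (ga N u g v)) \<in>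
    linear_maps K (tens (ObjMap M u) (ObjMap N u)) (tens (ObjMap M v) (ObjMap N v))"
    if g: "g \<in> hs u v" for g
    using Arr_vectD(3)[OF TensA_vect_arr[OF ga_arr(1)[OF M I g] ga_arr(1)[OF N I g]]] ga_arr[OF M I g]
      ga_arr[OF N I g] by simp
  \<comment> \<open>The one law that does not follow from functoriality of the tensor product: it
    needs that tensoring over a field preserves injectivity.\<close>
  show "inj_on (dat (TensA (vect K) (ga M u \<one>\<^sub>G v) (ga N u \<one>\<^sub>G v)))
    (carrier (tens (ObjMap M u) (ObjMap N u)))" if le: "index_le u v"
    using inj_TensA_vect[of "ga M u \<one>\<^sub>G v" "ga N u \<one>\<^sub>G v"] hs_le[OF I le] ga_inj[OF M I le] ga_inj[OF N I le] M N I
    by simp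
  fix w g h x
  assume a: "w \<in> IX" "g \<in> hs u v" "h \<in> hs v w" "x \<in> carrier (tens (ObjMap M u) (ObjMap N u))"
  have "TensA (vect K) (ga M v h w) (ga N v h w) \<star> TensA (vect K) (ga M u g v) (ga N u g v) =
    TensA (vect K) (ga M u (h \<otimes>\<^bsub>G\<^esub> g) w) (ga N u (h \<otimes>\<^bsub>G\<^esub> g) w)"
    using TensA_vect_Comp[of "ga M u g v" "ga M v h w" "ga N u g v" "ga N v h w"] a M N I
    by (simp add: ga_comp[OF M I] ga_comp[OF N I])
  from arg_cong[OF this, of "\<lambda>f. dat f x"]
  show "dat (TensA (vect K) (ga M v h w) (ga N v h w)) (dat (TensA (vect K) (ga M u g v) (ga N u g v)) x) =
    dat (TensA (vect K) (ga M u (h \<otimes>\<^bsub>G\<^esub> g) w) (ga N u (h \<otimes>\<^bsub>G\<^esub> g) w)) x"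
    using a M N I by simp
qed

text \<open>Comultiplication is diagonal on group elements, so the tensor product carries the
  diagonal action, extended linearly; the coefficient travels in the left factor.\<close>

lemma glider_tensor_eq:
  assumes M: "preglider M" and N: "preglider N"
  shows "T M N = mk_glider (\<lambda>i. tens (ObjMap M i) (ObjMap N i))
    (\<lambda>u g v. dat (TensA (vect K) (ga M u g v) (ga N u g v)))"
proof -
  let ?V = "\<lambda>i. tens (ObjMap M i) (ObjMap N i)"
  let ?act = "\<lambda>u g v. dat (TensA (vect K) (ga M u g v) (ga N u g v))"
  note r = glider_rep_tensor[OF M N]
  have "(\<Oplus>\<^bsub>?V v\<^esub> p \<in> comult_terms B b. dat (TensA (vect K) (ArrMap M (Arrow u (fst p) v))
      (ArrMap N (Arrow u (snd p) v))) t) = (\<Oplus>\<^bsub>?V v\<^esub> g \<in> hs u v. b g \<odot>\<^bsub>?V v\<^esub> ?act u g v t)"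
    if I: "u \<in> IX" "v \<in> IX" and b: "b \<in> hom_space u v" and t: "t \<in> carrier (?V u)" for u v b t
  proof -
    interpret W: vspace K "?V v" by (rule vspace.intro) (use M N I in simp)
    note bB = hom_space_B[OF b] and cl = glider_repD(6)[OF r I _ t]
    define A where "A = {g \<in> carrier G. b g \<noteq> \<zero>}"
    have A: "A \<subseteq> hs u v" using b by (auto simp: A_def hom_space_def)
    then have finA: "finite A" using finite_hs finite_subset by blast
    define p where "p g = ((\<lambda>h \<in> carrier G. b g \<otimes> bv g h), bv g)" for g
    have ct: "comult_terms B b = p ` A" by (auto simp: group_bialgebra_def A_def p_def)
    \<comment> \<open>The listed terms form a set, so distinct group elements must give distinct
      terms; the second component recovers \<open>g\<close>.\<close>
    have inj: "inj_on p A"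
    proof (rule inj_onI)
      fix g h assume gh: "g \<in> A" "h \<in> A" "p g = p h"
      then have "bv g g = bv h g" by (simp add: p_def)
      then show "g = h" using gh by (auto simp: bv_apply A_def split: if_splits)
    qed
    have tp: "dat (TensA (vect K) (ArrMap M (Arrow u (fst (p g)) v)) (ArrMap N (Arrow u (snd (p g)) v))) t
      = b g \<odot>\<^bsub>?V v\<^esub> ?act u g v t" if g: "g \<in> A" for g
    proof -
      have g': "g \<in> hs u v" "b g \<in> carrier K" using g A bB by (auto simp: A_def)
      have "Arrow u (fst (p g)) v = Scale Cc (b g) (Arrow u (bv g) v)" by (simp add: p_def smult_B)
      then have "ArrMap M (Arrow u (fst (p g)) v) = Scale (vect K) (b g) (ga M u g v)"
        using preglider_linear(2)[OF M g'(2), of "Arrow u (bv g) v"] I g' by (simp add: Arr_Cc)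
      then show ?thesis
        using TensA_vect_Scale[OF ga_arr(1)[OF M I g'(1)] ga_arr(1)[OF N I g'(1)] g'(2)] M N I g' t
        by (simp add: p_def)
    qed
    have "(\<Oplus>\<^bsub>?V v\<^esub> p \<in> p ` A. dat (TensA (vect K) (ArrMap M (Arrow u (fst p) v))
      (ArrMap N (Arrow u (snd p) v))) t) = (\<Oplus>\<^bsub>?V v\<^esub> g \<in> A. dat (TensA (vect K)
      (ArrMap M (Arrow u (fst (p g)) v)) (ArrMap N (Arrow u (snd (p g)) v))) t)"
      by (rule W.M.finsum_reindex[OF _ inj]) (use A cl bB in \<open>auto simp: tp A_def\<close>)
    also have "\<dots> = (\<Oplus>\<^bsub>?V v\<^esub> g \<in> A. b g \<odot>\<^bsub>?V v\<^esub> ?act u g v t)"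
      by (rule W.M.finsum_cong') (use A cl bB in \<open>auto simp: tp A_def\<close>)
    also have "\<dots> = (\<Oplus>\<^bsub>?V v\<^esub> g \<in> hs u v. b g \<odot>\<^bsub>?V v\<^esub> ?act u g v t)"
      by (rule W.M.add.finprod_mono_neutral_cong_left[OF finite_hs A])
        (use cl bB in \<open>auto simp: A_def\<close>)
    finally show ?thesis by (simp only: ct)
  qed
  then show ?thesis
    unfolding glider_tensor_def mk_glider_def Let_def rep_sum_def Obj_Cc
    by (auto simp: Arr_Cc intro!: restrict_ext)
qed

lemma preglider_T [simp]: "preglider M \<Longrightarrow> preglider N \<Longrightarrow> preglider (T M N)"
  by (simp add: glider_tensor_eq is_preglider_mk_glider[OF glider_rep_tensor])

lemma ObjMap_T [simp]: "preglider M \<Longrightarrow> preglider N \<Longrightarrow> u \<in> IX \<Longrightarrow>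
    ObjMap (T M N) u = tens (ObjMap M u) (ObjMap N u)"
  by (simp add: glider_tensor_eq)

lemma ga_T: "preglider M \<Longrightarrow> preglider N \<Longrightarrow> u \<in> IX \<Longrightarrow> v \<in> IX \<Longrightarrow> g \<in> hs u v \<Longrightarrow>
    ga (T M N) u g v = TensA (vect K) (ga M u g v) (ga N u g v)"
  by (rule arrow_eqI) (simp_all add: glider_tensor_eq ga_mk_glider[OF glider_rep_tensor])

subsection \<open>The categories of gliders\<close>

text \<open>The set \<open>I\<close> of visible levels is a parameter: all three levels give the
  original morphisms, the levels -1 and 0 give those that survive localization.\<close>

definition glider_nat :: "index set \<Rightarrow> ('k, 'u, 'g \<Rightarrow> 'k) glider \<Rightarrow> ('k, 'u, 'g \<Rightarrow> 'k) glider \<Rightarrow>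
    ('k, 'u) glider_map \<Rightarrow> bool" where
  "glider_nat I M N \<eta> \<longleftrightarrow>
     (\<forall>u \<in> I. \<eta> u \<in> Arr (vect K) \<and> src (\<eta> u) = ObjMap M u \<and> trg (\<eta> u) = ObjMap N u) \<and>
     (\<forall>u \<in> I. \<forall>v \<in> I. \<forall>g \<in> hs u v. \<eta> v \<star> ga M u g v = ga N u g v \<star> \<eta> u)"

text \<open>Naturality is linear in the arrow of the companion category, so it may be tested on
  group elements.\<close>

lemma nat_trans_iff:
  assumes M: "preglider M" and N: "preglider N"
  shows "is_nat_trans Cc (vect K) M N \<eta> \<longleftrightarrow> glider_nat IX M N \<eta>"
proof
  assume n: "is_nat_trans Cc (vect K) M N \<eta>"
  have "\<eta> v \<star> ga M u g v = ga N u g v \<star> \<eta> u"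
    if "u \<in> IX" "v \<in> IX" "g \<in> hs u v" for u v g
  proof -
    have "Arrow u (bv g) v \<in> Arr Cc" using that by (simp add: Arr_Cc)
    then show ?thesis using n unfolding is_nat_trans_def by force
  qed
  then show "glider_nat IX M N \<eta>"
    using n by (auto simp: is_nat_trans_def glider_nat_def homset_def)
next
  assume n: "glider_nat IX M N \<eta>"
  have "\<eta> (trg f) \<star> ArrMap M f = ArrMap N f \<star> \<eta> (src f)" if f: "f \<in> Arr Cc" for f
  proof (rule arrow_eqI)
    obtain u b v where fe: "f = Arrow u b v" by (cases f)
    have I: "u \<in> IX" "v \<in> IX" and b: "b \<in> hom_space u v" using f by (auto simp: Arr_Cc fe)
    note bB = hom_space_B[OF b]
    have \<eta>: "\<eta> u \<in> Arr (vect K)" "src (\<eta> u) = ObjMap M u" "trg (\<eta> u) = ObjMap N u"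
      "\<eta> v \<in> Arr (vect K)" "src (\<eta> v) = ObjMap M v" "trg (\<eta> v) = ObjMap N v"
      using n I by (auto simp: glider_nat_def)
    show "src (\<eta> (trg f) \<star> ArrMap M f) = src (ArrMap N f \<star> \<eta> (src f))"
      "trg (\<eta> (trg f) \<star> ArrMap M f) = trg (ArrMap N f \<star> \<eta> (src f))"
      using preglider_arr[OF M f] preglider_arr[OF N f] \<eta> by (simp_all add: fe)
    interpret W: vspace K "ObjMap M v" by (rule vspace.intro) (use M I in simp)
    interpret Z: vspace K "ObjMap N v" by (rule vspace.intro) (use N I in simp)
    note rM = glider_rep_preglider[OF M] and rN = glider_rep_preglider[OF N]
    note l = Arr_vectD(3)[OF \<eta>(4), unfolded \<eta>(5,6)]
    have "dat (\<eta> v) (rep_sum (ObjMap M) (gm M) u b v x) = rep_sum (ObjMap N) (gm N) u b v (dat (\<eta> u) x)"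
      if x: "x \<in> lev M u" for x
    proof -
      note cl = glider_repD(6)[OF rM I _ x]
      have nx: "dat (\<eta> u) x \<in> lev N u" using dat_in[OF \<eta>(1)] x \<eta> by simp
      have e: "dat (\<eta> v) (gm M u g v x) = gm N u g v (dat (\<eta> u) x)" if "g \<in> hs u v" for g
      proof -
        have "\<eta> v \<star> ga M u g v = ga N u g v \<star> \<eta> u" using n I that by (simp add: glider_nat_def)
        from arg_cong[OF this, of "\<lambda>f. dat f x"] show ?thesis using x \<eta> M I that by simp
      qed
      have "dat (\<eta> v) (rep_sum (ObjMap M) (gm M) u b v x) =
        (\<Oplus>\<^bsub>ObjMap N v\<^esub> g \<in> hs u v. dat (\<eta> v) (b g \<odot>\<^bsub>ObjMap M v\<^esub> gm M u g v x))"
        unfolding rep_sum_apply[of x "ObjMap M" u, OF x]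
        by (rule W.linear_map_finsum[OF Z.module_axioms l finite_hs]) (use cl bB in auto)
      also have "\<dots> = (\<Oplus>\<^bsub>ObjMap N v\<^esub> g \<in> hs u v. b g \<odot>\<^bsub>ObjMap N v\<^esub> gm N u g v (dat (\<eta> u) x))"
        by (rule Z.M.finsum_cong')
          (use cl bB linear_smult[OF l] glider_repD(6)[OF rN I _ nx] in \<open>auto simp: e\<close>)
      finally show ?thesis unfolding rep_sum_apply[of _ "ObjMap N" u, OF nx] .
    qed
    then show "dat (\<eta> (trg f) \<star> ArrMap M f) = dat (ArrMap N f \<star> \<eta> (src f))"
      using \<eta> by (auto simp: fe preglider_arr_eq[OF M I b] preglider_arr_eq[OF N I b] intro!: restrict_ext)
  qed
  then show "is_nat_trans Cc (vect K) M N \<eta>"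
    using n by (auto simp: is_nat_trans_def glider_nat_def homset_def)
qed

text \<open>For every \<open>I\<close> the objects are complete gliders, ambient representation
  included; only the morphisms forget levels. This keeps the comparison with the localization the
  identity on objects.\<close>

definition gcat :: "index set \<Rightarrow> ('k, ('k, 'u, 'g \<Rightarrow> 'k) glider, ('k, 'u) glider_map) mon_category" where
  "gcat I = (let V = vect K in
      \<lparr>Obj = {M. preglider M},
       Arr = {Arrow M \<eta> N | M \<eta> N. preglider M \<and> preglider N \<and> glider_nat I M N \<eta> \<and> \<eta> \<in> extensional I},
       Id = (\<lambda>M. Arrow M (\<lambda>i \<in> I. Id V (ObjMap M i)) M),
       Comp = (\<lambda>g f. Arrow (src f) (\<lambda>i \<in> I. dat g i \<cdot>\<^bsub>V\<^esub> dat f i) (trg g)),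
       Add = (\<lambda>f g. Arrow (src f) (\<lambda>i \<in> I. Add V (dat f i) (dat g i)) (trg f)),
       Scale = (\<lambda>c f. Arrow (src f) (\<lambda>i \<in> I. Scale V c (dat f i)) (trg f)),
       TensO = T,
       TensA = (\<lambda>f g. Arrow (T (src f) (src g)) (\<lambda>i \<in> I. TensA V (dat f i) (dat g i))
                            (T (trg f) (trg g))),
       UnitO = E,
       Assoc = (\<lambda>L M N. Arrow (T (T L M) N)
          (\<lambda>i \<in> I. Assoc V (ObjMap L i) (ObjMap M i) (ObjMap N i)) (T L (T M N))),
       LUnit = (\<lambda>M. Arrow (T E M) (\<lambda>i \<in> I. LUnit V (ObjMap M i)) M),
       RUnit = (\<lambda>M. Arrow (T M E) (\<lambda>i \<in> I. RUnit V (ObjMap M i)) M)\<rparr>)"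

lemma preglid_eq: "preglid K {-1, 0} B Fl = gcat IX"
proof -
  have "{Arrow M \<eta> N | M \<eta> N. preglider M \<and> preglider N \<and> is_nat_trans Cc (vect K) M N \<eta> \<and>
      \<eta> \<in> extensional IX} =
    {Arrow M \<eta> N | M \<eta> N. preglider M \<and> preglider N \<and> glider_nat IX M N \<eta> \<and> \<eta> \<in> extensional IX}"
    using nat_trans_iff by blast
  then show ?thesis unfolding preglid_def gcat_def Let_def Obj_Cc by simp
qed

lemma gcat_Obj [simp]: "Obj (gcat I) = {M. preglider M}"
  and gcat_TensO [simp]: "TensO (gcat I) = T"
  and gcat_UnitO [simp]: "UnitO (gcat I) = E"
  by (simp_all add: gcat_def Let_def)

lemma gcat_Arr: "f \<in> Arr (gcat I) \<longleftrightarrow> preglider (src f) \<and> preglider (trg f) \<and>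
    glider_nat I (src f) (trg f) (dat f) \<and> dat f \<in> extensional I"
  by (cases f) (auto simp: gcat_def Let_def)

lemma gcat_sel [simp]:
  "src (Id (gcat I) M) = M" "trg (Id (gcat I) M) = M"
  "src (g \<cdot>\<^bsub>gcat I\<^esub> f) = src f" "trg (g \<cdot>\<^bsub>gcat I\<^esub> f) = trg g"
  "src (Add (gcat I) f g) = src f" "trg (Add (gcat I) f g) = trg f"
  "src (Scale (gcat I) c f) = src f" "trg (Scale (gcat I) c f) = trg f"
  "src (TensA (gcat I) f g) = T (src f) (src g)" "trg (TensA (gcat I) f g) = T (trg f) (trg g)"
  "src (Assoc (gcat I) L M N) = T (T L M) N" "trg (Assoc (gcat I) L M N) = T L (T M N)"
  "src (LUnit (gcat I) M) = T E M" "trg (LUnit (gcat I) M) = M"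
  "src (RUnit (gcat I) M) = T M E" "trg (RUnit (gcat I) M) = M"
  by (simp_all add: gcat_def Let_def)

lemma gcat_dat [simp]:
  "dat (Id (gcat I) M) = (\<lambda>i \<in> I. Id (vect K) (ObjMap M i))"
  "dat (g \<cdot>\<^bsub>gcat I\<^esub> f) = (\<lambda>i \<in> I. dat g i \<star> dat f i)"
  "dat (Add (gcat I) f g) = (\<lambda>i \<in> I. Add (vect K) (dat f i) (dat g i))"
  "dat (Scale (gcat I) c f) = (\<lambda>i \<in> I. Scale (vect K) c (dat f i))"
  "dat (TensA (gcat I) f g) = (\<lambda>i \<in> I. TensA (vect K) (dat f i) (dat g i))"
  "dat (Assoc (gcat I) L M N) = (\<lambda>i \<in> I. Assoc (vect K) (ObjMap L i) (ObjMap M i) (ObjMap N i))"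
  "dat (LUnit (gcat I) M) = (\<lambda>i \<in> I. LUnit (vect K) (ObjMap M i))"
  "dat (RUnit (gcat I) M) = (\<lambda>i \<in> I. RUnit (vect K) (ObjMap M i))"
  by (simp_all add: gcat_def Let_def)

lemma gcat_ArrD:
  assumes "f \<in> Arr (gcat I)"
  shows "preglider (src f)" "preglider (trg f)" "dat f \<in> extensional I"
    "i \<in> I \<Longrightarrow> dat f i \<in> Arr (vect K)" "i \<in> I \<Longrightarrow> src (dat f i) = ObjMap (src f) i"
    "i \<in> I \<Longrightarrow> trg (dat f i) = ObjMap (trg f) i"
    "i \<in> I \<Longrightarrow> j \<in> I \<Longrightarrow> g \<in> hs i j \<Longrightarrow>
      dat f j \<star> ga (src f) i g j = ga (trg f) i g j \<star> dat f i"
  using assms by (auto simp: gcat_Arr glider_nat_def)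

lemma gcat_ArrI:
  assumes "preglider (src f)" "preglider (trg f)" "dat f \<in> extensional I"
    "\<And>i. i \<in> I \<Longrightarrow> dat f i \<in> Arr (vect K)" "\<And>i. i \<in> I \<Longrightarrow> src (dat f i) = ObjMap (src f) i"
    "\<And>i. i \<in> I \<Longrightarrow> trg (dat f i) = ObjMap (trg f) i"
    "\<And>i j g. i \<in> I \<Longrightarrow> j \<in> I \<Longrightarrow> g \<in> hs i j \<Longrightarrow>
      dat f j \<star> ga (src f) i g j = ga (trg f) i g j \<star> dat f i"
  shows "f \<in> Arr (gcat I)"
  using assms by (auto simp: gcat_Arr glider_nat_def)

lemma gcat_eqI:
  assumes "f \<in> Arr (gcat I)" "g \<in> Arr (gcat I)" "src f = src g" "trg f = trg g"
    "\<And>i. i \<in> I \<Longrightarrow> dat f i = dat g i"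
  shows "f = g"
  using assms gcat_ArrD(3) by (intro arrow_eqI extensionalityI[of "dat f" I "dat g"]) auto

lemma Assoc_natural:
  fixes a b c :: "('k, 'u) vect_arrow"
  assumes a: "a \<in> Arr (vect K)" and b: "b \<in> Arr (vect K)" and c: "c \<in> Arr (vect K)"
  shows "Assoc (vect K) (trg a) (trg b) (trg c) \<star> TensA (vect K) (TensA (vect K) a b) c =
    TensA (vect K) a (TensA (vect K) b c) \<star> Assoc (vect K) (src a) (src b) (src c)"
proof -
  note m = Arr_vectD(1)[OF a] Arr_vectD(1)[OF b] Arr_vectD(1)[OF c]
  note n = Arr_vectD(2)[OF a] Arr_vectD(2)[OF b] Arr_vectD(2)[OF c]
  note A = TensA_vect_arr[OF TensA_vect_arr[OF a b] c] TensA_vect_arr[OF a TensA_vect_arr[OF b c]]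
  show ?thesis
  proof (rule tensor3_arr_eqI[OF m])
    fix x y z assume x: "x \<in> carrier (src a)" "y \<in> carrier (src b)" "z \<in> carrier (src c)"
    show "dat (Assoc (vect K) (trg a) (trg b) (trg c) \<star> TensA (vect K) (TensA (vect K) a b) c)
        (pt (tens (src a) (src b)) (src c) (pt (src a) (src b) x y) z) =
      dat (TensA (vect K) a (TensA (vect K) b c) \<star> Assoc (vect K) (src a) (src b) (src c))
        (pt (tens (src a) (src b)) (src c) (pt (src a) (src b) x y) z)"
      using x m dat_in[OF a] dat_in[OF b] dat_in[OF c] Assoc_vect_pt[OF m x]
        Assoc_vect_pt[OF n, of "dat a x" "dat b y" "dat c z"] TensA_vect_pt[OF a b, of x y]
        TensA_vect_pt[OF b c, of y z] TensA_vect_pt[OF TensA_vect_arr[OF a b] c, of "pt (src a) (src b) x y" z]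
        TensA_vect_pt[OF a TensA_vect_arr[OF b c], of x "pt (src b) (src c) y z"]
      by simp
  qed (use A m n in \<open>auto simp: Assoc_vect_arr\<close>)
qed

lemma Unit_natural:
  fixes a :: "('k, 'u) vect_arrow"
  assumes a: "a \<in> Arr (vect K)"
  shows "LUnit (vect K) (trg a) \<star> TensA (vect K) (Id (vect K) S) a = a \<star> LUnit (vect K) (src a)"
    "RUnit (vect K) (trg a) \<star> TensA (vect K) a (Id (vect K) S) = a \<star> RUnit (vect K) (src a)"
proof -
  note m = Arr_vectD(1,2)[OF a]
  have S: "Id (vect K) S \<in> Arr (vect K)" by (simp add: module_S)
  show "LUnit (vect K) (trg a) \<star> TensA (vect K) (Id (vect K) S) a = a \<star> LUnit (vect K) (src a)"
    by (rule tensor_arr_eqI[OF module_S m(1)])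
      (use S a m TensA_vect_pt[OF S a] dat_in[OF a] linear_smult[OF Arr_vectD(3)[OF a]] module_S in
        \<open>simp_all add: LUnit_vect_arr LUnit_vect_pt\<close>)
  show "RUnit (vect K) (trg a) \<star> TensA (vect K) a (Id (vect K) S) = a \<star> RUnit (vect K) (src a)"
    by (rule tensor_arr_eqI[OF m(1) module_S])
      (use S a m TensA_vect_pt[OF a S] dat_in[OF a] linear_smult[OF Arr_vectD(3)[OF a]] module_S in
        \<open>simp_all add: RUnit_vect_arr RUnit_vect_pt\<close>)
qed

text \<open>All structure is levelwise, so the laws come from vector spaces; the actual content is
  that the levelwise maps commute with the group action.\<close>

lemma lin_mon_cat_gcat:
  assumes I: "I \<subseteq> IX"
  shows "lin_mon_cat K (gcat I)"
proof
  have IX: "i \<in> IX" if "i \<in> I" for i using I that by blast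
  show "x \<in> Obj (gcat I) \<Longrightarrow> Id (gcat I) x \<in> Arr (gcat I)" for x
    by (rule gcat_ArrI) (auto simp: IX)
  show Comp: "g \<cdot>\<^bsub>gcat I\<^esub> f \<in> Arr (gcat I)" if "f \<in> Arr (gcat I)" "g \<in> Arr (gcat I)" "trg f = src g" for f g
  proof (rule gcat_ArrI)
    fix i j h assume ij: "i \<in> I" "j \<in> I" "h \<in> hs i j"
    note f = gcat_ArrD[OF that(1)] and g = gcat_ArrD[OF that(2)]
    have "(dat g j \<star> dat f j) \<star> ga (src f) i h j =
      dat g j \<star> (dat f j \<star> ga (src f) i h j)"
      using f g ij that IX by simp
    also have "\<dots> = (dat g j \<star> ga (trg f) i h j) \<star> dat f i"
      using f(1-6) g(1-6) ij that IX by (simp add: f(7)[OF ij])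
    also have "\<dots> = ga (trg g) i h j \<star> (dat g i \<star> dat f i)"
      using f(1-6) g(1-6) ij that IX g(7)[OF ij] by simp
    finally show "dat (g \<cdot>\<^bsub>gcat I\<^esub> f) j \<star> ga (src (g \<cdot>\<^bsub>gcat I\<^esub> f)) i h j =
      ga (trg (g \<cdot>\<^bsub>gcat I\<^esub> f)) i h j \<star> dat (g \<cdot>\<^bsub>gcat I\<^esub> f) i"
      using ij by simp
  qed (use that gcat_ArrD[OF that(1)] gcat_ArrD[OF that(2)] IX in auto)
  show "(h \<cdot>\<^bsub>gcat I\<^esub> g) \<cdot>\<^bsub>gcat I\<^esub> f = h \<cdot>\<^bsub>gcat I\<^esub> (g \<cdot>\<^bsub>gcat I\<^esub> f)"
    if "f \<in> Arr (gcat I)" "g \<in> Arr (gcat I)" "h \<in> Arr (gcat I)" "trg f = src g" "trg g = src h" for f g h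
    using that gcat_ArrD[OF that(1)] gcat_ArrD[OF that(2)] gcat_ArrD[OF that(3)]
    by (intro arrow_eqI) (auto intro!: restrict_ext vect.Comp_assoc)
  show "Id (gcat I) (trg f) \<cdot>\<^bsub>gcat I\<^esub> f = f" "f \<cdot>\<^bsub>gcat I\<^esub> Id (gcat I) (src f) = f"
    if "f \<in> Arr (gcat I)" for f
    using gcat_ArrD[OF that] by (auto intro!: arrow_eqI extensionalityI[of _ I])
  show "Add (gcat I) f g \<in> Arr (gcat I)"
    if "f \<in> Arr (gcat I)" "g \<in> Arr (gcat I)" "src f = src g" "trg f = trg g" for f g
  proof (rule gcat_ArrI)
    fix i j h assume ij: "i \<in> I" "j \<in> I" "h \<in> hs i j"
    note f = gcat_ArrD[OF that(1)] and g = gcat_ArrD[OF that(2)]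
    show "dat (Add (gcat I) f g) j \<star> ga (src (Add (gcat I) f g)) i h j =
      ga (trg (Add (gcat I) f g)) i h j \<star> dat (Add (gcat I) f g) i"
      using f(1-6) g(1-6) f(7)[OF ij] g(7)[OF ij] ij that(3,4) IX by (simp add: vect_bilinear)
  qed (use that gcat_ArrD[OF that(1)] gcat_ArrD[OF that(2)] IX in \<open>auto intro!: vect_Add_arr\<close>)
  show "Scale (gcat I) c f \<in> Arr (gcat I)" if "c \<in> carrier K" "f \<in> Arr (gcat I)" for c f
  proof (rule gcat_ArrI)
    fix i j h assume ij: "i \<in> I" "j \<in> I" "h \<in> hs i j"
    note f = gcat_ArrD[OF that(2)]
    show "dat (Scale (gcat I) c f) j \<star> ga (src (Scale (gcat I) c f)) i h j =
      ga (trg (Scale (gcat I) c f)) i h j \<star> dat (Scale (gcat I) c f) i"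
      using f(1-6) f(7)[OF ij] ij that(1) IX
        vect_bilinear(3)[of "dat f j" "dat f j" "ga (src f) i h j" c]
        vect_bilinear(4)[of "dat f i" "dat f i" "ga (trg f) i h j" c] by simp
  qed (use that gcat_ArrD[OF that(2)] IX in \<open>auto intro!: vect_Scale_arr\<close>)
  show "TensA (gcat I) f g \<in> Arr (gcat I)" if "f \<in> Arr (gcat I)" "g \<in> Arr (gcat I)" for f g
  proof (rule gcat_ArrI)
    fix i j h assume ij: "i \<in> I" "j \<in> I" "h \<in> hs i j"
    note f = gcat_ArrD[OF that(1)] and g = gcat_ArrD[OF that(2)]
    show "dat (TensA (gcat I) f g) j \<star> ga (src (TensA (gcat I) f g)) i h j =
      ga (trg (TensA (gcat I) f g)) i h j \<star> dat (TensA (gcat I) f g) i"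
      using f(1-6) g(1-6) f(7)[OF ij] g(7)[OF ij] ij IX by (simp add: ga_T flip: TensA_vect_Comp)
  qed (use that gcat_ArrD[OF that(1)] gcat_ArrD[OF that(2)] IX in auto)
  show "TensA (gcat I) (Id (gcat I) x) (Id (gcat I) y) = Id (gcat I) (TensO (gcat I) x y)"
    if "x \<in> Obj (gcat I)" "y \<in> Obj (gcat I)" for x y
    using that by (auto intro!: arrow_eqI restrict_ext simp: TensA_vect_Id IX)
  show "TensA (gcat I) (g \<cdot>\<^bsub>gcat I\<^esub> f) (g' \<cdot>\<^bsub>gcat I\<^esub> f') =
      TensA (gcat I) g g' \<cdot>\<^bsub>gcat I\<^esub> TensA (gcat I) f f'"
    if "f \<in> Arr (gcat I)" "g \<in> Arr (gcat I)" "trg f = src g"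
      "f' \<in> Arr (gcat I)" "g' \<in> Arr (gcat I)" "trg f' = src g'" for f g f' g'
    using that gcat_ArrD[OF that(1)] gcat_ArrD[OF that(2)] gcat_ArrD[OF that(4)] gcat_ArrD[OF that(5)]
    by (intro arrow_eqI) (auto intro!: restrict_ext TensA_vect_Comp)
  show "Assoc (gcat I) x y z \<in> homset (gcat I) (TensO (gcat I) (TensO (gcat I) x y) z)
      (TensO (gcat I) x (TensO (gcat I) y z))"
    if "x \<in> Obj (gcat I)" "y \<in> Obj (gcat I)" "z \<in> Obj (gcat I)" for x y z
  proof -
    have "Assoc (gcat I) x y z \<in> Arr (gcat I)"
    proof (rule gcat_ArrI)
      fix i j h assume ij: "i \<in> I" "j \<in> I" "h \<in> hs i j"
      show "dat (Assoc (gcat I) x y z) j \<star> ga (src (Assoc (gcat I) x y z)) i h j =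
        ga (trg (Assoc (gcat I) x y z)) i h j \<star> dat (Assoc (gcat I) x y z) i"
        using Assoc_natural[of "ga x i h j" "ga y i h j" "ga z i h j"] that ij IX by (simp add: ga_T)
    qed (use that IX in \<open>auto simp: Assoc_vect_arr\<close>)
    then show ?thesis by (simp add: homset_def)
  qed
  show "LUnit (gcat I) x \<in> homset (gcat I) (TensO (gcat I) (UnitO (gcat I)) x) x"
    if "x \<in> Obj (gcat I)" for x
  proof -
    have "LUnit (gcat I) x \<in> Arr (gcat I)"
    proof (rule gcat_ArrI)
      fix i j h assume ij: "i \<in> I" "j \<in> I" "h \<in> hs i j"
      show "dat (LUnit (gcat I) x) j \<star> ga (src (LUnit (gcat I) x)) i h j =
        ga (trg (LUnit (gcat I) x)) i h j \<star> dat (LUnit (gcat I) x) i"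
        using Unit_natural(1)[of "ga x i h j"] that ij IX by (simp add: ga_T ga_E)
    qed (use that IX in \<open>auto simp: LUnit_vect_arr\<close>)
    then show ?thesis by (simp add: homset_def)
  qed
  show "RUnit (gcat I) x \<in> homset (gcat I) (TensO (gcat I) x (UnitO (gcat I))) x"
    if "x \<in> Obj (gcat I)" for x
  proof -
    have "RUnit (gcat I) x \<in> Arr (gcat I)"
    proof (rule gcat_ArrI)
      fix i j h assume ij: "i \<in> I" "j \<in> I" "h \<in> hs i j"
      show "dat (RUnit (gcat I) x) j \<star> ga (src (RUnit (gcat I) x)) i h j =
        ga (trg (RUnit (gcat I) x)) i h j \<star> dat (RUnit (gcat I) x) i"
        using Unit_natural(2)[of "ga x i h j"] that ij IX by (simp add: ga_T ga_E)
    qed (use that IX in \<open>auto simp: RUnit_vect_arr\<close>)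
    then show ?thesis by (simp add: homset_def)
  qed
qed (auto simp: gcat_Arr)

text \<open>Levelwise inverses commute with the action because the given maps do and can be
  cancelled.\<close>

lemma iso_gcat_iff:
  assumes I: "I \<subseteq> IX" and f: "f \<in> Arr (gcat I)"
  shows "iso_arr (gcat I) f \<longleftrightarrow> (\<forall>i \<in> I. iso_arr (vect K) (dat f i))"
proof
  interpret lin_mon_cat K "gcat I" by (rule lin_mon_cat_gcat[OF I])
  have IX: "i \<in> IX" if "i \<in> I" for i using I that by blast
  note F = gcat_ArrD[OF f]
  show "\<forall>i \<in> I. iso_arr (vect K) (dat f i)" if "iso_arr (gcat I) f"
  proof
    fix i assume i: "i \<in> I"
    from that obtain g where g: "g \<in> Arr (gcat I)" "src g = trg f" "trg g = src f"
      "g \<cdot>\<^bsub>gcat I\<^esub> f = Id (gcat I) (src f)" "f \<cdot>\<^bsub>gcat I\<^esub> g = Id (gcat I) (trg f)"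
      using iso_arrE by blast
    show "iso_arr (vect K) (dat f i)"
    proof (rule vect.iso_arrI[where g = "dat g i"])
      show "dat g i \<star> dat f i = Id (vect K) (src (dat f i))"
        using arg_cong[OF g(4), of "\<lambda>a. dat a i"] i F by simp
      show "dat f i \<star> dat g i = Id (vect K) (trg (dat f i))"
        using arg_cong[OF g(5), of "\<lambda>a. dat a i"] i F by simp
    qed (use F gcat_ArrD[OF g(1)] g i in auto)
  qed
  assume iso: "\<forall>i \<in> I. iso_arr (vect K) (dat f i)"
  then have inv: "\<forall>i \<in> I. \<exists>g. g \<in> Arr (vect K) \<and> src g = trg (dat f i) \<and> trg g = src (dat f i) \<and>
    g \<star> dat f i = Id (vect K) (src (dat f i)) \<and> dat f i \<star> g = Id (vect K) (trg (dat f i))"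
    by (meson vect.iso_arrE)
  then obtain g where g: "\<And>i. i \<in> I \<Longrightarrow> g i \<in> Arr (vect K)" "\<And>i. i \<in> I \<Longrightarrow> src (g i) = trg (dat f i)"
    "\<And>i. i \<in> I \<Longrightarrow> trg (g i) = src (dat f i)"
    "\<And>i. i \<in> I \<Longrightarrow> g i \<star> dat f i = Id (vect K) (src (dat f i))"
    "\<And>i. i \<in> I \<Longrightarrow> dat f i \<star> g i = Id (vect K) (trg (dat f i))"
    using bchoice[OF inv] by blast
  let ?g = "Arrow (trg f) (restrict g I) (src f)"
  have gA: "?g \<in> Arr (gcat I)"
  proof (rule gcat_ArrI)
    fix i j h assume ij: "i \<in> I" "j \<in> I" "h \<in> hs i j"
    have "g j \<star> ga (trg f) i h j = ga (src f) i h j \<star> g i"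
    proof (rule vect.iso_cancel_right[of K "dat f i"])
      have "(g j \<star> ga (trg f) i h j) \<star> dat f i =
        g j \<star> (dat f j \<star> ga (src f) i h j)"
        using F(1-6) F(7)[OF ij] g(1-3) ij IX by simp
      also have "\<dots> = ga (src f) i h j" by (rule vect.cancel_left) (use F g ij IX in auto)
      also have "\<dots> = (ga (src f) i h j \<star> g i) \<star> dat f i" using F g ij IX by simp
      finally show "(g j \<star> ga (trg f) i h j) \<star> dat f i =
        (ga (src f) i h j \<star> g i) \<star> dat f i" .
    qed (use iso F g ij IX in auto)
    then show "dat ?g j \<star> ga (src ?g) i h j = ga (trg ?g) i h j \<star> dat ?g i" using ij by simp
  qed (use F g in auto)
  show "iso_arr (gcat I) f"
    by (rule iso_arrI[OF f gA]) (use F g in \<open>auto intro!: arrow_eqI restrict_ext\<close>)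
qed


lemma gm_comp: "preglider M \<Longrightarrow> u \<in> IX \<Longrightarrow> v \<in> IX \<Longrightarrow> w \<in> IX \<Longrightarrow> g \<in> hs u v \<Longrightarrow> h \<in> hs v w \<Longrightarrow>
    x \<in> lev M u \<Longrightarrow> gm M v h w (gm M u g v x) = gm M u (h \<otimes>\<^bsub>G\<^esub> g) w x"
  using glider_repD(4)[OF glider_rep_preglider] .

lemma gm_linear: "preglider M \<Longrightarrow> u \<in> IX \<Longrightarrow> v \<in> IX \<Longrightarrow> g \<in> hs u v \<Longrightarrow>
    gm M u g v \<in> linear_maps K (ObjMap M u) (ObjMap M v)"
  using glider_repD(2)[OF glider_rep_preglider] .

lemma gm_in: "preglider M \<Longrightarrow> u \<in> IX \<Longrightarrow> v \<in> IX \<Longrightarrow> g \<in> hs u v \<Longrightarrow> x \<in> lev M u \<Longrightarrow>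
    gm M u g v x \<in> lev M v"
  using glider_repD(6)[OF glider_rep_preglider] .

lemma gm_one: "preglider M \<Longrightarrow> u \<in> IX \<Longrightarrow> x \<in> lev M u \<Longrightarrow> gm M u \<one>\<^sub>G u x = x"
  by (simp add: ga_one)

definition ga_arrow :: "index set \<Rightarrow> ('k, 'u, 'g \<Rightarrow> 'k) glider \<Rightarrow> (index \<Rightarrow> 'u \<Rightarrow> 'u) \<Rightarrow>
    ('k, 'u, 'g \<Rightarrow> 'k) glider \<Rightarrow> ('k, 'u, 'g) glider_arrow" where
  "ga_arrow I M h N = Arrow M (\<lambda>i \<in> I. Arrow (ObjMap M i) (h i) (ObjMap N i)) N"

lemma ga_arrow_sel [simp]: "src (ga_arrow I M h N) = M" "trg (ga_arrow I M h N) = N"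
  "i \<in> I \<Longrightarrow> dat (ga_arrow I M h N) i = Arrow (ObjMap M i) (h i) (ObjMap N i)"
  by (simp_all add: ga_arrow_def)

text \<open>Every level embeds into the ambient representation, so a naturality square between
  finite levels may be compared there, where it follows from equivariance.\<close>

lemma ga_arrow_IX:
  assumes M: "preglider M" and N: "preglider N"
    and lin: "\<And>i. i \<in> IX \<Longrightarrow> h i \<in> linear_maps K (ObjMap M i) (ObjMap N i)"
    and emb: "\<And>i x. i \<in> {lo, hi} \<Longrightarrow> x \<in> lev M i \<Longrightarrow>
      h Infty (gm M i \<one>\<^sub>G Infty x) = gm N i \<one>\<^sub>G Infty (h i x)"
    and act: "\<And>g x. g \<in> carrier G \<Longrightarrow> x \<in> lev M Infty \<Longrightarrow>
      h Infty (gm M Infty g Infty x) = gm N Infty g Infty (h Infty x)"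
  shows "ga_arrow IX M h N \<in> Arr (gcat IX)"
proof (rule gcat_ArrI)
  fix i j g assume ij: "i \<in> IX" "j \<in> IX" "g \<in> hs i j"
  note cl = linear_closed[OF lin]
  have e: "h Infty (gm M i \<one>\<^sub>G Infty x) = gm N i \<one>\<^sub>G Infty (h i x)"
    if "i \<in> IX" "x \<in> lev M i" for i x
    using that emb[of i x] cl[of Infty x] gm_one[OF M, of Infty x] gm_one[OF N, of Infty "h Infty x"]
    by (auto simp: IX_def)
  have "h j (gm M i g j x) = gm N i g j (h i x)" if x: "x \<in> lev M i" for x
  proof -
    note hx = cl[OF ij(1) x] and gx = gm_in[OF M ij x]
    have g: "g \<in> carrier G" using ij(3) by simp
    have "gm N j \<one>\<^sub>G Infty (h j (gm M i g j x)) = h Infty (gm M i g Infty x)"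
      using e[OF ij(2) gx] gm_comp[OF M ij(1,2) _ ij(3), of Infty "\<one>\<^sub>G" x] x g by simp
    also have "gm M i g Infty x = gm M Infty g Infty (gm M i \<one>\<^sub>G Infty x)"
      using gm_comp[OF M ij(1), of Infty Infty "\<one>\<^sub>G" g x] x g by simp
    also have "h Infty \<dots> = gm N Infty g Infty (gm N i \<one>\<^sub>G Infty (h i x))"
      using act[OF g gm_in[OF M ij(1) _ _ x, of Infty "\<one>\<^sub>G"]] e[OF ij(1) x] by simp
    also have "\<dots> = gm N i g Infty (h i x)"
      using gm_comp[OF N ij(1), of Infty Infty "\<one>\<^sub>G" g "h i x"] hx g by simp
    also have "\<dots> = gm N j \<one>\<^sub>G Infty (gm N i g j (h i x))"
      using gm_comp[OF N ij(1,2) _ ij(3), of Infty "\<one>\<^sub>G" "h i x"] hx g by simp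
    finally have eq: "gm N j \<one>\<^sub>G Infty (h j (gm M i g j x)) = gm N j \<one>\<^sub>G Infty (gm N i g j (h i x))" .
    have "inj_on (gm N j \<one>\<^sub>G Infty) (lev N j)"
      by (rule ga_inj[OF N ij(2)]) (cases j; simp)+
    then show ?thesis using eq cl[OF ij(2) gx] gm_in[OF N ij hx] by (auto dest: inj_onD)
  qed
  then show "dat (ga_arrow IX M h N) j \<star> ga (src (ga_arrow IX M h N)) i g j =
    ga (trg (ga_arrow IX M h N)) i g j \<star> dat (ga_arrow IX M h N) i"
    using ij M N by (auto intro!: arrow_eqI restrict_ext)
qed (use M N lin in \<open>auto simp: Arr_vect ga_arrow_def\<close>)

definition LX :: "index set" where "LX = {lo, hi}"

lemma LX_IX: "LX \<subseteq> IX" by (auto simp: LX_def IX_def)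

lemma LX_mem [simp]: "lo \<in> LX" "hi \<in> LX" by (simp_all add: LX_def)

text \<open>Among the levels -1 and 0 the only hom set that is neither trivial nor empty leads from
  -1 to 0.\<close>

lemma ga_arrow_LX:
  assumes M: "preglider M" and N: "preglider N"
    and lin: "\<And>i. i \<in> LX \<Longrightarrow> h i \<in> linear_maps K (ObjMap M i) (ObjMap N i)"
    and act: "\<And>g x. g \<in> carrier G \<Longrightarrow> x \<in> lev M lo \<Longrightarrow>
      h hi (gm M lo g hi x) = gm N lo g hi (h lo x)"
  shows "ga_arrow LX M h N \<in> Arr (gcat LX)"
proof (rule gcat_ArrI)
  fix i j g assume ij: "i \<in> LX" "j \<in> LX" "g \<in> hs i j"
  then have I: "i \<in> IX" "j \<in> IX" using LX_IX by auto
  have "h j (gm M i g j x) = gm N i g j (h i x)" if x: "x \<in> lev M i" for x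
    using ij act[of g x] x gm_one[OF M I(1) x] gm_one[OF N I(1) linear_closed[OF lin[OF ij(1)] x]]
    by (auto simp: LX_def)
  then show "dat (ga_arrow LX M h N) j \<star> ga (src (ga_arrow LX M h N)) i g j =
    ga (trg (ga_arrow LX M h N)) i g j \<star> dat (ga_arrow LX M h N) i"
    using ij I M N by (auto intro!: arrow_eqI restrict_ext)
qed (use M N lin LX_IX in \<open>auto simp: Arr_vect ga_arrow_def subset_iff\<close>)

lemma gcat_dat_nat:
  assumes f: "f \<in> Arr (gcat I)" and I: "I \<subseteq> IX" and ij: "i \<in> I" "j \<in> I" "g \<in> hs i j"
    and x: "x \<in> lev (src f) i"
  shows "dat (dat f j) (gm (src f) i g j x) = gm (trg f) i g j (dat (dat f i) x)"
    "dat (dat f i) x \<in> lev (trg f) i"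
proof -
  note F = gcat_ArrD[OF f]
  have I': "i \<in> IX" "j \<in> IX" using I ij by auto
  show "dat (dat f j) (gm (src f) i g j x) = gm (trg f) i g j (dat (dat f i) x)"
    using arg_cong[OF F(7)[OF ij], of "\<lambda>a. dat a x"] F(1-6) ij x I' by simp
  show "dat (dat f i) x \<in> lev (trg f) i"
    using dat_in[OF F(4)[OF ij(1)], of x] F(5,6)[OF ij(1)] x by simp
qed

lemma gcat_dat_in:
  assumes f: "f \<in> Arr (gcat I)" and i: "i \<in> I" and x: "x \<in> lev (src f) i"
  shows "dat (dat f i) x \<in> lev (trg f) i"
  using dat_in[OF gcat_ArrD(4)[OF f i], of x] gcat_ArrD(5,6)[OF f i] x by simp

lemma gcat_dat_linear:
  assumes f: "f \<in> Arr (gcat I)" and i: "i \<in> I"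
  shows "dat (dat f i) \<in> linear_maps K (ObjMap (src f) i) (ObjMap (trg f) i)"
  using Arr_vectD(3)[OF gcat_ArrD(4)[OF f i]] gcat_ArrD(5,6)[OF f i] by simp

subsection \<open>Gliders inside a group representation\<close>

text \<open>Subspaces are given by injective maps and not by inclusions, so that a level can keep
  its own underlying space while the ambient representation varies.\<close>

definition emb_data :: "('k, 'u) module \<Rightarrow> ('g \<Rightarrow> 'u \<Rightarrow> 'u) \<Rightarrow> ('k, 'u) module \<Rightarrow> ('u \<Rightarrow> 'u) \<Rightarrow>
    ('k, 'u) module \<Rightarrow> ('u \<Rightarrow> 'u) \<Rightarrow> bool" where
  "emb_data \<Omega> \<rho> V jV W jW \<longleftrightarrow> module K \<Omega> \<and> module K V \<and> module K W \<and>
     (\<forall>g \<in> carrier G. \<rho> g \<in> linear_maps K \<Omega> \<Omega>) \<and> (\<forall>x \<in> carrier \<Omega>. \<rho> \<one>\<^sub>G x = x) \<and>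
     (\<forall>g \<in> carrier G. \<forall>h \<in> carrier G. \<forall>x \<in> carrier \<Omega>. \<rho> h (\<rho> g x) = \<rho> (h \<otimes>\<^bsub>G\<^esub> g) x) \<and>
     jV \<in> linear_maps K V \<Omega> \<and> inj_on jV (carrier V) \<and>
     jW \<in> linear_maps K W \<Omega> \<and> inj_on jW (carrier W) \<and>
     (\<forall>g \<in> carrier G. \<forall>x \<in> carrier V. \<rho> g (jV x) \<in> jW ` carrier W)"

definition emb_glider :: "('k, 'u) module \<Rightarrow> ('g \<Rightarrow> 'u \<Rightarrow> 'u) \<Rightarrow> ('k, 'u) module \<Rightarrow> ('u \<Rightarrow> 'u) \<Rightarrow>
    ('k, 'u) module \<Rightarrow> ('u \<Rightarrow> 'u) \<Rightarrow> ('k, 'u, 'g \<Rightarrow> 'k) glider" where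
  "emb_glider \<Omega> \<rho> V jV W jW = (
     let X = (\<lambda>i. if i = Infty then \<Omega> else if i = lo then V else W);
         j = (\<lambda>i. if i = Infty then (\<lambda>x \<in> carrier \<Omega>. x) else if i = lo then jV else jW)
     in mk_glider X (\<lambda>u g v. \<lambda>x \<in> carrier (X u). inv_into (carrier (X v)) (j v) (\<rho> g (j u x))))"

text \<open>The action on a level is the ambient action pulled back along an injection; every law
  holds after applying that injection.\<close>

lemma emb_glider:
  assumes d: "emb_data \<Omega> \<rho> V jV W jW"
  shows "preglider (emb_glider \<Omega> \<rho> V jV W jW)"
    and "ObjMap (emb_glider \<Omega> \<rho> V jV W jW) Infty = \<Omega>"
    and "ObjMap (emb_glider \<Omega> \<rho> V jV W jW) lo = V"
    and "ObjMap (emb_glider \<Omega> \<rho> V jV W jW) hi = W"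
    and "g \<in> carrier G \<Longrightarrow> x \<in> carrier \<Omega> \<Longrightarrow> gm (emb_glider \<Omega> \<rho> V jV W jW) Infty g Infty x = \<rho> g x"
    and "x \<in> carrier V \<Longrightarrow> gm (emb_glider \<Omega> \<rho> V jV W jW) lo \<one>\<^sub>G Infty x = jV x"
    and "x \<in> carrier W \<Longrightarrow> gm (emb_glider \<Omega> \<rho> V jV W jW) hi \<one>\<^sub>G Infty x = jW x"
    and "g \<in> carrier G \<Longrightarrow> x \<in> carrier V \<Longrightarrow>
      jW (gm (emb_glider \<Omega> \<rho> V jV W jW) lo g hi x) = \<rho> g (jV x)"
proof -
  define X where "X = (\<lambda>i. if i = Infty then \<Omega> else if i = lo then V else W)"
  define j where "j = (\<lambda>i. if i = Infty then (\<lambda>x \<in> carrier \<Omega>. x) else if i = lo then jV else jW)"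
  define act where "act u g v = (\<lambda>x \<in> carrier (X u). inv_into (carrier (X v)) (j v) (\<rho> g (j u x)))" for u g v
  have e: "emb_glider \<Omega> \<rho> V jV W jW = mk_glider X act"
    unfolding emb_glider_def X_def j_def act_def[abs_def] Let_def by simp
  have m: "module K \<Omega>" "module K V" "module K W"
    and \<rho>: "\<And>g. g \<in> carrier G \<Longrightarrow> \<rho> g \<in> linear_maps K \<Omega> \<Omega>" "\<And>x. x \<in> carrier \<Omega> \<Longrightarrow> \<rho> \<one>\<^sub>G x = x"
      "\<And>g h x. g \<in> carrier G \<Longrightarrow> h \<in> carrier G \<Longrightarrow> x \<in> carrier \<Omega> \<Longrightarrow> \<rho> h (\<rho> g x) = \<rho> (h \<otimes>\<^bsub>G\<^esub> g) x"
    and jV: "jV \<in> linear_maps K V \<Omega>" "inj_on jV (carrier V)"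
    and jW: "jW \<in> linear_maps K W \<Omega>" "inj_on jW (carrier W)"
    and st: "\<And>g x. g \<in> carrier G \<Longrightarrow> x \<in> carrier V \<Longrightarrow> \<rho> g (jV x) \<in> jW ` carrier W"
    using d unfolding emb_data_def by blast+
  interpret \<Omega>: vspace K \<Omega> by (rule vspace.intro) (rule m)
  have X: "module K (X i)" for i using m by (simp add: X_def)
  have jl: "j i \<in> linear_maps K (X i) \<Omega>" and ji: "inj_on (j i) (carrier (X i))" for i
    using jV jW \<Omega>.linear_map_id by (auto simp: X_def j_def inj_on_def)
  note jc = linear_closed[OF jl] and \<rho>c = linear_closed[OF \<rho>(1)]
  \<comment> \<open>The pullback is defined: into the ambient level nothing is to be shown, from a
    finite level to itself only the unit acts, and from -1 to 0 the stability condition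
    applies.\<close>
  have img: "\<rho> g (j u x) \<in> j v ` carrier (X v)"
    if "u \<in> IX" "v \<in> IX" "g \<in> hs u v" "x \<in> carrier (X u)" for u v g x
  proof (cases "v = Infty")
    case True
    have "\<rho> g (j u x) \<in> carrier \<Omega>" using \<rho>c jc that by simp
    then show ?thesis using True by (auto simp: X_def j_def)
  next
    case False
    then show ?thesis
    proof (cases "u = v")
      case True
      have "\<not> (v = lo \<and> v = hi)" by auto
      then have "g = \<one>\<^sub>G" using that(3) False unfolding True hs_def by (simp only: if_False if_True refl singleton_iff simp_thms)
      then show ?thesis using that(4) True jc \<rho>(2) by simp
    next
      case neq: False
      have "u = lo \<and> v = hi"
        using that(3) False neq unfolding hs_def by (cases "u = lo \<and> v = hi") simp_all
      then have "u = lo" "v = hi" by simp_all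
      then show ?thesis using st[of g x] that by (simp add: X_def j_def)
    qed
  qed
  have jact: "j v (act u g v x) = \<rho> g (j u x)" "act u g v x \<in> carrier (X v)"
    if "u \<in> IX" "v \<in> IX" "g \<in> hs u v" "x \<in> carrier (X u)" for u v g x
    using img[OF that] that by (auto simp: act_def f_inv_into_f inv_into_into)
  have cancel: "x = y" if "j v x = j v y" "x \<in> carrier (X v)" "y \<in> carrier (X v)" for v x y
    using inj_onD[OF ji that] .
  have r: "glider_rep X act"
    unfolding glider_rep_def
  proof (intro conjI ballI impI)
    fix u assume u: "u \<in> IX"
    show "module K (X u)" by (rule X)
    fix x assume x: "x \<in> carrier (X u)"
    show "act u \<one>\<^sub>G u x = x"
      by (rule cancel[of u]) (use jact[OF u u hs_one x] x \<rho>(2) jc[OF x] in auto)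
  next
    fix u v assume I: "u \<in> IX" "v \<in> IX"
    show "act u g v \<in> linear_maps K (X u) (X v)" if g: "g \<in> hs u v" for g
    proof (rule linear_mapsI)
      interpret A: module K "X u" by (rule X)
      interpret Bm: module K "X v" by (rule X)
      have gG: "g \<in> carrier G" using g by simp
      show "act u g v \<in> extensional (carrier (X u))" by (simp add: act_def)
      show "act u g v x \<in> carrier (X v)" if "x \<in> carrier (X u)" for x using jact(2)[OF I g that] .
      show "act u g v (x \<oplus>\<^bsub>X u\<^esub> y) = act u g v x \<oplus>\<^bsub>X v\<^esub> act u g v y"
        if "x \<in> carrier (X u)" "y \<in> carrier (X u)" for x y
        by (rule cancel[of v])
          (use that jact[OF I g] jc \<rho>c[OF gG] in \<open>simp_all add: linear_add[OF jl] linear_add[OF \<rho>(1)[OF gG]]\<close>)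
      show "act u g v (c \<odot>\<^bsub>X u\<^esub> x) = c \<odot>\<^bsub>X v\<^esub> act u g v x"
        if "c \<in> carrier K" "x \<in> carrier (X u)" for c x
        by (rule cancel[of v])
          (use that jact[OF I g] jc \<rho>c[OF gG] in \<open>simp_all add: linear_smult[OF jl] linear_smult[OF \<rho>(1)[OF gG]]\<close>)
    qed
    show "inj_on (act u \<one>\<^sub>G v) (carrier (X u))" if "index_le u v"
    proof (rule inj_onI)
      fix x y assume xy: "x \<in> carrier (X u)" "y \<in> carrier (X u)" "act u \<one>\<^sub>G v x = act u \<one>\<^sub>G v y"
      note o = hs_le[OF I that]
      have "j u x = j u y" using jact(1)[OF I o xy(1)] jact(1)[OF I o xy(2)] xy \<rho>(2) jc by simp
      then show "x = y" using cancel xy by blast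
    qed
    fix w g h x
    assume a: "w \<in> IX" "g \<in> hs u v" "h \<in> hs v w" "x \<in> carrier (X u)"
    note hg = hs_comp[OF I a(1-3)]
    have gG: "g \<in> carrier G" "h \<in> carrier G" using a by auto
    show "act v h w (act u g v x) = act u (h \<otimes>\<^bsub>G\<^esub> g) w x"
      by (rule cancel[of w])
        (use jact[OF I a(2,4)] jact[OF I(2) a(1,3), of "act u g v x"] jact[OF I(1) a(1) hg a(4)]
          \<rho>(3)[OF gG jc[OF a(4)]] in simp_all)
  qed
  have gmact: "gm (emb_glider \<Omega> \<rho> V jV W jW) u g v = act u g v"
    if "u \<in> IX" "v \<in> IX" "g \<in> hs u v" for u g v
    unfolding e using ga_mk_glider[OF r that] by simp
  show "preglider (emb_glider \<Omega> \<rho> V jV W jW)" unfolding e by (rule is_preglider_mk_glider[OF r])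
  show "ObjMap (emb_glider \<Omega> \<rho> V jV W jW) Infty = \<Omega>"
    "ObjMap (emb_glider \<Omega> \<rho> V jV W jW) lo = V"
    "ObjMap (emb_glider \<Omega> \<rho> V jV W jW) hi = W"
    unfolding e by (simp_all add: X_def)
  show "gm (emb_glider \<Omega> \<rho> V jV W jW) Infty g Infty x = \<rho> g x" if "g \<in> carrier G" "x \<in> carrier \<Omega>"
    using jact[of Infty Infty g x] that by (simp add: gmact) (simp add: X_def j_def \<rho>c)
  show "gm (emb_glider \<Omega> \<rho> V jV W jW) lo \<one>\<^sub>G Infty x = jV x" if "x \<in> carrier V"
    using jact[of "lo" Infty "\<one>\<^sub>G" x] that linear_closed[OF jV(1)] \<rho>(2)
    by (simp add: gmact) (simp add: X_def j_def)
  show "gm (emb_glider \<Omega> \<rho> V jV W jW) hi \<one>\<^sub>G Infty x = jW x" if "x \<in> carrier W"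
    using jact[of "hi" Infty "\<one>\<^sub>G" x] that linear_closed[OF jW(1)] \<rho>(2)
    by (simp add: gmact) (simp add: X_def j_def)
  show "jW (gm (emb_glider \<Omega> \<rho> V jV W jW) lo g hi x) = \<rho> g (jV x)"
    if "g \<in> carrier G" "x \<in> carrier V"
    using jact[of "lo" "hi" g x] that
    by (simp add: gmact) (simp add: X_def j_def)
qed

lemma emb_dataI:
  assumes "module K \<Omega>" "module K V" "module K W"
    "\<And>g. g \<in> carrier G \<Longrightarrow> \<rho> g \<in> linear_maps K \<Omega> \<Omega>" "\<And>x. x \<in> carrier \<Omega> \<Longrightarrow> \<rho> \<one>\<^sub>G x = x"
    "\<And>g h x. g \<in> carrier G \<Longrightarrow> h \<in> carrier G \<Longrightarrow> x \<in> carrier \<Omega> \<Longrightarrow> \<rho> h (\<rho> g x) = \<rho> (h \<otimes>\<^bsub>G\<^esub> g) x"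
    "jV \<in> linear_maps K V \<Omega>" "inj_on jV (carrier V)" "jW \<in> linear_maps K W \<Omega>" "inj_on jW (carrier W)"
    "\<And>g x. g \<in> carrier G \<Longrightarrow> x \<in> carrier V \<Longrightarrow> \<rho> g (jV x) \<in> jW ` carrier W"
  shows "emb_data \<Omega> \<rho> V jV W jW"
  using assms by (simp add: emb_data_def)

subsection \<open>Gliders are a localization\<close>

definition Res :: "('k, 'u, 'g) glider_arrow \<Rightarrow>
    ('k, 'u, 'g) glider_arrow" where
  "Res f = Arrow (src f) (restrict (dat f) LX) (trg f)"

lemma Res_sel [simp]: "src (Res f) = src f" "trg (Res f) = trg f" "i \<in> LX \<Longrightarrow> dat (Res f) i = dat f i"
  "dat (Res f) = restrict (dat f) LX"
  by (simp_all add: Res_def)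

lemma Res_arr: "f \<in> Arr (gcat IX) \<Longrightarrow> Res f \<in> Arr (gcat LX)"
  using LX_IX by (auto simp: gcat_Arr glider_nat_def subset_iff)

text \<open>The denominator is the graph of \<open>r\<close>: its levels \<open>-1\<close> and \<open>0\<close> are those of the source, embedded by
  \<open>m \<mapsto> (m, r m)\<close> into the direct sum of the two ambient spaces.\<close>

lemma glider_roof:
  assumes r: "r \<in> Arr (gcat LX)"
  shows "\<exists>s \<in> Arr (gcat IX). \<exists>a \<in> Arr (gcat IX). src a = src s \<and> trg s = src r \<and> trg a = trg r \<and>
    (\<forall>i \<in> LX. dat s i = Id (vect K) (ObjMap (src r) i)) \<and> (\<forall>i \<in> LX. dat a i = dat r i)"
proof -
  define M N where "M = src r" and "N = trg r"
  have M: "preglider M" and N: "preglider N" using gcat_ArrD(1,2)[OF r] by (simp_all add: M_def N_def)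
  define r' where "r' i = dat (dat r i)" for i
  have r'l: "r' i \<in> linear_maps K (ObjMap M i) (ObjMap N i)" if "i \<in> LX" for i
    using gcat_dat_linear[OF r that] by (simp add: M_def N_def r'_def)
  have r'n: "r' hi (gm M lo g hi x) = gm N lo g hi (r' lo x)"
    if "g \<in> carrier G" "x \<in> lev M lo" for g x
    using gcat_dat_nat(1)[OF r LX_IX, of "lo" "hi" g x] that by (simp add: M_def N_def r'_def)
  let ?P = "prod_module (ObjMap M Infty) (ObjMap N Infty)"
  \<comment> \<open>The direct sum of the two ambient representations, coded into the universe by
    \<open>pair\<close>.\<close>
  define \<Omega> where "\<Omega> = transport_module pair ?P"
  have inj: "inj_on pair A" for A using inj_pair by (rule inj_on_subset) simp
  have mP: "module K ?P" using M N by (simp add: module_prod_module)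
  have m\<Omega>: "module K \<Omega>" unfolding \<Omega>_def by (rule module_transport_module[OF mP inj])
  interpret MI: module K "ObjMap M Infty" using M by simp
  interpret NI: module K "ObjMap N Infty" using N by simp
  have c\<Omega>: "carrier \<Omega> = pair ` (lev M Infty \<times> lev N Infty)"
    by (simp add: \<Omega>_def transport_module_sel(1)[OF inj]) (simp add: prod_module_def)
  have a\<Omega>: "pair (m, n) \<oplus>\<^bsub>\<Omega>\<^esub> pair (m', n') = pair (m \<oplus>\<^bsub>ObjMap M Infty\<^esub> m', n \<oplus>\<^bsub>ObjMap N Infty\<^esub> n')"
    if "m \<in> lev M Infty" "m' \<in> lev M Infty"
      "n \<in> lev N Infty" "n' \<in> lev N Infty" for m n m' n'
    unfolding \<Omega>_def using that by (subst transport_module_sel(3)[OF inj]) (auto simp: prod_module_def)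
  have s\<Omega>: "c \<odot>\<^bsub>\<Omega>\<^esub> pair (m, n) = pair (c \<odot>\<^bsub>ObjMap M Infty\<^esub> m, c \<odot>\<^bsub>ObjMap N Infty\<^esub> n)"
    if "m \<in> lev M Infty" "n \<in> lev N Infty" for m n c
    unfolding \<Omega>_def using that by (subst transport_module_sel(4)[OF inj]) (auto simp: prod_module_def)
  have [simp]: "inv_into UNIV pair (pair p) = p" for p using inj_pair by simp
  have [simp]: "pair p = pair q \<longleftrightarrow> p = q" for p q using inj_pair by (simp add: inj_eq)
  define \<rho> where "\<rho> g = (\<lambda>p \<in> carrier \<Omega>. pair (gm M Infty g Infty (fst (inv_into UNIV pair p)),
    gm N Infty g Infty (snd (inv_into UNIV pair p))))" for g
  have \<rho>: "\<rho> g (pair (m, n)) = pair (gm M Infty g Infty m, gm N Infty g Infty n)"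
    if "m \<in> lev M Infty" "n \<in> lev N Infty" for g m n
    using that by (simp add: \<rho>_def c\<Omega>)
  \<comment> \<open>The graph embedding of a finite level. It commutes with the action from -1 to 0
    because \<open>r\<close> does.\<close>
  define j where "j i = (\<lambda>x \<in> lev M i. pair (gm M i \<one>\<^sub>G Infty x, gm N i \<one>\<^sub>G Infty (r' i x)))" for i
  note gM = gm_linear[OF M] and gN = gm_linear[OF N]
  have jl: "j i \<in> linear_maps K (ObjMap M i) \<Omega>" and ji: "inj_on (j i) (lev M i)"
    if i: "i \<in> LX" for i
  proof -
    have I: "i \<in> IX" "index_le i Infty" using i by (auto simp: LX_def)
    interpret Mi: module K "ObjMap M i" using M I by simp
    note cl = gm_in[OF M I(1)] gm_in[OF N I(1)] linear_closed[OF r'l[OF i]]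
    show "j i \<in> linear_maps K (ObjMap M i) \<Omega>"
      by (rule linear_mapsI)
        (use I in \<open>auto simp: j_def c\<Omega> a\<Omega> s\<Omega> cl linear_add[OF gM] linear_add[OF gN] linear_smult[OF gM]
          linear_smult[OF gN] linear_add[OF r'l[OF i]] linear_smult[OF r'l[OF i]]\<close>)
    \<comment> \<open>The first coordinate alone separates points, since levels of \<open>M\<close>
      embed into its ambient space; \<open>r\<close> may be arbitrary.\<close>
    show "inj_on (j i) (lev M i)"
      using ga_inj[OF M I(1) _ I(2)] by (auto simp: j_def inj_on_def)
  qed
  have \<rho>j: "\<rho> g (j lo x) = j hi (gm M lo g hi x)"
    if g: "g \<in> carrier G" and x: "x \<in> lev M lo" for g x
  proof -
    have rx: "r' lo x \<in> lev N lo" using linear_closed[OF r'l x] by simp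
    show ?thesis
      using g x rx gm_in[OF M, of "lo" "hi" g x] gm_in[OF M, of "lo" Infty "\<one>\<^sub>G" x]
        gm_in[OF N, of "lo" Infty "\<one>\<^sub>G" "r' lo x"]
      by (simp add: j_def \<rho> r'n gm_comp[OF M] gm_comp[OF N])
  qed
  have d: "emb_data \<Omega> \<rho> (ObjMap M lo) (j lo) (ObjMap M hi) (j hi)"
  proof (rule emb_dataI[OF m\<Omega>])
    show "\<rho> g \<in> linear_maps K \<Omega> \<Omega>" if g: "g \<in> carrier G" for g
    proof (rule linear_mapsI)
      show "\<rho> g \<in> extensional (carrier \<Omega>)" by (simp add: \<rho>_def)
    qed (use g in \<open>auto simp: c\<Omega> \<rho> a\<Omega> s\<Omega> gm_in[OF M] gm_in[OF N] linear_add[OF gM] linear_add[OF gN]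
        linear_smult[OF gM] linear_smult[OF gN]\<close>)
    show "\<rho> h (\<rho> g x) = \<rho> (h \<otimes>\<^bsub>G\<^esub> g) x" if "g \<in> carrier G" "h \<in> carrier G" "x \<in> carrier \<Omega>" for g h x
      using that by (auto simp: c\<Omega> \<rho> gm_in[OF M] gm_in[OF N] gm_comp[OF M] gm_comp[OF N])
    show "\<rho> g (j lo x) \<in> j hi ` lev M hi"
      if "g \<in> carrier G" "x \<in> lev M lo" for g x
      using \<rho>j[OF that] gm_in[OF M _ _ _ that(2), of "hi" g] that by simp
  qed (use M jl ji in \<open>auto simp: c\<Omega> \<rho> gm_one[OF M] gm_one[OF N]\<close>)
  define L where "L = emb_glider \<Omega> \<rho> (ObjMap M lo) (j lo) (ObjMap M hi) (j hi)"
  note L = emb_glider[OF d, folded L_def]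
  have Lo: "ObjMap L i = ObjMap M i" if "i \<in> LX" for i using that L(3,4) by (auto simp: LX_def)
  have Lg: "gm L i \<one>\<^sub>G Infty x = j i x" if "i \<in> LX" "x \<in> lev M i" for i x
    using that L(6,7) by (auto simp: LX_def)
  \<comment> \<open>The denominator is the first projection and the identity on finite levels; the
    numerator is the second projection and \<open>r\<close> on finite levels.\<close>
  define hs' where "hs' i = (if i = Infty then (\<lambda>p \<in> carrier \<Omega>. fst (inv_into UNIV pair p)) else (\<lambda>x \<in> lev M i. x))" for i
  define ha where "ha i = (if i = Infty then (\<lambda>p \<in> carrier \<Omega>. snd (inv_into UNIV pair p)) else r' i)" for i
  have jx: "j i x = pair (gm M i \<one>\<^sub>G Infty x, gm N i \<one>\<^sub>G Infty (r' i x))"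
    "gm M i \<one>\<^sub>G Infty x \<in> lev M Infty" "gm N i \<one>\<^sub>G Infty (r' i x) \<in> lev N Infty"
    if "i \<in> LX" "x \<in> lev M i" for i x
    using that LX_IX linear_closed[OF r'l] by (auto simp: j_def gm_in[OF M] gm_in[OF N] subset_iff)
  have s: "ga_arrow IX L hs' M \<in> Arr (gcat IX)"
  proof (rule ga_arrow_IX[OF L(1) M])
    fix i assume i: "i \<in> IX"
    interpret V: vspace K "ObjMap M i" by (rule vspace.intro) (use i M in simp)
    have "(\<lambda>p \<in> carrier \<Omega>. fst (inv_into UNIV pair p)) \<in> linear_maps K \<Omega> (ObjMap M Infty)"
      by (rule linear_mapsI) (auto simp: c\<Omega> a\<Omega> s\<Omega>)
    then show "hs' i \<in> linear_maps K (ObjMap L i) (ObjMap M i)"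
      using i V.linear_map_id Lo[of i] L(2) by (auto simp: hs'_def IX_def)
  next
    fix i x assume i: "i \<in> {lo, hi}" "x \<in> lev L i"
    then have "i \<in> LX" "x \<in> lev M i" "i \<noteq> Infty" using Lo by (auto simp: LX_def)
    then show "hs' Infty (gm L i \<one>\<^sub>G Infty x) = gm M i \<one>\<^sub>G Infty (hs' i x)"
      using jx[of i x] by (simp add: Lg hs'_def c\<Omega>)
  next
    fix g x assume "g \<in> carrier G" "x \<in> lev L Infty"
    then show "hs' Infty (gm L Infty g Infty x) = gm M Infty g Infty (hs' Infty x)"
      using L(2,5) by (auto simp: hs'_def c\<Omega> \<rho> gm_in[OF M] gm_in[OF N])
  qed
  have a: "ga_arrow IX L ha N \<in> Arr (gcat IX)"
  proof (rule ga_arrow_IX[OF L(1) N])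
    fix i assume i: "i \<in> IX"
    have "(\<lambda>p \<in> carrier \<Omega>. snd (inv_into UNIV pair p)) \<in> linear_maps K \<Omega> (ObjMap N Infty)"
      by (rule linear_mapsI) (auto simp: c\<Omega> a\<Omega> s\<Omega>)
    then show "ha i \<in> linear_maps K (ObjMap L i) (ObjMap N i)"
      using i r'l[of i] Lo[of i] L(2) by (auto simp: ha_def IX_def)
  next
    fix i x assume i: "i \<in> {lo, hi}" "x \<in> lev L i"
    then have "i \<in> LX" "x \<in> lev M i" "i \<noteq> Infty" using Lo by (auto simp: LX_def)
    then show "ha Infty (gm L i \<one>\<^sub>G Infty x) = gm N i \<one>\<^sub>G Infty (ha i x)"
      using jx[of i x] by (simp add: Lg ha_def c\<Omega>)
  next
    fix g x assume "g \<in> carrier G" "x \<in> lev L Infty"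
    then show "ha Infty (gm L Infty g Infty x) = gm N Infty g Infty (ha Infty x)"
      using L(2,5) by (auto simp: ha_def c\<Omega> \<rho> gm_in[OF M] gm_in[OF N])
  qed
  have "dat (ga_arrow IX L hs' M) i = Id (vect K) (ObjMap M i)" if "i \<in> LX" for i
  proof -
    have "i \<in> IX" "i \<noteq> Infty" using that by (auto simp: LX_def)
    then show ?thesis using Lo[OF that] by (intro arrow_eqI) (auto simp: hs'_def)
  qed
  moreover have "dat (ga_arrow IX L ha N) i = dat r i" if "i \<in> LX" for i
  proof -
    have "i \<in> IX" "i \<noteq> Infty" using that by (auto simp: LX_def)
    then show ?thesis
      using Lo[OF that] gcat_ArrD(5,6)[OF r that] by (intro arrow_eqI) (auto simp: ha_def r'_def M_def N_def)
  qed
  ultimately show ?thesis using s a by (intro bexI[OF _ s] bexI[OF _ a]) (auto simp: M_def N_def)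
qed

text \<open>The subspace of the ambient representation on which both maps agree is stable under the
  group. It contains the images of the levels -1 and 0, so it can serve as a smaller ambient
  representation for the same finite levels.\<close>

lemma glider_equalizer:
  assumes f: "f \<in> Arr (gcat IX)" and f': "f' \<in> Arr (gcat IX)" and st: "src f = src f'" "trg f = trg f'"
    and eq: "\<And>i. i \<in> LX \<Longrightarrow> dat f i = dat f' i"
  shows "\<exists>s \<in> Arr (gcat IX). trg s = src f \<and> (\<forall>i \<in> LX. dat s i = Id (vect K) (ObjMap (src f) i)) \<and>
    f \<cdot>\<^bsub>gcat IX\<^esub> s = f' \<cdot>\<^bsub>gcat IX\<^esub> s"
proof -
  define M N where "M = src f" and "N = trg f"
  have M: "preglider M" and N: "preglider N" using gcat_ArrD(1,2)[OF f] by (simp_all add: M_def N_def)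
  interpret MI: vspace K "ObjMap M Infty" by (rule vspace.intro) (use M in simp)
  interpret NI: vspace K "ObjMap N Infty" by (rule vspace.intro) (use N in simp)
  let ?f = "dat (dat f Infty)" and ?f' = "dat (dat f' Infty)"
  have l: "?f \<in> linear_maps K (ObjMap M Infty) (ObjMap N Infty)"
    "?f' \<in> linear_maps K (ObjMap M Infty) (ObjMap N Infty)"
    using gcat_dat_linear[OF f, of Infty] gcat_dat_linear[OF f', of Infty] st by (simp_all add: M_def N_def)
  define D where "D = {x \<in> lev M Infty. ?f x = ?f' x}"
  have D: "submodule D K (ObjMap M Infty)"
    by (auto simp: MI.submodule_iff D_def linear_add[OF l(1)] linear_add[OF l(2)] linear_smult[OF l(1)]
      linear_smult[OF l(2)] MI.linear_map_zero[OF NI.module_axioms l(1)] MI.linear_map_zero[OF NI.module_axioms l(2)])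
  let ?\<Omega> = "(ObjMap M Infty)\<lparr>carrier := D\<rparr>"
  have m\<Omega>: "module K ?\<Omega>" using submodule.submodule_is_module[OF D MI.module_axioms] .
  have DM: "x \<in> lev M Infty" if "x \<in> D" for x using that by (simp add: D_def)
  have stable: "gm M Infty g Infty x \<in> D" if "g \<in> carrier G" "x \<in> D" for g x
    using that gcat_dat_nat(1)[OF f order_refl, of Infty Infty g x] gcat_dat_nat(1)[OF f' order_refl, of Infty Infty g x]
      gm_in[OF M, of Infty Infty g x] st by (simp add: D_def M_def)
  have jD: "gm M i \<one>\<^sub>G Infty x \<in> D" if "i \<in> LX" "x \<in> lev M i" for i x
    using that gcat_dat_nat(1)[OF f order_refl, of i Infty "\<one>\<^sub>G" x]
      gcat_dat_nat(1)[OF f' order_refl, of i Infty "\<one>\<^sub>G" x] eq[OF that(1)] LX_IX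
      gm_in[OF M, of i Infty "\<one>\<^sub>G" x] st by (auto simp: D_def M_def)
  have jl: "gm M i \<one>\<^sub>G Infty \<in> linear_maps K (ObjMap M i) ?\<Omega>"
    and ji: "inj_on (gm M i \<one>\<^sub>G Infty) (lev M i)" if "i \<in> LX" for i
  proof -
    have I: "i \<in> IX" "index_le i Infty" using that by (auto simp: LX_def)
    note l = gm_linear[OF M I(1), of Infty "\<one>\<^sub>G"]
    show "gm M i \<one>\<^sub>G Infty \<in> linear_maps K (ObjMap M i) ?\<Omega>"
      using l linear_ext[OF l] linear_add[OF l] linear_smult[OF l] jD[OF that] by (intro linear_mapsI) auto
    show "inj_on (gm M i \<one>\<^sub>G Infty) (lev M i)" using ga_inj[OF M I(1) _ I(2)] by simp
  qed
  let ?j = "\<lambda>i. gm M i \<one>\<^sub>G Infty" and ?\<rho> = "\<lambda>g. \<lambda>x \<in> D. gm M Infty g Infty x"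
  have d: "emb_data ?\<Omega> ?\<rho> (ObjMap M lo) (?j lo) (ObjMap M hi) (?j hi)"
  proof (rule emb_dataI[OF m\<Omega>])
    fix g assume g: "g \<in> carrier G"
    note l = gm_linear[OF M, of Infty Infty g]
    have "x \<oplus>\<^bsub>ObjMap M Infty\<^esub> y \<in> D" "c \<odot>\<^bsub>ObjMap M Infty\<^esub> x \<in> D" if "x \<in> D" "y \<in> D" "c \<in> carrier K" for x y c
      using that D by (auto simp: MI.submodule_iff)
    then show "?\<rho> g \<in> linear_maps K ?\<Omega> ?\<Omega>" using D g DM stable linear_add[OF l] linear_smult[OF l]
      by (intro linear_mapsI) (auto simp: MI.submodule_iff)
    show "?\<rho> h (?\<rho> g x) = ?\<rho> (h \<otimes>\<^bsub>G\<^esub> g) x" if "h \<in> carrier G" "x \<in> carrier ?\<Omega>" for h x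
      using that g DM stable by (simp add: gm_comp[OF M])
    show "?\<rho> g (?j lo x) \<in> ?j hi ` lev M hi"
      if x: "x \<in> lev M lo" for x
    proof -
      have "?\<rho> g (?j lo x) = ?j hi (gm M lo g hi x)"
        using g x jD[of "lo" x] by (simp add: gm_comp[OF M])
      then show ?thesis using gm_in[OF M _ _ _ x, of "hi" g] g by simp
    qed
  qed (use M jl ji DM gm_one[OF M] in auto)
  define L where "L = emb_glider ?\<Omega> ?\<rho> (ObjMap M lo) (?j lo) (ObjMap M hi) (?j hi)"
  note L = emb_glider[OF d, folded L_def]
  have Lo: "ObjMap L i = ObjMap M i" if "i \<in> LX" for i using that L(3,4) by (auto simp: LX_def)
  have Lg: "gm L i \<one>\<^sub>G Infty x = ?j i x" if "i \<in> LX" "x \<in> lev M i" for i x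
    using that L(6,7) by (auto simp: LX_def)
  define h where "h i = (if i = Infty then (\<lambda>x \<in> D. x) else (\<lambda>x \<in> lev M i. x))" for i
  have s: "ga_arrow IX L h M \<in> Arr (gcat IX)"
  proof (rule ga_arrow_IX[OF L(1) M])
    fix i assume i: "i \<in> IX"
    interpret V: vspace K "ObjMap M i" by (rule vspace.intro) (use i M in simp)
    show "h i \<in> linear_maps K (ObjMap L i) (ObjMap M i)"
      using i V.linear_map_id Lo[of i] L(2) MI.linear_map_incl[OF D] by (auto simp: h_def IX_def)
  next
    fix i x assume i: "i \<in> {lo, hi}" "x \<in> lev L i"
    then have "i \<in> LX" "x \<in> lev M i" "i \<noteq> Infty" using Lo by (auto simp: LX_def)
    then show "h Infty (gm L i \<one>\<^sub>G Infty x) = gm M i \<one>\<^sub>G Infty (h i x)"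
      using jD[of i x] by (simp add: Lg h_def)
  next
    fix g x assume "g \<in> carrier G" "x \<in> lev L Infty"
    then show "h Infty (gm L Infty g Infty x) = gm M Infty g Infty (h Infty x)"
      using L(2,5) stable by (auto simp: h_def)
  qed
  have id: "dat (ga_arrow IX L h M) i = Id (vect K) (ObjMap M i)" if "i \<in> LX" for i
  proof -
    have "i \<in> IX" "i \<noteq> Infty" using that by (auto simp: LX_def)
    then show ?thesis using Lo[OF that] by (intro arrow_eqI) (auto simp: h_def)
  qed
  have "f \<cdot>\<^bsub>gcat IX\<^esub> ga_arrow IX L h M = f' \<cdot>\<^bsub>gcat IX\<^esub> ga_arrow IX L h M"
  proof -
    have "dat f i \<star> dat (ga_arrow IX L h M) i = dat f' i \<star> dat (ga_arrow IX L h M) i"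
      if i: "i \<in> IX" for i
    proof (cases "i = Infty")
      case True
      then show ?thesis using L(2) gcat_ArrD(6)[OF f, of Infty] gcat_ArrD(6)[OF f', of Infty] st
        by (auto simp: h_def D_def intro!: arrow_eqI restrict_ext)
    next
      case False
      then have "i \<in> LX" using i by (auto simp: IX_def LX_def)
      then show ?thesis using eq by simp
    qed
    then show ?thesis using st by (intro arrow_eqI) (auto intro!: restrict_ext)
  qed
  then show ?thesis using s id by (intro bexI[OF _ s]) (auto simp: M_def)
qed

lemma weak_isos_eq: "glider_weak_isos K {-1, 0} B Fl = {s \<in> Arr (gcat IX). iso_arr (gcat LX) (Res s)}"
  unfolding glider_weak_isos_def preglid_eq
  using iso_gcat_iff[OF LX_IX Res_arr] by (auto simp: LX_def)

lemma fractions_gliders: "fractions K (gcat IX) (gcat LX) Res (glider_weak_isos K {-1, 0} B Fl)"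
proof -
  interpret C: lin_mon_cat K "gcat IX" by (rule lin_mon_cat_gcat) simp
  interpret D: lin_mon_cat K "gcat LX" by (rule lin_mon_cat_gcat[OF LX_IX])
  have LI: "i \<in> IX" if "i \<in> LX" for i using that LX_IX by auto
  \<comment> \<open>The denominators built from the graph and from the equalizer are identities on
    the finite levels, hence lie in the class to be inverted.\<close>
  have weak: "s \<in> glider_weak_isos K {-1, 0} B Fl"
    if "s \<in> Arr (gcat IX)" "\<forall>i \<in> LX. dat s i = Id (vect K) (ObjMap (trg s) i)" for s
  proof -
    have "iso_arr (gcat LX) (Res s)"
      unfolding iso_gcat_iff[OF LX_IX Res_arr[OF that(1)]]
      using that(2) gcat_ArrD(2)[OF that(1)] LI by (auto intro!: vect.iso_Id)
    then show ?thesis using that(1) by (simp add: weak_isos_eq)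
  qed
  show ?thesis
  proof
    show "Obj (gcat LX) = Obj (gcat IX)" by simp
    show "f \<in> Arr (gcat IX) \<Longrightarrow> Res f \<in> Arr (gcat LX)" for f by (rule Res_arr)
    show "glider_weak_isos K {-1, 0} B Fl = {s \<in> Arr (gcat IX). iso_arr (gcat LX) (Res s)}"
      by (rule weak_isos_eq)
  next
    fix r assume r: "r \<in> Arr (gcat LX)"
    obtain s a where sa: "s \<in> Arr (gcat IX)" "a \<in> Arr (gcat IX)" "src a = src s" "trg s = src r" "trg a = trg r"
      "\<forall>i \<in> LX. dat s i = Id (vect K) (ObjMap (src r) i)" "\<forall>i \<in> LX. dat a i = dat r i"
      using glider_roof[OF r] by blast
    have "r \<cdot>\<^bsub>gcat LX\<^esub> Res s = Res a"
      using sa gcat_ArrD(4,5)[OF r] by (intro arrow_eqI) (auto intro!: restrict_ext)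
    then show "\<exists>s \<in> glider_weak_isos K {-1, 0} B Fl. \<exists>a \<in> Arr (gcat IX). src a = src s \<and> trg s = src r \<and>
      trg a = trg r \<and> r \<cdot>\<^bsub>gcat LX\<^esub> Res s = Res a"
      using sa weak[of s] by metis
  next
    fix f g assume fg: "f \<in> Arr (gcat IX)" "g \<in> Arr (gcat IX)" "src f = src g" "trg f = trg g" "Res f = Res g"
    have "dat f i = dat g i" if "i \<in> LX" for i
      using arg_cong[OF fg(5), of "\<lambda>a. dat a i"] that by simp
    from glider_equalizer[OF fg(1-4) this] obtain s where "s \<in> Arr (gcat IX)" "trg s = src f"
      "\<forall>i \<in> LX. dat s i = Id (vect K) (ObjMap (src f) i)" "f \<cdot>\<^bsub>gcat IX\<^esub> s = g \<cdot>\<^bsub>gcat IX\<^esub> s" by blast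
    then show "\<exists>s \<in> glider_weak_isos K {-1, 0} B Fl. trg s = src f \<and> f \<cdot>\<^bsub>gcat IX\<^esub> s = g \<cdot>\<^bsub>gcat IX\<^esub> s"
      using weak[of s] by metis
  next
    fix p q r assume pqr: "p \<in> Arr (gcat LX)" "q \<in> Arr (gcat LX)" "r \<in> Arr (gcat LX)" "src p = src q"
      "trg p = trg q" "trg r = src p"
    show "Add (gcat LX) p q \<cdot>\<^bsub>gcat LX\<^esub> r = Add (gcat LX) (p \<cdot>\<^bsub>gcat LX\<^esub> r) (q \<cdot>\<^bsub>gcat LX\<^esub> r)"
      using pqr gcat_ArrD(4-6)[OF pqr(1)] gcat_ArrD(4-6)[OF pqr(2)] gcat_ArrD(4-6)[OF pqr(3)]
      by (intro arrow_eqI) (auto intro!: restrict_ext vect_bilinear)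
  next
    fix c p r assume pr: "c \<in> carrier K" "p \<in> Arr (gcat LX)" "r \<in> Arr (gcat LX)" "trg r = src p"
    show "Scale (gcat LX) c p \<cdot>\<^bsub>gcat LX\<^esub> r = Scale (gcat LX) c (p \<cdot>\<^bsub>gcat LX\<^esub> r)"
      using pr gcat_ArrD(4-6)[OF pr(2)] gcat_ArrD(4-6)[OF pr(3)]
      by (intro arrow_eqI) (auto intro!: restrict_ext vect_bilinear(3)[of "dat p i" "dat p i" for i])
  qed (auto intro!: arrow_eqI restrict_ext simp: LI)
qed

lemma strict_iso_Glid:
  "strict_iso K (gcat LX) (Glid K {-1, 0} B Fl) (\<lambda>x. x)
    (fractions.frac_class (gcat IX) (gcat LX) Res (glider_weak_isos K {-1, 0} B Fl))"
  unfolding Glid_def preglid_eq by (rule fractions.strict_iso_localization[OF fractions_gliders])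


abbreviation lcomp (infixl "\<bullet>" 70) where "g \<bullet> f \<equiv> g \<cdot>\<^bsub>gcat LX\<^esub> f"

section \<open>Test objects\<close>

definition cd :: "('g \<Rightarrow> 'k) \<Rightarrow> 'u" where "cd = (SOME f. inj_on f (carrier B))"

text \<open>A function on the finite group is coded by the list of its values along an
  enumeration.\<close>

lemma cd_inj: "inj_on cd (carrier B)"
proof -
  obtain code :: "'k list \<Rightarrow> 'u" where code: "inj_on code (lists (carrier K))"
    using list_code[OF sc_inj] by blast
  obtain gs where gs: "set gs = carrier G" using finite_list[OF fin] by blast
  have "inj_on (\<lambda>b. code (map b gs)) (carrier B)"
  proof (rule inj_onI)
    fix b b' assume b: "b \<in> carrier B" "b' \<in> carrier B" and "code (map b gs) = code (map b' gs)"
    then have "map b gs = map b' gs" by (intro inj_onD[OF code]) (auto simp: gs)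
    then have "\<And>g. g \<in> carrier G \<Longrightarrow> b g = b' g" using gs by (metis map_eq_conv)
    then show "b = b'" using b unfolding carrier_B by (intro PiE_ext[of b "carrier G" "\<lambda>_. carrier K" b']) auto
  qed
  then show ?thesis unfolding cd_def by (rule someI[where P = "\<lambda>f. inj_on f (carrier B)"])
qed

definition kG :: "('k, 'u) module" where
  "kG = transport_module cd \<lparr>carrier = carrier B, mult = mult B, one = one B, zero = zero B,
    add = add B, smult = smult B\<rparr>"

text \<open>Coordinates of a coded element of the group algebra; the matching basis vectors are the
  \<open>ev g\<close>, the group elements themselves.\<close>

definition co :: "'g \<Rightarrow> 'u \<Rightarrow> 'k" where "co g x = inv_into (carrier B) cd x g"

definition ev :: "'g \<Rightarrow> 'u" where "ev g = cd (bv g)"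

lemma module_kG [simp]: "module K kG"
proof -
  have "module K \<lparr>carrier = carrier B, mult = mult B, one = one B, zero = zero B,
      add = add B, smult = smult B\<rparr>"
    by (rule moduleI')
      (auto simp: carrier_B zero_B add_B smult_B PiE_iff fun_eq_iff restrict_def extensional_def
        is_cring a_ac m_assoc l_distr r_distr)
  then show ?thesis unfolding kG_def by (rule module_transport_module) (simp add: cd_inj)
qed

interpretation kG: vspace K kG by (rule vspace.intro) simp

lemma carrier_kG: "carrier kG = cd ` carrier B"
  by (simp add: kG_def transport_module_sel(1) cd_inj)

lemma co_cd: "b \<in> carrier B \<Longrightarrow> co g (cd b) = b g"
  by (simp add: co_def inv_into_f_f[OF cd_inj])

lemma co_in [simp]: "x \<in> carrier kG \<Longrightarrow> g \<in> carrier G \<Longrightarrow> co g x \<in> carrier K"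
  by (auto simp: carrier_kG co_cd)

lemma co_add: "x \<in> carrier kG \<Longrightarrow> y \<in> carrier kG \<Longrightarrow> g \<in> carrier G \<Longrightarrow> co g (x \<oplus>\<^bsub>kG\<^esub> y) = co g x \<oplus> co g y"
  and co_smult: "c \<in> carrier K \<Longrightarrow> x \<in> carrier kG \<Longrightarrow> g \<in> carrier G \<Longrightarrow> co g (c \<odot>\<^bsub>kG\<^esub> x) = c \<otimes> co g x"
  and ev_in [simp]: "g \<in> carrier G \<Longrightarrow> ev g \<in> carrier kG"
  and co_ev: "g \<in> carrier G \<Longrightarrow> h \<in> carrier G \<Longrightarrow> co h (ev g) = (if h = g then \<one> else \<zero>)"
proof -
  have "b \<oplus>\<^bsub>B\<^esub> b' \<in> carrier B" if "b \<in> carrier B" "b' \<in> carrier B" for b b'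
    using that by (auto simp: add_B carrier_B)
  then show "x \<in> carrier kG \<Longrightarrow> y \<in> carrier kG \<Longrightarrow> g \<in> carrier G \<Longrightarrow> co g (x \<oplus>\<^bsub>kG\<^esub> y) = co g x \<oplus> co g y"
    by (auto simp: carrier_kG co_cd) (simp add: kG_def transport_module_sel(3) cd_inj co_cd add_B)
  have "c \<odot>\<^bsub>B\<^esub> b \<in> carrier B" if "c \<in> carrier K" "b \<in> carrier B" for c b
    using that by (auto simp: smult_B carrier_B)
  then show "c \<in> carrier K \<Longrightarrow> x \<in> carrier kG \<Longrightarrow> g \<in> carrier G \<Longrightarrow> co g (c \<odot>\<^bsub>kG\<^esub> x) = c \<otimes> co g x"
    by (auto simp: carrier_kG co_cd) (simp add: kG_def transport_module_sel(4) cd_inj co_cd smult_B)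
  show "g \<in> carrier G \<Longrightarrow> ev g \<in> carrier kG" by (simp add: ev_def carrier_kG)
  show "g \<in> carrier G \<Longrightarrow> h \<in> carrier G \<Longrightarrow> co h (ev g) = (if h = g then \<one> else \<zero>)"
    by (simp add: ev_def co_cd bv_apply)
qed

lemma kG_eqI: "x \<in> carrier kG \<Longrightarrow> y \<in> carrier kG \<Longrightarrow> (\<And>g. g \<in> carrier G \<Longrightarrow> co g x = co g y) \<Longrightarrow> x = y"
  by (auto simp: carrier_kG co_cd) (auto simp: carrier_B intro: arg_cong[of _ _ cd] PiE_ext)

lemma ev_eq_iff: "g \<in> carrier G \<Longrightarrow> h \<in> carrier G \<Longrightarrow> ev g = ev h \<longleftrightarrow> g = h"
  using co_ev[of g g] co_ev[of h g] one_not_zero by (auto split: if_splits)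

lemma co_linear: "g \<in> carrier G \<Longrightarrow> (\<lambda>x \<in> carrier kG. sc (co g x)) \<in> linear_maps K kG S"
  by (rule linear_mapsI) (auto simp: co_add co_smult add_S smult_S)

text \<open>Linear extension of a family of vectors indexed by the basis \<open>ev\<close>.\<close>

definition kG_map :: "('k, 'u) module \<Rightarrow> ('g \<Rightarrow> 'u) \<Rightarrow> 'u \<Rightarrow> 'u" where
  "kG_map V v = (\<lambda>x \<in> carrier kG. \<Oplus>\<^bsub>V\<^esub> g \<in> carrier G. co g x \<odot>\<^bsub>V\<^esub> v g)"

lemma kG_map:
  assumes V: "module K V" and v: "\<And>g. g \<in> carrier G \<Longrightarrow> v g \<in> carrier V"
  shows kG_map_linear: "kG_map V v \<in> linear_maps K kG V"
    and kG_map_ev: "g \<in> carrier G \<Longrightarrow> kG_map V v (ev g) = v g"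
proof -
  interpret V: vspace K V by (rule vspace.intro[OF V])
  show "kG_map V v \<in> linear_maps K kG V"
  proof (rule linear_mapsI)
    fix x y assume xy: "x \<in> carrier kG" "y \<in> carrier kG"
    have "(\<Oplus>\<^bsub>V\<^esub> g \<in> carrier G. co g (x \<oplus>\<^bsub>kG\<^esub> y) \<odot>\<^bsub>V\<^esub> v g) =
        (\<Oplus>\<^bsub>V\<^esub> g \<in> carrier G. co g x \<odot>\<^bsub>V\<^esub> v g \<oplus>\<^bsub>V\<^esub> co g y \<odot>\<^bsub>V\<^esub> v g)"
      using xy v by (intro V.finsum_cong') (auto simp: co_add V.smult_l_distr)
    then show "kG_map V v (x \<oplus>\<^bsub>kG\<^esub> y) = kG_map V v x \<oplus>\<^bsub>V\<^esub> kG_map V v y"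
      using xy v by (simp add: kG_map_def V.finsum_addf Pi_def)
  qed (auto simp: kG_map_def v co_smult V.smult_assoc1 V.finsum_smult_ldistr fin Pi_def
      intro!: V.finsum_closed V.finsum_cong')
  show "kG_map V v (ev g) = v g" if g: "g \<in> carrier G"
  proof -
    have "kG_map V v (ev g) = (\<Oplus>\<^bsub>V\<^esub> h \<in> carrier G. if g = h then v h else \<zero>\<^bsub>V\<^esub>)"
      using g v unfolding kG_map_def by (auto intro!: V.finsum_cong' simp: co_ev)
    then show ?thesis using V.finsum_singleton[OF g fin, of v] v by simp
  qed
qed

text \<open>Basis expansion, verified one coordinate at a time. It makes linear maps out of
  \<open>kG\<close> determined by their values on group elements.\<close>

lemma kG_sum: assumes x: "x \<in> carrier kG" shows "kG_map kG ev x = x"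
proof (rule kG_eqI)
  have l: "kG_map kG ev \<in> linear_maps K kG kG" by (rule kG_map_linear) auto
  show c: "kG_map kG ev x \<in> carrier kG" using linear_closed[OF l x] .
  show "x \<in> carrier kG" by fact
  fix g assume g: "g \<in> carrier G"
  interpret S: vspace K S by (rule vspace.intro) (rule module_S)
  have "sc (co g (kG_map kG ev x)) = (\<lambda>x \<in> carrier kG. sc (co g x)) (\<Oplus>\<^bsub>kG\<^esub> h \<in> carrier G. co h x \<odot>\<^bsub>kG\<^esub> ev h)"
    using x c by (simp add: kG_map_def)
  also have "\<dots> = (\<Oplus>\<^bsub>S\<^esub> h \<in> carrier G. (\<lambda>x \<in> carrier kG. sc (co g x)) (co h x \<odot>\<^bsub>kG\<^esub> ev h))"
    by (rule kG.linear_map_finsum[OF module_S co_linear[OF g] fin]) (use x in auto)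
  also have "\<dots> = (\<Oplus>\<^bsub>S\<^esub> h \<in> carrier G. if g = h then sc (co h x) else \<zero>\<^bsub>S\<^esub>)"
    by (rule S.finsum_cong') (use x g in \<open>auto simp: co_smult co_ev zero_S\<close>)
  also have "\<dots> = sc (co g x)" using S.finsum_singleton[OF g fin, of "\<lambda>h. sc (co h x)"] x by simp
  finally show "co g (kG_map kG ev x) = co g x" using x c g by simp
qed

lemma kG_map_eqI:
  assumes V: "module K V" and f: "f \<in> linear_maps K kG V" "f' \<in> linear_maps K kG V"
    and eq: "\<And>g. g \<in> carrier G \<Longrightarrow> f (ev g) = f' (ev g)"
  shows "f = f'"
proof (rule linear_eqI[OF f])
  interpret V: vspace K V by (rule vspace.intro[OF V])
  fix x assume x: "x \<in> carrier kG"
  have *: "h x = (\<Oplus>\<^bsub>V\<^esub> g \<in> carrier G. co g x \<odot>\<^bsub>V\<^esub> h (ev g))" if h: "h \<in> linear_maps K kG V" for h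
  proof -
    have "h x = h (\<Oplus>\<^bsub>kG\<^esub> g \<in> carrier G. co g x \<odot>\<^bsub>kG\<^esub> ev g)" using kG_sum[OF x] x by (simp add: kG_map_def)
    also have "\<dots> = (\<Oplus>\<^bsub>V\<^esub> g \<in> carrier G. h (co g x \<odot>\<^bsub>kG\<^esub> ev g))"
      by (rule kG.linear_map_finsum[OF V h fin]) (use x in auto)
    also have "\<dots> = (\<Oplus>\<^bsub>V\<^esub> g \<in> carrier G. co g x \<odot>\<^bsub>V\<^esub> h (ev g))"
      by (rule V.finsum_cong') (use x linear_smult[OF h] linear_closed[OF h] in auto)
    finally show ?thesis .
  qed
  show "f x = f' x"
    unfolding *[OF f(1)] *[OF f(2)] by (rule V.finsum_cong') (use x eq linear_closed[OF f(2)] in auto)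
qed

text \<open>The left regular representation.\<close>

definition reg :: "'g \<Rightarrow> 'u \<Rightarrow> 'u" where "reg g = kG_map kG (\<lambda>h. ev (g \<otimes>\<^bsub>G\<^esub> h))"

lemma reg: "g \<in> carrier G \<Longrightarrow> reg g \<in> linear_maps K kG kG"
    "g \<in> carrier G \<Longrightarrow> h \<in> carrier G \<Longrightarrow> reg g (ev h) = ev (g \<otimes>\<^bsub>G\<^esub> h)"
  unfolding reg_def by (auto intro: kG_map_linear kG_map_ev)

lemma emb_data_kG:
  assumes "module K V" "j \<in> linear_maps K V kG" "inj_on j (carrier V)"
  shows "emb_data kG reg V j kG (\<lambda>x \<in> carrier kG. x)"
proof (rule emb_dataI)
  note regc = linear_closed[OF reg(1)]
  have "reg \<one>\<^sub>G = (\<lambda>x \<in> carrier kG. x)"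
    by (rule kG_map_eqI[OF module_kG]) (auto simp: reg kG.linear_map_id)
  then show "reg \<one>\<^sub>G x = x" if "x \<in> carrier kG" for x using that by simp
  show "reg h (reg g x) = reg (h \<otimes>\<^bsub>G\<^esub> g) x" if gh: "g \<in> carrier G" "h \<in> carrier G" and x: "x \<in> carrier kG" for g h x
  proof -
    have "(\<lambda>x \<in> carrier kG. reg h (reg g x)) = reg (h \<otimes>\<^bsub>G\<^esub> g)"
      by (rule kG_map_eqI[OF module_kG kG.linear_map_comp[OF reg(1)[OF gh(1)] reg(1)[OF gh(2)]] reg(1)])
        (use gh in \<open>auto simp: reg G.m_assoc\<close>)
    from fun_cong[OF this, of x] x show ?thesis by simp
  qed
  show "reg g (j x) \<in> (\<lambda>x \<in> carrier kG. x) ` carrier kG" if "g \<in> carrier G" "x \<in> carrier V" for g x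
    using regc[OF that(1) linear_closed[OF assms(2) that(2)]] by force
qed (use assms kG.linear_map_id in \<open>auto simp: reg inj_on_def\<close>)

abbreviation lv :: "('k, 'u, 'g) glider_arrow \<Rightarrow> index \<Rightarrow> 'u \<Rightarrow> 'u" where
  "lv f i \<equiv> dat (dat f i)"

text \<open>In the levels \<open>-1\<close>, \<open>0\<close> and \<open>\<infinity>\<close>, \<open>PP\<close> is \<open>k1 \<subseteq> kG \<subseteq> kG\<close>, \<open>RR\<close> is \<open>kG \<subseteq> kG \<subseteq> kG\<close>, and
  \<open>Sub W A\<close> is \<open>0 \<subseteq> A \<subseteq> W\<close> with trivial action. Morphisms from \<open>PP\<close> are elements of level \<open>-1\<close>, and those
  from \<open>X = Sub k k\<close> are elements of level \<open>0\<close>.\<close>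

definition PP :: "('k, 'u, 'g \<Rightarrow> 'k) glider" where
  "PP = emb_glider kG reg S (\<lambda>a \<in> carrier S. us a \<odot>\<^bsub>kG\<^esub> ev \<one>\<^sub>G) kG (\<lambda>x \<in> carrier kG. x)"

definition RR :: "('k, 'u, 'g \<Rightarrow> 'k) glider" where
  "RR = emb_glider kG reg kG (\<lambda>x \<in> carrier kG. x) kG (\<lambda>x \<in> carrier kG. x)"

definition Sub :: "('k, 'u) module \<Rightarrow> 'u set \<Rightarrow> ('k, 'u, 'g \<Rightarrow> 'k) glider" where
  "Sub W A = emb_glider W (\<lambda>g. \<lambda>x \<in> carrier W. x) (W\<lparr>carrier := {\<zero>\<^bsub>W\<^esub>}\<rparr>) (\<lambda>x \<in> {\<zero>\<^bsub>W\<^esub>}. x)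
     (W\<lparr>carrier := A\<rparr>) (\<lambda>x \<in> A. x)"

lemma PP [simp]: "preglider PP" "ObjMap PP lo = S" "ObjMap PP hi = kG"
  and PP_act: "g \<in> carrier G \<Longrightarrow> gm PP lo g hi (sc \<one>) = ev g"
proof -
  have "inj_on (\<lambda>a \<in> carrier S. us a \<odot>\<^bsub>kG\<^esub> ev \<one>\<^sub>G) (carrier S)"
  proof (rule inj_onI)
    fix a b assume ab: "a \<in> carrier S" "b \<in> carrier S"
      "(\<lambda>a \<in> carrier S. us a \<odot>\<^bsub>kG\<^esub> ev \<one>\<^sub>G) a = (\<lambda>a \<in> carrier S. us a \<odot>\<^bsub>kG\<^esub> ev \<one>\<^sub>G) b"
    then have "co \<one>\<^sub>G (us a \<odot>\<^bsub>kG\<^esub> ev \<one>\<^sub>G) = co \<one>\<^sub>G (us b \<odot>\<^bsub>kG\<^esub> ev \<one>\<^sub>G)" by simp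
    then have "us a = us b" using ab by (simp add: co_smult co_ev)
    then show "a = b" using ab sc_us by metis
  qed
  from emb_data_kG[OF module_S scalar_line[OF module_kG] this]
  have d: "emb_data kG reg S (\<lambda>a \<in> carrier S. us a \<odot>\<^bsub>kG\<^esub> ev \<one>\<^sub>G) kG (\<lambda>x \<in> carrier kG. x)" by simp
  note e = emb_glider[OF d, folded PP_def]
  show P: "preglider PP" "ObjMap PP lo = S" "ObjMap PP hi = kG" using e by simp_all
  show "gm PP lo g hi (sc \<one>) = ev g" if g: "g \<in> carrier G"
    using e(8)[OF g, of "sc \<one>"] g gm_in[OF P(1), of lo hi g "sc \<one>"] by (simp add: P reg)
qed

lemma RR [simp]: "preglider RR" "ObjMap RR lo = kG" "ObjMap RR hi = kG"
  and RR_act: "g \<in> carrier G \<Longrightarrow> x \<in> carrier kG \<Longrightarrow> gm RR lo g hi x = reg g x"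
proof -
  have d: "emb_data kG reg kG (\<lambda>x \<in> carrier kG. x) kG (\<lambda>x \<in> carrier kG. x)"
    by (rule emb_data_kG) (auto simp: kG.linear_map_id inj_on_def)
  note e = emb_glider[OF d, folded RR_def]
  show P: "preglider RR" "ObjMap RR lo = kG" "ObjMap RR hi = kG" using e by simp_all
  show "gm RR lo g hi x = reg g x" if g: "g \<in> carrier G" "x \<in> carrier kG"
    using e(8)[OF g] g gm_in[OF P(1), of lo hi g x] by (simp add: P)
qed

lemma Sub:
  assumes W: "module K W" and A: "submodule A K W"
  shows "preglider (Sub W A)" "ObjMap (Sub W A) lo = W\<lparr>carrier := {\<zero>\<^bsub>W\<^esub>}\<rparr>"
    "ObjMap (Sub W A) hi = W\<lparr>carrier := A\<rparr>" "g \<in> carrier G \<Longrightarrow> gm (Sub W A) lo g hi \<zero>\<^bsub>W\<^esub> = \<zero>\<^bsub>W\<^esub>"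
proof -
  interpret W: vspace K W by (rule vspace.intro[OF W])
  have A': "A \<subseteq> carrier W" "\<zero>\<^bsub>W\<^esub> \<in> A" using A by (auto simp: W.submodule_iff)
  have d: "emb_data W (\<lambda>g. \<lambda>x \<in> carrier W. x) (W\<lparr>carrier := {\<zero>\<^bsub>W\<^esub>}\<rparr>) (\<lambda>x \<in> {\<zero>\<^bsub>W\<^esub>}. x)
     (W\<lparr>carrier := A\<rparr>) (\<lambda>x \<in> A. x)"
  proof (rule emb_dataI)
    show "module K (W\<lparr>carrier := A\<rparr>)" by (rule submodule.submodule_is_module[OF A W])
    show "module K (W\<lparr>carrier := {\<zero>\<^bsub>W\<^esub>}\<rparr>)" by (rule submodule.submodule_is_module[OF W.submodule_zero W])
  qed (use A' W W.linear_map_incl[OF A] W.linear_map_incl[OF W.submodule_zero] W.linear_map_id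
    in \<open>auto simp: inj_on_def\<close>)
  note e = emb_glider[OF d, folded Sub_def]
  show P: "preglider (Sub W A)" "ObjMap (Sub W A) lo = W\<lparr>carrier := {\<zero>\<^bsub>W\<^esub>}\<rparr>"
    "ObjMap (Sub W A) hi = W\<lparr>carrier := A\<rparr>" using e by simp_all
  show "gm (Sub W A) lo g hi \<zero>\<^bsub>W\<^esub> = \<zero>\<^bsub>W\<^esub>" if g: "g \<in> carrier G"
    using e(8)[OF g, of "\<zero>\<^bsub>W\<^esub>"] g gm_in[OF P(1), of lo hi g "\<zero>\<^bsub>W\<^esub>"] by (simp add: P)
qed

definition sub_arr :: "('k, 'u) module \<Rightarrow> 'u set \<Rightarrow> ('u \<Rightarrow> 'u) \<Rightarrow> ('k, 'u, 'g \<Rightarrow> 'k) glider \<Rightarrow>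
    ('k, 'u, 'g) glider_arrow" where
  "sub_arr W A h M =
     ga_arrow LX (Sub W A) (\<lambda>i. if i = hi then h else (\<lambda>x \<in> {\<zero>\<^bsub>W\<^esub>}. \<zero>\<^bsub>ObjMap M lo\<^esub>)) M"

lemma sub_arr_sel [simp]: "src (sub_arr W A h M) = Sub W A" "trg (sub_arr W A h M) = M"
  "lv (sub_arr W A h M) hi = h" "lv (sub_arr W A h M) lo = (\<lambda>x \<in> {\<zero>\<^bsub>W\<^esub>}. \<zero>\<^bsub>ObjMap M lo\<^esub>)"
  by (simp_all add: sub_arr_def)

text \<open>Level -1 of the source is zero, so compatibility with the action is automatic and any
  linear map on level 0 is allowed.\<close>

lemma sub_arr:
  assumes W: "module K W" and A: "submodule A K W" and M: "preglider M"
    and h: "h \<in> linear_maps K (W\<lparr>carrier := A\<rparr>) (ObjMap M hi)"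
  shows "sub_arr W A h M \<in> Arr (gcat LX)"
proof -
  interpret W: vspace K W by (rule vspace.intro[OF W])
  interpret A: vspace K "W\<lparr>carrier := A\<rparr>"
    by (rule vspace.intro) (rule submodule.submodule_is_module[OF A W])
  interpret V: vspace K "ObjMap M lo" by (rule vspace.intro) (use M in simp)
  interpret V': vspace K "ObjMap M hi" by (rule vspace.intro) (use M in simp)
  have "h \<zero>\<^bsub>W\<^esub> = \<zero>\<^bsub>ObjMap M hi\<^esub>" using A.linear_map_zero[OF V'.module_axioms h] by simp
  moreover have "gm M lo g hi \<zero>\<^bsub>ObjMap M lo\<^esub> = \<zero>\<^bsub>ObjMap M hi\<^esub>" if "g \<in> carrier G" for g
    using V.linear_map_zero[OF V'.module_axioms gm_linear[OF M]] that by simp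
  ultimately show ?thesis
    unfolding sub_arr_def using h Sub[OF W A]
    by (intro ga_arrow_LX[OF _ M]) (auto simp: LX_def intro!: linear_mapsI)
qed

abbreviation X :: "('k, 'u, 'g \<Rightarrow> 'k) glider" where "X \<equiv> Sub S (carrier S)"

lemma submodule_S: "submodule (carrier S) K S"
proof -
  interpret S: vspace K S by (rule vspace.intro) (rule module_S)
  show ?thesis by (simp add: S.submodule_iff)
qed

lemma X [simp]: "preglider X" "ObjMap X lo = S\<lparr>carrier := {\<zero>\<^bsub>S\<^esub>}\<rparr>" "ObjMap X hi = S"
  using Sub[OF module_S submodule_S] by simp_all

definition x_arr :: "('k, 'u, 'g \<Rightarrow> 'k) glider \<Rightarrow> 'u \<Rightarrow> ('k, 'u, 'g) glider_arrow" where
  "x_arr M y = sub_arr S (carrier S) (\<lambda>a \<in> carrier S. us a \<odot>\<^bsub>ObjMap M hi\<^esub> y) M"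

definition p_arr :: "('k, 'u, 'g \<Rightarrow> 'k) glider \<Rightarrow> 'u \<Rightarrow> ('k, 'u, 'g) glider_arrow" where
  "p_arr M m = ga_arrow LX PP (\<lambda>i. if i = hi then kG_map (ObjMap M hi) (\<lambda>g. gm M lo g hi m)
     else (\<lambda>a \<in> carrier S. us a \<odot>\<^bsub>ObjMap M lo\<^esub> m)) M"

lemma x_arr_sel [simp]: "src (x_arr M y) = X" "trg (x_arr M y) = M"
  and p_arr_sel [simp]: "src (p_arr M m) = PP" "trg (p_arr M m) = M"
  by (simp_all add: x_arr_def p_arr_def)

lemma x_arr:
  assumes M: "preglider M" and y: "y \<in> lev M hi"
  shows "x_arr M y \<in> Arr (gcat LX)" "lv (x_arr M y) hi (sc \<one>) = y"
proof -
  interpret V: vspace K "ObjMap M hi" by (rule vspace.intro) (use M in simp)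
  show "x_arr M y \<in> Arr (gcat LX)" unfolding x_arr_def
    by (rule sub_arr[OF module_S submodule_S M]) (use scalar_line[OF V.module_axioms y] in simp)
  show "lv (x_arr M y) hi (sc \<one>) = y" using y by (simp add: x_arr_def)
qed

lemma PP_act': "g \<in> carrier G \<Longrightarrow> a \<in> carrier S \<Longrightarrow> gm PP lo g hi a = us a \<odot>\<^bsub>kG\<^esub> ev g"
  using linear_smult[OF gm_linear[OF PP(1), of lo hi g], of "us a" "sc \<one>"] PP_act[of g]
  by (simp flip: sc_one)

text \<open>Level 0 of \<open>PP\<close> is free on the group and \<open>ev g\<close> is
  \<open>g\<close> applied to the generator in level -1, so \<open>m\<close> may be chosen freely
  and forces everything else.\<close>

lemma p_arr:
  assumes M: "preglider M" and m: "m \<in> lev M lo"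
  shows "p_arr M m \<in> Arr (gcat LX)" "lv (p_arr M m) lo (sc \<one>) = m"
    "g \<in> carrier G \<Longrightarrow> lv (p_arr M m) hi (ev g) = gm M lo g hi m"
proof -
  interpret V: vspace K "ObjMap M lo" by (rule vspace.intro) (use M in simp)
  interpret W: vspace K "ObjMap M hi" by (rule vspace.intro) (use M in simp)
  have gm: "gm M lo g hi m \<in> lev M hi" if "g \<in> carrier G" for g
    using gm_in[OF M, of lo hi g m] that m by simp
  note l = kG_map_linear[OF W.module_axioms gm] kG_map_ev[OF W.module_axioms gm]
  show "p_arr M m \<in> Arr (gcat LX)" unfolding p_arr_def
  proof (rule ga_arrow_LX[OF PP(1) M])
    show "(if i = hi then kG_map (ObjMap M hi) (\<lambda>g. gm M lo g hi m) else (\<lambda>a \<in> carrier S. us a \<odot>\<^bsub>ObjMap M lo\<^esub> m))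
        \<in> linear_maps K (ObjMap PP i) (ObjMap M i)" if "i \<in> LX" for i
      using that l(1) scalar_line[OF V.module_axioms m] by (auto simp: LX_def)
  next
    fix g x assume gx: "g \<in> carrier G" "x \<in> carrier (ObjMap PP lo)"
    then show "(if hi = hi then kG_map (ObjMap M hi) (\<lambda>g. gm M lo g hi m) else (\<lambda>a \<in> carrier S. us a \<odot>\<^bsub>ObjMap M lo\<^esub> m)) (gm PP lo g hi x) =
        gm M lo g hi ((if lo = hi then kG_map (ObjMap M hi) (\<lambda>g. gm M lo g hi m) else (\<lambda>a \<in> carrier S. us a \<odot>\<^bsub>ObjMap M lo\<^esub> m)) x)"
      using m linear_smult[OF l(1)] linear_smult[OF gm_linear[OF M, of lo hi g]] l(2) by (simp add: PP_act')
  qed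
  show "lv (p_arr M m) lo (sc \<one>) = m" using m by (simp add: p_arr_def)
  show "g \<in> carrier G \<Longrightarrow> lv (p_arr M m) hi (ev g) = gm M lo g hi m" using l(2) by (simp add: p_arr_def)
qed

lemma S_map_eqI:
  assumes "f \<in> linear_maps K S V" "f' \<in> linear_maps K S V" "f (sc \<one>) = f' (sc \<one>)"
  shows "f = f'"
proof (rule linear_eqI[OF assms(1,2)])
  fix a assume a: "a \<in> carrier S"
  have *: "g a = us a \<odot>\<^bsub>V\<^esub> g (sc \<one>)" if g: "g \<in> linear_maps K S V" for g
    using linear_smult[OF g, of "us a" "sc \<one>"] a by (simp flip: sc_one)
  show "f a = f' a" unfolding *[OF assms(1)] *[OF assms(2)] assms(3) ..
qed

lemma gcat_arr_eqI:
  assumes f: "f \<in> Arr (gcat LX)" "f' \<in> Arr (gcat LX)" "src f = src f'" "trg f = trg f'"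
    and "lv f lo = lv f' lo" "lv f hi = lv f' hi"
  shows "f = f'"
proof (rule gcat_eqI[OF f])
  fix i assume i: "i \<in> LX"
  then show "dat f i = dat f' i"
    using assms(3-) gcat_ArrD(5,6)[OF f(1) i] gcat_ArrD(5,6)[OF f(2) i]
    by (intro arrow_eqI) (auto simp: LX_def)
qed

text \<open>\<open>X\<close> has level -1 zero, and its level 0 is the line spanned by
  \<open>sc \<one>\<close>.\<close>

lemma X_arr_eqI:
  assumes f: "f \<in> Arr (gcat LX)" "f' \<in> Arr (gcat LX)" "src f = X" "src f' = X" "trg f = trg f'"
    and eq: "lv f hi (sc \<one>) = lv f' hi (sc \<one>)"
  shows "f = f'"
proof (rule gcat_arr_eqI)
  note l = gcat_dat_linear[OF f(1)] gcat_dat_linear[OF f(2)]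
  show "lv f hi = lv f' hi" using l[of hi] f eq by (intro S_map_eqI[where V = "ObjMap (trg f) hi"]) auto
  interpret X: vspace K "ObjMap X lo" by (rule vspace.intro) (simp del: X(2))
  have m: "module K (ObjMap (trg f) lo)" using gcat_ArrD(2)[OF f(1)] by simp
  have "lv f lo \<zero>\<^bsub>S\<^esub> = lv f' lo \<zero>\<^bsub>S\<^esub>"
    using X.linear_map_zero[OF m, of "lv f lo"] X.linear_map_zero[OF m, of "lv f' lo"] l[of lo] f by simp
  then show "lv f lo = lv f' lo"
    using l[of lo] f by (intro linear_eqI[where V = "ObjMap X lo"]) auto
qed (use f in auto)

lemma P_arr_eqI:
  assumes f: "f \<in> Arr (gcat LX)" "f' \<in> Arr (gcat LX)" "src f = PP" "src f' = PP" "trg f = trg f'"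
    and eq: "lv f lo (sc \<one>) = lv f' lo (sc \<one>)"
  shows "f = f'"
proof (rule gcat_arr_eqI)
  note l = gcat_dat_linear[OF f(1)] gcat_dat_linear[OF f(2)]
  show "lv f lo = lv f' lo" using l[of lo] f eq by (intro S_map_eqI[where V = "ObjMap (trg f) lo"]) auto
  have "lv f hi (ev g) = lv f' hi (ev g)" if "g \<in> carrier G" for g
    using gcat_dat_nat(1)[OF f(1) LX_IX, of lo hi g "sc \<one>"] gcat_dat_nat(1)[OF f(2) LX_IX, of lo hi g "sc \<one>"]
      f eq that by (simp add: PP_act)
  then show "lv f hi = lv f' hi"
    using l[of hi] f gcat_ArrD(2)[OF f(1)] by (intro kG_map_eqI[where V = "ObjMap (trg f) hi"]) auto
qed (use f in auto)


section \<open>Noetherian gliders\<close>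

interpretation R: lin_mon_cat K "gcat LX" by (rule lin_mon_cat_gcat[OF LX_IX])

abbreviation fs :: "(('k, 'u, 'g \<Rightarrow> 'k) glider \<Rightarrow> bool) \<Rightarrow>
    ('k, ('k, 'u, 'g \<Rightarrow> 'k) glider, ('k, 'u) glider_map) mon_category" where
  "fs Q \<equiv> full_subcategory (gcat LX) Q"

lemma gcat_fs: "fs (\<lambda>_. True) = gcat LX"
  by (simp add: full_subcategory_def)

lemma lv_comp: "f \<in> Arr (gcat LX) \<Longrightarrow> i \<in> LX \<Longrightarrow> x \<in> lev (src f) i \<Longrightarrow>
    lv (g \<bullet> f) i x = lv g i (lv f i x)"
  by (simp add: gcat_ArrD(5))

text \<open>\<open>X\<close> represents level 0 and \<open>PP\<close> level -1, so a monomorphism is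
  injective on both. The argument works in any full subcategory containing these two objects,
  notably in the finitely generated gliders.\<close>

lemma mono_fs_iff:
  assumes m: "m \<in> Arr (gcat LX)" "Q (src m)" "Q (trg m)" and Q: "Q X" "Q PP"
  shows "mono_arr (fs Q) m \<longleftrightarrow> (\<forall>i \<in> LX. inj_on (lv m i) (lev (src m) i))"
proof
  assume mono: "mono_arr (fs Q) m"
  have M: "preglider (src m)" using gcat_ArrD(1)[OF m(1)] .
  have cancel: "f = g" if "f \<in> Arr (gcat LX)" "g \<in> Arr (gcat LX)" "trg f = src m" "trg g = src m"
    "src f = src g" "Q (src g)" "m \<bullet> f = m \<bullet> g" for f g
    using mono that m gcat_ArrD(1)[OF that(2)] unfolding mono_arr_def homset_def full_subcategory_def
    by auto
  have "inj_on (lv m hi) (lev (src m) hi)"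
  proof (rule inj_onI)
    fix x y assume xy: "x \<in> lev (src m) hi" "y \<in> lev (src m) hi" "lv m hi x = lv m hi y"
    note a = x_arr[OF M xy(1)] x_arr[OF M xy(2)]
    have "m \<bullet> x_arr (src m) x = m \<bullet> x_arr (src m) y"
      using a m xy by (intro X_arr_eqI R.Comp_arr) (auto simp: lv_comp simp del: gcat_dat)
    from cancel[OF a(1,3) _ _ _ _ this] have "x_arr (src m) x = x_arr (src m) y" using Q(1) by simp
    then show "x = y" using a(2,4) by metis
  qed
  moreover have "inj_on (lv m lo) (lev (src m) lo)"
  proof (rule inj_onI)
    fix x y assume xy: "x \<in> lev (src m) lo" "y \<in> lev (src m) lo" "lv m lo x = lv m lo y"
    note a = p_arr[OF M xy(1)] p_arr[OF M xy(2)]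
    have "m \<bullet> p_arr (src m) x = m \<bullet> p_arr (src m) y"
      using a m xy by (intro P_arr_eqI R.Comp_arr) (auto simp: lv_comp simp del: gcat_dat)
    from cancel[OF a(1,4) _ _ _ _ this] have "p_arr (src m) x = p_arr (src m) y" using Q(2) by simp
    then show "x = y" using a(2,5) by metis
  qed
  ultimately show "\<forall>i \<in> LX. inj_on (lv m i) (lev (src m) i)" by (simp add: LX_def)
next
  assume inj: "\<forall>i \<in> LX. inj_on (lv m i) (lev (src m) i)"
  have "f = g" if fg: "f \<in> Arr (gcat LX)" "g \<in> Arr (gcat LX)" "src f = src g" "trg f = src m" "trg g = src m"
    and eq: "m \<bullet> f = m \<bullet> g" for f g
  proof -
    have "lv f i = lv g i" if i: "i \<in> LX" for i
    proof (rule linear_eqI)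
      show l: "lv f i \<in> linear_maps K (ObjMap (src f) i) (ObjMap (src m) i)"
        "lv g i \<in> linear_maps K (ObjMap (src f) i) (ObjMap (src m) i)"
        using gcat_dat_linear[OF fg(1) i] gcat_dat_linear[OF fg(2) i] fg by simp_all
      fix x assume x: "x \<in> lev (src f) i"
      have "lv m i (lv f i x) = lv m i (lv g i x)"
        using lv_comp[OF fg(1) i, of x m] lv_comp[OF fg(2) i, of x m] x fg(3) eq by simp
      then show "lv f i x = lv g i x" using inj i linear_closed[OF l(1) x] linear_closed[OF l(2) x]
        by (auto dest: inj_onD)
    qed
    then show "f = g" using fg by (intro gcat_arr_eqI) auto
  qed
  then show "mono_arr (fs Q) m" using m unfolding mono_arr_def homset_def full_subcategory_def by auto
qed

lemma iso_fs_iff: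
  assumes f: "f \<in> Arr (gcat LX)" "Q (src f)" "Q (trg f)"
  shows "iso_arr (fs Q) f \<longleftrightarrow>
    (\<forall>i \<in> LX. bij_betw (lv f i) (lev (src f) i) (lev (trg f) i))"
proof -
  have "iso_arr (fs Q) f \<longleftrightarrow> iso_arr (gcat LX) f"
    using f by (auto simp: iso_arr_def homset_def full_subcategory_def)
  also have "\<dots> \<longleftrightarrow> (\<forall>i \<in> LX. iso_arr (vect K) (dat f i))" by (rule iso_gcat_iff[OF LX_IX f(1)])
  also have "\<dots> \<longleftrightarrow> (\<forall>i \<in> LX. bij_betw (lv f i) (lev (src f) i) (lev (trg f) i))"
    using gcat_ArrD(4-6)[OF f(1)] iso_vectD(2) iso_vectI by (metis (no_types, lifting))
  finally show ?thesis .
qed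

text \<open>A levelwise factorization through injective maps is unique, hence linear and compatible
  with the action.\<close>

lemma subobj_fs_iff:
  assumes m: "m \<in> Arr (gcat LX)" "Q (src m)" and n: "n \<in> Arr (gcat LX)" "Q (src n)" "trg m = trg n"
    and inj: "\<And>i. i \<in> LX \<Longrightarrow> inj_on (lv n i) (lev (src n) i)"
  shows "subobj_le (fs Q) m n \<longleftrightarrow>
    (\<forall>i \<in> LX. lv m i ` lev (src m) i \<subseteq> lv n i ` lev (src n) i)"
proof
  assume "subobj_le (fs Q) m n"
  then obtain h where h: "h \<in> Arr (gcat LX)" "src h = src m" "trg h = src n" "m = n \<bullet> h"
    by (auto simp: subobj_le_def homset_def full_subcategory_def)
  show "\<forall>i \<in> LX. lv m i ` lev (src m) i \<subseteq> lv n i ` lev (src n) i"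
  proof (intro ballI image_subsetI)
    fix i x assume i: "i \<in> LX" and x: "x \<in> lev (src m) i"
    have e: "lv m i x = lv n i (lv h i x)" using lv_comp[OF h(1) i, of x n] x h by metis
    have "lv h i x \<in> lev (src n) i" using gcat_dat_in[OF h(1) i, of x] x h(2,3) by simp
    then show "lv m i x \<in> lv n i ` lev (src n) i" unfolding e by (rule imageI)
  qed
next
  assume sub: "\<forall>i \<in> LX. lv m i ` lev (src m) i \<subseteq> lv n i ` lev (src n) i"
  define h where "h i = (\<lambda>x \<in> lev (src m) i. inv_into (lev (src n) i) (lv n i) (lv m i x))" for i
  have M: "preglider (src m)" and N: "preglider (src n)" using gcat_ArrD(1)[OF m(1)] gcat_ArrD(1)[OF n(1)] by auto
  have h: "lv n i (h i x) = lv m i x" "h i x \<in> lev (src n) i"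
    if "i \<in> LX" "x \<in> lev (src m) i" for i x
  proof -
    have "lv m i x \<in> lv n i ` lev (src n) i" using sub that by blast
    then show "lv n i (h i x) = lv m i x" "h i x \<in> lev (src n) i"
      using that by (simp_all add: h_def f_inv_into_f inv_into_into)
  qed
  have eq: "x = y" if "i \<in> LX" "lv n i x = lv n i y" "x \<in> lev (src n) i" "y \<in> lev (src n) i" for i x y
    using inj_onD[OF inj[OF that(1)] that(2-)] .
  let ?h = "ga_arrow LX (src m) h (src n)"
  have "?h \<in> Arr (gcat LX)"
  proof (rule ga_arrow_LX[OF M N])
    fix i assume i: "i \<in> LX"
    then have I: "i \<in> IX" using LX_IX by auto
    interpret A: module K "ObjMap (src m) i" using M I by simp
    interpret B: module K "ObjMap (src n) i" using N I by simp
    note l = gcat_dat_linear[OF m(1) i] gcat_dat_linear[OF n(1) i]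
    note rules = linear_add[OF l(1)] linear_add[OF l(2)] linear_smult[OF l(1)] linear_smult[OF l(2)]
    show "h i \<in> linear_maps K (ObjMap (src m) i) (ObjMap (src n) i)"
    proof (rule linear_mapsI)
      show "h i (x \<oplus>\<^bsub>ObjMap (src m) i\<^esub> y) = h i x \<oplus>\<^bsub>ObjMap (src n) i\<^esub> h i y"
        if "x \<in> lev (src m) i" "y \<in> lev (src m) i" for x y
        by (rule eq[OF i]) (use that h[OF i] n(3) in \<open>simp_all add: rules\<close>)
      show "h i (c \<odot>\<^bsub>ObjMap (src m) i\<^esub> x) = c \<odot>\<^bsub>ObjMap (src n) i\<^esub> h i x"
        if "c \<in> carrier K" "x \<in> lev (src m) i" for c x
        by (rule eq[OF i]) (use that h[OF i] n(3) in \<open>simp_all add: rules\<close>)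
    qed (use h[OF i] in \<open>auto simp: h_def\<close>)
  next
    fix g x assume gx: "g \<in> carrier G" "x \<in> lev (src m) lo"
    note g1 = gm_in[OF M _ _ _ gx(2), of hi g] and g2 = gm_in[OF N _ _ _ h(2)[OF LX_mem(1) gx(2)], of hi g]
    show "h hi (gm (src m) lo g hi x) = gm (src n) lo g hi (h lo x)"
      by (rule eq[of hi])
        (use gx g1 g2 h[of hi "gm (src m) lo g hi x"] h[of lo x] n(3)
          gcat_dat_nat(1)[OF m(1) LX_IX, of lo hi g x] gcat_dat_nat(1)[OF n(1) LX_IX, of lo hi g "h lo x"] in simp_all)
  qed
  moreover have "m = n \<bullet> ?h"
  proof (rule gcat_arr_eqI[OF m(1)])
    show c: "n \<bullet> ?h \<in> Arr (gcat LX)" using \<open>?h \<in> Arr (gcat LX)\<close> n by (intro R.Comp_arr) auto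
    have "lv m i = lv (n \<bullet> ?h) i" if i: "i \<in> LX" for i
    proof (rule linear_eqI[OF gcat_dat_linear[OF m(1) i]])
      show "lv (n \<bullet> ?h) i \<in> linear_maps K (ObjMap (src m) i) (ObjMap (trg n) i)"
        using gcat_dat_linear[OF c i] by (simp del: gcat_dat)
      show "lv m i x = lv (n \<bullet> ?h) i x" if "x \<in> lev (src m) i" for x
        using h(1)[OF i that] that i by (subst lv_comp[OF \<open>?h \<in> Arr (gcat LX)\<close> i]) simp_all
    qed
    then show "lv m lo = lv (n \<bullet> ?h) lo" "lv m hi = lv (n \<bullet> ?h) hi" by simp_all
  qed (use n in auto)
  ultimately show "subobj_le (fs Q) m n"
    using m n by (auto simp: subobj_le_def homset_def full_subcategory_def intro!: bexI[of _ ?h])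
qed

text \<open>Level -1 embeds into level 0, so a chain of subobjects is controlled by two chains of
  subspaces of level 0. Conversely, subspaces of level 0 are subobjects with zero level -1.\<close>

lemma noetherian_gcat_iff:
  assumes M: "preglider M"
  shows "noetherian_obj (gcat LX) M \<longleftrightarrow> finitely_generated K (ObjMap M hi)"
proof -
  interpret V: vspace K "ObjMap M hi" by (rule vspace.intro) (use M in simp)
  interpret V': vspace K "ObjMap M lo" by (rule vspace.intro) (use M in simp)
  note mono = mono_fs_iff[where Q = "\<lambda>_. True", unfolded gcat_fs]
    and sub = subobj_fs_iff[where Q = "\<lambda>_. True", unfolded gcat_fs]
  have "noetherian_obj (gcat LX) M \<longleftrightarrow> noetherian_space K (ObjMap M hi)"
  proof
    assume noeth: "noetherian_obj (gcat LX) M"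
    show "noetherian_space K (ObjMap M hi)" unfolding noetherian_space_def
    proof (intro allI impI; elim conjE)
      fix A :: "nat \<Rightarrow> 'u set"
      assume A: "\<forall>n. submodule (A n) K (ObjMap M hi)" and inc: "\<forall>n. A n \<subseteq> A (Suc n)"
      \<comment> \<open>The subspace \<open>A n\<close> as the glider with levels 0 and
        \<open>A n\<close> in the trivial representation on level 0.\<close>
      define s where "s n = sub_arr (ObjMap M hi) (A n) (\<lambda>x \<in> A n. x) M" for n
      have s: "s n \<in> Arr (gcat LX)" "src (s n) = Sub (ObjMap M hi) (A n)" "trg (s n) = M"
        "lv (s n) hi = (\<lambda>x \<in> A n. x)" "lv (s n) lo = (\<lambda>x \<in> {\<zero>\<^bsub>ObjMap M hi\<^esub>}. \<zero>\<^bsub>ObjMap M lo\<^esub>)" for n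
        unfolding s_def using A V.linear_map_incl by (auto intro!: sub_arr V.module_axioms M)
      have c: "lev (src (s n)) hi = A n" "lev (src (s n)) lo = {\<zero>\<^bsub>ObjMap M hi\<^esub>}" for n
        using Sub[OF V.module_axioms A[rule_format, of n]] s(2) by simp_all
      have i: "inj_on (lv (s n) i) (lev (src (s n)) i)" if "i \<in> LX" for n i
        using that c[of n] s(4,5)[of n] by (auto simp: LX_def inj_on_def)
      have le: "subobj_le (gcat LX) (s i) (s j) \<longleftrightarrow> A i \<subseteq> A j" for i j
        using sub[OF s(1) _ s(1) _ _ i, of i j] s(3) by (simp add: LX_def c s(4,5))
      have "mono_arr (gcat LX) (s n)" for n using mono[OF s(1)] i by simp
      then obtain n where "\<forall>i \<ge> n. subobj_le (gcat LX) (s i) (s n)"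
        using noeth inc s(3) unfolding noetherian_obj_def le[symmetric] by blast
      then show "\<exists>n. \<forall>i \<ge> n. A i \<subseteq> A n" unfolding le by blast
    qed
  next
    assume noeth: "noetherian_space K (ObjMap M hi)"
    show "noetherian_obj (gcat LX) M" unfolding noetherian_obj_def
    proof (intro conjI allI impI; (elim conjE)?)
      show "M \<in> Obj (gcat LX)" using M by simp
      fix s assume s: "\<forall>i. mono_arr (gcat LX) (s i) \<and> trg (s i) = M"
        and inc: "\<forall>i. subobj_le (gcat LX) (s i) (s (Suc i))"
      have sA: "s n \<in> Arr (gcat LX)" for n using s by (auto simp: mono_arr_def)
      have i: "inj_on (lv (s n) i) (lev (src (s n)) i)" if "i \<in> LX" for n i
        using mono[OF sA] s that by blast
      note le = sub[OF sA _ sA _ _ i]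
      let ?A = "\<lambda>i n. lv (s n) i ` lev (src (s n)) i"
      \<comment> \<open>Only level 0 is known to be Noetherian; chains in level -1 are moved there
        by this embedding and recovered by its injectivity.\<close>
      let ?j = "gm M lo \<one>\<^sub>G hi"
      have sm: "submodule (?A i n) K (ObjMap M i)" if "i \<in> LX" for i n
      proof -
        have I: "i \<in> IX" using that LX_IX by auto
        interpret N: vspace K "ObjMap (src (s n)) i"
          by (rule vspace.intro) (use I gcat_ArrD(1)[OF sA] in simp)
        have "submodule (lev (src (s n)) i) K (ObjMap (src (s n)) i)"
          by (simp add: N.submodule_iff)
        then show ?thesis
          using M I gcat_dat_linear[OF sA that, of n] s by (intro N.linear_map_image_submodule) auto
      qed
      have inc': "?A i n \<subseteq> ?A i (Suc n)" if "i \<in> LX" for i n using inc le[of n "Suc n"] s that by simp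
      have stat: "\<exists>n. \<forall>i \<ge> n. A i \<subseteq> A n"
        if "\<And>n. submodule (A n) K (ObjMap M hi)" "\<And>n. A n \<subseteq> A (Suc n)" for A :: "nat \<Rightarrow> 'u set"
        using noeth that unfolding noetherian_space_def by blast
      obtain n1 where n1: "\<And>n. n \<ge> n1 \<Longrightarrow> ?A hi n \<subseteq> ?A hi n1"
        using stat[of "?A hi", OF sm[OF LX_mem(2)] inc'[OF LX_mem(2)]] by blast
      have sj: "submodule (?j ` ?A lo n) K (ObjMap M hi)" for n
        by (rule V'.linear_map_image_submodule[OF V.module_axioms gm_linear[OF M] sm]) simp_all
      have "\<exists>n2. \<forall>n \<ge> n2. ?j ` ?A lo n \<subseteq> ?j ` ?A lo n2"
        by (rule stat[of "\<lambda>n. ?j ` ?A lo n", OF sj image_mono[OF inc'[OF LX_mem(1)]]])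
      then obtain n2 where n2: "\<forall>n \<ge> n2. ?j ` ?A lo n \<subseteq> ?j ` ?A lo n2" ..
      have n2': "?A lo n \<subseteq> ?A lo n2" if "n \<ge> n2" for n
      proof -
        have sub: "?A lo k \<subseteq> lev M lo" for k using sm[of lo k] V'.submodule_iff by auto
        have inj: "inj_on ?j (lev M lo)" using ga_inj[OF M, of lo hi] by simp
        show ?thesis
        proof
          fix x assume x: "x \<in> ?A lo n"
          then have "?j x \<in> ?j ` ?A lo n2" using n2[rule_format, OF that] by blast
          then show "x \<in> ?A lo n2" using inj_on_image_mem_iff[OF inj _ sub] x sub by blast
        qed
      qed
      have mon: "?A i a \<subseteq> ?A i b" if "a \<le> b" "i \<in> LX" for a b i
        using lift_Suc_mono_le[of "?A i", OF inc'[OF that(2)] that(1)] .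
      \<comment> \<open>Two levels become stationary at different indices; the maximum serves
        both.\<close>
      have "subobj_le (gcat LX) (s n) (s (max n1 n2))" if "n \<ge> max n1 n2" for n
        unfolding le[of n "max n1 n2", simplified, unfolded s[rule_format, THEN conjunct2], OF refl]
        using n1[of n] n2'[of n] mon[of n1 "max n1 n2" hi] mon[of n2 "max n1 n2" lo] that
        by (simp add: LX_def) (meson order_trans)
      then show "\<exists>n. \<forall>i \<ge> n. subobj_le (gcat LX) (s i) (s n)" by blast
    qed
  qed
  then show ?thesis using noetherian_iff_finitely_generated[OF V.module_axioms] by simp
qed

abbreviation fg :: "('k, 'u, 'g \<Rightarrow> 'k) glider \<Rightarrow> bool" where "fg M \<equiv> finitely_generated K (ObjMap M hi)"

lemma fg_S [simp]: "finitely_generated K S"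
proof (rule finitely_generatedI[OF module_S, of "{sc \<one>}"])
  interpret S: vspace K S by (rule vspace.intro) (rule module_S)
  fix H assume H: "submodule H K S" "{sc \<one>} \<subseteq> H"
  show "carrier S \<subseteq> H"
  proof
    fix a assume a: "a \<in> carrier S"
    then have "a = us a \<odot>\<^bsub>S\<^esub> sc \<one>" using sc_one[of "us a"] by simp
    then show "a \<in> H" using H a us_in[OF a] unfolding S.submodule_iff by (metis insert_subset)
  qed
qed auto

text \<open>The linear map fixing every basis vector can be formed with values in any subspace
  containing the basis, and it is the identity.\<close>

lemma fg_kG [simp]: "finitely_generated K kG"
proof (rule finitely_generatedI[OF module_kG, of "ev ` carrier G"])
  interpret kG: vspace K kG by (rule vspace.intro) simp
  fix H assume H: "submodule H K kG" "ev ` carrier G \<subseteq> H"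
  have m: "module K (kG\<lparr>carrier := H\<rparr>)" by (rule submodule.submodule_is_module[OF H(1) module_kG])
  have l: "kG_map (kG\<lparr>carrier := H\<rparr>) ev \<in> linear_maps K kG (kG\<lparr>carrier := H\<rparr>)"
    by (rule kG_map_linear[OF m]) (use H in auto)
  have "kG_map (kG\<lparr>carrier := H\<rparr>) ev = (\<lambda>x \<in> carrier kG. x)"
  proof (rule kG_map_eqI[OF module_kG _ kG.linear_map_id])
    have "H \<subseteq> carrier kG" using H by (simp add: kG.submodule_iff)
    then show "kG_map (kG\<lparr>carrier := H\<rparr>) ev \<in> linear_maps K kG kG"
      using l by (auto simp: linear_maps_def)
    show "kG_map (kG\<lparr>carrier := H\<rparr>) ev (ev g) = (\<lambda>x \<in> carrier kG. x) (ev g)" if "g \<in> carrier G" for g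
      using kG_map_ev[OF m _ that, of ev] H that by auto
  qed
  then show "carrier kG \<subseteq> H" using linear_closed[OF l] by auto
qed (use fin in auto)

lemma fg_T [simp]: "preglider M \<Longrightarrow> preglider N \<Longrightarrow> fg M \<Longrightarrow> fg N \<Longrightarrow> fg (T M N)"
  by (simp add: finitely_generated_tensor)

lemma lin_mon_cat_fg: "lin_mon_cat K (fs fg)"
  by (rule R.full_subcategory) (auto simp: fg_S finitely_generated_tensor)

text \<open>Being Noetherian passes through the isomorphism with the localization, so the full
  subcategories cut out on both sides correspond.\<close>

lemma strict_iso_glid: "\<exists>fo fa. strict_iso K (fs fg) (glid U K {-1, 0} B Fl) fo fa"
proof -
  note i = strict_iso_Glid
  have "fs fg = fs (noetherian_obj (gcat LX))"
    using gcat_ArrD(1,2)[where I = LX] noetherian_gcat_iff by (auto simp: full_subcategory_def intro!: arg_cong2[of _ _ _ _ "\<lambda>a b. (gcat LX)\<lparr>Obj := a, Arr := b\<rparr>"])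
  moreover have "strict_iso K (fs (noetherian_obj (gcat LX))) (glid U K {-1, 0} B Fl) (\<lambda>x. x)
      (fractions.frac_class (gcat IX) (gcat LX) Res (glider_weak_isos K {-1, 0} B Fl))"
    unfolding glid_def
    using strict_iso.noetherian_iff[OF i R.lin_mon_cat_axioms]
    by (intro strict_iso.full_subcategory[OF i _ R.cat_axioms]) auto
  ultimately show ?thesis by auto
qed


section \<open>The group encoded by the finitely generated gliders\<close>

interpretation R: lin_mon_cat K "gcat LX" by (rule lin_mon_cat_gcat[OF LX_IX])
interpretation S: vspace K S by (rule vspace.intro) (rule module_S)
interpretation kG: vspace K kG by (rule vspace.intro) simp

lemma fs_sel [simp]:
  "Arr (fs Q) = {f \<in> Arr (gcat LX). Q (src f) \<and> Q (trg f)}" "g \<cdot>\<^bsub>fs Q\<^esub> f = g \<bullet> f"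
  "Id (fs Q) = Id (gcat LX)" "TensO (fs Q) = T" "TensA (fs Q) = TensA (gcat LX)" "UnitO (fs Q) = E"
  by (simp_all add: full_subcategory_def)

text \<open>A nonzero scalar is a unit, so it generates the whole line.\<close>

lemma S_submodule:
  assumes H: "submodule H K S"
  shows "H = {\<zero>\<^bsub>S\<^esub>} \<or> H = carrier S"
proof (cases "H \<subseteq> {\<zero>\<^bsub>S\<^esub>}")
  case True
  then show ?thesis using H unfolding S.submodule_iff by blast
next
  case False
  then obtain a where a: "a \<in> H" "a \<noteq> \<zero>\<^bsub>S\<^esub>" by auto
  then have aS: "a \<in> carrier S" using H unfolding S.submodule_iff by blast
  then have "us a \<noteq> \<zero>" using a(2) sc_us zero_S by metis
  then have u: "us a \<in> Units K" using field_Units us_in[OF aS] by simp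
  have "x \<in> H" if x: "x \<in> carrier S" for x
  proof -
    have "(us x \<otimes> inv (us a)) \<odot>\<^bsub>S\<^esub> sc (us a) = sc (us x)"
      using smult_S[of "us a" "us x \<otimes> inv (us a)"] u x aS by (simp add: m_assoc)
    then have "x = (us x \<otimes> inv (us a)) \<odot>\<^bsub>S\<^esub> a" using x aS by simp
    then show ?thesis using H a u x unfolding S.submodule_iff by (metis Units_inv_closed m_closed us_in)
  qed
  then show ?thesis using H unfolding S.submodule_iff by blast
qed

lemma sc_ne: "sc \<one> \<noteq> \<zero>\<^bsub>S\<^esub>" by (simp add: zero_S)

definition eta :: "('k, 'u, 'g) glider_arrow" where "eta = x_arr E (sc \<one>)"

definition eps :: "('k, 'u, 'g) glider_arrow" where "eps = p_arr E (sc \<one>)"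

definition gl :: "'g \<Rightarrow> ('k, 'u, 'g) glider_arrow" where "gl g = x_arr PP (ev g)"

lemma smult_one: "a \<in> carrier S \<Longrightarrow> us a \<odot>\<^bsub>S\<^esub> sc \<one> = a"
  by (simp flip: sc_one)

lemma eta [simp]: "eta \<in> Arr (gcat LX)" "src eta = X" "trg eta = E"
  and eta_hi: "a \<in> carrier S \<Longrightarrow> lv eta hi a = a" and eta_lo: "lv eta lo \<zero>\<^bsub>S\<^esub> = \<zero>\<^bsub>S\<^esub>"
  using x_arr[of E "sc \<one>"] by (simp_all add: eta_def) (simp_all add: x_arr_def smult_one)

lemma eps [simp]: "eps \<in> Arr (gcat LX)" "src eps = PP" "trg eps = E"
  and eps_lo: "a \<in> carrier S \<Longrightarrow> lv eps lo a = a"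
  and eps_hi: "g \<in> carrier G \<Longrightarrow> lv eps hi (ev g) = sc \<one>"
  using p_arr[of E "sc \<one>"] by (simp_all add: eps_def ga_E) (simp_all add: p_arr_def smult_one)

lemma gl [simp]:
  assumes "g \<in> carrier G"
  shows "gl g \<in> Arr (gcat LX)" "src (gl g) = X" "trg (gl g) = PP" "lv (gl g) hi (sc \<one>) = ev g"
  using x_arr[of PP "ev g"] assms by (simp_all add: gl_def)

text \<open>In the unit the map from level -1 to level 0 is the identity, so a vector hit on level
  -1 is hit on level 0.\<close>

lemma hi_surj:
  assumes f: "f \<in> Arr (gcat LX)" "trg f = E" and s: "lv f lo ` lev (src f) lo = carrier S"
  shows "lv f hi ` lev (src f) hi = carrier S"
proof
  show "lv f hi ` lev (src f) hi \<subseteq> carrier S"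
    using gcat_dat_in[OF f(1), of hi] f(2) by auto
  show "carrier S \<subseteq> lv f hi ` lev (src f) hi"
  proof
    fix a assume a: "a \<in> carrier S"
    then obtain x where x: "x \<in> lev (src f) lo" "a = lv f lo x" using s by auto
    have "lv f hi (gm (src f) lo \<one>\<^sub>G hi x) = a"
      using gcat_dat_nat(1)[OF f(1) LX_IX, of lo hi "\<one>\<^sub>G" x] x a f(2) by (simp add: ga_E)
    then show "a \<in> lv f hi ` lev (src f) hi"
      using gm_in[OF gcat_ArrD(1)[OF f(1)], of lo hi "\<one>\<^sub>G" x] x(1) by force
  qed
qed

lemma lo_image:
  assumes f: "f \<in> Arr (gcat LX)" "trg f = E"
  shows "lv f lo ` lev (src f) lo = {\<zero>\<^bsub>S\<^esub>} \<or> lv f lo ` lev (src f) lo = carrier S"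
proof (rule S_submodule)
  interpret V: vspace K "ObjMap (src f) lo" by (rule vspace.intro) (use gcat_ArrD(1)[OF f(1)] in simp)
  have "submodule (lev (src f) lo) K (ObjMap (src f) lo)" by (simp add: V.submodule_iff)
  then show "submodule (lv f lo ` lev (src f) lo) K S"
    using gcat_dat_linear[OF f(1), of lo] f(2) by (intro V.linear_map_image_submodule module_S) auto
qed

text \<open>A subobject of the unit is proper only if it misses level -1: surjectivity there spreads
  to level 0.\<close>

lemma iso_if_lo_surj:
  assumes m: "mono_arr (fs fg) m" "trg m = E" and s: "lv m lo ` lev (src m) lo = carrier S"
  shows "iso_arr (fs fg) m"
proof -
  have a: "m \<in> Arr (gcat LX)" "fg (src m)" "fg (trg m)" using m by (auto simp: mono_arr_def)
  have "\<forall>i \<in> LX. inj_on (lv m i) (lev (src m) i)" using mono_fs_iff[OF a] m by simp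
  then show ?thesis
    unfolding iso_fs_iff[where Q = fg, OF a] using s hi_surj[OF a(1) m(2) s] m(2) by (simp add: LX_def bij_betw_def)
qed

text \<open>The image on level -1 is zero or everything, and for a proper subobject it is zero.
  \<open>eta\<close> already contains all of level 0, so it contains every such subobject.\<close>

lemma maximal_eta: "is_maximal_sub (fs fg) eta" and not_iso_eta: "\<not> iso_arr (fs fg) eta"
proof -
  have inj: "inj_on (lv eta i) (carrier (ObjMap (src eta) i))" if "i \<in> LX" for i
    using that by (auto simp: LX_def inj_on_def eta_hi)
  then have mono: "mono_arr (fs fg) eta" using mono_fs_iff[of eta fg] by simp
  show niso: "\<not> iso_arr (fs fg) eta"
  proof
    assume "iso_arr (fs fg) eta"
    then have "\<forall>i \<in> LX. bij_betw (lv eta i) (lev X i) (lev E i)"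
      using iso_fs_iff[of eta fg] by simp
    from bspec[OF this LX_mem(1)] have "lv eta lo ` {\<zero>\<^bsub>S\<^esub>} = carrier S" by (simp add: bij_betw_def)
    moreover have "sc \<one> \<in> carrier S" by simp
    ultimately have "sc \<one> \<in> lv eta lo ` {\<zero>\<^bsub>S\<^esub>}" by (simp only:)
    then show False using sc_ne by (simp add: eta_lo)
  qed
  have "subobj_le (fs fg) m eta" if m: "mono_arr (fs fg) m" "\<not> iso_arr (fs fg) m" "trg m = trg eta" for m
  proof -
    have a: "m \<in> Arr (gcat LX)" "fg (src m)" "fg (trg m)" using m by (auto simp: mono_arr_def)
    have t: "trg m = E" using m by simp
    have z: "lv m lo ` lev (src m) lo = {\<zero>\<^bsub>S\<^esub>}"
      using lo_image[OF a(1) t] iso_if_lo_surj[OF m(1) t] m(2) by blast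
    have h: "lv m hi ` lev (src m) hi \<subseteq> lv eta hi ` carrier S"
      using gcat_dat_in[OF a(1), of hi] t eta_hi by (force simp: image_iff)
    show ?thesis
      unfolding subobj_fs_iff[where Q = fg, OF a(1,2) eta(1) _ m(3) inj, simplified]
      using z h by (simp add: LX_def eta_lo)
  qed
  then show "is_maximal_sub (fs fg) eta" unfolding is_maximal_sub_def using mono niso by blast
qed

text \<open>An arrow to the unit that vanishes on level -1 factors through \<open>eta\<close>, a
  proper subobject, and so is no cover.\<close>

lemma cover_lo:
  assumes f: "is_cover (fs fg) f" "trg f = E"
  shows "\<exists>m \<in> lev (src f) lo. lv f lo m = sc \<one>"
proof -
  have a: "f \<in> Arr (gcat LX)" "fg (src f)" using f by (auto simp: is_cover_def)
  have M: "preglider (src f)" using gcat_ArrD(1)[OF a(1)] .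
  interpret V: vspace K "ObjMap (src f) lo" by (rule vspace.intro) (use M in simp)
  have "lv f lo ` lev (src f) lo \<noteq> {\<zero>\<^bsub>S\<^esub>}"
  proof
    assume z: "lv f lo ` lev (src f) lo = {\<zero>\<^bsub>S\<^esub>}"
    \<comment> \<open>The arrow \<open>f\<close> itself with its target shrunk to \<open>X\<close>;
      this is legitimate because its component on level -1 is zero.\<close>
    define h where "h i = (if i = hi then lv f hi else lv f lo)" for i
    have l: "lv f i \<in> linear_maps K (ObjMap (src f) i) S" if "i \<in> LX" for i
      using gcat_dat_linear[OF a(1) that] f(2) that LX_IX by auto
    have z': "lv f lo x = \<zero>\<^bsub>S\<^esub>" if "x \<in> lev (src f) lo" for x using z that by blast
    have "ga_arrow LX (src f) h X \<in> Arr (gcat LX)"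
    proof (rule ga_arrow_LX[OF M X(1)])
      have "lv f lo \<in> linear_maps K (ObjMap (src f) lo) (ObjMap X lo)"
        by (rule linear_mapsI) (use linear_ext[OF l[of lo]] z' in auto)
      then show "h i \<in> linear_maps K (ObjMap (src f) i) (ObjMap X i)" if "i \<in> LX" for i
        using that l[of hi] unfolding h_def LX_def by auto
      show "h hi (gm (src f) lo g hi x) = gm X lo g hi (h lo x)"
        if "g \<in> carrier G" "x \<in> lev (src f) lo" for g x
        using gcat_dat_nat(1)[OF a(1) LX_IX, of lo hi g x] that f(2) z'
        by (simp add: h_def ga_E Sub(4)[OF module_S submodule_S])
    qed
    moreover have fe: "f = eta \<bullet> ga_arrow LX (src f) h X" (is "_ = _ \<bullet> ?h")
    proof (rule gcat_arr_eqI[OF a(1)])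
      show c: "eta \<bullet> ?h \<in> Arr (gcat LX)" using calculation by (intro R.Comp_arr) auto
      have "lv f i = lv (eta \<bullet> ?h) i" if i: "i \<in> LX" for i
      proof (rule linear_eqI[OF l[OF i]])
        show "lv (eta \<bullet> ?h) i \<in> linear_maps K (ObjMap (src f) i) (ObjMap E i)"
          using gcat_dat_linear[OF c i] by (simp del: gcat_dat)
        fix x assume x: "x \<in> lev (src f) i"
        have "lv (eta \<bullet> ?h) i x = lv eta i (h i x)"
          using lv_comp[OF calculation i, of x eta] x i by simp
        then show "lv f i x = lv (eta \<bullet> ?h) i x"
          using i x linear_closed[OF l[of hi]] z' by (auto simp: LX_def h_def eta_lo eta_hi)
      qed
      then show "lv f lo = lv (eta \<bullet> ?h) lo" "lv f hi = lv (eta \<bullet> ?h) hi" by simp_all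
    qed (use f(2) in auto)
    moreover have "mono_arr (fs fg) eta" using maximal_eta by (simp add: is_maximal_sub_def)
    moreover have cov: "iso_arr (fs fg) m"
      if "mono_arr (fs fg) m" "trg m = trg f" "h \<in> homset (fs fg) (src f) (src m)" "f = m \<cdot>\<^bsub>fs fg\<^esub> h" for m h
      using f(1) that unfolding is_cover_def by blast
    ultimately have "iso_arr (fs fg) eta" using cov[of eta ?h] f(2) a(2) by (simp add: homset_def)
    then show False using not_iso_eta by simp
  qed
  then have "lv f lo ` lev (src f) lo = carrier S" using lo_image[OF a(1) f(2)] by simp
  moreover have "sc \<one> \<in> carrier S" by simp
  ultimately have "sc \<one> \<in> lv f lo ` lev (src f) lo" by (simp only:)
  then show ?thesis by force
qed

text \<open>Arrows out of \<open>PP\<close> are vectors of level -1, and \<open>eps\<close> is the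
  vector \<open>sc \<one>\<close>. All three clauses become statements about vectors mapped to
  \<open>sc \<one>\<close>.\<close>

lemma minimal_cover_eps: "is_minimal_cover (fs fg) eps"
  unfolding is_minimal_cover_def
proof (intro conjI allI impI ballI; (elim conjE)?)
  show "is_cover (fs fg) eps" unfolding is_cover_def
  proof (intro conjI allI impI; (elim conjE)?)
    fix m h assume m: "mono_arr (fs fg) m" "trg m = trg eps" and h: "h \<in> homset (fs fg) (src eps) (src m)"
      and e: "eps = m \<cdot>\<^bsub>fs fg\<^esub> h"
    have a: "m \<in> Arr (gcat LX)" and h': "h \<in> Arr (gcat LX)" "src h = PP" "trg h = src m"
      and t: "trg m = E" using m h by (auto simp: mono_arr_def homset_def)
    have "lv m lo (lv h lo (sc \<one>)) = sc \<one>"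
      using lv_comp[OF h'(1), of lo "sc \<one>" m] e h' eps_lo[of "sc \<one>"] by simp
    moreover have "lv h lo (sc \<one>) \<in> lev (src m) lo"
      using gcat_dat_in[OF h'(1), of lo "sc \<one>"] h' by simp
    ultimately have "sc \<one> \<in> lv m lo ` lev (src m) lo" by (metis imageI)
    then have "lv m lo ` lev (src m) lo = carrier S" using lo_image[OF a t] sc_ne by auto
    then show "iso_arr (fs fg) m" by (rule iso_if_lo_surj[OF m(1) t])
  qed simp
next
  fix f assume f: "is_cover (fs fg) f" "trg f = trg eps"
  have t: "trg f = E" using f by simp
  have a: "f \<in> Arr (gcat LX)" "fg (src f)" using f by (auto simp: is_cover_def)
  \<comment> \<open>A preimage of \<open>sc \<one>\<close> is the same thing as a factorization of
    \<open>eps\<close> through \<open>f\<close>.\<close>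
  obtain m where m: "m \<in> lev (src f) lo" "lv f lo m = sc \<one>" using cover_lo[OF f(1) t] by blast
  note p = p_arr[OF gcat_ArrD(1)[OF a(1)] m(1)]
  have "f \<bullet> p_arr (src f) m = eps"
  proof (rule P_arr_eqI)
    show "lv (f \<bullet> p_arr (src f) m) lo (sc \<one>) = lv eps lo (sc \<one>)"
      using lv_comp[OF p(1), of lo "sc \<one>" f] p(2) m eps_lo[of "sc \<one>"] by simp
  qed (use p a t in \<open>auto intro: R.Comp_arr\<close>)
  then show "\<exists>h \<in> homset (fs fg) (src eps) (src f). f \<cdot>\<^bsub>fs fg\<^esub> h = eps"
    using p(1) a by (intro bexI[of _ "p_arr (src f) m"]) (auto simp: homset_def)
next
  fix h assume h: "h \<in> homset (fs fg) (src eps) (src eps)" "eps \<cdot>\<^bsub>fs fg\<^esub> h = eps"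
  then have h': "h \<in> Arr (gcat LX)" "src h = PP" "trg h = PP" by (auto simp: homset_def)
  \<comment> \<open>\<open>eps\<close> is the identity on level -1, so \<open>h\<close> fixes the
    vector that determines arrows out of \<open>PP\<close>.\<close>
  have "lv eps lo (lv h lo (sc \<one>)) = lv (eps \<bullet> h) lo (sc \<one>)"
    using lv_comp[OF h'(1), of lo "sc \<one>" eps] h' by (simp del: gcat_dat)
  also have "\<dots> = sc \<one>" using h(2) by (simp add: eps_lo del: gcat_dat)
  finally have "lv h lo (sc \<one>) = sc \<one>"
    using gcat_dat_in[OF h'(1), of lo "sc \<one>"] h h' by (simp add: eps_lo del: gcat_dat)
  then show "h = Id (fs fg) (src eps)"
    using h' by (intro P_arr_eqI) (auto simp: R.Id_arr)
qed


section \<open>Group elements as grouplike arrows\<close>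

interpretation R: lin_mon_cat K "gcat LX" by (rule lin_mon_cat_gcat[OF LX_IX])
interpretation S: vspace K S by (rule vspace.intro) (rule module_S)
interpretation kG: vspace K kG by (rule vspace.intro) simp

lemma lv_comp1: "f \<in> Arr (gcat LX) \<Longrightarrow> src f = M \<Longrightarrow> i \<in> LX \<Longrightarrow> x \<in> lev M i \<Longrightarrow>
    lv (g \<bullet> f) i x = lv g i (lv f i x)"
  using lv_comp by blast

abbreviation tt :: 'u where "tt \<equiv> pt S S (sc \<one>) (sc \<one>)"

text \<open>The multiples of \<open>tt\<close> form a subspace containing all pure tensors. So the
  tensor square of the scalars is a line, which leaves only a scalar of freedom in the two
  existential witnesses of \<open>grouplikes\<close>.\<close>

lemma tens_S:
  assumes z: "z \<in> carrier (tens S S)"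
  shows "\<exists>c \<in> carrier S. z = us c \<odot>\<^bsub>tens S S\<^esub> tt"
proof -
  interpret TS: vspace K "tens S S" by (rule vspace.intro) (simp add: module_S)
  have t: "tt \<in> carrier (tens S S)" by (simp add: module_S)
  have "(\<lambda>c \<in> carrier S. us c \<odot>\<^bsub>tens S S\<^esub> tt) ` carrier S = carrier (tens S S)"
  proof (rule tensor_submodule[OF module_S module_S])
    show "submodule ((\<lambda>c \<in> carrier S. us c \<odot>\<^bsub>tens S S\<^esub> tt) ` carrier S) K (tens S S)"
      by (rule S.linear_map_image_submodule[OF TS.module_axioms scalar_line[OF TS.module_axioms t] submodule_S])
    fix x y assume xy: "x \<in> carrier S" "y \<in> carrier S"
    have "pt S S x y = pt S S (us x \<odot>\<^bsub>S\<^esub> sc \<one>) (us y \<odot>\<^bsub>S\<^esub> sc \<one>)" using xy by (simp only: smult_one)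
    also have "\<dots> = (us x \<otimes> us y) \<odot>\<^bsub>tens S S\<^esub> tt"
      using xy pt_rules(4,5)[OF module_S module_S] t by (simp add: m_comm flip: TS.smult_assoc1)
    finally show "pt S S x y \<in> (\<lambda>c \<in> carrier S. us c \<odot>\<^bsub>tens S S\<^esub> tt) ` carrier S"
      using xy by (intro image_eqI[of _ _ "sc (us x \<otimes> us y)"]) auto
  qed
  then have "z \<in> (\<lambda>c \<in> carrier S. us c \<odot>\<^bsub>tens S S\<^esub> tt) ` carrier S" using z by (simp only:)
  then show ?thesis by (rule imageE) auto
qed

text \<open>The left unit constraint maps \<open>tt\<close> to \<open>sc \<one>\<close>, so it reads
  off the coefficient.\<close>

lemma tens_S_inj: "c \<in> carrier S \<Longrightarrow> d \<in> carrier S \<Longrightarrow> us c \<odot>\<^bsub>tens S S\<^esub> tt = us d \<odot>\<^bsub>tens S S\<^esub> tt \<Longrightarrow> c = d"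
proof -
  assume cd: "c \<in> carrier S" "d \<in> carrier S" and eq: "us c \<odot>\<^bsub>tens S S\<^esub> tt = us d \<odot>\<^bsub>tens S S\<^esub> tt"
  have l: "dat (LUnit (vect K) S) \<in> linear_maps K (tens S S) S"
    using Arr_vectD(3)[OF LUnit_vect_arr[OF module_S]] by simp
  have "dat (LUnit (vect K) S) (us a \<odot>\<^bsub>tens S S\<^esub> tt) = a" if a: "a \<in> carrier S" for a
    using linear_smult[OF l, of "us a" tt] LUnit_vect_pt[OF module_S, of "sc \<one>" "sc \<one>"] a
    by (simp add: module_S smult_one)
  then show "c = d" using cd eq by metis
qed

text \<open>On level 0 this is the isomorphism from the line to its tensor square; on level -1 both
  sides are zero.\<close>

lemma delta_iso: "iso_arr (fs fg) (x_arr (T X X) tt)"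
proof -
  let ?d = "x_arr (T X X) tt"
  have t: "tt \<in> carrier (ObjMap (T X X) hi)" by (simp add: module_S)
  note d = x_arr[OF preglider_T[OF X(1) X(1)] t]
  have hi: "lv ?d hi = (\<lambda>a \<in> carrier S. us a \<odot>\<^bsub>tens S S\<^esub> tt)" by (simp add: x_arr_def)
  have "bij_betw (lv ?d hi) (carrier S) (carrier (tens S S))"
    unfolding hi bij_betw_def inj_on_def
    using tens_S tens_S_inj linear_closed[OF scalar_line[OF module_tensor[OF module_S module_S]], of tt]
    by (auto simp: module_S image_iff) 
  moreover have "bij_betw (lv ?d lo) (lev X lo) (carrier (ObjMap (T X X) lo))"
  proof -
    let ?Z = "S\<lparr>carrier := {\<zero>\<^bsub>S\<^esub>}\<rparr>"
    have mZ: "module K ?Z" using preglider_module[OF X(1), of lo] by simp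
    interpret TZ: vspace K "tens ?Z ?Z" by (rule vspace.intro) (simp add: mZ)
    interpret Z: module K ?Z by (rule mZ)
    \<comment> \<open>The chosen tensor square of the zero space: every pure tensor vanishes,
      because its first factor is zero times itself.\<close>
    have "{\<zero>\<^bsub>tens ?Z ?Z\<^esub>} = carrier (tens ?Z ?Z)"
    proof (rule tensor_submodule[OF mZ mZ TZ.submodule_zero])
      fix x y assume "x \<in> carrier ?Z" "y \<in> carrier ?Z"
      then have "pt ?Z ?Z x y = pt ?Z ?Z (\<zero> \<odot>\<^bsub>?Z\<^esub> x) y" by simp
      also have "\<dots> = \<zero>\<^bsub>tens ?Z ?Z\<^esub>"
        using pt_rules(4)[OF mZ mZ, of \<zero> x y] pt_in[OF mZ mZ, of x y] \<open>x \<in> carrier ?Z\<close> \<open>y \<in> carrier ?Z\<close> by simp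
      finally show "pt ?Z ?Z x y \<in> {\<zero>\<^bsub>tens ?Z ?Z\<^esub>}" by simp
    qed
    then show ?thesis by (simp add: x_arr_def bij_betw_def inj_on_def)
  qed
  ultimately have "\<forall>i \<in> LX. bij_betw (lv ?d i) (lev X i) (carrier (ObjMap (T X X) i))"
    by (simp add: LX_def)
  then show ?thesis using iso_fs_iff[of ?d fg] d(1) fg_T[OF X(1) X(1)] by simp
qed

lemma TensA_lv:
  assumes f: "f \<in> Arr (gcat LX)" and x: "x \<in> lev (src f) hi"
  shows "lv (TensA (gcat LX) f f) hi (pt (ObjMap (src f) hi) (ObjMap (src f) hi) x x) =
    pt (ObjMap (trg f) hi) (ObjMap (trg f) hi) (lv f hi x) (lv f hi x)"
  using TensA_vect_pt[of "dat f hi" "dat f hi" x x] gcat_ArrD(4-6)[OF f, of hi] x by simp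

lemma gm_TPP:
  assumes g: "g \<in> carrier G"
  shows "gm (T PP PP) lo g hi tt = pt kG kG (ev g) (ev g)"
  using TensA_vect_pt[of "ga PP lo g hi" "ga PP lo g hi" "sc \<one>" "sc \<one>"] g by (simp add: ga_T PP_act)

text \<open>The arrow out of \<open>PP\<close> given by \<open>tt\<close> sends each group element
  to its tensor square, which is the usual comultiplication.\<close>

lemma gl_grouplike:
  assumes g: "g \<in> carrier G"
  shows "gl g \<in> grouplikes (fs fg) eta eps"
proof -
  have TP: "preglider (T PP PP)" and TX: "preglider (T X X)" by simp_all
  have t: "tt \<in> carrier (ObjMap (T PP PP) lo)" "tt \<in> carrier (ObjMap (T X X) hi)" by (simp_all add: module_S)
  let ?D = "p_arr (T PP PP) tt" and ?d = "x_arr (T X X) tt"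
  note D = p_arr[OF TP t(1)] and d = x_arr[OF TX t(2)]
  have TA: "TensA (gcat LX) (gl g) (gl g) \<in> Arr (gcat LX)" by (rule R.TensA_arr) (simp_all add: g)
  have "eps \<bullet> gl g = eta"
    by (rule X_arr_eqI)
      (use g in \<open>auto intro!: R.Comp_arr simp: lv_comp1[of _ X] eps_hi eta_hi simp del: gcat_dat\<close>)
  moreover have "?D \<bullet> gl g = TensA (gcat LX) (gl g) (gl g) \<bullet> ?d"
    by (rule X_arr_eqI)
      (use g D d TA TensA_lv[of "gl g" "sc \<one>"] in \<open>auto intro!: R.Comp_arr simp: lv_comp1[of _ X] gm_TPP
        simp del: gcat_dat\<close>)
  moreover have "?D \<in> homset (fs fg) PP (T PP PP)" "?d \<in> homset (fs fg) X (T X X)" "gl g \<in> homset (fs fg) X PP"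
    using g D(1) d(1) fg_T[OF PP(1) PP(1)] fg_T[OF X(1) X(1)] by (simp_all add: homset_def)
  ultimately show ?thesis
    unfolding grouplikes_def using delta_iso by (simp del: gcat_dat ObjMap_T) blast
qed

text \<open>Let b be the element of kG given by the arrow. Its image under \<open>D\<close> is a
  combination of the squares of group elements, and by the grouplike equation also a nonzero
  multiple of the tensor square of b. Comparing off-diagonal coordinates shows that b has only one
  nonzero coordinate, and the counit makes it one.\<close>

lemma grouplike_gl:
  assumes \<gamma>: "\<gamma> \<in> grouplikes (fs fg) eta eps"
  shows "\<exists>g \<in> carrier G. \<gamma> = gl g"
proof -
  obtain D d where g: "\<gamma> \<in> Arr (gcat LX)" "src \<gamma> = X" "trg \<gamma> = PP" "eps \<bullet> \<gamma> = eta"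
    and D: "D \<in> Arr (gcat LX)" "src D = PP" "trg D = T PP PP"
    and d: "d \<in> Arr (gcat LX)" "src d = X" "trg d = T X X" "iso_arr (fs fg) d"
    and eq: "D \<bullet> \<gamma> = TensA (gcat LX) \<gamma> \<gamma> \<bullet> d"
    using \<gamma> unfolding grouplikes_def homset_def by (auto simp del: gcat_dat)
  define b where "b = lv \<gamma> hi (sc \<one>)"
  have b: "b \<in> carrier kG" unfolding b_def using gcat_dat_in[OF g(1), of hi "sc \<one>"] g by simp
  have eb: "lv eps hi b = sc \<one>"
    unfolding b_def using lv_comp1[OF g(1,2), of hi "sc \<one>" eps] g(4) by (simp add: eta_hi del: gcat_dat)
  have epsl: "lv eps hi \<in> linear_maps K kG S" using gcat_dat_linear[OF eps(1), of hi] by simp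
  have mT: "module K (tens S S)" "module K (tens kG kG)" by (simp_all add: module_S)
  interpret TK: vspace K "tens kG kG" by (rule vspace.intro) (rule mT)
  interpret TS: vspace K "tens S S" by (rule vspace.intro) (rule mT)
  have dl: "lv d hi \<in> linear_maps K S (tens S S)" using gcat_dat_linear[OF d(1), of hi] d by simp
  obtain c where c: "c \<in> carrier S" "lv d hi (sc \<one>) = us c \<odot>\<^bsub>tens S S\<^esub> tt"
    using tens_S[OF linear_closed[OF dl]] sc_in[of \<one>] by blast
  \<comment> \<open>Here the isomorphism requirement on \<open>d\<close> enters: otherwise
    \<open>d\<close> would kill \<open>sc \<one>\<close> and the grouplike equation would carry no
    information about \<open>b\<close>.\<close>
  have c0: "us c \<noteq> \<zero>"
  proof
    assume "us c = \<zero>"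
    then have "lv d hi (sc \<one>) = lv d hi \<zero>\<^bsub>S\<^esub>"
      using c S.linear_map_zero[OF mT(1) dl] by (simp add: module_S)
    moreover have "inj_on (lv d hi) (carrier S)"
      using d iso_fs_iff[of d fg] fg_T[OF X(1) X(1)] by (simp add: LX_def bij_betw_def)
    ultimately show False using sc_ne by (auto dest: inj_onD)
  qed
  have Dl: "lv D hi \<in> linear_maps K kG (tens kG kG)" using gcat_dat_linear[OF D(1), of hi] D by simp
  obtain e where e: "e \<in> carrier S" "lv D lo (sc \<one>) = us e \<odot>\<^bsub>tens S S\<^esub> tt"
    using tens_S gcat_dat_in[OF D(1), of lo "sc \<one>"] D by auto
  \<comment> \<open>Naturality from level -1 to level 0 propagates the single scalar of
    \<open>D\<close> to every group element.\<close>
  have Dev: "lv D hi (ev h) = us e \<odot>\<^bsub>tens kG kG\<^esub> pt kG kG (ev h) (ev h)" if h: "h \<in> carrier G" for h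
    using gcat_dat_nat(1)[OF D(1) LX_IX, of lo hi h "sc \<one>"] D h e
      linear_smult[OF gm_linear[of "T PP PP" lo hi h], of "us e" tt] by (simp add: PP_act gm_TPP module_S)
  have TA: "TensA (gcat LX) \<gamma> \<gamma> \<in> Arr (gcat LX)" by (rule R.TensA_arr) (simp_all add: g)
  have TAl: "lv (TensA (gcat LX) \<gamma> \<gamma>) hi \<in> linear_maps K (tens S S) (tens kG kG)"
    using gcat_dat_linear[OF TA, of hi] g by (simp del: gcat_dat)
  have "lv D hi b = lv (TensA (gcat LX) \<gamma> \<gamma>) hi (lv d hi (sc \<one>))"
    unfolding b_def using lv_comp1[OF g(1,2), of hi "sc \<one>" D] lv_comp1[OF d(1,2), of hi "sc \<one>" "TensA (gcat LX) \<gamma> \<gamma>"] eq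
    by (simp del: gcat_dat)
  also have "\<dots> = us c \<odot>\<^bsub>tens kG kG\<^esub> pt kG kG b b"
    using linear_smult[OF TAl, of "us c" tt] TensA_lv[OF g(1), of "sc \<one>"] c g by (simp add: module_S b_def del: gcat_dat)
  finally have Db: "lv D hi b = us c \<odot>\<^bsub>tens kG kG\<^esub> pt kG kG b b" .
  have orth: "co h b \<otimes> co h' b = \<zero>" if h: "h \<in> carrier G" "h' \<in> carrier G" "h \<noteq> h'" for h h'
  proof -
    \<comment> \<open>The functional reading off the coordinate at the pair (h, h').\<close>
    have "bilinear K kG kG S (\<lambda>x y. sc (co h x \<otimes> co h' y))"
      by (rule bilinearI) (use h in \<open>auto simp: co_add co_smult add_S smult_S l_distr r_distr m_ac\<close>)
    then obtain \<phi> where \<phi>: "\<phi> \<in> linear_maps K (tens kG kG) S"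
      "\<And>x y. x \<in> carrier kG \<Longrightarrow> y \<in> carrier kG \<Longrightarrow> \<phi> (pt kG kG x y) = sc (co h x \<otimes> co h' y)"
      using tensor_lift[OF module_kG module_kG module_S] by blast
    have "(\<lambda>x \<in> carrier kG. \<phi> (lv D hi x)) = (\<lambda>x \<in> carrier kG. \<zero>\<^bsub>S\<^esub>)"
    proof (rule kG_map_eqI[OF module_S kG.linear_map_comp[OF Dl \<phi>(1)] kG.linear_map_zero_map[OF module_S]])
      fix k assume k: "k \<in> carrier G"
      then have "\<phi> (lv D hi (ev k)) = us e \<odot>\<^bsub>S\<^esub> \<zero>\<^bsub>S\<^esub>"
        using linear_smult[OF \<phi>(1), of "us e" "pt kG kG (ev k) (ev k)"] h e by (auto simp: Dev \<phi>(2) co_ev zero_S)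
      then show "(\<lambda>x \<in> carrier kG. \<phi> (lv D hi x)) (ev k) = (\<lambda>x \<in> carrier kG. \<zero>\<^bsub>S\<^esub>) (ev k)" using k e by simp
    qed
    from fun_cong[OF this, of b] b have "\<phi> (lv D hi b) = \<zero>\<^bsub>S\<^esub>" by simp
    moreover have "\<phi> (lv D hi b) = sc (us c \<otimes> (co h b \<otimes> co h' b))"
      using linear_smult[OF \<phi>(1), of "us c" "pt kG kG b b"] b c h by (simp add: Db \<phi>(2) smult_S)
    ultimately have "us c \<otimes> (co h b \<otimes> co h' b) = \<zero>" using c h b by (simp add: zero_S)
    then show ?thesis using c0 c h b integral[of "us c" "co h b \<otimes> co h' b"] by simp
  qed
  have "\<exists>h \<in> carrier G. co h b \<noteq> \<zero>"
  proof (rule ccontr)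
    assume "\<not> ?thesis"
    \<comment> \<open>Zero is written as a multiple of \<open>b\<close>, since coordinates of
      multiples are known from \<open>co_smult\<close>.\<close>
    then have "b = \<zero> \<odot>\<^bsub>kG\<^esub> b" using b by (intro kG_eqI) (auto simp: co_smult simp del: kG.smult_l_null)
    then have "lv eps hi b = \<zero>\<^bsub>S\<^esub>" using b kG.linear_map_zero[OF module_S epsl] by simp
    then show False using eb sc_ne by simp
  qed
  then obtain h where h: "h \<in> carrier G" "co h b \<noteq> \<zero>" by blast
  \<comment> \<open>Orthogonality with the nonzero coordinate at \<open>h\<close> kills all the
    others, as a field has no zero divisors.\<close>
  have bh: "b = co h b \<odot>\<^bsub>kG\<^esub> ev h"
    using b h orth[of h] integral[of "co h b"] by (intro kG_eqI) (auto simp: co_smult co_ev)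
  have "sc \<one> = co h b \<odot>\<^bsub>S\<^esub> sc \<one>"
    using linear_smult[OF epsl, of "co h b" "ev h"] bh[symmetric] eb eps_hi[OF h(1)] h b by simp
  then have "co h b = \<one>" using h b by (simp add: smult_S)
  then have "b = ev h" using bh h by simp
  then have "\<gamma> = gl h" using g h by (intro X_arr_eqI) (auto simp: b_def)
  then show ?thesis using h by blast
qed

text \<open>If x is given by the vector m of level -1, then x composed with \<open>gl k\<close> is
  given by k m in level 0. Hence the relation speaks about equations k m = k' m' in arbitrary
  gliders.\<close>

lemma quotient_rel_gl:
  assumes G: "h \<in> carrier G" "h' \<in> carrier G" "l \<in> carrier G" "l' \<in> carrier G"
  shows "quotient_rel (fs fg) PP (gl h) (gl h') (gl l) (gl l') \<longleftrightarrow>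
    (\<exists>g \<in> carrier G. l = g \<otimes>\<^bsub>G\<^esub> h \<and> l' = g \<otimes>\<^bsub>G\<^esub> h')"
proof -
  have comp: "lv (x \<bullet> gl k) hi (sc \<one>) = gm (trg x) lo k hi (lv x lo (sc \<one>))"
    if "x \<in> Arr (gcat LX)" "src x = PP" "k \<in> carrier G" for x k
    using lv_comp1[of "gl k" X hi "sc \<one>" x] gcat_dat_nat(1)[OF that(1) LX_IX, of lo hi k "sc \<one>"] that
    by (simp add: PP_act del: gcat_dat)
  have eq_iff: "x \<bullet> gl k = y \<bullet> gl k' \<longleftrightarrow>
      gm (trg x) lo k hi (lv x lo (sc \<one>)) = gm (trg y) lo k' hi (lv y lo (sc \<one>))"
    if "x \<in> Arr (gcat LX)" "y \<in> Arr (gcat LX)" "src x = PP" "src y = PP" "trg x = trg y"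
      "k \<in> carrier G" "k' \<in> carrier G" for x y k k'
  proof
    show "x \<bullet> gl k = y \<bullet> gl k' \<Longrightarrow>
        gm (trg x) lo k hi (lv x lo (sc \<one>)) = gm (trg y) lo k' hi (lv y lo (sc \<one>))"
      using comp[of x k] comp[of y k'] that by metis
    show "gm (trg x) lo k hi (lv x lo (sc \<one>)) = gm (trg y) lo k' hi (lv y lo (sc \<one>)) \<Longrightarrow>
        x \<bullet> gl k = y \<bullet> gl k'"
      using comp[of x k] comp[of y k'] that by (intro X_arr_eqI R.Comp_arr) (auto simp del: gcat_dat)
  qed
  show ?thesis
  proof
    assume q: "quotient_rel (fs fg) PP (gl h) (gl h') (gl l) (gl l')"
    \<comment> \<open>The vectors are the inverses of \<open>h\<close> and \<open>h'\<close> in the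
      regular representation, so that h and h' both carry them to the unit and the premise of the
      relation holds.\<close>
    let ?x = "p_arr RR (ev (inv\<^bsub>G\<^esub> h))" and ?y = "p_arr RR (ev (inv\<^bsub>G\<^esub> h'))"
    have x: "?x \<in> Arr (gcat LX)" "lv ?x lo (sc \<one>) = ev (inv\<^bsub>G\<^esub> h)"
      and y: "?y \<in> Arr (gcat LX)" "lv ?y lo (sc \<one>) = ev (inv\<^bsub>G\<^esub> h')"
      using p_arr[of RR] G by simp_all
    have "?x \<bullet> gl l = ?y \<bullet> gl l'"
      using q x y eq_iff[OF x(1) y(1), of h h'] G unfolding quotient_rel_def by (auto simp: RR_act reg)
    then have e: "l \<otimes>\<^bsub>G\<^esub> inv\<^bsub>G\<^esub> h = l' \<otimes>\<^bsub>G\<^esub> inv\<^bsub>G\<^esub> h'"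
      using eq_iff[OF x(1) y(1), of l l'] G x y by (simp add: RR_act reg ev_eq_iff)
    have e1: "l = (l \<otimes>\<^bsub>G\<^esub> inv\<^bsub>G\<^esub> h) \<otimes>\<^bsub>G\<^esub> h" using G by (simp add: G.m_assoc)
    have e2: "l' = (l \<otimes>\<^bsub>G\<^esub> inv\<^bsub>G\<^esub> h) \<otimes>\<^bsub>G\<^esub> h'" unfolding e using G by (simp add: G.m_assoc)
    show "\<exists>g \<in> carrier G. l = g \<otimes>\<^bsub>G\<^esub> h \<and> l' = g \<otimes>\<^bsub>G\<^esub> h'"
      by (rule bexI[where x = "l \<otimes>\<^bsub>G\<^esub> inv\<^bsub>G\<^esub> h"], rule conjI[OF e1 e2]) (use G in simp)
  next
    assume "\<exists>g \<in> carrier G. l = g \<otimes>\<^bsub>G\<^esub> h \<and> l' = g \<otimes>\<^bsub>G\<^esub> h'"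
    then obtain g where g: "g \<in> carrier G" "l = g \<otimes>\<^bsub>G\<^esub> h" "l' = g \<otimes>\<^bsub>G\<^esub> h'" by blast
    show "quotient_rel (fs fg) PP (gl h) (gl h') (gl l) (gl l')" unfolding quotient_rel_def
    proof (intro ballI impI; elim conjE)
      fix x y assume xy: "x \<in> Arr (fs fg)" "y \<in> Arr (fs fg)" "src x = PP" "src y = PP" "trg x = trg y"
        "x \<cdot>\<^bsub>fs fg\<^esub> gl h = y \<cdot>\<^bsub>fs fg\<^esub> gl h'"
      define M where "M = trg x"
      have a: "x \<in> Arr (gcat LX)" "y \<in> Arr (gcat LX)" using xy by auto
      have M: "preglider M" using gcat_ArrD(2)[OF a(1)] by (simp add: M_def)
      define m m' where "m = lv x lo (sc \<one>)" and "m' = lv y lo (sc \<one>)"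
      have m: "m \<in> lev M lo" "m' \<in> lev M lo"
        using gcat_dat_in[OF a(1), of lo "sc \<one>"] gcat_dat_in[OF a(2), of lo "sc \<one>"] xy(3-5) by (simp_all add: M_def m_def m'_def)
      have e: "gm M lo h hi m = gm M lo h' hi m'"
        using eq_iff[OF a xy(3-5) G(1,2)] xy(5,6) by (simp add: M_def m_def m'_def)
      \<comment> \<open>The factor \<open>g\<close> does not act on level 0 itself; it acts from
        level 0 into the ambient representation, where the equation is multiplied by
        \<open>g\<close> and then brought back by injectivity.\<close>
      have *: "gm M hi \<one>\<^sub>G Infty (gm M lo (g \<otimes>\<^bsub>G\<^esub> k) hi z) = gm M hi g Infty (gm M lo k hi z)"
        if "k \<in> carrier G" "z \<in> lev M lo" for k z
        using gm_comp[OF M, of lo hi Infty "g \<otimes>\<^bsub>G\<^esub> k" "\<one>\<^sub>G" z] gm_comp[OF M, of lo hi Infty k g z] that g(1) by simp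
      have "gm M lo l hi m = gm M lo l' hi m'"
      proof (rule inj_onD[OF ga_inj[OF M, of hi Infty]])
        show "gm M hi \<one>\<^sub>G Infty (gm M lo l hi m) = gm M hi \<one>\<^sub>G Infty (gm M lo l' hi m')"
          unfolding g(2,3) using *[OF G(1) m(1)] *[OF G(2) m(2)] e by simp
      qed (use m gm_in[OF M, of lo hi l m] gm_in[OF M, of lo hi l' m'] G in auto)
      then show "x \<cdot>\<^bsub>fs fg\<^esub> gl l = y \<cdot>\<^bsub>fs fg\<^esub> gl l'"
        using eq_iff[OF a xy(3-5) G(3,4)] xy(5) by (simp add: M_def m_def m'_def)
    qed
  qed
qed

lemma encodes_group_fg: "encodes_group (fs fg) G"
proof -
  have "bij_betw gl (carrier G) (grouplikes (fs fg) eta eps)"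
  proof (rule bij_betwI')
    show "gl g = gl h \<longleftrightarrow> g = h" if "g \<in> carrier G" "h \<in> carrier G" for g h
      using that gl(4) ev_eq_iff by metis
  qed (use gl_grouplike grouplike_gl in auto)
  then show ?thesis
    unfolding encodes_group_def
    using maximal_eta minimal_cover_eps quotient_rel_gl
    by (intro exI[of _ eta] exI[of _ eps] exI[of _ gl]) auto
qed

end

section \<open>Transport along a group isomorphism\<close>

text \<open>The inverse homomorphism is part of the data, which makes the setting symmetric: it can
  be interpreted with the two groups exchanged.\<close>

locale glider_iso = P: gliders K U G + Q: gliders K U H
  for K :: "('k, 'm) ring_scheme" and U :: "'u itself" and G :: "('g, 'n) monoid_scheme"
    and H :: "('h, 'p) monoid_scheme" +
  fixes \<phi> :: "'g \<Rightarrow> 'h" and \<psi> :: "'h \<Rightarrow> 'g"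
  assumes \<phi>_hom: "\<phi> \<in> hom G H" and \<psi>_hom: "\<psi> \<in> hom H G"
    and \<psi>_\<phi> [simp]: "g \<in> carrier G \<Longrightarrow> \<psi> (\<phi> g) = g" and \<phi>_\<psi> [simp]: "h \<in> carrier H \<Longrightarrow> \<phi> (\<psi> h) = h"
begin

lemma glider_iso_sym: "glider_iso K U H G \<psi> \<phi>"
  by unfold_locales (simp_all add: \<phi>_hom \<psi>_hom)

lemma \<psi>_in [simp]: "h \<in> carrier H \<Longrightarrow> \<psi> h \<in> carrier G"
  using \<psi>_hom by (auto simp: hom_def)

lemma \<psi>_mult: "h \<in> carrier H \<Longrightarrow> h' \<in> carrier H \<Longrightarrow> \<psi> (h \<otimes>\<^bsub>H\<^esub> h') = \<psi> h \<otimes>\<^bsub>G\<^esub> \<psi> h'"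
  using \<psi>_hom by (auto simp: hom_def)

lemma \<psi>_one [simp]: "\<psi> \<one>\<^bsub>H\<^esub> = \<one>\<^bsub>G\<^esub>"
  by (rule hom_one[OF \<psi>_hom Q.G.is_group P.G.is_group])

lemma \<psi>_hs [simp]: "h \<in> Q.hs u v \<Longrightarrow> \<psi> h \<in> P.hs u v"
  unfolding P.hs_def Q.hs_def by (auto split: if_splits)

text \<open>Restriction of the action along \<open>\<psi>\<close>; the three spaces are kept as they
  are.\<close>

definition Tr :: "('k, 'u, 'g \<Rightarrow> 'k) glider \<Rightarrow> ('k, 'u, 'h \<Rightarrow> 'k) glider" where
  "Tr M = Q.mk_glider (ObjMap M) (\<lambda>u h v. P.gm M u (\<psi> h) v)"

definition tr :: "('k, 'u, 'g) glider_arrow \<Rightarrow>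
    (('k, 'u, 'h \<Rightarrow> 'k) glider, ('k, 'u) glider_map) arrow" where
  "tr f = Arrow (Tr (src f)) (dat f) (Tr (trg f))"

lemma tr_sel [simp]: "src (tr f) = Tr (src f)" "trg (tr f) = Tr (trg f)" "dat (tr f) = dat f"
  by (simp_all add: tr_def)

lemma Tr_rep:
  assumes M: "P.preglider M"
  shows "Q.glider_rep (ObjMap M) (\<lambda>u h v. P.gm M u (\<psi> h) v)"
  unfolding Q.glider_rep_def
proof (intro conjI ballI impI)
  fix u v assume I: "u \<in> P.IX" "v \<in> P.IX"
  show "P.gm M u (\<psi> h) v \<in> linear_maps K (ObjMap M u) (ObjMap M v)" if "h \<in> Q.hs u v" for h
    using P.gm_linear[OF M I] that by simp
  show "inj_on (P.gm M u (\<psi> \<one>\<^bsub>H\<^esub>) v) (carrier (ObjMap M u))" if "index_le u v"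
    using P.ga_inj[OF M I that] by simp
  fix w g h x assume a: "w \<in> P.IX" "g \<in> Q.hs u v" "h \<in> Q.hs v w" "x \<in> carrier (ObjMap M u)"
  have gh: "g \<in> carrier H" "h \<in> carrier H" using a by auto
  show "P.gm M v (\<psi> h) w (P.gm M u (\<psi> g) v x) = P.gm M u (\<psi> (h \<otimes>\<^bsub>H\<^esub> g)) w x"
    unfolding \<psi>_mult[OF gh(2,1)] by (rule P.gm_comp[OF M I a(1) _ _ a(4)]) (use a in simp_all)
qed (use M P.gm_one in auto)

lemma Tr [simp]:
  assumes M: "P.preglider M"
  shows "Q.preglider (Tr M)" "u \<in> P.IX \<Longrightarrow> ObjMap (Tr M) u = ObjMap M u"
    "u \<in> P.IX \<Longrightarrow> v \<in> P.IX \<Longrightarrow> h \<in> Q.hs u v \<Longrightarrow> Q.ga (Tr M) u h v = P.ga M u (\<psi> h) v"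
proof -
  show "Q.preglider (Tr M)" unfolding Tr_def by (rule Q.is_preglider_mk_glider[OF Tr_rep[OF M]])
  show "u \<in> P.IX \<Longrightarrow> ObjMap (Tr M) u = ObjMap M u" by (simp add: Tr_def)
  show "Q.ga (Tr M) u h v = P.ga M u (\<psi> h) v" if "u \<in> P.IX" "v \<in> P.IX" "h \<in> Q.hs u v"
    unfolding Tr_def Q.ga_mk_glider[OF Tr_rep[OF M] that]
    using that M by (intro arrow_eqI) simp_all
qed

lemma Tr_E: "Tr P.E = Q.E"
  by (rule Q.preglider_eqI) (simp_all add: P.ga_E Q.ga_E)

lemma Tr_T: "P.preglider M \<Longrightarrow> P.preglider N \<Longrightarrow> Tr (P.T M N) = Q.T (Tr M) (Tr N)"
  by (rule Q.preglider_eqI) (simp_all add: P.ga_T Q.ga_T)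

lemma tr_arr: "f \<in> Arr (P.gcat P.LX) \<Longrightarrow> tr f \<in> Arr (Q.gcat P.LX)"
proof (rule Q.gcat_ArrI)
  assume f: "f \<in> Arr (P.gcat P.LX)"
  note F = P.gcat_ArrD[OF f]
  have I: "i \<in> P.IX" if "i \<in> P.LX" for i using that P.LX_IX by auto
  show "dat (tr f) j \<cdot>\<^bsub>vect K\<^esub> Q.ga (src (tr f)) i g j = Q.ga (trg (tr f)) i g j \<cdot>\<^bsub>vect K\<^esub> dat (tr f) i"
    if "i \<in> P.LX" "j \<in> P.LX" "g \<in> Q.hs i j" for i j g
    using F(1,2) F(7)[OF that(1,2) \<psi>_hs[OF that(3)]] that I by simp
qed (use P.gcat_ArrD[of f] P.LX_IX in auto)

end

context glider_iso
begin

interpretation inv: glider_iso K U H G \<psi> \<phi> by (rule glider_iso_sym)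

lemma inv_Tr: "P.preglider M \<Longrightarrow> inv.Tr (Tr M) = M"
  by (rule P.preglider_eqI) simp_all

lemma Tr_inv: "Q.preglider M \<Longrightarrow> Tr (inv.Tr M) = M"
  by (rule Q.preglider_eqI) simp_all

text \<open>Only the labels of the action are renamed. The chosen tensor products depend on the
  spaces alone, so they agree literally, and the two restrictions are inverse to each other on the
  nose.\<close>

lemma strict_iso_Tr: "strict_iso K (P.gcat P.LX) (Q.gcat P.LX) Tr tr"
proof
  show "bij_betw Tr (Obj (P.gcat P.LX)) (Obj (Q.gcat P.LX))"
    by (rule bij_betw_byWitness[where f' = inv.Tr]) (auto simp: inv_Tr Tr_inv)
  have "inv.tr (tr f) = f" if "f \<in> Arr (P.gcat P.LX)" for f
    using P.gcat_ArrD(1,2)[OF that] by (intro arrow_eqI) (simp_all add: inv_Tr)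
  moreover have "tr (inv.tr f) = f" if "f \<in> Arr (Q.gcat P.LX)" for f
    using Q.gcat_ArrD(1,2)[OF that] by (intro arrow_eqI) (simp_all add: Tr_inv)
  ultimately show "bij_betw tr (Arr (P.gcat P.LX)) (Arr (Q.gcat P.LX))"
    by (intro bij_betw_byWitness[where f' = inv.tr]) (auto simp: tr_arr inv.tr_arr)
qed (use P.LX_IX in \<open>auto intro!: arrow_eqI restrict_ext simp: P.gcat_ArrD(1,2) Tr_T Tr_E subset_iff\<close>)

lemma strict_iso_fg: "strict_iso K (P.fs P.fg) (Q.fs Q.fg) Tr tr"
  by (rule strict_iso.full_subcategory[OF strict_iso_Tr]) 
    (use lin_mon_cat.axioms(1)[OF P.lin_mon_cat_gcat[OF P.LX_IX]] in auto)

end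

theorem corollary9p20:
  fixes K :: "('k, 'm) ring_scheme"
    and G :: "('g, 'n) monoid_scheme"
    and H :: "('h, 'p) monoid_scheme"
  assumes "field K"
    and "vector_space_universe TYPE('u) K"
    and "group G" and "finite (carrier G)"
    and "group H" and "finite (carrier H)"
  shows "G \<cong> H \<longleftrightarrow>
    linear_monoidally_equivalent K
      (glid TYPE('u) K {-1, 0} (group_bialgebra K G)
         (one_step_filtration K (group_bialgebra K G)))
      (glid TYPE('u) K {-1, 0} (group_bialgebra K H)
         (one_step_filtration K (group_bialgebra K H)))"
proof -
  have vs: "vector_spaces K TYPE('u)"
    using assms(1,2) by (intro vector_spaces.intro vector_spaces_axioms.intro)
  interpret P: gliders K "TYPE('u)" G
    using vs assms(3,4) by (intro gliders.intro gliders_axioms.intro)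
  interpret Q: gliders K "TYPE('u)" H
    using vs assms(5,6) by (intro gliders.intro gliders_axioms.intro)
  let ?A = "glid TYPE('u) K {-1, 0} P.B P.Fl" and ?B = "glid TYPE('u) K {-1, 0} Q.B Q.Fl"
  obtain fo fa where i: "strict_iso K (P.fs P.fg) ?A fo fa" using P.strict_iso_glid by blast
  obtain fo' fa' where j: "strict_iso K (Q.fs Q.fg) ?B fo' fa'" using Q.strict_iso_glid by blast
  note A = strict_iso.lin_mon_cat_target[OF i P.lin_mon_cat_fg]
    and B = strict_iso.lin_mon_cat_target[OF j Q.lin_mon_cat_fg]
  show ?thesis
  proof
    assume "G \<cong> H"
    then obtain \<phi> where \<phi>: "\<phi> \<in> Group.iso G H" by (auto simp: is_iso_def)
    interpret glider_iso K "TYPE('u)" G H \<phi> "inv_into (carrier G) \<phi>"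
    proof
      show "\<phi> \<in> hom G H" using \<phi> by (simp add: Group.iso_def)
      show "inv_into (carrier G) \<phi> \<in> hom H G"
        using group.iso_set_sym[OF assms(3) \<phi>] by (simp add: Group.iso_def)
    qed (use \<phi> in \<open>auto simp: Group.iso_def bij_betw_def f_inv_into_f\<close>)
    note s = strict_iso.strict_iso_inverse[OF i P.lin_mon_cat_fg]
    \<comment> \<open>From \<open>?A\<close> to the finitely generated gliders for \<open>G\<close>,
      across to those for \<open>H\<close>, and on to \<open>?B\<close>.\<close>
    note t = strict_iso_comp[OF strict_iso_comp[OF s strict_iso_fg A] j A]
    show "linear_monoidally_equivalent K ?A ?B" by (rule strict_iso.linear_monoidally_equivalent[OF t A])
  next
    assume e: "linear_monoidally_equivalent K ?A ?B"
    \<comment> \<open>The encoding of \<open>G\<close> travels to \<open>?A\<close> and through the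
      given equivalence to \<open>?B\<close>, which also encodes \<open>H\<close>; a category
      encodes at most one group up to isomorphism.\<close>
    have "encodes_group ?A G"
      by (rule encodes_group_equivalent[OF P.lin_mon_cat_fg A
            strict_iso.linear_monoidally_equivalent[OF i P.lin_mon_cat_fg] P.encodes_group_fg])
    then have "encodes_group ?B G" by (rule encodes_group_equivalent[OF A B e])
    moreover have "encodes_group ?B H"
      by (rule encodes_group_equivalent[OF Q.lin_mon_cat_fg B
            strict_iso.linear_monoidally_equivalent[OF j Q.lin_mon_cat_fg] Q.encodes_group_fg])
    ultimately show "G \<cong> H" using lin_mon_cat.encoded_group_unique[OF B assms(3,5)] by blast
  qed
qed

end
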